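(* Let $(X,G)$ be one of the following pairs of a labeled affine Dynkin diagram $X$ and a finite group $G$ acting on its vertex set (the folded type $Y$ is recorded only for reference): (a) $X=\widetilde{A}_{2,2}$: vertex set $[4]$, underlying graph the $4$-cycle $1-2-4-3-1$, $G=\mathbb{Z}/2\mathbb{Z}=\langle\tau\rangle$ with $\tau=(1\,4)(2\,3)$ ($Y=\widetilde{A}_1$); (b) $X=\widetilde{A}_{n,n}$ ($n\ge 2$): vertex set $[2n]$, underlying graph the $2n$-cycle with edges $\{i,i+1\}$ for $1\le i\le n-1$, $\{n,2n\}$, $\{1,n+1\}$, $\{j,j+1\}$ for $n+1\le j\le 2n-1$; $G=\langle\tau\rangle\cong\mathbb{Z}/2\mathbb{Z}$ with $\tau(1)=1$, $\tau(2n)=2n$, $\tau(i)=n+i-1$ and $\tau(n+i-1)=i$ for $2\le i\le n$ ($Y=D_{n+1}^{(2)}$); (c) $X=\widetilde{D}_4$: vertex set $[5]$, edges $\{1,2\},\{1,3\},\{1,4\},\{1,5\}$; $G\cong(\mathbb{Z}/2\mathbb{Z})^2=\{\mathrm{id},(2\,3)(4\,5),(2\,4)(3\,5),(2\,5)(3\,4)\}$ ($Y=A_2^{(2)}$); (d) $X=\widetilde{D}_4$ as in (c), $G=\langle(3\,4\,5)\rangle\cong\mathbb{Z}/3\mathbb{Z}$ ($Y=D_4^{(3)}$); (e) $X=\widetilde{D}_n$ ($n\ge5$): vertex set $[n+1]$, edges $\{1,2\},\{1,3\},\{1,4\}$, $\{i,i+1\}$ for $4\le i\le n-2$, $\{n-1,n\},\{n-1,n+1\}$;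 $G=\langle(2\,3)(n\ \,n{+}1)\rangle\cong\mathbb{Z}/2\mathbb{Z}$ ($Y=\widetilde{C}_{n-2}$); (f) $X=\widetilde{D}_n$ ($n\ge5$) as in (e), $G=\langle(n\ \,n{+}1)\rangle\cong\mathbb{Z}/2\mathbb{Z}$ ($Y=A^{(2)}_{2(n-1)-1}$); (g) $X=\widetilde{D}_{2n}$ ($n\ge3$): vertex set $[2n+1]$, edges $\{1,2\},\{1,3\},\{1,4\}$, $\{i,i+1\}$ for $4\le i\le 2n-2$, $\{2n-1,2n\},\{2n-1,2n+1\}$; $G=\langle\sigma\rangle\cong\mathbb{Z}/2\mathbb{Z}$ where $\sigma$ is the involution with $\sigma(1)=2n-1$, $\sigma(2)=2n+1$, $\sigma(3)=2n$, $\sigma(i)=2n+2-i$ for $4\le i\le 2n-2$ ($Y=\widetilde{B}_n$); (h) $X=\widetilde{D}_{2n}$ ($n\ge3$) as in (g), $G=\langle\sigma,\rho\rangle\cong(\mathbb{Z}/2\mathbb{Z})^2$ with $\sigma$ as in (g) and $\rho=(2\,3)(2n\ \,2n{+}1)$ ($Y=A^{(2)}_{2n-2}$); (i) $X=\widetilde{E}_6$: vertex set $[7]$, edges $\{1,2\},\{1,4\},\{1,6\},\{2,3\},\{4,5\},\{6,7\}$; $G=\langle(2\,4\,6)(3\,5\,7)\rangle\cong\mathbb{Z}/3\mathbb{Z}$ ($Y=\widetilde{G}_2$); (j) $X=\widetilde{E}_6$ as in (i), $G=\langle(4\,6)(5\,7)\rangle\cong\mathbb{Z}/2\mathbb{Z}$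 ($Y=E_6^{(2)}$); (k) $X=\widetilde{E}_7$: vertex set $[8]$, edges $\{1,2\},\{1,3\},\{1,6\},\{3,4\},\{4,5\},\{6,7\},\{7,8\}$; $G=\langle(3\,6)(4\,7)(5\,8)\rangle\cong\mathbb{Z}/2\mathbb{Z}$ ($Y=\widetilde{F}_4$). Let $Q$ be a quiver of type $X$. If $Q$ is $G$-invariant, then $Q$ is $G$-admissible. In particular, for quivers of type $X$, $G$-invariance and $G$-admissibility are equivalent.
   Context: A quiver on $[N]=\{1,\dots,N\}$ is a finite directed multigraph with vertex set $[N]$ with no loops and no directed $2$-cycles. Its adjacency matrix $B=(b_{i,j})$ has $b_{i,j}=$ (number of arrows $i\to j$) $-$ (number of arrows $j\to i$). The mutation $\mu_k(Q)$ at $k\in[N]$ is the quiver with adjacency matrix $b'_{i,j}=-b_{i,j}$ if $k\in\{i,j\}$ and $b'_{i,j}=b_{i,j}+\frac{|b_{i,k}|b_{k,j}+b_{i,k}|b_{k,j}|}{2}$ otherwise. Quivers are mutation equivalent if one is obtained from the other by finitely many mutations; a quiver is acyclic if it has no directed cycle. For a labeled diagram $X$ on $[N]$ (a simple undirected graph with the given vertex labels), a quiver is of type $X$ if it is mutation equivalent to an acyclic quiver whose underlying undirected graph is $X$ (with the same labels); for $X=\widetilde{A}_{p,q}$ one additionally requires that this acyclic quiver on the cycle has exactly $p$ arrows oriented in one direction around the cycle and $q$ in the other. For a finite group $G$ acting on $[N]$: $Q$ is $G$-invariant if $b_{g(i),g(j)}=b_{i,j}$ for all $i,j\in[N]$ and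 $g\in G$; a $G$-invariant $Q$ is $G$-admissible if for all $i,i'$ in the same $G$-orbit, $b_{i,i'}=0$ and $b_{i,j}b_{i',j}\ge 0$ for all $j\in[N]$. *)

theory Defs
  imports "HOL-Library.Multiset" "HOL-Algebra.Sym_Groups"
begin

section \<open>Quivers and mutation\<close>

text \<open>A finite directed multigraph on \<open>{1..N}\<close> is given by its multiset of arrows;
  \<open>(i, j)\<close> is an arrow from \<open>i\<close> to \<open>j\<close>.\<close>

type_synonym quiver = "(nat \<times> nat) multiset"

definition quiver :: "nat \<Rightarrow> quiver \<Rightarrow> bool" where
  "quiver N Q \<longleftrightarrow>
     set_mset Q \<subseteq> {1..N} \<times> {1..N} \<and>
     (\<forall>i. (i, i) \<notin># Q) \<and>
     (\<forall>i j. (i, j) \<in># Q \<longrightarrow> (j, i) \<notin># Q)"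

definition adj :: "quiver \<Rightarrow> nat \<Rightarrow> nat \<Rightarrow> int" where
  "adj Q i j = int (count Q (i, j)) - int (count Q (j, i))"

text \<open>The integer division by 2 is exact: the numerator is \<open>0\<close> or
  \<open>\<plusminus>2 * adj Q i k * adj Q k j\<close>.\<close>

definition mutated_adj :: "nat \<Rightarrow> quiver \<Rightarrow> nat \<Rightarrow> nat \<Rightarrow> int" where
  "mutated_adj k Q i j =
     (if k \<in> {i, j} then - adj Q i j
      else adj Q i j + (\<bar>adj Q i k\<bar> * adj Q k j + adj Q i k * \<bar>adj Q k j\<bar>) div 2)"

text \<open>\<open>is_mutation N k Q Q'\<close> says \<open>Q' = \<mu>\<^sub>k(Q)\<close>; a quiver is determined by its adjacency
  matrix.\<close>

definition is_mutation :: "nat \<Rightarrow> nat \<Rightarrow> quiver \<Rightarrow> quiver \<Rightarrow> bool" where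
  "is_mutation N k Q Q' \<longleftrightarrow>
     quiver N Q \<and> quiver N Q' \<and> k \<in> {1..N} \<and>
     (\<forall>i\<in>{1..N}. \<forall>j\<in>{1..N}. adj Q' i j = mutated_adj k Q i j)"

definition mutation_equivalent :: "nat \<Rightarrow> quiver \<Rightarrow> quiver \<Rightarrow> bool" where
  "mutation_equivalent N Q Q' \<longleftrightarrow>
     (\<lambda>P P'. \<exists>k. is_mutation N k P P')\<^sup>*\<^sup>* Q Q' \<or>
     (\<lambda>P P'. \<exists>k. is_mutation N k P P')\<^sup>*\<^sup>* Q' Q"


section \<open>Type of a quiver\<close>

text \<open>Simple graphs on \<open>{1..N}\<close> are given by their set of edges. Comparing multisets of
  unoriented edges forces every edge of \<open>X\<close> to carry exactly one arrow.\<close>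

definition has_underlying_graph :: "quiver \<Rightarrow> nat set set \<Rightarrow> bool" where
  "has_underlying_graph Q X \<longleftrightarrow> image_mset (\<lambda>(i, j). {i, j}) Q = mset_set X"

definition of_type :: "nat \<Rightarrow> nat set set \<Rightarrow> quiver \<Rightarrow> bool" where
  "of_type N X Q \<longleftrightarrow>
     (\<exists>Q'. quiver N Q' \<and> acyclic (set_mset Q') \<and> has_underlying_graph Q' X \<and>
           mutation_equivalent N Q Q')"

text \<open>Number of arrows oriented along the cyclic sequence of vertices \<open>c\<close>.\<close>

definition arrows_along :: "nat list \<Rightarrow> quiver \<Rightarrow> nat" where
  "arrows_along c Q = (\<Sum>k<length c. count Q (c ! k, c ! (Suc k mod length c)))"

text \<open>Type \<open>A\<close> tilde with parameters \<open>p\<close>, \<open>q\<close>; the list \<open>c\<close> traverses the cycle \<open>X\<close> once.\<close>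

definition of_type_A :: "nat \<Rightarrow> nat set set \<Rightarrow> nat list \<Rightarrow> nat \<Rightarrow> nat \<Rightarrow> quiver \<Rightarrow> bool" where
  "of_type_A N X c p q Q \<longleftrightarrow>
     (\<exists>Q'. quiver N Q' \<and> acyclic (set_mset Q') \<and> has_underlying_graph Q' X \<and>
           {#arrows_along c Q', arrows_along (rev c) Q'#} = {#p, q#} \<and>
           mutation_equivalent N Q Q')"


section \<open>Invariance and admissibility\<close>

text \<open>A group acting on \<open>{1..N}\<close> is given by its set of permutations.\<close>

definition G_invariant :: "nat \<Rightarrow> (nat \<Rightarrow> nat) set \<Rightarrow> quiver \<Rightarrow> bool" where
  "G_invariant N G Q \<longleftrightarrow>
     (\<forall>g\<in>G. \<forall>i\<in>{1..N}. \<forall>j\<in>{1..N}. adj Q (g i) (g j) = adj Q i j)"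

definition same_orbit :: "(nat \<Rightarrow> nat) set \<Rightarrow> nat \<Rightarrow> nat \<Rightarrow> bool" where
  "same_orbit G i i' \<longleftrightarrow> (\<exists>g\<in>G. g i = i')"

definition G_admissible :: "nat \<Rightarrow> (nat \<Rightarrow> nat) set \<Rightarrow> quiver \<Rightarrow> bool" where
  "G_admissible N G Q \<longleftrightarrow>
     G_invariant N G Q \<and>
     (\<forall>i\<in>{1..N}. \<forall>i'\<in>{1..N}. same_orbit G i i' \<longrightarrow>
        adj Q i i' = 0 \<and> (\<forall>j\<in>{1..N}. adj Q i j * adj Q i' j \<ge> 0))"


section \<open>The affine diagrams with group actions\<close>

definition A_edges :: "nat \<Rightarrow> nat set set" where
  "A_edges n = {{i, i + 1} | i. 1 \<le> i \<and> i \<le> n - 1} \<union> {{n, 2*n}, {1, n + 1}} \<union>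
               {{j, j + 1} | j. n + 1 \<le> j \<and> j \<le> 2*n - 1}"

definition D4_edges :: "nat set set" where
  "D4_edges = {{1, 2}, {1, 3}, {1, 4}, {1, 5}}"

definition D_edges :: "nat \<Rightarrow> nat set set" where
  "D_edges n = {{1, 2}, {1, 3}, {1, 4}} \<union> {{i, i + 1} | i. 4 \<le> i \<and> i \<le> n - 2} \<union>
               {{n - 1, n}, {n - 1, n + 1}}"

definition E6_edges :: "nat set set" where
  "E6_edges = {{1, 2}, {1, 4}, {1, 6}, {2, 3}, {4, 5}, {6, 7}}"

definition E7_edges :: "nat set set" where
  "E7_edges = {{1, 2}, {1, 3}, {1, 6}, {3, 4}, {4, 5}, {6, 7}, {7, 8}}"

definition tau :: "nat \<Rightarrow> nat \<Rightarrow> nat" where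
  "tau n x = (if 2 \<le> x \<and> x \<le> n then n + x - 1
              else if n + 1 \<le> x \<and> x \<le> 2*n - 1 then x + 1 - n
              else x)"

definition sigma :: "nat \<Rightarrow> nat \<Rightarrow> nat" where
  "sigma n x = (if x = 1 then 2*n - 1 else if x = 2*n - 1 then 1
                else if x = 2 then 2*n + 1 else if x = 2*n + 1 then 2
                else if x = 3 then 2*n else if x = 2*n then 3
                else if 4 \<le> x \<and> x \<le> 2*n - 2 then 2*n + 2 - x
                else x)"

text \<open>\<open>folding_pair N T G\<close>: \<open>T\<close> is the predicate ``of type \<open>X\<close>'' for a diagram \<open>X\<close> on \<open>{1..N}\<close>
  and \<open>G\<close> is the group acting on its vertices. In the cases \<open>A\<close> tilde the list of vertices is
  a traversal of the cycle.\<close>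

inductive folding_pair :: "nat \<Rightarrow> (quiver \<Rightarrow> bool) \<Rightarrow> (nat \<Rightarrow> nat) set \<Rightarrow> bool" where
  a: "folding_pair 4 (of_type_A 4 {{1, 2}, {2, 4}, {4, 3}, {3, 1}} [1, 2, 4, 3] 2 2)
        (generate (sym_group 4) {transpose 1 4 \<circ> transpose 2 3})"
| b: "n \<ge> 2 \<Longrightarrow>
      folding_pair (2*n)
        (of_type_A (2*n) (A_edges n) ([1..<n + 1] @ rev [n + 1..<2*n + 1]) n n)
        (generate (sym_group (2*n)) {tau n})"
| c: "folding_pair 5 (of_type 5 D4_edges)
        {id, transpose 2 3 \<circ> transpose 4 5, transpose 2 4 \<circ> transpose 3 5,
         transpose 2 5 \<circ> transpose 3 4}"
| d: "folding_pair 5 (of_type 5 D4_edges) (generate (sym_group 5) {cycle_of_list [3, 4, 5]})"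
| e: "n \<ge> 5 \<Longrightarrow>
      folding_pair (n + 1) (of_type (n + 1) (D_edges n))
        (generate (sym_group (n + 1)) {transpose 2 3 \<circ> transpose n (n + 1)})"
| f: "n \<ge> 5 \<Longrightarrow>
      folding_pair (n + 1) (of_type (n + 1) (D_edges n))
        (generate (sym_group (n + 1)) {transpose n (n + 1)})"
| g: "n \<ge> 3 \<Longrightarrow>
      folding_pair (2*n + 1) (of_type (2*n + 1) (D_edges (2*n)))
        (generate (sym_group (2*n + 1)) {sigma n})"
| h: "n \<ge> 3 \<Longrightarrow>
      folding_pair (2*n + 1) (of_type (2*n + 1) (D_edges (2*n)))
        (generate (sym_group (2*n + 1))
           {sigma n, transpose 2 3 \<circ> transpose (2*n) (2*n + 1)})"
| i: "folding_pair 7 (of_type 7 E6_edges)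
        (generate (sym_group 7) {cycle_of_list [2, 4, 6] \<circ> cycle_of_list [3, 5, 7]})"
| j: "folding_pair 7 (of_type 7 E6_edges)
        (generate (sym_group 7) {transpose 4 6 \<circ> transpose 5 7})"
| k: "folding_pair 8 (of_type 8 E7_edges)
        (generate (sym_group 8) {transpose 3 6 \<circ> transpose 4 7 \<circ> transpose 5 8})"

end

theory Submission
  imports Complex_Main Defs
begin

text \<open>Fix an acyclic quiver of the given affine type. Along every mutation sequence the
  \<open>c\<close>-vectors are roots of its Euler form, pairwise compatible in the sense of \<open>compat\<close>, and the
  exchange matrix \<open>B\<close> is the skew-symmetrization of their Gram matrix. That mutation preserves
  compatibility comes down to excluding three configurations of positive roots: applying the
  reflections in a cyclic order of the vertices moves some root of the family that is not orthogonal
  to the null root \<open>\<delta>\<close> to a simple root at a source or sink, and the other roots then live on the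
  graph without that vertex, where the form is positive definite.

  The symmetrized Gram matrix \<open>A\<close> is a companion of \<open>B\<close>: it has diagonal \<open>2\<close>, \<open>\<bar>A i j\<bar> = \<bar>B i j\<bar>\<close>
  for \<open>i \<noteq> j\<close>, it is positive semidefinite of corank one, and the sign of its product along a
  triangle or an oriented square of \<open>B\<close> is prescribed. When the graph is a tree, \<open>A\<close> is determined by \<open>B\<close>
  up to conjugation by signs, so an automorphism of \<open>B\<close> acts on \<open>A\<close> through signs. If an involution
  \<open>g\<close> with a fixed vertex preserves \<open>B\<close>, these signs are constant on orbits; a failure of admissibility
  would give an oriented square \<open>i \<rightarrow> j \<rightarrow> g i \<rightarrow> g j \<rightarrow> i\<close>, on which the product of \<open>A\<close> would be both
  negative and a square. For a cycle, \<open>A\<close> is the Gram matrix of vectors \<open>e\<^sub>a - e\<^sub>b\<close>, and no such vectors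
  form a square with negative product. For a rotation of order three the triangle signs, together with
  the null vector and the semidefiniteness of \<open>A\<close>, leave only admissible matrices.\<close>

section \<open>Euler forms and reflections\<close>

text \<open>For a positive definite graph no root stays positive under all powers of a Coxeter
  transformation: the sum over its finite orbit would be a fixed vector, hence zero. For an affine
  graph the same argument works only modulo \<delta>, and all it yields is that every root of a
  configuration stable under rotation has defect \<open>eul L \<delta> x = 0\<close>. This cannot be
  improved in general: the three quasi-simple roots of a tube of rank three form a configuration
  \<open>bad3\<close>. So the configurations cannot be excluded from their own data; a further root
  of nonzero defect is required, and \<open>family\<close> carries one through all mutations. Such a
  root can be turned into a simple root, up to sign, at an end of the order, and there compatibility
  with it becomes the vanishing of coordinates.

  The signs of triangles and squares are not built into A. They are forced, because \<bar>A i
  j\<bar> = \<bar>B i j\<bar> must still hold after one more mutation.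

  Mutation at a negative root is reduced to mutation at a positive one: reversing the order and
  negating all vectors exchanges the two signs and preserves compatibility.\<close>

locale weighted_graph =
  fixes n :: "nat \<Rightarrow> nat \<Rightarrow> int"
  assumes n_sym: "n i j = n j i" and n_nonneg: "0 \<le> n i j" and n_irrefl: "n i i = 0"
begin

text \<open>The Euler form of the orientation for which the list is a topological order: an edge
  contributes \<open>x\<close> at its later end times \<open>y\<close> at its earlier end. Encoding
  an orientation as a list turns the reversal of all edges at an extreme vertex into a rotation of
  the list.\<close>

fun eul :: "nat list \<Rightarrow> (nat \<Rightarrow> int) \<Rightarrow> (nat \<Rightarrow> int) \<Rightarrow> int" where
  "eul [] x y = 0"
| "eul (s # L) x y = (x s - (\<Sum>j\<in>set L. n j s * x j)) * y s + eul L x y"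

text \<open>The vertex set is a parameter because the same reflections are used on the whole graph
  and on the graph without one vertex.\<close>

definition reflect :: "nat set \<Rightarrow> nat \<Rightarrow> (nat \<Rightarrow> int) \<Rightarrow> nat \<Rightarrow> int" where
  "reflect J s x = x(s := (\<Sum>j\<in>J. n j s * x j) - x s)"

lemma eul_cong:
  assumes "\<And>i. i \<in> set L \<Longrightarrow> x i = x' i" "\<And>i. i \<in> set L \<Longrightarrow> y i = y' i"
  shows "eul L x y = eul L x' y'"
  using assms by (induction L) (auto intro!: sum.cong)

lemma eul_add_left: "eul L (\<lambda>i. x i + m * z i) y = eul L x y + m * eul L z y"
  by (induction L) (simp_all add: algebra_simps sum.distrib sum_distrib_left)

lemma eul_add_right: "eul L x (\<lambda>i. y i + m * z i) = eul L x y + m * eul L x z"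
  by (induction L) (simp_all add: algebra_simps)

lemma eul_uminus_left [simp]: "eul L (\<lambda>i. - x i) y = - eul L x y"
  by (induction L) (simp_all add: algebra_simps sum_negf)

lemma eul_uminus_right [simp]: "eul L x (\<lambda>i. - y i) = - eul L x y"
  by (induction L) (simp_all add: algebra_simps)

lemma eul_zero_left: "(\<And>i. i \<in> set L \<Longrightarrow> x i = 0) \<Longrightarrow> eul L x y = 0"
  by (induction L) simp_all

lemma eul_zero_right: "(\<And>i. i \<in> set L \<Longrightarrow> y i = 0) \<Longrightarrow> eul L x y = 0"
  by (induction L) simp_all

lemma eul_rel_right:
  assumes "\<And>i. i \<in> set L \<Longrightarrow> m * x i = y i + z i"
  shows "m * eul L w x = eul L w y + eul L w z"
proof -
  have "m * eul L w x = eul L w (\<lambda>i. 0 + m * x i)"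
    by (simp only: eul_add_right) (simp add: eul_zero_right)
  also have "\<dots> = eul L w (\<lambda>i. y i + 1 * z i)"
    by (rule eul_cong) (simp_all add: assms)
  finally show ?thesis by (simp add: eul_add_right[where m=1, simplified])
qed

lemma eul_sum_left: "eul L (\<lambda>v. \<Sum>t\<in>T. f t v) y = (\<Sum>t\<in>T. eul L (f t) y)"
proof (cases "finite T")
  case True
  then show ?thesis
    by (induction T rule: finite_induct)
       (simp_all add: eul_zero_left eul_add_left[where m=1, simplified])
qed (simp add: eul_zero_left)

lemma eul_sum_right: "eul L x (\<lambda>v. \<Sum>t\<in>T. f t v) = (\<Sum>t\<in>T. eul L x (f t))"
proof (cases "finite T")
  case True
  then show ?thesis
    by (induction T rule: finite_induct)
       (simp_all add: eul_zero_right eul_add_right[where m=1, simplified])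
qed (simp add: eul_zero_right)

lemma eul_append:
  "distinct (L @ [s]) \<Longrightarrow>
     eul (L @ [s]) x y = eul L x y + x s * (y s - (\<Sum>j\<in>set L. n j s * y j))"
proof (induction L)
  case (Cons t L)
  have "(\<Sum>j\<in>insert s (set L). n j t * x j) = n s t * x s + (\<Sum>j\<in>set L. n j t * x j)"
    using Cons.prems by (subst sum.insert) auto
  moreover have "(\<Sum>j\<in>insert t (set L). n j s * y j) = n t s * y t + (\<Sum>j\<in>set L. n j s * y j)"
    using Cons.prems by (subst sum.insert) auto
  moreover have "n t s = n s t" by (rule n_sym)
  ultimately show ?case using Cons by (simp add: algebra_simps)
qed simp

lemma eul_rev: "distinct L \<Longrightarrow> eul (rev L) x y = eul L y x"
  by (induction L) (simp_all add: eul_append algebra_simps)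

lemma reflect_same: "reflect J s x s = (\<Sum>j\<in>J. n j s * x j) - x s"
  by (simp add: reflect_def)

lemma sum_head: "finite J \<Longrightarrow> (\<Sum>j\<in>insert s J. n j s * x j) = (\<Sum>j\<in>J. n j s * x j)"
  by (cases "s \<in> J") (simp_all add: insert_absorb n_irrefl)

text \<open>The term of the old head and the term of the new last vertex both equal
  \<open>- reflect J s x s * y s\<close>; the coordinates of the rest of the list are
  untouched.\<close>

lemma eul_rotate:
  assumes "distinct (s # L)" "J = insert s (set L)"
  shows "eul (L @ [s]) (reflect J s x) (reflect J s y) = eul (s # L) x y"
proof -
  have "eul L (reflect J s x) (reflect J s y) = eul L x y"
    using assms by (intro eul_cong) (auto simp: reflect_def)
  moreover have "(\<Sum>j\<in>set L. n j s * reflect J s y j) = (\<Sum>j\<in>set L. n j s * y j)"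
    using assms by (intro sum.cong) (auto simp: reflect_def)
  ultimately show ?thesis
    using assms by (simp add: eul_append reflect_same sum_head n_irrefl algebra_simps)
qed

lemma eul_rotate_back:
  assumes "distinct (s # L)" "J = insert s (set L)"
  shows "eul (s # L) (reflect J s x) (reflect J s y) = eul (L @ [s]) x y"
proof -
  have "eul L (reflect J s x) (reflect J s y) = eul L x y"
    using assms by (intro eul_cong) (auto simp: reflect_def)
  moreover have "(\<Sum>j\<in>set L. n j s * reflect J s x j) = (\<Sum>j\<in>set L. n j s * x j)"
    using assms by (intro sum.cong) (auto simp: reflect_def)
  ultimately show ?thesis
    using assms by (simp add: eul_append reflect_same sum_head n_irrefl algebra_simps)
qed

lemma reflect_reflect:
  assumes "finite J"
  shows "reflect J s (reflect J s x) = x"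
proof -
  have "(\<Sum>j\<in>J. n j s * reflect J s x j) = (\<Sum>j\<in>J. n j s * x j)"
    by (intro sum.cong) (auto simp: reflect_def n_irrefl)
  then show ?thesis by (auto simp: fun_eq_iff reflect_def)
qed

lemma reflect_add: "reflect J s (\<lambda>i. x i + m * y i) = (\<lambda>i. reflect J s x i + m * reflect J s y i)"
  by (auto simp: reflect_def fun_eq_iff algebra_simps sum.distrib sum_distrib_left)

text \<open>Twice the Tits form. It does not see the order of the vertices, and roots are the
  vectors of value 2.\<close>

definition qf :: "nat set \<Rightarrow> (nat \<Rightarrow> int) \<Rightarrow> int" where
  "qf J x = 2 * (\<Sum>i\<in>J. x i * x i) - (\<Sum>i\<in>J. \<Sum>j\<in>J. n i j * x i * x j)"

lemma eul_qf: "distinct L \<Longrightarrow> 2 * eul L x x = qf (set L) x"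
proof (induction L)
  case (Cons s L)
  have "(\<Sum>i\<in>set L. n i s * x i * x s) = x s * (\<Sum>i\<in>set L. n i s * x i)"
    by (simp add: sum_distrib_left algebra_simps)
  moreover have "(\<Sum>i\<in>set L. n s i * x s * x i) = x s * (\<Sum>i\<in>set L. n i s * x i)"
    by (simp add: sum_distrib_left algebra_simps n_sym[of s])
  ultimately have "qf (set (s # L)) x
      = 2 * x s * x s - 2 * x s * (\<Sum>i\<in>set L. n i s * x i) + qf (set L) x"
    using Cons.prems by (simp add: qf_def sum.distrib n_irrefl algebra_simps)
  then show ?case using Cons by (simp add: algebra_simps)
qed (simp add: qf_def)

section \<open>Signs of roots\<close>

definition nonneg_on :: "nat list \<Rightarrow> (nat \<Rightarrow> int) \<Rightarrow> bool" where
  "nonneg_on L x \<longleftrightarrow> (\<forall>i\<in>set L. 0 \<le> x i)"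

definition nonpos_on :: "nat list \<Rightarrow> (nat \<Rightarrow> int) \<Rightarrow> bool" where
  "nonpos_on L x \<longleftrightarrow> (\<forall>i\<in>set L. x i \<le> 0)"

definition pos_root :: "nat list \<Rightarrow> (nat \<Rightarrow> int) \<Rightarrow> bool" where
  "pos_root L x \<longleftrightarrow> eul L x x = 1 \<and> nonneg_on L x"

definition simple_at :: "nat list \<Rightarrow> nat \<Rightarrow> (nat \<Rightarrow> int) \<Rightarrow> bool" where
  "simple_at L s x \<longleftrightarrow> (\<forall>i\<in>set L. x i = (if i = s then 1 else 0))"

definition dichotomy :: "nat list \<Rightarrow> bool" where
  "dichotomy L \<longleftrightarrow> (\<forall>x. eul L x x = 1 \<longrightarrow> nonneg_on L x \<or> nonpos_on L x)"

lemma nonneg_on_uminus [simp]: "nonneg_on L (\<lambda>i. - x i) = nonpos_on L x"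
  and nonpos_on_uminus [simp]: "nonpos_on L (\<lambda>i. - x i) = nonneg_on L x"
  by (simp_all add: nonneg_on_def nonpos_on_def)

lemma nonneg_on_rev [simp]: "nonneg_on (rev L) x = nonneg_on L x"
  and nonpos_on_rev [simp]: "nonpos_on (rev L) x = nonpos_on L x"
  by (simp_all add: nonneg_on_def nonpos_on_def)

lemma not_nonneg_nonpos: "eul L x x = 1 \<Longrightarrow> nonneg_on L x \<Longrightarrow> nonpos_on L x \<Longrightarrow> False"
  using eul_zero_left[of L x x] by (force simp: nonneg_on_def nonpos_on_def)

lemma simple_head_left:
  assumes "distinct (s # L)" "simple_at (s # L) s z"
  shows "eul (s # L) z y = y s"
proof -
  have "z i = 0" if "i \<in> set L" for i
    using assms that by (auto simp: simple_at_def split: if_splits)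
  then show ?thesis using assms by (simp add: eul_zero_left simple_at_def)
qed

lemma simple_head_right:
  assumes "distinct (s # L)" "simple_at (s # L) s z"
  shows "eul (s # L) x z = x s - (\<Sum>j\<in>set L. n j s * x j)"
proof -
  have "z i = 0" if "i \<in> set L" for i
    using assms that by (auto simp: simple_at_def split: if_splits)
  then show ?thesis using assms by (simp add: eul_zero_right simple_at_def)
qed

lemma zero_off_simple:
  assumes "pos_root L x" "distinct L" "s \<in> set L" "\<And>i. i \<in> set L \<Longrightarrow> i \<noteq> s \<Longrightarrow> x i = 0"
  shows "simple_at L s x"
proof -
  have "qf (set L) x = 2 * (x s * x s)"
  proof -
    have "(\<Sum>i\<in>set L. x i * x i) = (\<Sum>i\<in>set L. if i = s then x s * x s else 0)"
      using assms(4) by (intro sum.cong) auto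
    moreover have "(\<Sum>i\<in>set L. \<Sum>j\<in>set L. n i j * x i * x j) = 0"
    proof (intro sum.neutral ballI)
      fix i j assume "i \<in> set L" "j \<in> set L"
      then show "n i j * x i * x j = 0"
        using assms(4) n_irrefl by (cases "i = s"; cases "j = s") auto
    qed
    ultimately show ?thesis using assms by (simp add: qf_def)
  qed
  then have "x s * x s = 1" using eul_qf[OF assms(2), of x] assms(1) by (simp add: pos_root_def)
  moreover have "0 \<le> x s" using assms by (simp add: pos_root_def nonneg_on_def)
  ultimately have "x s = 1" by (metis abs_of_nonneg zmult_eq_1_iff abs_1 abs_minus zero_le_one neg_0_le_iff_le not_one_le_zero)
  then show ?thesis using assms(4) by (simp add: simple_at_def)
qed

text \<open>The reflection changes only the coordinate at \<open>s\<close>. If the image were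
  nonpositive, all other coordinates would be nonnegative and nonpositive at once, which leaves only
  the simple root at \<open>s\<close>.\<close>

lemma root_refl_sign:
  assumes "distinct (s # L)" "dichotomy (L @ [s])" "pos_root (s # L) x" "\<not> simple_at (s # L) s x"
    "J = insert s (set L)"
  shows "pos_root (L @ [s]) (reflect J s x)"
proof -
  have e: "eul (L @ [s]) (reflect J s x) (reflect J s x) = 1"
    using assms by (simp only: eul_rotate pos_root_def)
  have "\<not> nonpos_on (L @ [s]) (reflect J s x)"
  proof
    assume np: "nonpos_on (L @ [s]) (reflect J s x)"
    have "x i = 0" if "i \<in> set L" for i
    proof -
      have "reflect J s x i = x i" using that assms(1) by (auto simp: reflect_def)
      then have "x i \<le> 0" using np that by (auto simp: nonpos_on_def)
      moreover have "0 \<le> x i" using assms(3) that by (simp add: pos_root_def nonneg_on_def)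
      ultimately show ?thesis by simp
    qed
    then have "simple_at (s # L) s x"
      using assms by (intro zero_off_simple) auto
    then show False using assms by simp
  qed
  then show ?thesis using e assms(2) by (auto simp: dichotomy_def pos_root_def)
qed

lemma root_refl_sign_back:
  assumes "distinct (L @ [s])" "dichotomy (s # L)" "pos_root (L @ [s]) x"
    "\<not> simple_at (L @ [s]) s x" "J = insert s (set L)"
  shows "pos_root (s # L) (reflect J s x)"
proof -
  have e: "eul (s # L) (reflect J s x) (reflect J s x) = 1"
    using assms by (subst eul_rotate_back) (auto simp: pos_root_def)
  have "\<not> nonpos_on (s # L) (reflect J s x)"
  proof
    assume np: "nonpos_on (s # L) (reflect J s x)"
    have "x i = 0" if "i \<in> set L" for i
    proof -
      have "reflect J s x i = x i" using that assms(1) by (auto simp: reflect_def)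
      then have "x i \<le> 0" using np that by (auto simp: nonpos_on_def)
      moreover have "0 \<le> x i" using assms(3) that by (simp add: pos_root_def nonneg_on_def)
      ultimately show ?thesis by simp
    qed
    then have "simple_at (L @ [s]) s x"
      using assms by (intro zero_off_simple) auto
    then show False using assms by simp
  qed
  then show ?thesis using e assms(2) by (auto simp: dichotomy_def pos_root_def)
qed

text \<open>The value is minus the coordinate at \<open>s\<close> of the reflected root, and that
  root is still positive.\<close>

lemma simple_head_right_nonpos:
  assumes "distinct (s # L)" "dichotomy (L @ [s])" "pos_root (s # L) x" "\<not> simple_at (s # L) s x"
    "simple_at (s # L) s z"
  shows "eul (s # L) x z \<le> 0"
proof -
  have "0 \<le> reflect (insert s (set L)) s x s"
    using root_refl_sign[OF assms(1-4) refl] by (simp add: pos_root_def nonneg_on_def)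
  then show ?thesis
    using assms unfolding simple_head_right[OF assms(1,5)] by (simp add: reflect_same sum_head)
qed

lemma simple_last_right:
  assumes "distinct (L @ [s])" "simple_at (L @ [s]) s z"
  shows "eul (L @ [s]) y z = y s"
proof -
  have "eul (L @ [s]) y z = eul (s # rev L) z y"
    using eul_rev[of "s # rev L" y z] assms(1) by simp
  also have "\<dots> = y s" using assms by (intro simple_head_left) (auto simp: simple_at_def)
  finally show ?thesis .
qed

lemma simple_last_left:
  assumes "distinct (L @ [s])" "simple_at (L @ [s]) s z"
  shows "eul (L @ [s]) z y = y s - (\<Sum>j\<in>set L. n j s * y j)"
proof -
  have "eul (L @ [s]) z y = eul (s # rev L) y z"
    using eul_rev[of "s # rev L" z y] assms(1) by simp
  also have "\<dots> = y s - (\<Sum>j\<in>set (rev L). n j s * y j)"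
    using assms by (intro simple_head_right) (auto simp: simple_at_def)
  finally show ?thesis by simp
qed

lemma simple_last_left_nonpos:
  assumes "distinct (L @ [s])" "dichotomy (s # L)" "pos_root (L @ [s]) x"
    "\<not> simple_at (L @ [s]) s x" "simple_at (L @ [s]) s z"
  shows "eul (L @ [s]) z x \<le> 0"
proof -
  have "0 \<le> reflect (insert s (set L)) s x s"
    using root_refl_sign_back[OF assms(1-4) refl] by (simp add: pos_root_def nonneg_on_def)
  then show ?thesis
    using assms unfolding simple_last_left[OF assms(1,5)] by (simp add: reflect_same sum_head)
qed

end

section \<open>Affine graphs\<close>

context weighted_graph begin

abbreviation cox :: "nat set \<Rightarrow> nat list \<Rightarrow> (nat \<Rightarrow> int) \<Rightarrow> nat \<Rightarrow> int" where
  "cox J L \<equiv> fold (reflect J) L"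

lemma cox_add: "cox J L (\<lambda>i. x i + m * y i) = (\<lambda>i. cox J L x i + m * cox J L y i)"
  by (induction L arbitrary: x y) (simp_all add: reflect_add)

lemma cox_zero: "cox J L (\<lambda>i. 0) = (\<lambda>i. 0)"
  using cox_add[of J L "\<lambda>i. 0" "-1" "\<lambda>i. 0"] by simp

lemma cox_sum: "cox J L (\<lambda>i. \<Sum>t<h. f t i) = (\<lambda>i. \<Sum>t<(h::nat). cox J L (f t) i)"
proof (induction h)
  case (Suc h)
  have "cox J L (\<lambda>i. (\<Sum>t<h. f t i) + 1 * f h i)
      = (\<lambda>i. cox J L (\<lambda>i. \<Sum>t<h. f t i) i + 1 * cox J L (f h) i)"
    by (rule cox_add)
  then show ?case using Suc by simp
qed (simp add: cox_zero)

lemma cox_outside: "i \<notin> set L \<Longrightarrow> cox J L x i = x i"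
  by (induction L arbitrary: x) (simp_all add: reflect_def)

lemma cox_pow_outside: "i \<notin> set L \<Longrightarrow> (cox J L ^^ t) x i = x i"
  by (induction t) (simp_all add: cox_outside)

text \<open>Among the factors of the product only the reflection at \<open>t\<close> changes the
  coordinate at \<open>t\<close>. A vector fixed by the whole product is therefore fixed by the
  first factor, and then by the remaining ones.\<close>

lemma cox_fixed:
  assumes "distinct L" "cox J L u = u" "s \<in> set L"
  shows "reflect J s u = u"
  using assms
proof (induction L)
  case (Cons t L)
  have "cox J L (reflect J t u) t = reflect J t u t"
    using Cons.prems by (intro cox_outside) auto
  then have "reflect J t u t = u t" using Cons.prems(2) by simp
  then have "reflect J t u = u" by (auto simp: reflect_def fun_eq_iff)
  then show ?case using Cons by auto
qed simp

lemma cox_rev: "finite J \<Longrightarrow> cox J (rev L) (cox J L x) = x"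
  by (induction L arbitrary: x) (simp_all add: reflect_reflect)

lemma cox_orbit_sum_fixed:
  fixes h :: nat
  assumes "(cox J L ^^ h) y = y"
  shows "cox J L (\<lambda>i. \<Sum>t<h. (cox J L ^^ t) y i) = (\<lambda>i. \<Sum>t<h. (cox J L ^^ t) y i)"
proof -
  have "(\<Sum>t<h. (cox J L ^^ Suc t) y i) = (\<Sum>t<h. (cox J L ^^ t) y i)" for i
  proof -
    have "(\<Sum>t<h. (cox J L ^^ Suc t) y i) + (cox J L ^^ 0) y i = (\<Sum>t<Suc h. (cox J L ^^ t) y i)"
      by (simp only: sum.lessThan_Suc_shift add.commute)
    then show ?thesis using assms by simp
  qed
  then show ?thesis by (subst cox_sum) simp
qed

lemma reflect_fixed_radical:
  assumes "reflect J s u = u"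
  shows "(\<Sum>j\<in>J. n j s * u j) = 2 * u s"
  using fun_cong[OF assms, of s] by (simp add: reflect_same)

lemma qf_radical:
  assumes "\<And>s. s \<in> J \<Longrightarrow> (\<Sum>j\<in>J. n j s * u j) = 2 * u s"
  shows "qf J u = 0"
proof -
  have "(\<Sum>i\<in>J. \<Sum>j\<in>J. n i j * u i * u j) = (\<Sum>i\<in>J. u i * (\<Sum>j\<in>J. n j i * u j))"
    by (simp add: sum_distrib_left n_sym algebra_simps)
  also have "\<dots> = (\<Sum>i\<in>J. u i * (2 * u i))"
    by (intro sum.cong) (simp_all add: assms)
  also have "\<dots> = 2 * (\<Sum>i\<in>J. u i * u i)"
    by (simp add: sum_distrib_left algebra_simps)
  finally show ?thesis by (simp add: qf_def)
qed

lemma eul_cox_aux: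
  assumes "distinct (L1 @ L2)" "J = set (L1 @ L2)"
  shows "eul (L2 @ L1) (cox J L1 x) (cox J L1 y) = eul (L1 @ L2) x y"
  using assms
proof (induction L1 arbitrary: L2 x y)
  case (Cons s L1)
  have "eul ((L2 @ [s]) @ L1) (cox J L1 (reflect J s x)) (cox J L1 (reflect J s y))
      = eul (L1 @ (L2 @ [s])) (reflect J s x) (reflect J s y)"
    using Cons.prems by (intro Cons.IH) auto
  also have "\<dots> = eul (s # (L1 @ L2)) x y"
    using Cons.prems eul_rotate[of s "L1 @ L2" J x y] by simp
  finally show ?case by simp
qed simp

lemma eul_cox: "distinct L \<Longrightarrow> J = set L \<Longrightarrow> eul L (cox J L x) (cox J L y) = eul L x y"
  using eul_cox_aux[of L "[]" J x y] by simp

text \<open>One full turn of the list is one Coxeter transformation, so what survives every single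
  rotation survives all its powers.\<close>

lemma rotate_invariant:
  assumes step: "\<And>s L x. distinct (s # L) \<Longrightarrow> set (s # L) = J \<Longrightarrow> P (s # L) x \<Longrightarrow> P (L @ [s]) (reflect J s x)"
    and "distinct L" "set L = J" "P L x"
  shows "P L ((cox J L ^^ t) x)"
proof -
  have aux: "P (L2 @ L1) (cox J L1 x)"
    if "P (L1 @ L2) x" "distinct (L1 @ L2)" "set (L1 @ L2) = J" for L1 L2 x
    using that
  proof (induction L1 arbitrary: L2 x)
    case (Cons s L1)
    have "P (L1 @ (L2 @ [s])) (reflect J s x)"
      using step[of s "L1 @ L2" x] Cons.prems by simp
    then have "P ((L2 @ [s]) @ L1) (cox J L1 (reflect J s x))"
      using Cons.prems by (intro Cons.IH) auto
    then show ?case by simp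
  qed simp
  show ?thesis
    using assms(2-4) aux[of L "[]"] by (induction t) simp_all
qed

lemma rotate_back_invariant:
  assumes step: "\<And>s L x. distinct (L @ [s]) \<Longrightarrow> set (L @ [s]) = J \<Longrightarrow> P (L @ [s]) x \<Longrightarrow> P (s # L) (reflect J s x)"
    and "distinct L" "set L = J" "P L x"
  shows "P L ((cox J (rev L) ^^ t) x)"
proof -
  have "P (rev (rev L)) ((cox J (rev L) ^^ t) x)"
    by (rule rotate_invariant[where P = "\<lambda>M. P (rev M)"]) (use assms in auto)
  then show ?thesis by simp
qed

end

lemma nat_pigeonhole:
  fixes f :: "nat \<Rightarrow> 'a"
  assumes "finite B" "\<And>t. f t \<in> B"
  obtains t t' where "t < t'" "f t = f t'"
proof -
  have "\<not> inj f"
    using assms finite_subset[of "range f" B] finite_imageD[of f UNIV] by auto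
  then obtain a b where "a \<noteq> b" "f a = f b" by (auto simp: inj_def)
  then show ?thesis using that[of a b] that[of b a] by (cases a b rule: linorder_cases) auto
qed

section \<open>The semidefinite form of an affine graph\<close>

locale affine_graph = weighted_graph +
  fixes I :: "nat set" and \<delta> :: "nat \<Rightarrow> int"
  assumes fin: "finite I" and nonempty: "I \<noteq> {}"
    and delta_pos: "i \<in> I \<Longrightarrow> 0 < \<delta> i" and delta_out: "i \<notin> I \<Longrightarrow> \<delta> i = 0"
    and balanced: "i \<in> I \<Longrightarrow> (\<Sum>j\<in>I. n j i * \<delta> j) = 2 * \<delta> i"
    and connected: "S \<subseteq> I \<Longrightarrow> S \<noteq> {} \<Longrightarrow> (\<And>i j. i \<in> S \<Longrightarrow> j \<in> I - S \<Longrightarrow> n i j = 0) \<Longrightarrow> S = I"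
begin

text \<open>Expanding a square gives a term in \<open>x i\<close> alone, one in \<open>x j\<close>
  alone and a mixed one; the first two are summed over neighbours with the balance of \<delta>.
  Semidefiniteness and the radical are read off from the squares, without any classification of
  diagrams.\<close>

lemma qf_squares:
  "2 * real_of_int (qf I x) = (\<Sum>i\<in>I. \<Sum>j\<in>I. real_of_int (n i j * \<delta> i * \<delta> j) *
      (real_of_int (x i) / real_of_int (\<delta> i) - real_of_int (x j) / real_of_int (\<delta> j))\<^sup>2)"
proof -
  define r where "r i = real_of_int (x i)" for i
  define d where "d i = real_of_int (\<delta> i)" for i
  define m where "m i j = real_of_int (n i j)" for i j
  have dp: "0 < d i" if "i \<in> I" for i using delta_pos[OF that] by (simp add: d_def)
  have ms: "m i j = m j i" for i j by (simp add: m_def n_sym)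
  have bal: "(\<Sum>j\<in>I. m i j * d j) = 2 * d i" if "i \<in> I" for i
  proof -
    have "(\<Sum>j\<in>I. m i j * d j) = real_of_int (\<Sum>j\<in>I. n j i * \<delta> j)"
      by (simp add: m_def d_def n_sym)
    then show ?thesis using balanced[OF that] by (simp add: d_def)
  qed
  have "(\<Sum>i\<in>I. \<Sum>j\<in>I. m i j * d i * d j * (r i / d i - r j / d j)\<^sup>2)
      = (\<Sum>i\<in>I. \<Sum>j\<in>I. (r i * r i / d i) * (m i j * d j) + (r j * r j / d j) * (m j i * d i) - 2 * (m i j * r i * r j))"
  proof (intro sum.cong refl)
    fix i j assume "i \<in> I" "j \<in> I"
    then have "d i \<noteq> 0" "d j \<noteq> 0" using dp by (metis less_irrefl)+
    then show "m i j * d i * d j * (r i / d i - r j / d j)\<^sup>2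
       = (r i * r i / d i) * (m i j * d j) + (r j * r j / d j) * (m j i * d i) - 2 * (m i j * r i * r j)"
      by (simp add: ms[of j i] field_simps power2_eq_square)
  qed
  also have "\<dots> = (\<Sum>i\<in>I. (r i * r i / d i) * (\<Sum>j\<in>I. m i j * d j))
       + (\<Sum>j\<in>I. (r j * r j / d j) * (\<Sum>i\<in>I. m j i * d i)) - 2 * (\<Sum>i\<in>I. \<Sum>j\<in>I. m i j * r i * r j)"
  proof -
    have "(\<Sum>i\<in>I. \<Sum>j\<in>I. (r j * r j / d j) * (m j i * d i)) = (\<Sum>j\<in>I. \<Sum>i\<in>I. (r j * r j / d j) * (m j i * d i))"
      by (rule sum.swap)
    then show ?thesis
      by (simp only: sum.distrib sum_subtractf sum_distrib_left)
  qed
  also have "\<dots> = 4 * (\<Sum>i\<in>I. r i * r i) - 2 * (\<Sum>i\<in>I. \<Sum>j\<in>I. m i j * r i * r j)"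
  proof -
    have "(\<Sum>i\<in>I. (r i * r i / d i) * (\<Sum>j\<in>I. m i j * d j)) = (\<Sum>i\<in>I. 2 * (r i * r i))"
    proof (intro sum.cong refl)
      fix i assume "i \<in> I"
      then show "(r i * r i / d i) * (\<Sum>j\<in>I. m i j * d j) = 2 * (r i * r i)"
        using dp[of i] by (simp add: bal)
    qed
    then show ?thesis by (simp add: sum_distrib_left[symmetric])
  qed
  finally show ?thesis by (simp add: qf_def r_def d_def m_def)
qed

lemma square_term_nonneg:
  assumes "i \<in> I" "j \<in> I"
  shows "0 \<le> real_of_int (n i j * \<delta> i * \<delta> j) * (r::real)\<^sup>2"
  using n_nonneg[of i j] delta_pos[OF assms(1)] delta_pos[OF assms(2)] by simp

lemma qf_nonneg: "0 \<le> qf I x"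
proof -
  have "0 \<le> 2 * real_of_int (qf I x)"
    unfolding qf_squares by (intro sum_nonneg square_term_nonneg)
  then show ?thesis by simp
qed

text \<open>All squares vanish, so the ratio of \<open>x\<close> to \<delta> is constant along
  edges, and connectedness makes it constant everywhere.\<close>

lemma qf_zero_proportional:
  assumes "qf I x = 0" "i \<in> I" "j \<in> I"
  shows "x i * \<delta> j = x j * \<delta> i"
proof -
  let ?t = "\<lambda>i j. real_of_int (n i j * \<delta> i * \<delta> j) *
      (real_of_int (x i) / real_of_int (\<delta> i) - real_of_int (x j) / real_of_int (\<delta> j))\<^sup>2"
  have z: "(\<Sum>i\<in>I. \<Sum>j\<in>I. ?t i j) = 0" using qf_squares[of x] assms(1) by simp
  have edge: "x k * \<delta> l = x l * \<delta> k" if "k \<in> I" "l \<in> I" "n k l \<noteq> 0" for k l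
  proof -
    have "(\<Sum>j\<in>I. ?t k j) = 0"
      by (rule sum_nonneg_0[OF fin _ z that(1)]) (intro sum_nonneg square_term_nonneg)
    then have "?t k l = 0"
      using sum_nonneg_0[OF fin, of "?t k" l] square_term_nonneg[OF that(1)] that(2) by blast
    then have "real_of_int (x k) / real_of_int (\<delta> k) = real_of_int (x l) / real_of_int (\<delta> l)"
      using that delta_pos[OF that(1)] delta_pos[OF that(2)] by simp
    then have "real_of_int (x k * \<delta> l) = real_of_int (x l * \<delta> k)"
      using delta_pos[OF that(1)] delta_pos[OF that(2)] by (simp add: field_simps)
    then show ?thesis by (simp only: of_int_eq_iff)
  qed
  define S where "S = {k\<in>I. x i * \<delta> k = x k * \<delta> i}"
  have "S = I"
  proof (rule connected)
    show "S \<subseteq> I" by (auto simp: S_def)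
    show "S \<noteq> {}" using assms by (auto simp: S_def)
    fix k l assume kl: "k \<in> S" "l \<in> I - S"
    show "n k l = 0"
    proof (rule ccontr)
      assume "n k l \<noteq> 0"
      then have e: "x k * \<delta> l = x l * \<delta> k" using kl edge by (auto simp: S_def)
      have "\<delta> k * (x i * \<delta> l) = (x i * \<delta> k) * \<delta> l" by simp
      also have "\<dots> = (x k * \<delta> l) * \<delta> i" using kl by (simp add: S_def)
      also have "\<dots> = \<delta> k * (x l * \<delta> i)" by (simp add: e)
      finally have "x i * \<delta> l = x l * \<delta> i" using delta_pos[of k] kl by (simp add: S_def)
      then show False using kl by (simp add: S_def)
    qed
  qed
  then show ?thesis using assms by (auto simp: S_def)
qed

text \<open>Positive and negative parts have disjoint supports. Only the products mixing both parts
  are dropped, and since edge weights are nonnegative they can only make the form of the difference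
  larger.\<close>

lemma qf_split:
  assumes "\<And>i. x i = p i - q i" "\<And>i. p i * q i = 0" "\<And>i. 0 \<le> p i" "\<And>i. 0 \<le> q i"
  shows "qf I p + qf I q \<le> qf I x"
proof -
  have "(\<Sum>i\<in>I. x i * x i) = (\<Sum>i\<in>I. p i * p i) + (\<Sum>i\<in>I. q i * q i)"
  proof -
    have "x i * x i = p i * p i + q i * q i" for i
      using assms(2)[of i] by (simp add: assms(1) algebra_simps)
    then show ?thesis by (simp add: sum.distrib)
  qed
  moreover have "(\<Sum>i\<in>I. \<Sum>j\<in>I. n i j * x i * x j)
     \<le> (\<Sum>i\<in>I. \<Sum>j\<in>I. n i j * p i * p j) + (\<Sum>i\<in>I. \<Sum>j\<in>I. n i j * q i * q j)"
  proof -
    have "n i j * x i * x j \<le> n i j * p i * p j + n i j * q i * q j" for i j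
    proof -
      have "n i j * x i * x j = n i j * p i * p j + n i j * q i * q j - n i j * (p i * q j) - n i j * (q i * p j)"
        by (simp add: assms(1) algebra_simps)
      moreover have "0 \<le> n i j * (p i * q j)" "0 \<le> n i j * (q i * p j)"
        using n_nonneg assms by simp_all
      ultimately show ?thesis by linarith
    qed
    then show ?thesis by (simp add: sum.distrib[symmetric] sum_mono)
  qed
  ultimately show ?thesis by (simp add: qf_def)
qed

lemma qf_even: "even (qf I x)"
proof -
  obtain L where "distinct L" "set L = I" using finite_distinct_list[OF fin] by blast
  then show ?thesis using eul_qf[of L x] by (metis dvd_triv_left)
qed

text \<open>The forms of the two parts are even, nonnegative and at most 2 in total, so one part is
  null and thus a multiple of \<delta>. If that multiple is not zero, the part is positive at every
  vertex and leaves no room for the other part.\<close>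

lemma qf_two_dichotomy:
  assumes "qf I x = 2"
  shows "(\<forall>i\<in>I. 0 \<le> x i) \<or> (\<forall>i\<in>I. x i \<le> 0)"
proof -
  define p where "p i = max (x i) 0" for i
  define q where "q i = max (- x i) 0" for i
  have "qf I p + qf I q \<le> 2"
    unfolding assms[symmetric] by (rule qf_split) (auto simp: p_def q_def max_def)
  then have pq: "qf I p = 0 \<or> qf I q = 0"
    using qf_nonneg[of p] qf_nonneg[of q] qf_even[of p] qf_even[of q] by (smt (verit) odd_one)
  have aux: "(\<forall>i\<in>I. 0 \<le> y i) \<or> (\<forall>i\<in>I. y i \<le> 0)" if "qf I (\<lambda>i. max (y i) 0) = 0" for y
  proof (cases "\<exists>i\<in>I. 0 < y i")
    case True
    then obtain i where i: "i \<in> I" "0 < y i" by blast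
    have "0 \<le> y j" if "j \<in> I" for j
    proof -
      have "max (y i) 0 * \<delta> j = max (y j) 0 * \<delta> i"
        using qf_zero_proportional[OF \<open>qf I (\<lambda>i. max (y i) 0) = 0\<close> i(1) that] .
      moreover have "0 < max (y i) 0 * \<delta> j" using i delta_pos[OF that] by simp
      ultimately have "max (y j) 0 \<noteq> 0" by (metis less_irrefl mult_zero_left)
      then show ?thesis by (simp add: max_def split: if_splits)
    qed
    then show ?thesis by blast
  next
    case False
    then show ?thesis by (simp add: not_less)
  qed
  show ?thesis using pq
  proof
    assume "qf I p = 0"
    then show ?thesis using aux[of x] by (simp add: p_def[abs_def])
  next
    assume "qf I q = 0"
    then show ?thesis using aux[of "\<lambda>i. - x i"] by (auto simp: q_def[abs_def])
  qed
qed

lemma dichotomy_full: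
  assumes "distinct L" "set L = I"
  shows "dichotomy L"
  unfolding dichotomy_def nonneg_on_def nonpos_on_def
proof (intro allI impI)
  fix x assume "eul L x x = 1"
  then show "(\<forall>i\<in>set L. 0 \<le> x i) \<or> (\<forall>i\<in>set L. x i \<le> 0)"
    using qf_two_dichotomy[of x] eul_qf[of L x] assms by simp
qed

lemma eul_sub:
  assumes "distinct L" "set L = I - {s}" "s \<in> I"
  shows "eul L x y = eul (s # L) (x(s := 0)) (y(s := 0))"
proof -
  have "eul L x y = eul L (x(s := 0)) (y(s := 0))"
    using assms by (intro eul_cong) auto
  then show ?thesis by simp
qed

lemma qf_sub:
  assumes "s \<in> I"
  shows "qf (I - {s}) x = qf I (x(s := 0))"
proof -
  obtain L where L: "distinct L" "set L = I - {s}" using finite_distinct_list[of "I - {s}"] fin by blast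
  have "qf (I - {s}) x = 2 * eul L x x" using L by (simp add: eul_qf)
  also have "\<dots> = 2 * eul (s # L) (x(s := 0)) (x(s := 0))" by (simp only: eul_sub[OF L assms])
  also have "\<dots> = qf I (x(s := 0))" using L assms by (subst eul_qf) (auto simp: insert_absorb)
  finally show ?thesis .
qed

lemma dichotomy_sub:
  assumes "distinct L" "set L = I - {s}" "s \<in> I"
  shows "dichotomy L"
  unfolding dichotomy_def
proof (intro allI impI)
  fix x assume "eul L x x = 1"
  then have "eul (s # L) (x(s := 0)) (x(s := 0)) = 1" by (simp only: eul_sub[OF assms])
  moreover have "dichotomy (s # L)" using assms by (intro dichotomy_full) auto
  ultimately have "nonneg_on (s # L) (x(s := 0)) \<or> nonpos_on (s # L) (x(s := 0))"
    unfolding dichotomy_def by blast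
  then show "nonneg_on L x \<or> nonpos_on L x"
    using assms by (auto simp: nonneg_on_def nonpos_on_def split: if_splits)
qed

lemma reflect_delta: "s \<in> I \<Longrightarrow> reflect I s \<delta> = \<delta>"
  by (simp add: reflect_def balanced)

lemma cox_delta: "set L \<subseteq> I \<Longrightarrow> cox I L \<delta> = \<delta>"
  by (induction L) (simp_all add: reflect_delta)

lemma qf_delta: "qf I \<delta> = 0"
  by (rule qf_radical) (rule balanced)

lemma eul_delta_delta: "distinct L \<Longrightarrow> set L = I \<Longrightarrow> eul L \<delta> \<delta> = 0"
  using eul_qf[of L \<delta>] qf_delta by simp

lemma qf_add_delta: "qf I (\<lambda>i. x i + k * \<delta> i) = qf I x"
proof -
  have "(\<Sum>i\<in>I. \<Sum>j\<in>I. n i j * x i * \<delta> j) = (\<Sum>i\<in>I. x i * (\<Sum>j\<in>I. n j i * \<delta> j))"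
    by (simp add: sum_distrib_left n_sym algebra_simps)
  also have "\<dots> = (\<Sum>i\<in>I. x i * (2 * \<delta> i))"
    by (intro sum.cong) (simp_all add: balanced)
  also have "\<dots> = 2 * (\<Sum>i\<in>I. x i * \<delta> i)"
    by (simp add: sum_distrib_left algebra_simps)
  finally have 1: "(\<Sum>i\<in>I. \<Sum>j\<in>I. n i j * x i * \<delta> j) = 2 * (\<Sum>i\<in>I. x i * \<delta> i)" .
  have "(\<Sum>i\<in>I. \<Sum>j\<in>I. n i j * \<delta> i * x j) = (\<Sum>j\<in>I. \<Sum>i\<in>I. n i j * \<delta> i * x j)"
    by (rule sum.swap)
  also have "\<dots> = (\<Sum>i\<in>I. \<Sum>j\<in>I. n i j * x i * \<delta> j)"
    by (simp add: n_sym algebra_simps)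
  finally have 2: "(\<Sum>i\<in>I. \<Sum>j\<in>I. n i j * \<delta> i * x j) = 2 * (\<Sum>i\<in>I. x i * \<delta> i)" using 1 by simp
  have "qf I (\<lambda>i. x i + k * \<delta> i) = qf I x + k * k * qf I \<delta> + 4 * k * (\<Sum>i\<in>I. x i * \<delta> i)
      - k * (\<Sum>i\<in>I. \<Sum>j\<in>I. n i j * x i * \<delta> j) - k * (\<Sum>i\<in>I. \<Sum>j\<in>I. n i j * \<delta> i * x j)"
    by (simp add: qf_def sum.distrib sum_distrib_left algebra_simps)
  then show ?thesis using 1 2 qf_delta by simp
qed

text \<open>Every translate by a multiple of \<delta> is again a root and so has one sign; where the
  sign changes, the translate lies between 0 and \<delta>. Hence there are only finitely many roots
  modulo \<delta>.\<close>

lemma root_box: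
  assumes "qf I x = 2"
  obtains k where "\<And>i. i \<in> I \<Longrightarrow> 0 \<le> x i - k * \<delta> i \<and> x i - k * \<delta> i \<le> \<delta> i"
proof -
  have dich: "(\<forall>i\<in>I. 0 \<le> x i - k * \<delta> i) \<or> (\<forall>i\<in>I. x i - k * \<delta> i \<le> 0)" for k
    using qf_two_dichotomy[of "\<lambda>i. x i + (- k) * \<delta> i"] qf_add_delta[of x "-k"] assms by simp
  obtain j where j: "j \<in> I" using nonempty by blast
  \<comment> \<open>One coordinate determines the translate up to one step: \<open>k + 1\<close>
    makes it negative at \<open>j\<close>. If \<open>k\<close> itself already gives a nonpositive
    root, \<open>k - 1\<close> is the right choice.\<close>
  define k where "k = x j div \<delta> j"
  have dj: "0 < \<delta> j" using delta_pos j .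
  have 1: "k * \<delta> j \<le> x j" "x j < (k + 1) * \<delta> j"
    using pos_mod_sign[OF dj, of "x j"] pos_mod_bound[OF dj, of "x j"] div_mult_mod_eq[of "x j" "\<delta> j"]
    unfolding k_def distrib_right by linarith+
  have up: "x i - (k + 1) * \<delta> i \<le> 0" if "i \<in> I" for i
  proof -
    have "\<not> 0 \<le> x j - (k + 1) * \<delta> j" using 1(2) by linarith
    then have "\<forall>i\<in>I. x i - (k + 1) * \<delta> i \<le> 0" using dich[of "k + 1"] j by blast
    then show ?thesis using that by blast
  qed
  show ?thesis
  proof (cases "\<forall>i\<in>I. 0 \<le> x i - k * \<delta> i")
    case True
    then show ?thesis using up by (intro that[of k]) (auto simp: algebra_simps)
  next
    case False
    then have le: "\<forall>i\<in>I. x i - k * \<delta> i \<le> 0" using dich by blast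
    have "0 \<le> x i - (k - 1) * \<delta> i" if "i \<in> I" for i
    proof -
      have "0 < x j - (k - 1) * \<delta> j" using 1(1) dj by (simp add: algebra_simps)
      then have "\<not> x j - (k - 1) * \<delta> j \<le> 0" by linarith
      then have "\<forall>i\<in>I. 0 \<le> x i - (k - 1) * \<delta> i" using dich[of "k - 1"] j by blast
      then show ?thesis using that by blast
    qed
    then show ?thesis using le by (intro that[of "k - 1"]) (auto simp: algebra_simps)
  qed
qed

text \<open>Extended by zero and translated by minus \<delta>, the root is negative at
  \<open>s\<close>, hence nonpositive everywhere. The bound makes the set of positive roots away
  from \<open>s\<close> finite.\<close>

lemma pos_root_sub_le_delta:
  assumes "distinct L" "set L = I - {s}" "s \<in> I" "pos_root L x" "i \<in> set L"
  shows "x i \<le> \<delta> i"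
proof -
  have "qf I (x(s := 0)) = 2"
    using assms eul_qf[of L x] qf_sub[of s x] by (simp add: pos_root_def)
  then have "qf I (\<lambda>i. (x(s := 0)) i + (-1) * \<delta> i) = 2" by (simp only: qf_add_delta)
  then have "(\<forall>i\<in>I. 0 \<le> (x(s := 0)) i - \<delta> i) \<or> (\<forall>i\<in>I. (x(s := 0)) i - \<delta> i \<le> 0)"
    using qf_two_dichotomy[of "\<lambda>i. (x(s := 0)) i + (-1) * \<delta> i"] by simp
  moreover have "\<not> (0 \<le> (x(s := 0)) s - \<delta> s)" using delta_pos[OF assms(3)] by simp
  ultimately have "\<forall>i\<in>I. (x(s := 0)) i - \<delta> i \<le> 0" using assms(3) by blast
  then have "(x(s := 0)) i - \<delta> i \<le> 0" using assms by blast
  then show ?thesis using assms by (auto split: if_splits)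
qed

text \<open>A Coxeter orbit of positive roots bounded by \<delta> must repeat. The sum over a period
  is fixed by every reflection, hence null, hence a multiple of \<delta> vanishing at
  \<open>s\<close>, hence zero; but a sum of nonnegative vectors is zero only if all of them are. So
  no property of positive roots is stable under rotation here.\<close>

lemma escape_sub:
  assumes L: "distinct L" "set L = I - {s}" "s \<in> I" and "P L x"
    and root: "\<And>L x. distinct L \<Longrightarrow> set L = I - {s} \<Longrightarrow> P L x \<Longrightarrow> pos_root L x"
    and step: "\<And>t L x. distinct (t # L) \<Longrightarrow> set (t # L) = I - {s} \<Longrightarrow> P (t # L) x \<Longrightarrow>
       P (L @ [t]) (reflect (I - {s}) t x)"
  shows False
proof -
  let ?J = "I - {s}"
  define X where "X t = (cox ?J L ^^ t) x" for t
  have P: "P L (X t)" for t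
    unfolding X_def using step L(1,2) \<open>P L x\<close> by (rule rotate_invariant)
  then have pr: "pos_root L (X t)" for t using root L by blast
  have "finite (PiE ?J (\<lambda>i. {0..\<delta> i}))" using fin by (intro finite_PiE) auto
  moreover have "restrict (X t) ?J \<in> PiE ?J (\<lambda>i. {0..\<delta> i})" for t
    using pos_root_sub_le_delta[OF L pr] pr[of t] L by (auto simp: pos_root_def nonneg_on_def)
  ultimately obtain t t' where t: "t < t'" "restrict (X t) ?J = restrict (X t') ?J"
    using nat_pigeonhole[where f = "\<lambda>t. restrict (X t) ?J"] by metis
  define y where "y = X t"
  define h where "h = t' - t"
  have h: "0 < h" using t by (simp add: h_def)
  have "X t' = X t"
  proof
    fix i
    show "X t' i = X t i"
      using fun_cong[OF t(2), of i] L
      by (cases "i \<in> ?J") (auto simp: X_def cox_pow_outside)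
  qed
  moreover have Xy: "(cox ?J L ^^ r) y = X (r + t)" for r
    by (simp add: X_def y_def funpow_add)
  then have "X t' = (cox ?J L ^^ h) y" using t by (simp add: h_def)
  ultimately have "(cox ?J L ^^ h) y = y" by (simp add: y_def)
  then have fixd: "cox ?J L (\<lambda>i. \<Sum>t<h. (cox ?J L ^^ t) y i) = (\<lambda>i. \<Sum>t<h. (cox ?J L ^^ t) y i)"
    by (rule cox_orbit_sum_fixed)
  define u where "u = (\<lambda>i. \<Sum>t<h. (cox ?J L ^^ t) y i)"
  have "qf ?J u = 0"
    using cox_fixed[OF L(1) fixd] L(2) by (intro qf_radical reflect_fixed_radical) (auto simp: u_def)
  then have q0: "qf I (u(s := 0)) = 0" using qf_sub[OF L(3)] by simp
  have u0: "u i = 0" if "i \<in> ?J" for i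
    using qf_zero_proportional[OF q0, of i s] that L(3) delta_pos[OF L(3)] by auto
  have "y i = 0" if "i \<in> set L" for i
  proof -
    have nn: "0 \<le> (cox ?J L ^^ r) y i" for r
      using pr[of "r + t"] that by (simp add: Xy pos_root_def nonneg_on_def)
    have "(\<Sum>t<h. (cox ?J L ^^ t) y i) = 0" using u0 that L(2) by (simp add: u_def)
    then have "(cox ?J L ^^ 0) y i = 0"
      using sum_nonneg_0[of "{..<h}" "\<lambda>t. (cox ?J L ^^ t) y i" 0] nn h by simp
    then show ?thesis by simp
  qed
  then have "eul L y y = 0" by (rule eul_zero_left)
  then show False using pr[of t] by (simp add: y_def pos_root_def)
qed

text \<open>Modulo \<delta> the orbit repeats, so some power of the Coxeter transformation
  translates \<open>y\<close> by \<open>k * \<delta>\<close>. Positivity of all forward images gives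
  \<open>0 \<le> k\<close>, that of all backward images \<open>k \<le> 0\<close>. The sum over the
  period is then a multiple of \<delta>, of defect zero, while all its terms have the same
  defect.\<close>

lemma escape_full:
  assumes L: "distinct L" "set L = I" and "P L x"
    and root: "\<And>L x. distinct L \<Longrightarrow> set L = I \<Longrightarrow> P L x \<Longrightarrow> pos_root L x"
    and step: "\<And>t L x. distinct (t # L) \<Longrightarrow> set (t # L) = I \<Longrightarrow> P (t # L) x \<Longrightarrow>
       P (L @ [t]) (reflect I t x)"
    and step_back: "\<And>t L x. distinct (L @ [t]) \<Longrightarrow> set (L @ [t]) = I \<Longrightarrow> P (L @ [t]) x \<Longrightarrow>
       P (t # L) (reflect I t x)"
  shows "eul L \<delta> x = 0"
proof -
  define X where "X t = (cox I L ^^ t) x" for t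
  have P: "P L (X t)" for t
    unfolding X_def using step L(1,2) \<open>P L x\<close> by (rule rotate_invariant)
  then have pr: "pos_root L (X t)" for t using root L by blast
  have "qf I (X t) = 2" for t using pr[of t] L eul_qf[of L "X t"] by (simp add: pos_root_def)
  then have "\<exists>k. \<forall>i\<in>I. 0 \<le> X t i - k * \<delta> i \<and> X t i - k * \<delta> i \<le> \<delta> i" for t
    using root_box[of "X t"] by metis
  then obtain K where K: "\<And>t i. i \<in> I \<Longrightarrow> 0 \<le> X t i - K t * \<delta> i \<and> X t i - K t * \<delta> i \<le> \<delta> i"
    by metis
  have "finite (PiE I (\<lambda>i. {0..\<delta> i}))" using fin by (intro finite_PiE) auto
  moreover have "restrict (\<lambda>i. X t i - K t * \<delta> i) I \<in> PiE I (\<lambda>i. {0..\<delta> i})" for t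
    using K by auto
  ultimately obtain t t' where t: "t < t'"
    "restrict (\<lambda>i. X t i - K t * \<delta> i) I = restrict (\<lambda>i. X t' i - K t' * \<delta> i) I"
    using nat_pigeonhole[where f = "\<lambda>t. restrict (\<lambda>i. X t i - K t * \<delta> i) I"] by metis
  define y where "y = X t"
  define h where "h = t' - t"
  define k where "k = K t' - K t"
  have h: "0 < h" using t by (simp add: h_def)
  have Xy: "(cox I L ^^ r) y = X (r + t)" for r
    by (simp add: X_def y_def funpow_add)
  have shift: "(cox I L ^^ h) y = (\<lambda>i. y i + k * \<delta> i)"
  proof
    fix i
    have "X t' i = X t i + k * \<delta> i"
    proof (cases "i \<in> I")
      case True
      then have "X t i - K t * \<delta> i = X t' i - K t' * \<delta> i" using fun_cong[OF t(2), of i] by simp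
      then show ?thesis by (simp add: k_def algebra_simps)
    next
      case False
      then show ?thesis using L by (simp add: X_def cox_pow_outside delta_out)
    qed
    then show "(cox I L ^^ h) y i = y i + k * \<delta> i" using t Xy[of h] by (simp add: h_def y_def)
  qed
  have fwd: "(cox I L ^^ r) (\<lambda>i. z i + m * \<delta> i) = (\<lambda>i. (cox I L ^^ r) z i + m * \<delta> i)" for r m z
    using L by (induction r) (simp_all add: cox_add cox_delta)
  have bwd: "(cox I (rev L) ^^ r) (\<lambda>i. z i + m * \<delta> i) = (\<lambda>i. (cox I (rev L) ^^ r) z i + m * \<delta> i)" for r m z
    using L by (induction r) (simp_all add: cox_add cox_delta)
  have inv: "(cox I (rev L) ^^ r) ((cox I L ^^ r) z) = z" for r z
  proof (induction r arbitrary: z)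
    case (Suc r)
    have "(cox I (rev L) ^^ Suc r) ((cox I L ^^ Suc r) z)
        = (cox I (rev L) ^^ r) (cox I (rev L) (cox I L ((cox I L ^^ r) z)))"
      by (simp add: funpow_swap1)
    then show ?case using Suc fin by (simp add: cox_rev)
  qed simp
  have up: "(cox I L ^^ (m * h)) y = (\<lambda>i. y i + int m * k * \<delta> i)" for m
  proof (induction m)
    case (Suc m)
    have "(cox I L ^^ (Suc m * h)) y = (cox I L ^^ h) ((cox I L ^^ (m * h)) y)"
      by (simp add: funpow_add)
    then show ?case using Suc fwd[of h y "int m * k"] shift by (simp add: algebra_simps)
  qed simp
  have "(cox I (rev L) ^^ h) (\<lambda>i. y i + k * \<delta> i) = y" using inv[of h y] shift by simp
  then have shift': "(cox I (rev L) ^^ h) y = (\<lambda>i. y i + (- k) * \<delta> i)"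
    using bwd[of h y k] by (auto simp: fun_eq_iff algebra_simps dest: fun_cong)
  have down: "(cox I (rev L) ^^ (m * h)) y = (\<lambda>i. y i + int m * (- k) * \<delta> i)" for m
  proof (induction m)
    case (Suc m)
    have "(cox I (rev L) ^^ (Suc m * h)) y = (cox I (rev L) ^^ h) ((cox I (rev L) ^^ (m * h)) y)"
      by (simp add: funpow_add)
    then show ?case using Suc bwd[of h y "int m * (-k)"] shift' by (simp add: algebra_simps)
  qed simp
  obtain j where j: "j \<in> I" using nonempty by blast
  have Py: "P L y" using P by (simp add: y_def)
  \<comment> \<open>A negative \<open>l\<close> lowers the coordinate at \<open>j\<close> by at
    least one in each step, so \<open>\<bar>y j\<bar> + 1\<close> steps make it negative.\<close>
  have bounded: "0 \<le> l" if "\<And>m. 0 \<le> y j + int m * l * \<delta> j" for l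
  proof (rule ccontr)
    assume "\<not> 0 \<le> l"
    then have "l * \<delta> j \<le> - 1" using delta_pos[OF j]
      by (smt (verit) mult_less_0_iff)
    then have "int (nat (\<bar>y j\<bar> + 1)) * (l * \<delta> j) \<le> int (nat (\<bar>y j\<bar> + 1)) * (- 1)"
      by (intro mult_left_mono) auto
    then show False using that[of "nat (\<bar>y j\<bar> + 1)"] by (simp add: algebra_simps)
  qed
  have "0 \<le> k"
  proof (rule bounded)
    fix m :: nat
    have "pos_root L ((cox I L ^^ (m * h)) y)" using pr Xy by simp
    then show "0 \<le> y j + int m * k * \<delta> j" using j L by (simp add: up pos_root_def nonneg_on_def)
  qed
  moreover have "0 \<le> - k"
  proof (rule bounded)
    fix m :: nat
    have "P L ((cox I (rev L) ^^ (m * h)) y)"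
      using step_back L(1,2) Py by (rule rotate_back_invariant)
    then have "pos_root L ((cox I (rev L) ^^ (m * h)) y)" using root L by blast
    then show "0 \<le> y j + int m * (- k) * \<delta> j" using j L by (simp add: down pos_root_def nonneg_on_def)
  qed
  ultimately have "k = 0" by simp
  then have "(cox I L ^^ h) y = y" using shift by simp
  then have fixd: "cox I L (\<lambda>i. \<Sum>t<h. (cox I L ^^ t) y i) = (\<lambda>i. \<Sum>t<h. (cox I L ^^ t) y i)"
    by (rule cox_orbit_sum_fixed)
  define u where "u = (\<lambda>i. \<Sum>t<h. (cox I L ^^ t) y i)"
  have "qf I u = 0"
    using cox_fixed[OF L(1) fixd] L(2) by (intro qf_radical reflect_fixed_radical) (auto simp: u_def)
  then have pr_u: "u i * \<delta> j = u j * \<delta> i" if "i \<in> I" for i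
    using qf_zero_proportional that j by blast
  \<comment> \<open>The orbit sum is a rational multiple of \<delta>; multiplying by
    \<open>\<delta> j\<close> keeps the computation integral.\<close>
  have "\<delta> j * eul L \<delta> u = u j * eul L \<delta> \<delta>"
  proof -
    have "\<delta> j * eul L \<delta> u = eul L \<delta> (\<lambda>i. 0 + \<delta> j * u i)"
      by (simp only: eul_add_right) (simp add: eul_zero_right)
    also have "\<dots> = eul L \<delta> (\<lambda>i. 0 + u j * \<delta> i)"
      using pr_u L by (intro eul_cong) (simp_all add: algebra_simps)
    also have "\<dots> = u j * eul L \<delta> \<delta>"
      by (simp only: eul_add_right) (simp add: eul_zero_right)
    finally show ?thesis .
  qed
  then have "eul L \<delta> u = 0" using eul_delta_delta[OF L] delta_pos[OF j] by simp
  moreover have cst: "eul L \<delta> ((cox I L ^^ r) z) = eul L \<delta> z" for r z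
  proof (induction r)
    case (Suc r)
    have "eul L \<delta> (cox I L ((cox I L ^^ r) z)) = eul L (cox I L \<delta>) (cox I L ((cox I L ^^ r) z))"
      using L by (simp add: cox_delta)
    also have "\<dots> = eul L \<delta> ((cox I L ^^ r) z)" using L by (intro eul_cox) auto
    finally show ?case using Suc by simp
  qed simp
  then have "eul L \<delta> u = int h * eul L \<delta> y"
    by (simp add: u_def eul_sum_right)
  ultimately have "eul L \<delta> y = 0" using h by simp
  then show ?thesis using cst by (simp add: y_def X_def)
qed

end

section \<open>Forbidden configurations of roots\<close>

context weighted_graph begin

text \<open>A failure of compatibility at a push that changes the sign: the negative root
  \<open>- g\<close> is pushed along \<open>k\<close> to the positive root
  \<open>h = - g + m * k\<close>, and \<open>r\<close> is a positive root that should pair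
  nonpositively with the image.\<close>

definition bad1 where
  "bad1 L r k g h m \<longleftrightarrow> pos_root L r \<and> pos_root L k \<and> pos_root L g \<and> pos_root L h \<and> 0 < m \<and>
     (\<forall>i\<in>set L. m * k i = g i + h i) \<and> eul L k g = m \<and> eul L g k = 0 \<and>
     eul L r k \<le> 0 \<and> 0 < eul L r h"

text \<open>The analogue for a push that stays negative: \<open>- g\<close> goes to
  \<open>- h = - g + m * k\<close>, and \<open>- r\<close> is a further negative root.\<close>

definition bad2 where
  "bad2 L r k g h m \<longleftrightarrow> pos_root L r \<and> pos_root L k \<and> pos_root L g \<and> pos_root L h \<and> 0 < m \<and>
     (\<forall>i\<in>set L. g i = h i + m * k i) \<and> eul L k g = m \<and> eul L g k = 0 \<and>
     eul L g r \<le> 0 \<and> 0 < eul L h r"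

text \<open>Arises when \<open>x\<close> is pushed along \<open>z\<close> while a positive root
  \<open>y\<close> stays: afterwards both pairings of the new \<open>x\<close> with \<open>y\<close>
  would be nonzero.\<close>

definition bad3 where
  "bad3 L x y z \<longleftrightarrow> pos_root L x \<and> pos_root L y \<and> pos_root L z \<and>
     eul L x y < 0 \<and> eul L y z < 0 \<and> eul L z x < 0"

lemma pos_rootD: "pos_root L x \<Longrightarrow> i \<in> set L \<Longrightarrow> 0 \<le> x i"
  by (simp add: pos_root_def nonneg_on_def)

lemma eul_shift_left:
  "(\<And>i. i \<in> set L \<Longrightarrow> g i = h i + m * k i) \<Longrightarrow> eul L g w = eul L h w + m * eul L k w"
  by (simp add: eul_add_left[symmetric] cong: eul_cong)

lemma reflect_shift:
  assumes "\<And>i. i \<in> J \<Longrightarrow> g i = h i + m * k i" "s \<in> J" "i \<in> J"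
  shows "reflect J s g i = reflect J s h i + m * reflect J s k i"
proof -
  have "(\<Sum>j\<in>J. n j s * g j) = (\<Sum>j\<in>J. n j s * h j) + m * (\<Sum>j\<in>J. n j s * k j)"
    by (simp add: assms(1) algebra_simps sum.distrib sum_distrib_left)
  then show ?thesis using assms by (auto simp: reflect_def algebra_simps)
qed

text \<open>A root of the configuration that were simple at the vertex about to be reflected would
  have pairings given by nonnegative coordinates, against the prescribed signs. So all roots stay
  positive under the reflection, and the configuration moves with them.\<close>

lemma bad1_head:
  assumes d: "distinct (s # L)" "dichotomy (L @ [s])" and b: "bad1 (s # L) r k g h m"
  shows "\<not> simple_at (s # L) s r" "\<not> simple_at (s # L) s h"
    "\<not> simple_at (s # L) s k" "\<not> simple_at (s # L) s g"
proof -
  have sm: "m * k s = g s + h s" using b by (simp add: bad1_def)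
  have nn: "0 \<le> r i" "0 \<le> k i" "0 \<le> g i" "0 \<le> h i" if "i \<in> set (s # L)" for i
    using b that unfolding bad1_def by (blast dest: pos_rootD)+
  have nns: "0 \<le> k s" "0 \<le> g s" "0 \<le> h s" using nn[of s] by simp_all
  show 1: "\<not> simple_at (s # L) s r"
  proof
    assume a: "simple_at (s # L) s r"
    then have "k s \<le> 0" "0 < h s" using simple_head_left[OF d(1) a] b by (simp_all add: bad1_def)
    then show False using sm nns by simp
  qed
  show 2: "\<not> simple_at (s # L) s h"
    using simple_head_right_nonpos[OF d _ 1, of h] b by (auto simp: bad1_def)
  show 3: "\<not> simple_at (s # L) s k"
  proof
    assume a: "simple_at (s # L) s k"
    have "h i = 0" if "i \<in> set (s # L)" "i \<noteq> s" for i
    proof -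
      have "m * k i = g i + h i" using b that(1) unfolding bad1_def by blast
      moreover have "k i = 0" using a that by (simp add: simple_at_def)
      ultimately show ?thesis using nn[OF that(1)] by simp
    qed
    then have "simple_at (s # L) s h"
      using b d by (intro zero_off_simple) (auto simp: bad1_def)
    then show False using 2 by simp
  qed
  show "\<not> simple_at (s # L) s g"
    using simple_head_right_nonpos[OF d _ 3, of g] b by (auto simp: bad1_def)
qed

lemma bad1_last:
  assumes d: "distinct (L @ [s])" "dichotomy (s # L)" and b: "bad1 (L @ [s]) r k g h m"
  shows "\<not> simple_at (L @ [s]) s r" "\<not> simple_at (L @ [s]) s h"
    "\<not> simple_at (L @ [s]) s k" "\<not> simple_at (L @ [s]) s g"
proof -
  have nn: "0 \<le> r i" "0 \<le> k i" "0 \<le> g i" "0 \<le> h i" if "i \<in> set (L @ [s])" for i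
    using b that unfolding bad1_def by (blast dest: pos_rootD)+
  have rel: "m * k i = g i + h i" if "i \<in> set (L @ [s])" for i
    using b that unfolding bad1_def by blast
  have e1: "m * eul (L @ [s]) r k = eul (L @ [s]) r g + eul (L @ [s]) r h"
    and e2: "m * eul (L @ [s]) g k = eul (L @ [s]) g g + eul (L @ [s]) g h"
    by (intro eul_rel_right rel; assumption)+
  show "\<not> simple_at (L @ [s]) s g"
  proof
    assume a: "simple_at (L @ [s]) s g"
    then have "0 \<le> eul (L @ [s]) r g" using simple_last_right[OF d(1) a] nn[of s] by simp
    moreover have "m * eul (L @ [s]) r k \<le> 0" using b by (simp add: bad1_def mult_le_0_iff)
    ultimately show False using e1 b by (simp add: bad1_def)
  qed
  \<comment> \<open>From \<open>m * k = g + h\<close>, \<open>eul g k = 0\<close> and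
    \<open>eul g g = 1\<close> the pairing of \<open>g\<close> with \<open>h\<close> is -1, whereas
    a simple \<open>h\<close> at the end would give the coordinate \<open>g s\<close>.\<close>
  show 2: "\<not> simple_at (L @ [s]) s h"
  proof
    assume a: "simple_at (L @ [s]) s h"
    then have "0 \<le> eul (L @ [s]) g h" using simple_last_right[OF d(1) a] nn[of s] by simp
    then show False using e2 b by (simp add: bad1_def pos_root_def)
  qed
  show 3: "\<not> simple_at (L @ [s]) s k"
  proof
    assume a: "simple_at (L @ [s]) s k"
    have "h i = 0" if "i \<in> set (L @ [s])" "i \<noteq> s" for i
    proof -
      have "k i = 0" using a that by (simp add: simple_at_def)
      then show ?thesis using nn[OF that(1)] rel[OF that(1)] by simp
    qed
    then have "simple_at (L @ [s]) s h"
      using b d by (intro zero_off_simple) (auto simp: bad1_def)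
    then show False using 2 by simp
  qed
  show "\<not> simple_at (L @ [s]) s r"
    using simple_last_left_nonpos[OF d _ 2, of r] b by (auto simp: bad1_def)
qed

lemma bad2_head:
  assumes d: "distinct (s # L)" "dichotomy (L @ [s])" and b: "bad2 (s # L) r k g h m"
  shows "\<not> simple_at (s # L) s r" "\<not> simple_at (s # L) s h"
    "\<not> simple_at (s # L) s k" "\<not> simple_at (s # L) s g"
proof -
  have nn: "0 \<le> r i" "0 \<le> k i" "0 \<le> g i" "0 \<le> h i" if "i \<in> set (s # L)" for i
    using b that unfolding bad2_def by (blast dest: pos_rootD)+
  have rel: "g i = h i + m * k i" if "i \<in> set (s # L)" for i
    using b that unfolding bad2_def by blast
  have sh: "eul (s # L) g w = eul (s # L) h w + m * eul (s # L) k w" for w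
    by (intro eul_shift_left rel)
  have m: "0 < m" using b by (simp add: bad2_def)
  show 1: "\<not> simple_at (s # L) s k"
  proof
    assume a: "simple_at (s # L) s k"
    have "eul (s # L) k r = r s" by (rule simple_head_left[OF d(1) a])
    then have "0 \<le> m * eul (s # L) k r" using nn[of s] m by simp
    moreover have "eul (s # L) g r \<le> 0" "0 < eul (s # L) h r" using b unfolding bad2_def by blast+
    ultimately show False using sh[of r] by linarith
  qed
  show "\<not> simple_at (s # L) s g"
  proof
    assume a: "simple_at (s # L) s g"
    have "k i = 0" if "i \<in> set (s # L)" "i \<noteq> s" for i
    proof -
      have "h i + m * k i = 0" using a that rel[OF that(1)] by (simp add: simple_at_def)
      then have "m * k i \<le> 0" using nn(4)[OF that(1)] by linarith
      then show ?thesis using nn(2)[OF that(1)] m by (simp add: mult_le_0_iff)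
    qed
    then have "simple_at (s # L) s k"
      using b d by (intro zero_off_simple) (auto simp: bad2_def)
    then show False using 1 by simp
  qed
  \<comment> \<open>From \<open>g = h + m * k\<close> and \<open>eul g k = 0\<close> the pairing of
    \<open>h\<close> with \<open>k\<close> is \<open>- m\<close>, whereas a simple \<open>h\<close>
    at the head would give the coordinate \<open>k s\<close>.\<close>
  show 2: "\<not> simple_at (s # L) s h"
  proof
    assume a: "simple_at (s # L) s h"
    have "eul (s # L) h k = k s" by (rule simple_head_left[OF d(1) a])
    then have "0 \<le> eul (s # L) h k" using nn[of s] by simp
    moreover have "eul (s # L) g k = 0" "eul (s # L) k k = 1" using b unfolding bad2_def pos_root_def by blast+
    ultimately show False using sh[of k] m by simp
  qed
  show "\<not> simple_at (s # L) s r"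
    using simple_head_right_nonpos[OF d _ 2, of r] b by (auto simp: bad2_def)
qed

lemma bad2_last:
  assumes d: "distinct (L @ [s])" "dichotomy (s # L)" and b: "bad2 (L @ [s]) r k g h m"
  shows "\<not> simple_at (L @ [s]) s r" "\<not> simple_at (L @ [s]) s h"
    "\<not> simple_at (L @ [s]) s k" "\<not> simple_at (L @ [s]) s g"
proof -
  have nn: "0 \<le> r i" "0 \<le> k i" "0 \<le> g i" "0 \<le> h i" if "i \<in> set (L @ [s])" for i
    using b that unfolding bad2_def by (blast dest: pos_rootD)+
  have rel: "g i = h i + m * k i" if "i \<in> set (L @ [s])" for i
    using b that unfolding bad2_def by blast
  have m: "0 < m" using b by (simp add: bad2_def)
  show 1: "\<not> simple_at (L @ [s]) s r"
  proof
    assume a: "simple_at (L @ [s]) s r"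
    have "g s \<le> 0" "0 < h s" using b simple_last_right[OF d(1) a] by (simp_all add: bad2_def)
    moreover have "0 \<le> m * k s" using nn[of s] m by simp
    ultimately show False using rel[of s] by simp
  qed
  show "\<not> simple_at (L @ [s]) s h"
    using simple_last_left_nonpos[OF d _ 1, of h] b by (auto simp: bad2_def)
  show 3: "\<not> simple_at (L @ [s]) s k"
  proof
    assume a: "simple_at (L @ [s]) s k"
    have "g s = 0" using b simple_last_right[OF d(1) a] by (simp add: bad2_def)
    moreover have "k s = 1" using a by (simp add: simple_at_def)
    ultimately show False using rel[of s] nn[of s] m by simp
  qed
  show "\<not> simple_at (L @ [s]) s g"
  proof
    assume a: "simple_at (L @ [s]) s g"
    have "k i = 0" if "i \<in> set (L @ [s])" "i \<noteq> s" for i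
    proof -
      have "h i + m * k i = 0" using a that rel[OF that(1)] by (simp add: simple_at_def)
      then have "m * k i \<le> 0" using nn(4)[OF that(1)] by linarith
      then show ?thesis using nn(2)[OF that(1)] m by (simp add: mult_le_0_iff)
    qed
    then have "simple_at (L @ [s]) s k"
      using b d by (intro zero_off_simple) (auto simp: bad2_def)
    then show False using 3 by simp
  qed
qed

lemma bad3_head:
  assumes d: "distinct (s # L)" and b: "bad3 (s # L) x y z"
  shows "\<not> simple_at (s # L) s x" "\<not> simple_at (s # L) s y" "\<not> simple_at (s # L) s z"
proof -
  have nn: "0 \<le> x s" "0 \<le> y s" "0 \<le> z s"
    using b unfolding bad3_def by (auto dest: pos_rootD)
  then show "\<not> simple_at (s # L) s x" "\<not> simple_at (s # L) s y" "\<not> simple_at (s # L) s z"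
    using b simple_head_left[OF d, of x y] simple_head_left[OF d, of y z] simple_head_left[OF d, of z x]
    unfolding bad3_def by auto
qed

lemma bad3_last:
  assumes d: "distinct (L @ [s])" and b: "bad3 (L @ [s]) x y z"
  shows "\<not> simple_at (L @ [s]) s x" "\<not> simple_at (L @ [s]) s y" "\<not> simple_at (L @ [s]) s z"
proof -
  have nn: "0 \<le> x s" "0 \<le> y s" "0 \<le> z s"
    using b unfolding bad3_def by (auto dest: pos_rootD)
  then show "\<not> simple_at (L @ [s]) s x" "\<not> simple_at (L @ [s]) s y" "\<not> simple_at (L @ [s]) s z"
    using b simple_last_right[OF d, of x z] simple_last_right[OF d, of y x] simple_last_right[OF d, of z y]
    unfolding bad3_def by auto
qed

lemma bad1_transport:
  assumes "bad1 L r k g h m"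
    "\<And>x y. eul L' (T x) (T y) = eul L x y"
    "\<And>x. x \<in> {r, k, g, h} \<Longrightarrow> pos_root L' (T x)"
    "\<And>i. i \<in> set L' \<Longrightarrow> m * T k i = T g i + T h i"
  shows "bad1 L' (T r) (T k) (T g) (T h) m"
  using assms unfolding bad1_def by simp

lemma bad2_transport:
  assumes "bad2 L r k g h m"
    "\<And>x y. eul L' (T x) (T y) = eul L x y"
    "\<And>x. x \<in> {r, k, g, h} \<Longrightarrow> pos_root L' (T x)"
    "\<And>i. i \<in> set L' \<Longrightarrow> T g i = T h i + m * T k i"
  shows "bad2 L' (T r) (T k) (T g) (T h) m"
  using assms unfolding bad2_def by simp

lemma bad3_transport:
  assumes "bad3 L x y z"
    "\<And>x y. eul L' (T x) (T y) = eul L x y"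
    "\<And>u. u \<in> {x, y, z} \<Longrightarrow> pos_root L' (T u)"
  shows "bad3 L' (T x) (T y) (T z)"
  using assms unfolding bad3_def by simp

lemma bad1_rotate:
  assumes d: "distinct (s # L)" "dichotomy (L @ [s])" "J = insert s (set L)" and b: "bad1 (s # L) r k g h m"
  shows "bad1 (L @ [s]) (reflect J s r) (reflect J s k) (reflect J s g) (reflect J s h) m"
proof (rule bad1_transport[OF b])
  show "eul (L @ [s]) (reflect J s x) (reflect J s y) = eul (s # L) x y" for x y
    using d by (intro eul_rotate)
  show "pos_root (L @ [s]) (reflect J s x)" if "x \<in> {r, k, g, h}" for x
    using root_refl_sign[OF d(1,2) _ _ d(3)] bad1_head[OF d(1,2) b] that b unfolding bad1_def by blast
  have "m * k i = g i + h i" if "i \<in> J" for i using b that d unfolding bad1_def by auto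
  then have "h i = (- g i) + m * k i" if "i \<in> J" for i using that by simp
  then have "reflect J s h i = reflect J s (\<lambda>i. - g i) i + m * reflect J s k i" if "i \<in> J" for i
    using that d by (intro reflect_shift) auto
  moreover have "reflect J s (\<lambda>i. - g i) i = - reflect J s g i" for i
    by (simp add: reflect_def sum_negf)
  ultimately show "m * reflect J s k i = reflect J s g i + reflect J s h i" if "i \<in> set (L @ [s])" for i
    using that d by auto
qed

lemma bad1_rotate_back:
  assumes d: "distinct (L @ [s])" "dichotomy (s # L)" "J = insert s (set L)" and b: "bad1 (L @ [s]) r k g h m"
  shows "bad1 (s # L) (reflect J s r) (reflect J s k) (reflect J s g) (reflect J s h) m"
proof (rule bad1_transport[OF b])
  show "eul (s # L) (reflect J s x) (reflect J s y) = eul (L @ [s]) x y" for x y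
    using d by (intro eul_rotate_back) auto
  show "pos_root (s # L) (reflect J s x)" if "x \<in> {r, k, g, h}" for x
    using root_refl_sign_back[OF d(1,2) _ _ d(3)] bad1_last[OF d(1,2) b] that b unfolding bad1_def by blast
  have "m * k i = g i + h i" if "i \<in> J" for i using b that d unfolding bad1_def by auto
  then have "h i = (- g i) + m * k i" if "i \<in> J" for i using that by simp
  then have "reflect J s h i = reflect J s (\<lambda>i. - g i) i + m * reflect J s k i" if "i \<in> J" for i
    using that d by (intro reflect_shift) auto
  moreover have "reflect J s (\<lambda>i. - g i) i = - reflect J s g i" for i
    by (simp add: reflect_def sum_negf)
  ultimately show "m * reflect J s k i = reflect J s g i + reflect J s h i" if "i \<in> set (s # L)" for i
    using that d by auto
qed

lemma bad2_rotate:
  assumes d: "distinct (s # L)" "dichotomy (L @ [s])" "J = insert s (set L)" and b: "bad2 (s # L) r k g h m"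
  shows "bad2 (L @ [s]) (reflect J s r) (reflect J s k) (reflect J s g) (reflect J s h) m"
proof (rule bad2_transport[OF b])
  show "eul (L @ [s]) (reflect J s x) (reflect J s y) = eul (s # L) x y" for x y
    using d by (intro eul_rotate)
  show "pos_root (L @ [s]) (reflect J s x)" if "x \<in> {r, k, g, h}" for x
    using root_refl_sign[OF d(1,2) _ _ d(3)] bad2_head[OF d(1,2) b] that b unfolding bad2_def by blast
  show "reflect J s g i = reflect J s h i + m * reflect J s k i" if "i \<in> set (L @ [s])" for i
    using b that d by (intro reflect_shift) (auto simp: bad2_def)
qed

lemma bad2_rotate_back:
  assumes d: "distinct (L @ [s])" "dichotomy (s # L)" "J = insert s (set L)" and b: "bad2 (L @ [s]) r k g h m"
  shows "bad2 (s # L) (reflect J s r) (reflect J s k) (reflect J s g) (reflect J s h) m"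
proof (rule bad2_transport[OF b])
  show "eul (s # L) (reflect J s x) (reflect J s y) = eul (L @ [s]) x y" for x y
    using d by (intro eul_rotate_back) auto
  show "pos_root (s # L) (reflect J s x)" if "x \<in> {r, k, g, h}" for x
    using root_refl_sign_back[OF d(1,2) _ _ d(3)] bad2_last[OF d(1,2) b] that b unfolding bad2_def by blast
  show "reflect J s g i = reflect J s h i + m * reflect J s k i" if "i \<in> set (s # L)" for i
    using b that d by (intro reflect_shift) (auto simp: bad2_def)
qed

lemma bad3_rotate:
  assumes d: "distinct (s # L)" "dichotomy (L @ [s])" "J = insert s (set L)" and b: "bad3 (s # L) x y z"
  shows "bad3 (L @ [s]) (reflect J s x) (reflect J s y) (reflect J s z)"
proof (rule bad3_transport[OF b])
  show "eul (L @ [s]) (reflect J s x) (reflect J s y) = eul (s # L) x y" for x y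
    using d by (intro eul_rotate)
  show "pos_root (L @ [s]) (reflect J s u)" if "u \<in> {x, y, z}" for u
    using root_refl_sign[OF d(1,2) _ _ d(3)] bad3_head[OF d(1) b] that b unfolding bad3_def by blast
qed

lemma bad3_rotate_back:
  assumes d: "distinct (L @ [s])" "dichotomy (s # L)" "J = insert s (set L)" and b: "bad3 (L @ [s]) x y z"
  shows "bad3 (s # L) (reflect J s x) (reflect J s y) (reflect J s z)"
proof (rule bad3_transport[OF b])
  show "eul (s # L) (reflect J s x) (reflect J s y) = eul (L @ [s]) x y" for x y
    using d by (intro eul_rotate_back) auto
  show "pos_root (s # L) (reflect J s u)" if "u \<in> {x, y, z}" for u
    using root_refl_sign_back[OF d(1,2) _ _ d(3)] bad3_last[OF d(1) b] that b unfolding bad3_def by blast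
qed

end

section \<open>Forbidden configurations off a vertex and their defect\<close>

context affine_graph begin

lemma bad1_sub:
  assumes L: "distinct L" "set L = I - {s}" "s \<in> I" and b: "bad1 L r k g h m"
  shows False
\<comment> \<open>The orbit argument follows a single root; the others are quantified existentially
  and move along.\<close>
proof (rule escape_sub[OF L, where P = "\<lambda>L x. \<exists>k g h. bad1 L x k g h m" and x = r])
  show "\<exists>k g h. bad1 L r k g h m" using b by blast
  show "pos_root L x" if "\<exists>k g h. bad1 L x k g h m" for L x using that by (auto simp: bad1_def)
  fix t M x
  assume M: "distinct (t # M)" "set (t # M) = I - {s}" and "\<exists>k g h. bad1 (t # M) x k g h m"
  moreover have "dichotomy (M @ [t])" using M L by (intro dichotomy_sub) auto
  moreover have "I - {s} = insert t (set M)" using M by simp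
  ultimately show "\<exists>k g h. bad1 (M @ [t]) (reflect (I - {s}) t x) k g h m"
    by (blast intro: bad1_rotate)
qed

lemma bad2_sub:
  assumes L: "distinct L" "set L = I - {s}" "s \<in> I" and b: "bad2 L r k g h m"
  shows False
proof (rule escape_sub[OF L, where P = "\<lambda>L x. \<exists>k g h. bad2 L x k g h m" and x = r])
  show "\<exists>k g h. bad2 L r k g h m" using b by blast
  show "pos_root L x" if "\<exists>k g h. bad2 L x k g h m" for L x using that by (auto simp: bad2_def)
  fix t M x
  assume M: "distinct (t # M)" "set (t # M) = I - {s}" and "\<exists>k g h. bad2 (t # M) x k g h m"
  moreover have "dichotomy (M @ [t])" using M L by (intro dichotomy_sub) auto
  moreover have "I - {s} = insert t (set M)" using M by simp
  ultimately show "\<exists>k g h. bad2 (M @ [t]) (reflect (I - {s}) t x) k g h m"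
    by (blast intro: bad2_rotate)
qed

lemma bad3_sub:
  assumes L: "distinct L" "set L = I - {s}" "s \<in> I" and b: "bad3 L x y z"
  shows False
proof (rule escape_sub[OF L, where P = "\<lambda>L x. \<exists>y z. bad3 L x y z" and x = x])
  show "\<exists>y z. bad3 L x y z" using b by blast
  show "pos_root L x" if "\<exists>y z. bad3 L x y z" for L x using that by (auto simp: bad3_def)
  fix t M x
  assume M: "distinct (t # M)" "set (t # M) = I - {s}" and "\<exists>y z. bad3 (t # M) x y z"
  moreover have "dichotomy (M @ [t])" using M L by (intro dichotomy_sub) auto
  moreover have "I - {s} = insert t (set M)" using M by simp
  ultimately show "\<exists>y z. bad3 (M @ [t]) (reflect (I - {s}) t x) y z"
    by (blast intro: bad3_rotate)
qed

lemma bad1_regular: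
  assumes L: "distinct L" "set L = I" and b: "bad1 L r k g h m" and x: "x \<in> {r, k, g, h}"
  shows "eul L \<delta> x = 0"
proof (rule escape_full[OF L, where P = "\<lambda>L x. \<exists>r k g h. bad1 L r k g h m \<and> x \<in> {r, k, g, h}"])
  show "\<exists>r k g h. bad1 L r k g h m \<and> x \<in> {r, k, g, h}" using b x by blast
  show "pos_root L x" if "\<exists>r k g h. bad1 L r k g h m \<and> x \<in> {r, k, g, h}" for L x
    using that by (auto simp: bad1_def)
  fix t M x
  assume *: "\<exists>r k g h. bad1 (t # M) r k g h m \<and> x \<in> {r, k, g, h}"
    and M: "distinct (t # M)" "set (t # M) = I"
  then have "dichotomy (M @ [t])" "I = insert t (set M)" by (auto intro: dichotomy_full)
  then show "\<exists>r k g h. bad1 (M @ [t]) r k g h m \<and> reflect I t x \<in> {r, k, g, h}"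
    using * bad1_rotate[OF M(1)] by (elim exE conjE) (intro exI conjI, assumption | blast)+
next
  fix t M x
  assume *: "\<exists>r k g h. bad1 (M @ [t]) r k g h m \<and> x \<in> {r, k, g, h}"
    and M: "distinct (M @ [t])" "set (M @ [t]) = I"
  then have "dichotomy (t # M)" "I = insert t (set M)" by (auto intro: dichotomy_full)
  then show "\<exists>r k g h. bad1 (t # M) r k g h m \<and> reflect I t x \<in> {r, k, g, h}"
    using * bad1_rotate_back[OF M(1)] by (elim exE conjE) (intro exI conjI, assumption | blast)+
qed

lemma bad2_regular:
  assumes L: "distinct L" "set L = I" and b: "bad2 L r k g h m" and x: "x \<in> {r, k, g, h}"
  shows "eul L \<delta> x = 0"
proof (rule escape_full[OF L, where P = "\<lambda>L x. \<exists>r k g h. bad2 L r k g h m \<and> x \<in> {r, k, g, h}"])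
  show "\<exists>r k g h. bad2 L r k g h m \<and> x \<in> {r, k, g, h}" using b x by blast
  show "pos_root L x" if "\<exists>r k g h. bad2 L r k g h m \<and> x \<in> {r, k, g, h}" for L x
    using that by (auto simp: bad2_def)
  fix t M x
  assume *: "\<exists>r k g h. bad2 (t # M) r k g h m \<and> x \<in> {r, k, g, h}"
    and M: "distinct (t # M)" "set (t # M) = I"
  then have "dichotomy (M @ [t])" "I = insert t (set M)" by (auto intro: dichotomy_full)
  then show "\<exists>r k g h. bad2 (M @ [t]) r k g h m \<and> reflect I t x \<in> {r, k, g, h}"
    using * bad2_rotate[OF M(1)] by (elim exE conjE) (intro exI conjI, assumption | blast)+
next
  fix t M x
  assume *: "\<exists>r k g h. bad2 (M @ [t]) r k g h m \<and> x \<in> {r, k, g, h}"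
    and M: "distinct (M @ [t])" "set (M @ [t]) = I"
  then have "dichotomy (t # M)" "I = insert t (set M)" by (auto intro: dichotomy_full)
  then show "\<exists>r k g h. bad2 (t # M) r k g h m \<and> reflect I t x \<in> {r, k, g, h}"
    using * bad2_rotate_back[OF M(1)] by (elim exE conjE) (intro exI conjI, assumption | blast)+
qed

lemma bad3_regular:
  assumes L: "distinct L" "set L = I" and b: "bad3 L u y z" and x: "x \<in> {u, y, z}"
  shows "eul L \<delta> x = 0"
proof (rule escape_full[OF L, where P = "\<lambda>L x. \<exists>u y z. bad3 L u y z \<and> x \<in> {u, y, z}"])
  show "\<exists>u y z. bad3 L u y z \<and> x \<in> {u, y, z}" using b x by blast
  show "pos_root L x" if "\<exists>u y z. bad3 L u y z \<and> x \<in> {u, y, z}" for L x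
    using that by (auto simp: bad3_def)
  fix t M x
  assume *: "\<exists>u y z. bad3 (t # M) u y z \<and> x \<in> {u, y, z}"
    and M: "distinct (t # M)" "set (t # M) = I"
  then have "dichotomy (M @ [t])" "I = insert t (set M)" by (auto intro: dichotomy_full)
  then show "\<exists>u y z. bad3 (M @ [t]) u y z \<and> reflect I t x \<in> {u, y, z}"
    using * bad3_rotate[OF M(1)] by (elim exE conjE) (intro exI conjI, assumption | blast)+
next
  fix t M x
  assume *: "\<exists>u y z. bad3 (M @ [t]) u y z \<and> x \<in> {u, y, z}"
    and M: "distinct (M @ [t])" "set (M @ [t]) = I"
  then have "dichotomy (t # M)" "I = insert t (set M)" by (auto intro: dichotomy_full)
  then show "\<exists>u y z. bad3 (t # M) u y z \<and> reflect I t x \<in> {u, y, z}"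
    using * bad3_rotate_back[OF M(1)] by (elim exE conjE) (intro exI conjI, assumption | blast)+
qed

end

section \<open>Compatible pairs of roots\<close>

context weighted_graph begin

text \<open>At most one of the two Euler values is nonzero. Equal signs make it nonpositive; for
  opposite signs it is the value with the positive root on the left, and it may have either
  sign.\<close>

definition compat :: "nat list \<Rightarrow> (nat \<Rightarrow> int) \<Rightarrow> (nat \<Rightarrow> int) \<Rightarrow> bool" where
  "compat L x y \<longleftrightarrow> eul L x y * eul L y x = 0 \<and>
     (nonneg_on L x \<and> nonneg_on L y \<longrightarrow> eul L x y \<le> 0 \<and> eul L y x \<le> 0) \<and>
     (nonpos_on L x \<and> nonpos_on L y \<longrightarrow> eul L x y \<le> 0 \<and> eul L y x \<le> 0) \<and>
     (nonpos_on L x \<and> nonneg_on L y \<longrightarrow> eul L x y = 0) \<and>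
     (nonneg_on L x \<and> nonpos_on L y \<longrightarrow> eul L y x = 0)"

lemma compat_commute: "compat L x y = compat L y x"
  by (auto simp: compat_def mult.commute)

text \<open>Reversing the order exchanges the arguments of the form, negation exchanges the signs,
  and in the mixed clauses the two exchanges cancel. This symmetry lets a negative mutated root be
  replaced by a positive one.\<close>

lemma compat_rev: "distinct L \<Longrightarrow> compat (rev L) (\<lambda>i. - x i) (\<lambda>i. - y i) = compat L x y"
  by (auto simp: compat_def eul_rev mult.commute)

lemma root_reflect_sign:
  assumes d: "distinct (s # L)" "dichotomy (s # L)" "dichotomy (L @ [s])" "J = insert s (set L)"
    and r: "eul (s # L) x x = 1" "\<not> simple_at (s # L) s x" "\<not> simple_at (s # L) s (\<lambda>i. - x i)"
  shows "nonneg_on (L @ [s]) (reflect J s x) = nonneg_on (s # L) x"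
    "nonpos_on (L @ [s]) (reflect J s x) = nonpos_on (s # L) x"
proof -
  have neg: "reflect J s (\<lambda>i. - x i) = (\<lambda>i. - reflect J s x i)"
    by (auto simp: reflect_def sum_negf fun_eq_iff)
  have e: "eul (L @ [s]) (reflect J s x) (reflect J s x) = 1" using d r by (subst eul_rotate) auto
  have 1: "nonneg_on (L @ [s]) (reflect J s x)" if "nonneg_on (s # L) x"
    using root_refl_sign[OF d(1,3) _ r(2) d(4)] that r(1) unfolding pos_root_def by blast
  have 2: "nonpos_on (L @ [s]) (reflect J s x)" if "nonpos_on (s # L) x"
  proof -
    have "pos_root (s # L) (\<lambda>i. - x i)"
      unfolding pos_root_def eul_uminus_left eul_uminus_right nonneg_on_uminus using that r by simp
    then have "pos_root (L @ [s]) (reflect J s (\<lambda>i. - x i))" using root_refl_sign[OF d(1,3) _ r(3) d(4)] by blast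
    then show ?thesis unfolding neg pos_root_def by simp
  qed
  have 3: "nonneg_on (s # L) x \<or> nonpos_on (s # L) x" using d(2) r(1) unfolding dichotomy_def by blast
  show "nonneg_on (L @ [s]) (reflect J s x) = nonneg_on (s # L) x"
    "nonpos_on (L @ [s]) (reflect J s x) = nonpos_on (s # L) x"
    using 1 2 3 not_nonneg_nonpos[OF e] not_nonneg_nonpos[OF r(1)] by blast+
qed

lemma root_reflect_sign_back:
  assumes d: "distinct (L @ [s])" "dichotomy (s # L)" "dichotomy (L @ [s])" "J = insert s (set L)"
    and r: "eul (L @ [s]) x x = 1" "\<not> simple_at (L @ [s]) s x" "\<not> simple_at (L @ [s]) s (\<lambda>i. - x i)"
  shows "nonneg_on (s # L) (reflect J s x) = nonneg_on (L @ [s]) x"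
    "nonpos_on (s # L) (reflect J s x) = nonpos_on (L @ [s]) x"
proof -
  have neg: "reflect J s (\<lambda>i. - x i) = (\<lambda>i. - reflect J s x i)"
    by (auto simp: reflect_def sum_negf fun_eq_iff)
  have e: "eul (s # L) (reflect J s x) (reflect J s x) = 1" using d r by (subst eul_rotate_back) auto
  have 1: "nonneg_on (s # L) (reflect J s x)" if "nonneg_on (L @ [s]) x"
    using root_refl_sign_back[OF d(1,2) _ r(2) d(4)] that r(1) unfolding pos_root_def by blast
  have 2: "nonpos_on (s # L) (reflect J s x)" if "nonpos_on (L @ [s]) x"
  proof -
    have "pos_root (L @ [s]) (\<lambda>i. - x i)"
      unfolding pos_root_def eul_uminus_left eul_uminus_right nonneg_on_uminus using that r by simp
    then have "pos_root (s # L) (reflect J s (\<lambda>i. - x i))" using root_refl_sign_back[OF d(1,2) _ r(3) d(4)] by blast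
    then show ?thesis unfolding neg pos_root_def by simp
  qed
  have 3: "nonneg_on (L @ [s]) x \<or> nonpos_on (L @ [s]) x" using d(3) r(1) unfolding dichotomy_def by blast
  show "nonneg_on (s # L) (reflect J s x) = nonneg_on (L @ [s]) x"
    "nonpos_on (s # L) (reflect J s x) = nonpos_on (L @ [s]) x"
    using 1 2 3 not_nonneg_nonpos[OF e] not_nonneg_nonpos[OF r(1)] by blast+
qed

end

section \<open>Moving a root of nonzero defect to an extreme vertex\<close>

context affine_graph begin

text \<open>The value is \<open>- \<delta> s\<close>, by balance; at the other end of the list it is
  \<open>\<delta> s\<close>. Consequently a root of defect zero is never simple at an extreme vertex
  and keeps its sign under every rotation.\<close>

lemma eul_delta_simple_head:
  assumes "distinct (s # L)" "set (s # L) = I" "simple_at (s # L) s z"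
  shows "eul (s # L) \<delta> z \<noteq> 0"
proof -
  have "(\<Sum>j\<in>set L. n j s * \<delta> j) = (\<Sum>j\<in>I. n j s * \<delta> j)"
    using assms sum_head[of "set L" s \<delta>] by simp
  then have "eul (s # L) \<delta> z = - \<delta> s"
    unfolding simple_head_right[OF assms(1,3)] using balanced[of s] assms by auto
  then show ?thesis using delta_pos[of s] assms by auto
qed

lemma eul_delta_simple_last:
  assumes "distinct (L @ [s])" "set (L @ [s]) = I" "simple_at (L @ [s]) s z"
  shows "eul (L @ [s]) \<delta> z \<noteq> 0"
  unfolding simple_last_right[OF assms(1,3)] using delta_pos[of s] assms by auto

text \<open>A product of reflections along rotations, seen as an isometry between the forms of two
  orders. Signs are kept for roots of defect zero, which are never simple at an extreme vertex, and
  for the one root \<open>w\<close>, which is followed only until it becomes simple there up to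
  sign.\<close>

definition transport :: "nat list \<Rightarrow> nat list \<Rightarrow> ((nat \<Rightarrow> int) \<Rightarrow> nat \<Rightarrow> int) \<Rightarrow> (nat \<Rightarrow> int) \<Rightarrow> bool" where
  "transport L L' T w \<longleftrightarrow> distinct L' \<and> set L' = I \<and>
     (\<forall>x y. eul L' (T x) (T y) = eul L x y) \<and>
     (\<forall>x y m. T (\<lambda>i. x i + m * y i) = (\<lambda>i. T x i + m * T y i)) \<and>
     T \<delta> = \<delta> \<and>
     (\<forall>x. eul L x x = 1 \<and> (eul L \<delta> x = 0 \<or> x = w) \<longrightarrow>
        nonneg_on L' (T x) = nonneg_on L x \<and> nonpos_on L' (T x) = nonpos_on L x)"

lemma transport_step:
  assumes tr: "transport L (s # M) T w"
    and w: "\<not> simple_at (s # M) s (T w)" "\<not> simple_at (s # M) s (\<lambda>i. - T w i)"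
  shows "transport L (M @ [s]) (\<lambda>x. reflect I s (T x)) w"
proof -
  have d: "distinct (s # M)" "I = insert s (set M)"
    and e: "\<And>x y. eul (s # M) (T x) (T y) = eul L x y" and td: "T \<delta> = \<delta>"
    and lin: "\<And>x y m. T (\<lambda>i. x i + m * y i) = (\<lambda>i. T x i + m * T y i)"
    using tr unfolding transport_def by auto
  have di: "dichotomy (s # M)" "dichotomy (M @ [s])"
    using d by (auto intro!: dichotomy_full)
  have "nonneg_on (M @ [s]) (reflect I s (T x)) = nonneg_on L x \<and>
        nonpos_on (M @ [s]) (reflect I s (T x)) = nonpos_on L x"
    if x: "eul L x x = 1" "eul L \<delta> x = 0 \<or> x = w" for x
  proof -
    have ns: "\<not> simple_at (s # M) s (T x) \<and> \<not> simple_at (s # M) s (\<lambda>i. - T x i)"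
    proof (cases "x = w")
      case False
      then have "eul (s # M) \<delta> (T x) = 0" using x(2) e[of \<delta> x] td by simp
      then have "eul (s # M) \<delta> (\<lambda>i. - T x i) = 0" by (simp only: eul_uminus_right)
      then show ?thesis
        using eul_delta_simple_head[OF d(1) d(2)[symmetric, folded list.simps(15)]] \<open>eul (s # M) \<delta> (T x) = 0\<close>
        by blast
    qed (use w in auto)
    have "nonneg_on (s # M) (T x) = nonneg_on L x" "nonpos_on (s # M) (T x) = nonpos_on L x"
      using tr x unfolding transport_def by blast+
    then show ?thesis
      using root_reflect_sign[OF d(1) di d(2)] e[of x x] x(1) ns by metis
  qed
  moreover have "eul (M @ [s]) (reflect I s (T x)) (reflect I s (T y)) = eul L x y" for x y
    unfolding eul_rotate[OF d(1,2)] by (rule e)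
  moreover have "reflect I s (T \<delta>) = \<delta>" unfolding td using d(2) by (intro reflect_delta) simp
  moreover have "distinct (M @ [s])" "set (M @ [s]) = I" using d by auto
  ultimately show ?thesis unfolding transport_def by (simp add: lin reflect_add)
qed

lemma transport_step_back:
  assumes tr: "transport L (M @ [s]) T w"
    and w: "\<not> simple_at (M @ [s]) s (T w)" "\<not> simple_at (M @ [s]) s (\<lambda>i. - T w i)"
  shows "transport L (s # M) (\<lambda>x. reflect I s (T x)) w"
proof -
  have d: "distinct (M @ [s])" "I = insert s (set M)" "set (M @ [s]) = I" "distinct (s # M)"
    and e: "\<And>x y. eul (M @ [s]) (T x) (T y) = eul L x y" and td: "T \<delta> = \<delta>"
    and lin: "\<And>x y m. T (\<lambda>i. x i + m * y i) = (\<lambda>i. T x i + m * T y i)"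
    using tr unfolding transport_def by auto
  have di: "dichotomy (s # M)" "dichotomy (M @ [s])"
    using d by (auto intro!: dichotomy_full)
  have "nonneg_on (s # M) (reflect I s (T x)) = nonneg_on L x \<and>
        nonpos_on (s # M) (reflect I s (T x)) = nonpos_on L x"
    if x: "eul L x x = 1" "eul L \<delta> x = 0 \<or> x = w" for x
  proof -
    have ns: "\<not> simple_at (M @ [s]) s (T x) \<and> \<not> simple_at (M @ [s]) s (\<lambda>i. - T x i)"
    proof (cases "x = w")
      case False
      then have "eul (M @ [s]) \<delta> (T x) = 0" using x(2) e[of \<delta> x] td by simp
      then have "eul (M @ [s]) \<delta> (\<lambda>i. - T x i) = 0" by (simp only: eul_uminus_right)
      then show ?thesis
        using eul_delta_simple_last[OF d(1) d(3)] \<open>eul (M @ [s]) \<delta> (T x) = 0\<close> by blast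
    qed (use w in auto)
    have "nonneg_on (M @ [s]) (T x) = nonneg_on L x" "nonpos_on (M @ [s]) (T x) = nonpos_on L x"
      using tr x unfolding transport_def by blast+
    then show ?thesis
      using root_reflect_sign_back[OF d(1) di d(2)] e[of x x] x(1) ns by metis
  qed
  moreover have "eul (s # M) (reflect I s (T x)) (reflect I s (T y)) = eul L x y" for x y
    unfolding eul_rotate_back[OF d(4,2)] by (rule e)
  moreover have "reflect I s (T \<delta>) = \<delta>" unfolding td using d(2) by (intro reflect_delta) simp
  moreover have "set (s # M) = I" using d by auto
  ultimately show ?thesis using d(4) unfolding transport_def by (simp add: lin reflect_add del: eul.simps)
qed

text \<open>Otherwise the sign of the images of \<open>w\<close> would survive all rotations in both
  directions, and \<open>escape_full\<close>, applied to whichever of \<open>w\<close> and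
  \<open>- w\<close> is positive, would give defect zero.\<close>

lemma move_to_simple:
  assumes L: "distinct L" "set L = I" and w: "eul L w w = 1" "eul L \<delta> w \<noteq> 0"
  obtains (head) s M T where "transport L (s # M) T w"
      "simple_at (s # M) s (T w) \<or> simple_at (s # M) s (\<lambda>i. - T w i)"
    | (last) s M T where "transport L (M @ [s]) T w"
      "simple_at (M @ [s]) s (T w) \<or> simple_at (M @ [s]) s (\<lambda>i. - T w i)"
proof -
  let ?H = "\<exists>s M T. transport L (s # M) T w \<and>
      (simple_at (s # M) s (T w) \<or> simple_at (s # M) s (\<lambda>i. - T w i))"
  let ?K = "\<exists>s M T. transport L (M @ [s]) T w \<and>
      (simple_at (M @ [s]) s (T w) \<or> simple_at (M @ [s]) s (\<lambda>i. - T w i))"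
  have "?H \<or> ?K"
  proof (rule ccontr)
    assume no: "\<not> (?H \<or> ?K)"
    define P where "P L' x \<longleftrightarrow> (\<exists>T. transport L L' T w \<and> (x = T w \<or> x = (\<lambda>i. - T w i)) \<and> nonneg_on L' x)"
      for L' x
    have root: "pos_root L' x" if P: "P L' x" for L' x
    proof -
      obtain T where T: "transport L L' T w" "x = T w \<or> x = (\<lambda>i. - T w i)" "nonneg_on L' x"
        using P unfolding P_def by blast
      then have "eul L' (T w) (T w) = 1" using w by (simp add: transport_def)
      then show ?thesis using T(2,3) by (auto simp: pos_root_def)
    qed
    have neg: "reflect I t (\<lambda>i. - x i) = (\<lambda>i. - reflect I t x i)" for t x
      by (auto simp: reflect_def sum_negf fun_eq_iff)
    have step: "P (M @ [t]) (reflect I t x)" if P: "P (t # M) x" for t M x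
    proof -
      obtain T where T: "transport L (t # M) T w" "x = T w \<or> x = (\<lambda>i. - T w i)" "nonneg_on (t # M) x"
        using P unfolding P_def by blast
      have ns: "\<not> simple_at (t # M) t (T w)" "\<not> simple_at (t # M) t (\<lambda>i. - T w i)"
        using no T(1) by blast+
      have tr: "transport L (M @ [t]) (\<lambda>x. reflect I t (T x)) w" by (rule transport_step[OF T(1) ns])
      have "nonneg_on (M @ [t]) (reflect I t (T w)) = nonneg_on (t # M) (T w)"
        "nonpos_on (M @ [t]) (reflect I t (T w)) = nonpos_on (t # M) (T w)"
        using tr T(1) w unfolding transport_def by blast+
      then have "nonneg_on (M @ [t]) (reflect I t x)" using T(2,3) by (auto simp: neg)
      then show ?thesis unfolding P_def using tr T(2) neg by blast
    qed
    have bck: "P (t # M) (reflect I t x)" if P: "P (M @ [t]) x" for t M x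
    proof -
      obtain T where T: "transport L (M @ [t]) T w" "x = T w \<or> x = (\<lambda>i. - T w i)" "nonneg_on (M @ [t]) x"
        using P unfolding P_def by blast
      have ns: "\<not> simple_at (M @ [t]) t (T w)" "\<not> simple_at (M @ [t]) t (\<lambda>i. - T w i)"
        using no T(1) by blast+
      have tr: "transport L (t # M) (\<lambda>x. reflect I t (T x)) w" by (rule transport_step_back[OF T(1) ns])
      have "nonneg_on (t # M) (reflect I t (T w)) = nonneg_on (M @ [t]) (T w)"
        "nonpos_on (t # M) (reflect I t (T w)) = nonpos_on (M @ [t]) (T w)"
        using tr T(1) w unfolding transport_def by blast+
      then have "nonneg_on (t # M) (reflect I t x)" using T(2,3) by (auto simp: neg)
      then show ?thesis unfolding P_def using tr T(2) neg by blast
    qed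
    have id: "transport L L (\<lambda>x. x) w" using L by (simp add: transport_def)
    have "nonneg_on L w \<or> nonpos_on L w"
      using dichotomy_full[OF L] w(1) unfolding dichotomy_def by blast
    then obtain x where x: "x = w \<or> x = (\<lambda>i. - w i)" "nonneg_on L x" by fastforce
    then have "P L x" unfolding P_def using id by blast
    then have "eul L \<delta> x = 0" using escape_full[OF L, of P x] root step bck by blast
    then show False using x(1) w(2) by auto
  qed
  then show ?thesis using head last by blast
qed

end

context weighted_graph begin

lemma compatD:
  assumes "compat L x y"
  shows "eul L x y * eul L y x = 0"
    "nonneg_on L x \<Longrightarrow> nonneg_on L y \<Longrightarrow> eul L x y \<le> 0"
    "nonneg_on L x \<Longrightarrow> nonneg_on L y \<Longrightarrow> eul L y x \<le> 0"
    "nonpos_on L x \<Longrightarrow> nonpos_on L y \<Longrightarrow> eul L x y \<le> 0"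
    "nonpos_on L x \<Longrightarrow> nonpos_on L y \<Longrightarrow> eul L y x \<le> 0"
    "nonpos_on L x \<Longrightarrow> nonneg_on L y \<Longrightarrow> eul L x y = 0"
    "nonneg_on L x \<Longrightarrow> nonpos_on L y \<Longrightarrow> eul L y x = 0"
  using assms by (auto simp: compat_def)

text \<open>Pairing with the simple root at an end gives the coordinate at \<open>s\<close> on one
  side and, up to sign, the reflected coordinate on the other. Compatibility makes one of them
  vanish, depending on the sign of \<open>x\<close>, and either vanishing removes \<open>s\<close>
  from the relevant Euler values.\<close>

lemma compat_simple_head:
  assumes d: "distinct (s # M)" and z: "simple_at (s # M) s z" and c: "compat (s # M) z x"
  shows "nonneg_on (s # M) x \<Longrightarrow> x s = 0"
    "nonpos_on (s # M) x \<Longrightarrow> x s - (\<Sum>j\<in>set M. n j s * x j) = 0"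
proof -
  have zn: "nonneg_on (s # M) z" using z by (auto simp: simple_at_def nonneg_on_def)
  show "x s = 0" if "nonneg_on (s # M) x"
    using compatD(2)[OF c zn that] simple_head_left[OF d z, of x] that by (simp add: nonneg_on_def)
  show "x s - (\<Sum>j\<in>set M. n j s * x j) = 0" if "nonpos_on (s # M) x"
    using compatD(7)[OF c zn that] simple_head_right[OF d z, of x] by simp
qed

lemma compat_neg_simple_head:
  assumes d: "distinct (s # M)" and z: "simple_at (s # M) s (\<lambda>i. - z i)" and c: "compat (s # M) z x"
  shows "nonneg_on (s # M) x \<Longrightarrow> x s = 0" "nonpos_on (s # M) x \<Longrightarrow> x s = 0"
proof -
  have "nonneg_on (s # M) (\<lambda>i. - z i)"
    using z unfolding simple_at_def nonneg_on_def by (metis zero_le_one order.refl)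
  then have zn: "nonpos_on (s # M) z" by (simp only: nonneg_on_uminus)
  have e: "eul (s # M) z x = - x s"
    using simple_head_left[OF d z, of x] unfolding eul_uminus_left by linarith
  show "x s = 0" if "nonneg_on (s # M) x"
    using compatD(6)[OF c zn that] e by simp
  show "x s = 0" if "nonpos_on (s # M) x"
    using compatD(4)[OF c zn that] e that by (simp add: nonpos_on_def)
qed

lemma compat_simple_last:
  assumes d: "distinct (M @ [s])" and z: "simple_at (M @ [s]) s z" and c: "compat (M @ [s]) z x"
  shows "nonneg_on (M @ [s]) x \<Longrightarrow> x s = 0" "nonpos_on (M @ [s]) x \<Longrightarrow> x s = 0"
proof -
  have zn: "nonneg_on (M @ [s]) z" using z by (auto simp: simple_at_def nonneg_on_def)
  show "x s = 0" if "nonneg_on (M @ [s]) x"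
    using compatD(3)[OF c zn that] simple_last_right[OF d z, of x] that by (simp add: nonneg_on_def)
  show "x s = 0" if "nonpos_on (M @ [s]) x"
    using compatD(7)[OF c zn that] simple_last_right[OF d z, of x] by simp
qed

lemma compat_neg_simple_last:
  assumes d: "distinct (M @ [s])" and z: "simple_at (M @ [s]) s (\<lambda>i. - z i)" and c: "compat (M @ [s]) z x"
  shows "nonneg_on (M @ [s]) x \<Longrightarrow> x s - (\<Sum>j\<in>set M. n j s * x j) = 0"
    "nonpos_on (M @ [s]) x \<Longrightarrow> x s = 0"
proof -
  have "nonneg_on (M @ [s]) (\<lambda>i. - z i)"
    using z unfolding simple_at_def nonneg_on_def by (metis zero_le_one order.refl)
  then have zn: "nonpos_on (M @ [s]) z" by (simp only: nonneg_on_uminus)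
  have e: "eul (M @ [s]) x z = - x s"
    using simple_last_right[OF d z, of x] unfolding eul_uminus_right by linarith
  have e': "eul (M @ [s]) z x = - (x s - (\<Sum>j\<in>set M. n j s * x j))"
    using simple_last_left[OF d z, of x] unfolding eul_uminus_left by linarith
  show "x s - (\<Sum>j\<in>set M. n j s * x j) = 0" if "nonneg_on (M @ [s]) x"
    using compatD(6)[OF c zn that] e' by simp
  show "x s = 0" if "nonpos_on (M @ [s]) x"
    using compatD(5)[OF c zn that] e that by (simp add: nonpos_on_def)
qed

lemma pos_root_drop: "pos_root L x \<Longrightarrow> set M \<subseteq> set L \<Longrightarrow> eul L x x = eul M x x \<Longrightarrow> pos_root M x"
  by (auto simp: pos_root_def nonneg_on_def)

text \<open>Apart from its square, \<open>r\<close> occurs only on the left. The list of pairs is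
  kept short because it is not known whether \<open>r\<close> or \<open>- r\<close> is compatible
  with the root at \<open>s\<close>, so the pairings with \<open>r\<close> on the right cannot be
  controlled.\<close>

lemma bad1_drop:
  assumes "bad1 L r k g h m" "set M \<subseteq> set L"
    and eq: "\<And>x y. (x, y) \<in> {(r, r), (k, k), (g, g), (h, h), (k, g), (g, k), (r, k), (r, h)} \<Longrightarrow>
      eul L x y = eul M x y"
  shows "bad1 M r k g h m"
proof -
  have "eul L r r = eul M r r" "eul L k k = eul M k k" "eul L g g = eul M g g" "eul L h h = eul M h h"
    "eul L k g = eul M k g" "eul L g k = eul M g k" "eul L r k = eul M r k" "eul L r h = eul M r h"
    by (intro eq; simp)+
  then show ?thesis
    using assms(1,2) pos_root_drop[OF _ assms(2)] unfolding bad1_def by auto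
qed

lemma bad2_drop:
  assumes "bad2 L r k g h m" "set M \<subseteq> set L"
    and eq: "\<And>x y. x \<in> {r, k, g, h} \<Longrightarrow> y \<in> {r, k, g, h} \<Longrightarrow> eul L x y = eul M x y"
  shows "bad2 M r k g h m"
proof -
  have "eul L r r = eul M r r" "eul L k k = eul M k k" "eul L g g = eul M g g" "eul L h h = eul M h h"
    "eul L k g = eul M k g" "eul L g k = eul M g k" "eul L g r = eul M g r" "eul L h r = eul M h r"
    by (intro eq; simp)+
  then show ?thesis
    using assms(1,2) pos_root_drop[OF _ assms(2)] unfolding bad2_def by auto
qed

lemma bad3_drop:
  assumes "bad3 L x y z" "set M \<subseteq> set L"
    and eq: "\<And>u v. u \<in> {x, y, z} \<Longrightarrow> v \<in> {x, y, z} \<Longrightarrow> eul L u v = eul M u v"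
  shows "bad3 M x y z"
proof -
  have "eul L x x = eul M x x" "eul L y y = eul M y y" "eul L z z = eul M z z"
    "eul L x y = eul M x y" "eul L y z = eul M y z" "eul L z x = eul M z x"
    by (intro eq; simp)+
  then show ?thesis
    using assms(1,2) pos_root_drop[OF _ assms(2)] unfolding bad3_def by auto
qed

lemma drop_head_right: "y s = 0 \<Longrightarrow> eul (s # M) x y = eul M x y"
  by simp

lemma drop_head_left: "x s - (\<Sum>j\<in>set M. n j s * x j) = 0 \<Longrightarrow> eul (s # M) x y = eul M x y"
  by simp

lemma drop_last_left: "distinct (M @ [s]) \<Longrightarrow> x s = 0 \<Longrightarrow> eul (M @ [s]) x y = eul M x y"
  by (simp add: eul_append)

lemma drop_last_right:
  "distinct (M @ [s]) \<Longrightarrow> y s - (\<Sum>j\<in>set M. n j s * y j) = 0 \<Longrightarrow> eul (M @ [s]) x y = eul M x y"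
  by (simp add: eul_append)

end

section \<open>Excluding the configurations with a root of nonzero defect\<close>

context affine_graph begin

lemma transport_uminus: "transport L L' T w \<Longrightarrow> T (\<lambda>i. - x i) = (\<lambda>i. - T x i)"
proof -
  assume tr: "transport L L' T w"
  have "T (\<lambda>i. x i + (- 2) * x i) = (\<lambda>i. T x i + (- 2) * T x i)"
    using tr unfolding transport_def by blast
  then show ?thesis by simp
qed

lemma transport_compat:
  assumes "transport L L' T w" "compat L w x" "eul L w w = 1" "eul L x x = 1" "eul L \<delta> x = 0"
  shows "compat L' (T w) (T x)"
proof -
  have "nonneg_on L' (T x) = nonneg_on L x" "nonpos_on L' (T x) = nonpos_on L x"
    "nonneg_on L' (T w) = nonneg_on L w" "nonpos_on L' (T w) = nonpos_on L w"
    "\<And>x y. eul L' (T x) (T y) = eul L x y"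
    using assms unfolding transport_def by blast+
  then show ?thesis using assms(2) by (simp add: compat_def)
qed

lemma transport_pos_root:
  assumes "transport L L' T w" "pos_root L x" "eul L \<delta> x = 0"
  shows "pos_root L' (T x)"
  using assms unfolding transport_def pos_root_def by simp

lemma transport_pos_drop_head:
  assumes "transport L (s # M) T w"
  shows "distinct (s # M)" "distinct M" "set M = I - {s}" "s \<in> I" "dichotomy (M @ [s])"
  using assms unfolding transport_def by (auto intro!: dichotomy_full)

lemma transport_pos_drop_last:
  assumes "transport L (M @ [s]) T w"
  shows "distinct (M @ [s])" "distinct M" "set M = I - {s}" "s \<in> I" "dichotomy (s # M)"
  using assms unfolding transport_def by (auto intro!: dichotomy_full)

text \<open>The roots of the configuration have defect zero, so they differ from \<open>w\<close> up
  to sign and keep their signs while \<open>w\<close> is moved. Nothing is assumed about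
  \<open>w\<close> and \<open>h\<close>: that \<open>h\<close> loses its contribution at
  \<open>s\<close> follows from \<open>m * k = g + h\<close> and a comparison of signs.\<close>

lemma bad1_excluded:
  assumes L: "distinct L" "set L = I" and b: "bad1 L r k g h m"
    and h: "h = (\<lambda>i. - g i + m * k i)"
    and w: "eul L w w = 1" "eul L \<delta> w \<noteq> 0"
    and ck: "w = k \<or> compat L w k" and cg: "w = (\<lambda>i. - g i) \<or> compat L w (\<lambda>i. - g i)"
    and cr: "w = r \<or> w = (\<lambda>i. - r i) \<or> compat L w r \<or> compat L w (\<lambda>i. - r i)"
  shows False
proof -
  have reg: "eul L \<delta> x = 0" if "x \<in> {r, k, g, h}" for x using bad1_regular[OF L b that] .
  have pr: "pos_root L r" "pos_root L k" "pos_root L g" "pos_root L h" using b by (auto simp: bad1_def)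
  have ck': "compat L w k" and cg': "compat L w (\<lambda>i. - g i)"
    and cr': "compat L w r \<or> compat L w (\<lambda>i. - r i)"
  proof -
    have "w \<noteq> k" "w \<noteq> r" "w \<noteq> (\<lambda>i. - g i)" "w \<noteq> (\<lambda>i. - r i)"
      using w(2) reg[of k] reg[of r] reg[of g] by auto
    then show "compat L w k" "compat L w (\<lambda>i. - g i)" "compat L w r \<or> compat L w (\<lambda>i. - r i)"
      using ck cg cr by blast+
  qed
  \<comment> \<open>Carries all hypotheses over to the new order; the arbitrary conclusion allows
    the images to be named \<open>r\<close>, \<open>k\<close>, \<open>g\<close>, \<open>h\<close>
    again.\<close>
  have main: thesis
    if tr: "transport L L' T w" and fin: "\<And>r k g h W. bad1 L' r k g h m \<Longrightarrow> compat L' W k \<Longrightarrow>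
       compat L' W (\<lambda>i. - g i) \<Longrightarrow> compat L' W r \<or> compat L' W (\<lambda>i. - r i) \<Longrightarrow> W = T w \<Longrightarrow> thesis"
    for L' T and thesis :: bool
  proof (rule fin[OF _ _ _ _ refl])
    have e: "\<And>x y. eul L' (T x) (T y) = eul L x y"
      and lin: "\<And>x y m. T (\<lambda>i. x i + m * y i) = (\<lambda>i. T x i + m * T y i)"
      using tr unfolding transport_def by blast+
    have Th: "T h = (\<lambda>i. - T g i + m * T k i)"
      unfolding h lin[of "\<lambda>i. - g i" m k] transport_uminus[OF tr] ..
    show "bad1 L' (T r) (T k) (T g) (T h) m"
      using b e
    proof (rule bad1_transport)
      show "pos_root L' (T x)" if "x \<in> {r, k, g, h}" for x
        using transport_pos_root[OF tr _ reg[OF that]] that pr by auto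
    qed (simp add: Th)
    show "compat L' (T w) (T k)"
      using transport_compat[OF tr ck' w(1)] pr reg by (simp add: pos_root_def)
    have c: "compat L' (T w) (\<lambda>i. - T x i)" if "compat L w (\<lambda>i. - x i)" "pos_root L x" "eul L \<delta> x = 0" for x
      using transport_compat[OF tr that(1) w(1)] that(2,3) by (simp add: pos_root_def transport_uminus[OF tr])
    show "compat L' (T w) (\<lambda>i. - T g i)" using c cg' pr reg by simp
    show "compat L' (T w) (T r) \<or> compat L' (T w) (\<lambda>i. - T r i)"
      using cr'
    proof
      assume "compat L w r"
      then show ?thesis using transport_compat[OF tr _ w(1)] pr reg by (simp add: pos_root_def)
    qed (use c pr reg in simp)
  qed
  show False
  proof (rule move_to_simple[OF L w])
    fix s M T assume tr: "transport L (s # M) T w"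
      and si: "simple_at (s # M) s (T w) \<or> simple_at (s # M) s (\<lambda>i. - T w i)"
    note D = transport_pos_drop_head[OF tr]
    show False
    proof (rule main[OF tr])
      fix r k g h W
      assume b: "bad1 (s # M) r k g h m" and ck: "compat (s # M) W k"
        and cr: "compat (s # M) W r \<or> compat (s # M) W (\<lambda>i. - r i)" and W: "W = T w"
      have nn: "nonneg_on (s # M) x" if "x \<in> {r, k, g, h}" for x
        using b that unfolding bad1_def pos_root_def by blast
      have ks: "k s = 0"
        using si[folded W] compat_simple_head(1)[OF D(1) _ ck] compat_neg_simple_head(1)[OF D(1) _ ck] nn[of k]
        by (elim disjE) simp_all
      have "m * k s = g s + h s" using b by (simp add: bad1_def)
      then have gh: "g s = 0" "h s = 0" using ks nn[of g] nn[of h] by (auto simp: nonneg_on_def)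
      have np: "nonpos_on (s # M) (\<lambda>i. - r i)" using nn[of r] by (simp only: nonpos_on_uminus) simp
      \<comment> \<open>The vertex \<open>s\<close> contributes exactly this product to the square
        of \<open>r\<close>, so it is enough that one factor vanishes, whichever of \<open>r\<close>
        and \<open>- r\<close> is compatible.\<close>
      have rr: "(r s - (\<Sum>j\<in>set M. n j s * r j)) * r s = 0"
        using cr
      proof
        assume c: "compat (s # M) W r"
        then have "r s = 0"
          using si[folded W] compat_simple_head(1)[OF D(1) _ c] compat_neg_simple_head(1)[OF D(1) _ c] nn[of r]
          by (elim disjE) simp_all
        then show ?thesis by simp
      next
        assume c: "compat (s # M) W (\<lambda>i. - r i)"
        from si[folded W] show ?thesis
        proof
          assume "simple_at (s # M) s W"
          from compat_simple_head(2)[OF D(1) this c np] show ?thesis by (simp add: sum_negf)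
        next
          assume "simple_at (s # M) s (\<lambda>i. - W i)"
          from compat_neg_simple_head(2)[OF D(1) this c np] show ?thesis by simp
        qed
      qed
      have "bad1 M r k g h m"
      proof (rule bad1_drop[OF b])
        fix x y assume "(x, y) \<in> {(r, r), (k, k), (g, g), (h, h), (k, g), (g, k), (r, k), (r, h)}"
        then have "y s = 0 \<or> (x = r \<and> y = r)" using ks gh by blast
        then show "eul (s # M) x y = eul M x y" using rr by (elim disjE conjE) simp_all
      qed auto
      then show False by (rule bad1_sub[OF D(2-4)])
    qed
  next
    fix s M T assume tr: "transport L (M @ [s]) T w"
      and si: "simple_at (M @ [s]) s (T w) \<or> simple_at (M @ [s]) s (\<lambda>i. - T w i)"
    note D = transport_pos_drop_last[OF tr]
    show False
    proof (rule main[OF tr])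
      fix r k g h W
      assume b: "bad1 (M @ [s]) r k g h m" and ck: "compat (M @ [s]) W k"
        and cg: "compat (M @ [s]) W (\<lambda>i. - g i)"
        and cr: "compat (M @ [s]) W r \<or> compat (M @ [s]) W (\<lambda>i. - r i)" and W: "W = T w"
      have nn: "nonneg_on (M @ [s]) x" if "x \<in> {r, k, g, h}" for x
        using b that unfolding bad1_def pos_root_def by blast
      have nns: "0 \<le> g s" "0 \<le> h s" using nn[of g] nn[of h] by (auto simp: nonneg_on_def)
      have np: "nonpos_on (M @ [s]) (\<lambda>i. - r i)" using nn[of r] by (simp only: nonpos_on_uminus) simp
      have rel: "m * k i = g i + h i" if "i \<in> set (M @ [s])" for i using b that unfolding bad1_def by blast
      from si[folded W] have "bad1 M r k g h m"
      proof
        assume z: "simple_at (M @ [s]) s W"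
        have ks: "k s = 0" using compat_simple_last(1)[OF D(1) z ck] nn by simp
        then have gh: "g s = 0" "h s = 0" using rel[of s] nns by auto
        have "r s = 0"
          using cr compat_simple_last(1)[OF D(1) z, of r] compat_simple_last(2)[OF D(1) z _ np] nn[of r]
          by (elim disjE) simp_all
        show ?thesis
        proof (rule bad1_drop[OF b])
          fix x y assume "(x, y) \<in> {(r, r), (k, k), (g, g), (h, h), (k, g), (g, k), (r, k), (r, h)}"
          then have "x s = 0" using ks gh \<open>r s = 0\<close> by blast
          then show "eul (M @ [s]) x y = eul M x y" by (rule drop_last_left[OF D(1)])
        qed auto
      next
        assume z: "simple_at (M @ [s]) s (\<lambda>i. - W i)"
        let ?t = "\<lambda>y. y s - (\<Sum>j\<in>set M. n j s * y j)"
        have tk: "?t k = 0" using compat_neg_simple_last(1)[OF D(1) z ck] nn by simp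
        note ns = bad1_last[OF D(1,5) b]
        \<comment> \<open>Both are pairings of the simple root at the last vertex with positive
          roots that are not simple there. Their sum is \<open>m * ?t k = 0\<close>, so both
          vanish.\<close>
        have le: "?t g \<le> 0" "?t h \<le> 0"
          using simple_last_left_nonpos[OF D(1,5) _ ns(4) z] simple_last_left_nonpos[OF D(1,5) _ ns(2) z] b
          unfolding simple_last_left[OF D(1) z] bad1_def by blast+
        have "m * eul (M @ [s]) (\<lambda>i. - W i) k = eul (M @ [s]) (\<lambda>i. - W i) g + eul (M @ [s]) (\<lambda>i. - W i) h"
          by (intro eul_rel_right rel)
        then have "m * ?t k = ?t g + ?t h" unfolding simple_last_left[OF D(1) z] .
        then have tg: "?t g = 0" and th: "?t h = 0" using tk le by auto
        have rr: "r s * ?t r = 0"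
          using cr compat_neg_simple_last(1)[OF D(1) z, of r] compat_neg_simple_last(2)[OF D(1) z _ np] nn[of r]
          by (elim disjE) simp_all
        show ?thesis
        proof (rule bad1_drop[OF b])
          fix x y assume "(x, y) \<in> {(r, r), (k, k), (g, g), (h, h), (k, g), (g, k), (r, k), (r, h)}"
          then have "?t y = 0 \<or> (x = r \<and> y = r)" using tk tg th by blast
          then show "eul (M @ [s]) x y = eul M x y"
          proof
            assume "x = r \<and> y = r"
            then show ?thesis using rr eul_append[OF D(1), of r r] by simp
          qed (rule drop_last_right[OF D(1)])
        qed auto
      qed
      then show False by (rule bad1_sub[OF D(2-4)])
    qed
  qed
qed

lemma bad2_excluded:
  assumes L: "distinct L" "set L = I" and b: "bad2 L r k g h m"
    and h: "h = (\<lambda>i. g i + (- m) * k i)"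
    and w: "eul L w w = 1" "eul L \<delta> w \<noteq> 0"
    and ck: "w = k \<or> compat L w k" and cg: "w = (\<lambda>i. - g i) \<or> compat L w (\<lambda>i. - g i)"
    and cr: "w = (\<lambda>i. - r i) \<or> compat L w (\<lambda>i. - r i)"
  shows False
proof -
  have reg: "eul L \<delta> x = 0" if "x \<in> {r, k, g, h}" for x using bad2_regular[OF L b that] .
  have pr: "pos_root L r" "pos_root L k" "pos_root L g" "pos_root L h" using b by (auto simp: bad2_def)
  have ck': "compat L w k" and cg': "compat L w (\<lambda>i. - g i)" and cr': "compat L w (\<lambda>i. - r i)"
  proof -
    have "w \<noteq> k" "w \<noteq> (\<lambda>i. - g i)" "w \<noteq> (\<lambda>i. - r i)"
      using w(2) reg[of k] reg[of r] reg[of g] by auto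
    then show "compat L w k" "compat L w (\<lambda>i. - g i)" "compat L w (\<lambda>i. - r i)"
      using ck cg cr by blast+
  qed
  have main: thesis
    if tr: "transport L L' T w" and fin: "\<And>r k g h W. bad2 L' r k g h m \<Longrightarrow> compat L' W k \<Longrightarrow>
       compat L' W (\<lambda>i. - g i) \<Longrightarrow> compat L' W (\<lambda>i. - r i) \<Longrightarrow> W = T w \<Longrightarrow> thesis"
    for L' T and thesis :: bool
  proof (rule fin[OF _ _ _ _ refl])
    have e: "\<And>x y. eul L' (T x) (T y) = eul L x y"
      and lin: "\<And>x y m. T (\<lambda>i. x i + m * y i) = (\<lambda>i. T x i + m * T y i)"
      using tr unfolding transport_def by blast+
    have Th: "T h = (\<lambda>i. T g i + (- m) * T k i)"
      unfolding h lin[of g "- m" k] ..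
    show "bad2 L' (T r) (T k) (T g) (T h) m"
      using b e
    proof (rule bad2_transport)
      show "pos_root L' (T x)" if "x \<in> {r, k, g, h}" for x
        using transport_pos_root[OF tr _ reg[OF that]] that pr by auto
    qed (simp add: Th)
    show "compat L' (T w) (T k)"
      using transport_compat[OF tr ck' w(1)] pr reg by (simp add: pos_root_def)
    have c: "compat L' (T w) (\<lambda>i. - T x i)" if "compat L w (\<lambda>i. - x i)" "pos_root L x" "eul L \<delta> x = 0" for x
      using transport_compat[OF tr that(1) w(1)] that(2,3) by (simp add: pos_root_def transport_uminus[OF tr])
    show "compat L' (T w) (\<lambda>i. - T g i)" using c cg' pr reg by simp
    show "compat L' (T w) (\<lambda>i. - T r i)" using c cr' pr reg by simp
  qed
  show False
  proof (rule move_to_simple[OF L w])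
    fix s M T assume tr: "transport L (s # M) T w"
      and si: "simple_at (s # M) s (T w) \<or> simple_at (s # M) s (\<lambda>i. - T w i)"
    note D = transport_pos_drop_head[OF tr]
    show False
    proof (rule main[OF tr])
      fix r k g h W
      assume b: "bad2 (s # M) r k g h m" and ck: "compat (s # M) W k"
        and cg: "compat (s # M) W (\<lambda>i. - g i)" and cr: "compat (s # M) W (\<lambda>i. - r i)" and W: "W = T w"
      have nn: "nonneg_on (s # M) x" if "x \<in> {r, k, g, h}" for x
        using b that unfolding bad2_def pos_root_def by blast
      have npr: "nonpos_on (s # M) (\<lambda>i. - r i)" and npg: "nonpos_on (s # M) (\<lambda>i. - g i)"
        using nn[of r] nn[of g] by (simp_all only: nonpos_on_uminus) simp_all
      have rel: "g i = h i + m * k i" if "i \<in> set (s # M)" for i using b that unfolding bad2_def by blast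
      from si[folded W] have "bad2 M r k g h m"
      proof
        assume z: "simple_at (s # M) s W"
        let ?t = "\<lambda>y. y s - (\<Sum>j\<in>set M. n j s * y j)"
        have tg: "?t g = 0" and tr: "?t r = 0"
          using compat_simple_head(2)[OF D(1) z cg npg] compat_simple_head(2)[OF D(1) z cr npr]
          by (simp_all add: sum_negf)
        note ns = bad2_head[OF D(1,5) b]
        \<comment> \<open>Both are pairings of positive roots with the simple root at the head.
          Since \<open>?t g = ?t h + m * ?t k\<close> is zero, both vanish.\<close>
        have le: "?t k \<le> 0" "?t h \<le> 0"
          using simple_head_right_nonpos[OF D(1,5) _ ns(3) z] simple_head_right_nonpos[OF D(1,5) _ ns(2) z] b
          unfolding simple_head_right[OF D(1) z] bad2_def by blast+
        have "eul (s # M) g W = eul (s # M) h W + m * eul (s # M) k W"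
          by (intro eul_shift_left rel)
        then have s: "?t g = ?t h + m * ?t k" unfolding simple_head_right[OF D(1) z] .
        have m: "0 < m" using b by (simp add: bad2_def)
        have "m * ?t k \<le> 0" using m le by (simp add: mult_le_0_iff)
        then have th: "?t h = 0" and "m * ?t k = 0" using s tg le by linarith+
        then have tk: "?t k = 0" using m by simp
        show ?thesis
        proof (rule bad2_drop[OF b])
          fix x y assume "x \<in> {r, k, g, h}" "y \<in> {r, k, g, h}"
          then have "?t x = 0" using tk tg th tr by blast
          then show "eul (s # M) x y = eul M x y" by (rule drop_head_left)
        qed auto
      next
        assume z: "simple_at (s # M) s (\<lambda>i. - W i)"
        have "k s = 0" using compat_neg_simple_head(1)[OF D(1) z ck] nn by simp
        moreover have "g s = 0" "r s = 0"
          using compat_neg_simple_head(2)[OF D(1) z cg npg] compat_neg_simple_head(2)[OF D(1) z cr npr] by simp_all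
        ultimately have "y s = 0" if "y \<in> {r, k, g, h}" for y using that rel[of s] by auto
        then show ?thesis by (intro bad2_drop[OF b] drop_head_right) auto
      qed
      then show False by (rule bad2_sub[OF D(2-4)])
    qed
  next
    fix s M T assume tr: "transport L (M @ [s]) T w"
      and si: "simple_at (M @ [s]) s (T w) \<or> simple_at (M @ [s]) s (\<lambda>i. - T w i)"
    note D = transport_pos_drop_last[OF tr]
    show False
    proof (rule main[OF tr])
      fix r k g h W
      assume b: "bad2 (M @ [s]) r k g h m" and ck: "compat (M @ [s]) W k"
        and cg: "compat (M @ [s]) W (\<lambda>i. - g i)" and cr: "compat (M @ [s]) W (\<lambda>i. - r i)" and W: "W = T w"
      have nn: "nonneg_on (M @ [s]) x" if "x \<in> {r, k, g, h}" for x
        using b that unfolding bad2_def pos_root_def by blast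
      have npr: "nonpos_on (M @ [s]) (\<lambda>i. - r i)" and npg: "nonpos_on (M @ [s]) (\<lambda>i. - g i)"
        using nn[of r] nn[of g] by (simp_all only: nonpos_on_uminus) simp_all
      have rel: "g s = h s + m * k s" using b unfolding bad2_def by auto
      have m: "0 < m" using b by (simp add: bad2_def)
      have nns: "0 \<le> k s" "0 \<le> h s" using nn[of k] nn[of h] by (auto simp: nonneg_on_def)
      have "g s = 0 \<and> r s = 0"
        using si[folded W]
      proof
        assume z: "simple_at (M @ [s]) s W"
        show ?thesis
          using compat_simple_last(2)[OF D(1) z cg npg] compat_simple_last(2)[OF D(1) z cr npr] by simp
      next
        assume z: "simple_at (M @ [s]) s (\<lambda>i. - W i)"
        show ?thesis
          using compat_neg_simple_last(2)[OF D(1) z cg npg] compat_neg_simple_last(2)[OF D(1) z cr npr] by simp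
      qed
      moreover have "0 \<le> m * k s" using m nns by simp
      ultimately have z: "g s = 0" "r s = 0" "h s = 0" "m * k s = 0" using rel nns by linarith+
      then have "k s = 0" using m by simp
      then have "x s = 0" if "x \<in> {r, k, g, h}" for x using that z by auto
      then have "bad2 M r k g h m" by (intro bad2_drop[OF b] drop_last_left[OF D(1)]) auto
      then show False by (rule bad2_sub[OF D(2-4)])
    qed
  qed
qed

lemma bad3_excluded:
  assumes L: "distinct L" "set L = I" and b: "bad3 L x y z"
    and w: "eul L w w = 1" "eul L \<delta> w \<noteq> 0"
    and c: "\<And>u. u \<in> {x, y, z} \<Longrightarrow> w = u \<or> compat L w u"
  shows False
proof -
  have reg: "eul L \<delta> u = 0" if "u \<in> {x, y, z}" for u using bad3_regular[OF L b that] .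
  have pr: "pos_root L u" if "u \<in> {x, y, z}" for u using b that by (auto simp: bad3_def)
  have c': "compat L w u" if "u \<in> {x, y, z}" for u using c[OF that] reg[OF that] w(2) by metis
  have main: "bad3 L' (T x) (T y) (T z) \<and> (\<forall>u\<in>{T x, T y, T z}. compat L' (T w) u \<and> nonneg_on L' u)"
    if tr: "transport L L' T w" for L' T
  proof -
    have e: "\<And>x y. eul L' (T x) (T y) = eul L x y" using tr unfolding transport_def by blast
    have p: "pos_root L' (T u)" if "u \<in> {x, y, z}" for u
      using transport_pos_root[OF tr pr[OF that] reg[OF that]] .
    have "compat L' (T w) (T u)" if "u \<in> {x, y, z}" for u
      using transport_compat[OF tr c'[OF that] w(1)] pr[OF that] reg[OF that] by (simp add: pos_root_def)
    moreover have "bad3 L' (T x) (T y) (T z)" by (rule bad3_transport[of L x y z L' T, OF b e p])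
    ultimately show ?thesis using p by (simp add: pos_root_def)
  qed
  show False
  proof (rule move_to_simple[OF L w])
    fix s M T assume tr: "transport L (s # M) T w"
      and si: "simple_at (s # M) s (T w) \<or> simple_at (s # M) s (\<lambda>i. - T w i)"
    note D = transport_pos_drop_head[OF tr]
    have z: "u s = 0" if "u \<in> {T x, T y, T z}" for u
    proof -
      have c: "compat (s # M) (T w) u" "nonneg_on (s # M) u" using main[OF tr] that by blast+
      show ?thesis
        using si compat_simple_head(1)[OF D(1) _ c] compat_neg_simple_head(1)[OF D(1) _ c] by blast
    qed
    have "bad3 M (T x) (T y) (T z)"
    proof (rule bad3_drop[OF conjunct1[OF main[OF tr]]])
      show "eul (s # M) u v = eul M u v" if "v \<in> {T x, T y, T z}" for u v
        by (rule drop_head_right, rule z, rule that)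
    qed auto
    then show False by (rule bad3_sub[OF D(2-4)])
  next
    fix s M T assume tr: "transport L (M @ [s]) T w"
      and si: "simple_at (M @ [s]) s (T w) \<or> simple_at (M @ [s]) s (\<lambda>i. - T w i)"
    note D = transport_pos_drop_last[OF tr]
    from si have "bad3 M (T x) (T y) (T z)"
    proof
      assume "simple_at (M @ [s]) s (T w)"
      then have z: "u s = 0" if "u \<in> {T x, T y, T z}" for u
      proof -
        have c: "compat (M @ [s]) (T w) u" "nonneg_on (M @ [s]) u" using main[OF tr] that by blast+
        show ?thesis using compat_simple_last(1)[OF D(1) \<open>simple_at (M @ [s]) s (T w)\<close> c] .
      qed
      show ?thesis
      proof (rule bad3_drop[OF conjunct1[OF main[OF tr]]])
        show "eul (M @ [s]) u v = eul M u v" if "u \<in> {T x, T y, T z}" for u v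
          by (rule drop_last_left[OF D(1)], rule z, rule that)
      qed auto
    next
      assume "simple_at (M @ [s]) s (\<lambda>i. - T w i)"
      then have z: "u s - (\<Sum>j\<in>set M. n j s * u j) = 0" if "u \<in> {T x, T y, T z}" for u
      proof -
        have c: "compat (M @ [s]) (T w) u" "nonneg_on (M @ [s]) u" using main[OF tr] that by blast+
        show ?thesis using compat_neg_simple_last(1)[OF D(1) \<open>simple_at (M @ [s]) s (\<lambda>i. - T w i)\<close> c] .
      qed
      show ?thesis
      proof (rule bad3_drop[OF conjunct1[OF main[OF tr]]])
        show "eul (M @ [s]) u v = eul M u v" if "v \<in> {T x, T y, T z}" for u v
          by (rule drop_last_right[OF D(1)], rule z, rule that)
      qed auto
    qed
    then show False by (rule bad3_sub[OF D(2-4)])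
  qed
qed

end

section \<open>Mutation of compatible families\<close>

definition mutate :: "nat \<Rightarrow> (nat \<Rightarrow> nat \<Rightarrow> int) \<Rightarrow> nat \<Rightarrow> nat \<Rightarrow> int" where
  "mutate k B i j = (if k \<in> {i, j} then - B i j
     else B i j + (\<bar>B i k\<bar> * B k j + B i k * \<bar>B k j\<bar>) div 2)"

text \<open>The form with positive parts is the one produced by the change of basis that adds a
  nonnegative multiple of \<open>c k\<close> to each \<open>c i\<close>.\<close>

lemma mutation_term:
  fixes x y :: int
  shows "(\<bar>x\<bar> * y + x * \<bar>y\<bar>) div 2 = x * max 0 y + max 0 (- x) * y"
proof -
  have "\<bar>x\<bar> * y + x * \<bar>y\<bar> = 2 * (x * max 0 y + max 0 (- x) * y)"
    by (cases "0 \<le> x"; cases "0 \<le> y") (auto simp: max_def)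
  then show ?thesis by simp
qed

lemma mutate_mutate: "mutate k (mutate k B) i j = B i j"
proof (cases "k \<in> {i, j}")
  case False
  have "x * max 0 y + max 0 (- x) * y + ((- x) * max 0 (- y) + max 0 (- (- x)) * (- y)) = 0" for x y :: int
    by (simp add: max_def)
  from this[of "B i k" "B k j"] show ?thesis
    using False unfolding mutate_def mutation_term by simp
qed (auto simp: mutate_def)

section \<open>Pushing a compatible pair along a positive root\<close>

context affine_graph begin

text \<open>Translation by \<delta> does not change the form, so the two mixed terms cancel.\<close>

lemma eul_delta_right:
  assumes "distinct L" "set L = I"
  shows "eul L x \<delta> = - eul L \<delta> x"
proof -
  have "2 * eul L (\<lambda>i. x i + 1 * \<delta> i) (\<lambda>i. x i + 1 * \<delta> i) = 2 * eul L x x"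
    using eul_qf[OF assms(1)] assms(2) qf_add_delta[of x 1] by simp
  then show ?thesis
    using eul_delta_delta[OF assms] by (simp only: eul_add_left eul_add_right) simp
qed

text \<open>If the pairing is negative, compatibility annihilates the opposite pairing, and the
  coefficient is that of the reflection in \<kappa>; otherwise nothing moves.\<close>

abbreviation push :: "nat list \<Rightarrow> (nat \<Rightarrow> int) \<Rightarrow> (nat \<Rightarrow> int) \<Rightarrow> nat \<Rightarrow> int" where
  "push L \<kappa> x \<equiv> (\<lambda>i. x i + max 0 (- eul L \<kappa> x) * \<kappa> i)"

lemma push_facts:
  assumes k: "pos_root L \<kappa>" and x: "eul L x x = 1" "nonneg_on L x \<or> nonpos_on L x" "compat L \<kappa> x"
  shows "eul L \<kappa> x < 0 \<Longrightarrow> eul L x \<kappa> = 0"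
    "eul L (push L \<kappa> x) (push L \<kappa> x) = 1"
    "nonneg_on L x \<Longrightarrow> nonneg_on L (push L \<kappa> x)"
proof -
  show 1: "eul L x \<kappa> = 0" if "eul L \<kappa> x < 0"
    using compatD(1)[OF x(3)] that by simp
  show "eul L (push L \<kappa> x) (push L \<kappa> x) = 1"
  proof (cases "eul L \<kappa> x < 0")
    case True
    then show ?thesis using 1 x k
      by (simp only: eul_add_left eul_add_right) (simp add: pos_root_def algebra_simps)
  qed (use x in \<open>simp add: max_def\<close>)
  show "nonneg_on L (push L \<kappa> x)" if "nonneg_on L x"
    using that k by (simp add: nonneg_on_def pos_root_def)
qed

lemma push_self_compat:
  assumes k: "pos_root L \<kappa>" and x: "eul L x x = 1" "nonneg_on L x \<or> nonpos_on L x" "compat L \<kappa> x"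
    and s: "nonneg_on L (push L \<kappa> x) \<or> nonpos_on L (push L \<kappa> x)"
  shows "compat L (\<lambda>i. - \<kappa> i) (push L \<kappa> x)"
proof -
  have kk: "eul L \<kappa> \<kappa> = 1" and kn: "nonneg_on L \<kappa>" using k by (simp_all add: pos_root_def)
  have kn': "\<not> nonpos_on L \<kappa>" using not_nonneg_nonpos[OF kk kn] by blast
  note C = compatD[OF x(3)]
  show ?thesis
  proof (cases "eul L \<kappa> x < 0")
    case True
    then have "eul L \<kappa> (push L \<kappa> x) = 0" "eul L (push L \<kappa> x) \<kappa> = - eul L \<kappa> x"
      unfolding eul_add_left eul_add_right using push_facts(1)[OF k x] kk by simp_all
    then show ?thesis using True kn' unfolding compat_def by simp
  next
    case False
    then have p: "push L \<kappa> x = x" by (simp add: max_def)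
    have excl: "\<not> (nonneg_on L x \<and> nonpos_on L x)" using not_nonneg_nonpos[OF x(1)] by blast
    show ?thesis
    proof (cases "nonneg_on L x")
      case True
      then show ?thesis using False kn kn' C(1,2) excl unfolding p compat_def by simp
    next
      case np: False
      then have "nonpos_on L x" using x by blast
      then show ?thesis using np False kn kn' C(7) unfolding p compat_def by simp
    qed
  qed
qed

text \<open>The positive roots \<open>- x\<close> and \<open>push L \<kappa> x\<close> add up to a
  multiple of \<kappa>, so a positive value would be a \<open>bad1\<close>.\<close>

lemma push_positive_bound:
  assumes L: "distinct L" "set L = I" and k: "pos_root L \<kappa>"
    and x: "eul L x x = 1" "nonpos_on L x" "compat L \<kappa> x" "eul L \<kappa> x < 0" "nonneg_on L (push L \<kappa> x)"
    and r: "pos_root L r" "eul L r \<kappa> \<le> 0"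
    and w: "eul L w w = 1" "eul L \<delta> w \<noteq> 0" "w = \<kappa> \<or> compat L w \<kappa>" "w = x \<or> compat L w x"
      "w = r \<or> w = (\<lambda>i. - r i) \<or> compat L w r \<or> compat L w (\<lambda>i. - r i)"
  shows "eul L r (push L \<kappa> x) \<le> 0"
proof (rule ccontr)
  assume *: "\<not> ?thesis"
  have "bad1 L r \<kappa> (\<lambda>i. - x i) (push L \<kappa> x) (- eul L \<kappa> x)"
    unfolding bad1_def
    using * x k r push_facts[OF k x(1) _ x(3)] by (simp add: pos_root_def)
  then show False
    by (rule bad1_excluded[OF L _ _ w(1,2)]) (use x(4) w in auto)
qed

text \<open>The positive root \<open>- x\<close> is \<open>- push L \<kappa> x\<close> plus a
  multiple of \<kappa>, so a positive value would be a \<open>bad2\<close> with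
  \<open>r = - y\<close>.\<close>

lemma push_negative_bound:
  assumes L: "distinct L" "set L = I" and k: "pos_root L \<kappa>"
    and x: "eul L x x = 1" "nonpos_on L x" "compat L \<kappa> x" "eul L \<kappa> x < 0" "nonpos_on L (push L \<kappa> x)"
    and y: "eul L y y = 1" "nonpos_on L y" "eul L x y \<le> 0"
    and w: "eul L w w = 1" "eul L \<delta> w \<noteq> 0" "w = \<kappa> \<or> compat L w \<kappa>" "w = x \<or> compat L w x"
      "w = y \<or> compat L w y"
  shows "eul L (push L \<kappa> x) y \<le> 0"
proof (rule ccontr)
  assume *: "\<not> ?thesis"
  let ?h = "\<lambda>i. - push L \<kappa> x i"
  have h: "eul L ?h ?h = 1" "nonneg_on L ?h"
    using push_facts(2)[OF k x(1) _ x(3)] x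
    unfolding eul_uminus_left eul_uminus_right nonneg_on_uminus by simp_all
  have hy: "0 < eul L ?h (\<lambda>i. - y i)"
    using * unfolding eul_uminus_left eul_uminus_right by simp
  have "bad2 L (\<lambda>i. - y i) \<kappa> (\<lambda>i. - x i) ?h (- eul L \<kappa> x)"
    unfolding bad2_def pos_root_def
    using h hy k x y push_facts(1)[OF k x(1) _ x(3)]
    by (simp add: pos_root_def)
  then show False
    by (rule bad2_excluded[OF L _ _ w(1,2)]) (use x(4) w in auto)
qed

lemma push_expand:
  "eul L (push L \<kappa> x) (push L \<kappa> y) = eul L x y + max 0 (- eul L \<kappa> y) * eul L x \<kappa>
     + max 0 (- eul L \<kappa> x) * eul L \<kappa> y + max 0 (- eul L \<kappa> x) * max 0 (- eul L \<kappa> y) * eul L \<kappa> \<kappa>"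
  unfolding eul_add_left eul_add_right by (simp add: algebra_simps)

text \<open>Each configuration has its place in the case distinction on signs: \<open>bad3\<close>
  when \<open>x\<close> and \<open>y\<close> are positive, \<open>bad1\<close> when the push makes a
  negative \<open>x\<close> positive, \<open>bad2\<close> when \<open>x\<close>, its image and
  \<open>y\<close> are all negative.\<close>

lemma push_compat_unmoved:
  assumes L: "distinct L" "set L = I" and k: "pos_root L \<kappa>"
    and x: "eul L x x = 1" "compat L \<kappa> x" and y: "eul L y y = 1" "compat L \<kappa> y"
    and xy: "compat L x y"
    and w: "eul L w w = 1" "eul L \<delta> w \<noteq> 0" "w = \<kappa> \<or> compat L w \<kappa>" "w = x \<or> compat L w x"
      "w = y \<or> compat L w y"
    and mx: "eul L \<kappa> x < 0" and my: "\<not> eul L \<kappa> y < 0"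
  shows "compat L (push L \<kappa> x) y"
proof -
  have dich: "\<And>z. eul L z z = 1 \<Longrightarrow> nonneg_on L z \<or> nonpos_on L z"
    using dichotomy_full[OF L] unfolding dichotomy_def by blast
  note dx = dich[OF x(1)] and dy = dich[OF y(1)]
  define m where "m = - eul L \<kappa> x"
  have m: "0 < m" using mx by (simp add: m_def)
  let ?x = "push L \<kappa> x"
  note P = push_facts[OF k x(1) dx x(2)]
  have xk: "eul L x \<kappa> = 0" using P(1)[OF mx] .
  have kn: "nonneg_on L \<kappa>" using k by (simp add: pos_root_def)
  have e1: "eul L ?x y = eul L x y + m * eul L \<kappa> y"
    and e2: "eul L y ?x = eul L y x + m * eul L y \<kappa>"
    unfolding eul_add_left eul_add_right using mx by (simp_all add: m_def)
  have dX: "nonneg_on L ?x \<or> nonpos_on L ?x" using dich[OF P(2)] .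
  have exx: "\<not> (nonneg_on L ?x \<and> nonpos_on L ?x)" using not_nonneg_nonpos[OF P(2)] by blast
  have exy: "\<not> (nonneg_on L y \<and> nonpos_on L y)" using not_nonneg_nonpos[OF y(1)] by blast
  note Cy = compatD[OF y(2)] and C = compatD[OF xy]
  show ?thesis
  proof (cases "nonneg_on L x")
    case px: True
    have pX: "nonneg_on L ?x" using P(3)[OF px] .
    show ?thesis
    proof (cases "nonneg_on L y")
      case py: True
      have ky: "eul L \<kappa> y = 0" using Cy(2)[OF kn py] my by simp
      have yk: "eul L y \<kappa> \<le> 0" using Cy(3)[OF kn py] .
      have "eul L ?x y * eul L y ?x = 0"
      proof (cases "eul L x y < 0")
        case True
        have "\<not> eul L y \<kappa> < 0"
        proof
          assume "eul L y \<kappa> < 0"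
          then have "bad3 L x y \<kappa>" using True mx k px py x(1) y(1) by (simp add: bad3_def pos_root_def)
          then show False by (rule bad3_excluded[OF L _ w(1,2)]) (use w in auto)
        qed
        then have "eul L y \<kappa> = 0" using yk by simp
        moreover have "eul L y x = 0" using C(1) True by simp
        ultimately show ?thesis using e2 by simp
      next
        case False
        then show ?thesis using C(2)[OF px py] e1 ky by simp
      qed
      moreover have "eul L ?x y \<le> 0" using e1 ky C(2)[OF px py] by simp
      moreover have "eul L y ?x \<le> 0"
        using e2 C(3)[OF px py] yk m mult_nonneg_nonpos[of m "eul L y \<kappa>"] by linarith
      ultimately show ?thesis using pX py exx exy unfolding compat_def by blast
    next
      case ny: False
      then have ny': "nonpos_on L y" using dy by blast
      have "eul L y ?x = 0" using e2 C(7)[OF px ny'] Cy(7)[OF kn ny'] by simp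
      then show ?thesis using pX ny ny' exx unfolding compat_def by simp
    qed
  next
    case False
    then have nx: "nonpos_on L x" using dx by blast
    show ?thesis
    proof (cases "nonneg_on L y")
      case py: True
      have ky: "eul L \<kappa> y = 0" using Cy(2)[OF kn py] my by simp
      have e0: "eul L ?x y = 0" using e1 ky C(6)[OF nx py] by simp
      show ?thesis
      proof (cases "nonneg_on L ?x")
        case pX: True
        have "eul L y ?x \<le> 0"
          by (rule push_positive_bound[OF L k x(1) nx x(2) mx pX _ _ w(1-4)])
             (use y py Cy(3)[OF kn py] w(5) in \<open>auto simp: pos_root_def\<close>)
        then show ?thesis using e0 pX py exx exy unfolding compat_def by simp
      next
        case nX: False
        then show ?thesis using e0 py exy unfolding compat_def by simp
      qed
    next
      case ny: False
      then have ny': "nonpos_on L y" using dy by blast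
      have yk: "eul L y \<kappa> = 0" using Cy(7)[OF kn ny'] .
      have yx: "eul L y ?x = eul L y x" using e2 yk by simp
      show ?thesis
      proof (cases "nonneg_on L ?x")
        case pX: True
        \<comment> \<open>For the positive root \<open>- y\<close> the bound reads as a lower bound
          for \<open>y\<close>. With the upper bound from compatibility it gives the vanishing
          demanded for opposite signs.\<close>
        have "eul L (\<lambda>i. - y i) ?x \<le> 0"
          by (rule push_positive_bound[OF L k x(1) nx x(2) mx pX _ _ w(1-4)])
             (use y ny' yk w(5) in \<open>auto simp: pos_root_def\<close>)
        then have "0 \<le> eul L y ?x" unfolding eul_uminus_left by simp
        then have "eul L y ?x = 0" using yx C(5)[OF nx ny'] by simp
        then show ?thesis using pX ny ny' exx unfolding compat_def by simp
      next
        case nX: False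
        then have nX': "nonpos_on L ?x" using dX by blast
        have le: "eul L ?x y \<le> 0"
          by (rule push_negative_bound[OF L k x(1) nx x(2) mx nX' y(1) ny' C(4)[OF nx ny'] w])
        have "eul L ?x y * eul L y ?x = 0"
        proof (cases "eul L y x = 0")
          case False
          then have "eul L x y = 0" using C(1) by simp
          then have "0 \<le> eul L ?x y" using e1 m my by simp
          then show ?thesis using le by simp
        qed (simp add: yx)
        then show ?thesis using le yx C(5)[OF nx ny'] nX nX' ny unfolding compat_def by simp
      qed
    qed
  qed
qed

text \<open>Both vectors are moved by the same reflection and both Euler values stay as they were;
  only signs can change, and the clauses for the new signs have to be verified. The hypothesis
  \<open>flip\<close> leaves out one of the mixed outcomes, which is recovered by exchanging
  \<open>x\<close> and \<open>y\<close>.\<close>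

lemma push_compat_moved:
  assumes L: "distinct L" "set L = I" and k: "pos_root L \<kappa>"
    and x: "eul L x x = 1" "compat L \<kappa> x" and y: "eul L y y = 1" "compat L \<kappa> y"
    and xy: "compat L x y"
    and w: "eul L w w = 1" "eul L \<delta> w \<noteq> 0" "w = \<kappa> \<or> compat L w \<kappa>" "w = x \<or> compat L w x"
      "w = y \<or> compat L w y"
    and mx: "eul L \<kappa> x < 0" and my: "eul L \<kappa> y < 0"
    and flip: "nonneg_on L x \<or> nonneg_on L (push L \<kappa> x) \<longrightarrow> nonneg_on L y \<or> nonneg_on L (push L \<kappa> y)"
  shows "compat L (push L \<kappa> x) (push L \<kappa> y)"
proof -
  have dich: "\<And>z. eul L z z = 1 \<Longrightarrow> nonneg_on L z \<or> nonpos_on L z"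
    using dichotomy_full[OF L] unfolding dichotomy_def by blast
  note dx = dich[OF x(1)] and dy = dich[OF y(1)]
  let ?x = "push L \<kappa> x" and ?y = "push L \<kappa> y"
  note P = push_facts[OF k x(1) dx x(2)] and Q = push_facts[OF k y(1) dy y(2)]
  have kk: "eul L \<kappa> \<kappa> = 1" using k by (simp add: pos_root_def)
  have xk: "eul L x \<kappa> = 0" and yk: "eul L y \<kappa> = 0" using P(1)[OF mx] Q(1)[OF my] .
  have e1: "eul L ?x ?y = eul L x y" and e2: "eul L ?y ?x = eul L y x"
    unfolding push_expand using mx my xk yk kk by (simp_all add: algebra_simps)
  have ex: "\<not> (nonneg_on L z \<and> nonpos_on L z)" if "eul L z z = 1" for z
    using not_nonneg_nonpos[OF that] by blast
  note E = ex[OF x(1)] ex[OF y(1)] ex[OF P(2)] ex[OF Q(2)] and D = dich[OF P(2)] dich[OF Q(2)]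
  note C = compatD[OF xy]
  have A: "eul L x y \<le> 0" if "nonneg_on L x" "nonpos_on L y" "nonneg_on L ?y"
  proof -
    have "eul L x ?y \<le> 0"
      by (rule push_positive_bound[OF L k y(1) that(2) y(2) my that(3) _ _ w(1-3,5)])
         (use x that xk w(4) in \<open>auto simp: pos_root_def\<close>)
    then show ?thesis unfolding eul_add_right using xk by simp
  qed
  have A': "eul L y x \<le> 0" if "nonneg_on L y" "nonpos_on L x" "nonneg_on L ?x"
  proof -
    have "eul L y ?x \<le> 0"
      by (rule push_positive_bound[OF L k x(1) that(2) x(2) mx that(3) _ _ w(1-4)])
         (use y that yk w(5) in \<open>auto simp: pos_root_def\<close>)
    then show ?thesis unfolding eul_add_right using yk by simp
  qed
  have F: "eul L x y = 0" if "nonpos_on L x" "nonpos_on L y" "nonneg_on L ?y"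
  proof -
    have "eul L (\<lambda>i. - x i) ?y \<le> 0"
      by (rule push_positive_bound[OF L k y(1) that(2) y(2) my that(3) _ _ w(1-3,5)])
         (use x that xk w(4) in \<open>auto simp: pos_root_def\<close>)
    then have "0 \<le> eul L x y" using xk unfolding eul_uminus_left eul_add_right by simp
    then show ?thesis using C(4)[OF that(1,2)] by simp
  qed
  have pX: "nonneg_on L x \<Longrightarrow> nonneg_on L ?x" and pY: "nonneg_on L y \<Longrightarrow> nonneg_on L ?y"
    using P(3) Q(3) by blast+
  show ?thesis
  proof (cases "nonneg_on L ?x")
    case True
    then have Y: "nonneg_on L ?y" using flip pY by blast
    have "eul L x y \<le> 0 \<and> eul L y x \<le> 0"
    proof (cases "nonneg_on L x")
      case px: True
      show ?thesis
      proof (cases "nonneg_on L y")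
        case True
        then show ?thesis using C(2,3) px by blast
      next
        case False
        then have "nonpos_on L y" using dy by blast
        then show ?thesis using A[OF px _ Y] C(7)[OF px] by simp
      qed
    next
      case False
      then have nx: "nonpos_on L x" using dx by blast
      show ?thesis
      proof (cases "nonneg_on L y")
        case py: True
        then show ?thesis using A'[OF py nx \<open>nonneg_on L ?x\<close>] C(6)[OF nx py] by simp
      next
        case False
        then have "nonpos_on L y" using dy by blast
        then show ?thesis using C(4,5)[OF nx] by simp
      qed
    qed
    then show ?thesis using C(1) E(3,4) True Y unfolding compat_def e1 e2 by blast
  next
    case nX: False
    then have nx: "nonpos_on L x" using pX dx by blast
    show ?thesis
    proof (cases "nonneg_on L ?y")
      case Y: True
      have "eul L x y = 0"
      proof (cases "nonneg_on L y")
        case False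
        then have "nonpos_on L y" using dy by blast
        then show ?thesis using F[OF nx _ Y] by simp
      qed (use C(6)[OF nx] in simp)
      then show ?thesis using nX Y E(4) unfolding compat_def e1 e2 by simp
    next
      case nY: False
      then have "nonpos_on L y" using pY dy by blast
      then have "eul L x y \<le> 0" "eul L y x \<le> 0" using C(4,5)[OF nx] by simp_all
      then show ?thesis using nX nY C(1) unfolding compat_def e1 e2 by simp
    qed
  qed
qed

lemma push_compat:
  assumes L: "distinct L" "set L = I" and k: "pos_root L \<kappa>"
    and x: "eul L x x = 1" "compat L \<kappa> x" and y: "eul L y y = 1" "compat L \<kappa> y"
    and xy: "compat L x y"
    and w: "eul L w w = 1" "eul L \<delta> w \<noteq> 0" "w = \<kappa> \<or> compat L w \<kappa>" "w = x \<or> compat L w x"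
      "w = y \<or> compat L w y"
  shows "compat L (push L \<kappa> x) (push L \<kappa> y)"
proof -
  have u: "push L \<kappa> z = z" if "\<not> eul L \<kappa> z < 0" for z using that by (simp add: max_def)
  have yx: "compat L y x" using xy by (simp only: compat_commute)
  consider "\<not> eul L \<kappa> x < 0" "\<not> eul L \<kappa> y < 0" | "eul L \<kappa> x < 0" "\<not> eul L \<kappa> y < 0"
    | "\<not> eul L \<kappa> x < 0" "eul L \<kappa> y < 0" | "eul L \<kappa> x < 0" "eul L \<kappa> y < 0" by blast
  then show ?thesis
  proof cases
    case 1
    then show ?thesis using xy u by simp
  next
    case 2
    then show ?thesis using push_compat_unmoved[OF L k x y xy w] u[of y] by simp
  next
    case 3
    then show ?thesis using push_compat_unmoved[OF L k y x yx w(1-3,5,4)] u[of x] by (simp add: compat_commute)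
  next
    case 4
    show ?thesis
    proof (cases "nonneg_on L x \<or> nonneg_on L (push L \<kappa> x) \<longrightarrow> nonneg_on L y \<or> nonneg_on L (push L \<kappa> y)")
      case True
      then show ?thesis using push_compat_moved[OF L k x y xy w 4] by blast
    next
      case False
      then have "compat L (push L \<kappa> y) (push L \<kappa> x)"
        using push_compat_moved[OF L k y x yx w(1-3,5,4) 4(2,1)] by blast
      then show ?thesis by (simp only: compat_commute)
    qed
  qed
qed

end

context weighted_graph begin

definition sym :: "nat list \<Rightarrow> (nat \<Rightarrow> int) \<Rightarrow> (nat \<Rightarrow> int) \<Rightarrow> int" where
  "sym L x y = eul L x y + eul L y x"

lemma eul_scale_left: "eul L (\<lambda>v. m * x v) y = m * eul L x y"
  using eul_add_left[of L "\<lambda>i. 0" m x y] eul_zero_left[of L "\<lambda>i. 0" y] by simp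

lemma eul_scale_right: "eul L y (\<lambda>v. m * x v) = m * eul L y x"
  using eul_add_right[of L y "\<lambda>i. 0" m x] eul_zero_right[of L "\<lambda>i. 0" y] by simp

end

section \<open>Families of roots and their mutation\<close>

context affine_graph begin

text \<open>The clause on the defect supplies the root with which the forbidden configurations are
  excluded. Independence, together with an integral expression of \<delta>, later identifies the
  kernel of the Gram matrix.\<close>

definition family :: "nat list \<Rightarrow> (nat \<Rightarrow> nat \<Rightarrow> int) \<Rightarrow> (nat \<Rightarrow> nat \<Rightarrow> int) \<Rightarrow> bool" where
  "family L B c \<longleftrightarrow> (\<forall>i\<in>I. eul L (c i) (c i) = 1) \<and>
     (\<forall>i\<in>I. \<forall>j\<in>I. i \<noteq> j \<longrightarrow> compat L (c i) (c j)) \<and>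
     (\<forall>i\<in>I. \<forall>j\<in>I. B i j = eul L (c i) (c j) - eul L (c j) (c i)) \<and>
     (\<exists>l\<in>I. eul L \<delta> (c l) \<noteq> 0) \<and>
     (\<forall>x. (\<forall>v\<in>I. (\<Sum>i\<in>I. x i * c i v) = 0) \<longrightarrow> (\<forall>i\<in>I. x i = 0)) \<and>
     (\<exists>x. \<forall>v\<in>I. (\<Sum>i\<in>I. x i * c i v) = \<delta> v)"

lemma familyD:
  assumes "family L B c"
  shows "\<And>i. i \<in> I \<Longrightarrow> eul L (c i) (c i) = 1"
    "\<And>i j. i \<in> I \<Longrightarrow> j \<in> I \<Longrightarrow> i \<noteq> j \<Longrightarrow> compat L (c i) (c j)"
    "\<And>i j. i \<in> I \<Longrightarrow> j \<in> I \<Longrightarrow> B i j = eul L (c i) (c j) - eul L (c j) (c i)"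
    "\<exists>l\<in>I. eul L \<delta> (c l) \<noteq> 0"
    "\<And>x i. (\<And>v. v \<in> I \<Longrightarrow> (\<Sum>i\<in>I. x i * c i v) = 0) \<Longrightarrow> i \<in> I \<Longrightarrow> x i = 0"
    "\<exists>x. \<forall>v\<in>I. (\<Sum>i\<in>I. x i * c i v) = \<delta> v"
  using assms unfolding family_def by blast+

text \<open>The value -2 lets the single rule \<open>c i + coeff * c k\<close> also send
  \<open>c k\<close> to its negative. For a negative \<open>c k\<close> the arguments of the form
  are exchanged, as they are after reversal and negation.\<close>

definition coeff :: "nat list \<Rightarrow> (nat \<Rightarrow> nat \<Rightarrow> int) \<Rightarrow> nat \<Rightarrow> nat \<Rightarrow> int" where
  "coeff L c k i = (if i = k then -2 else if nonneg_on L (c k) then max 0 (- eul L (c k) (c i))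
     else max 0 (- eul L (c i) (c k)))"

definition move :: "nat list \<Rightarrow> nat \<Rightarrow> (nat \<Rightarrow> nat \<Rightarrow> int) \<Rightarrow> nat \<Rightarrow> nat \<Rightarrow> int" where
  "move L k c i = (\<lambda>v. c i v + coeff L c k i * c k v)"

lemma move_self: "move L k c k = (\<lambda>v. - c k v)"
  by (simp add: move_def coeff_def)

lemma move_pos:
  "i \<noteq> k \<Longrightarrow> nonneg_on L (c k) \<Longrightarrow> move L k c i = push L (c k) (c i)"
  by (simp add: move_def coeff_def)

lemma move_neg:
  assumes "i \<noteq> k" "\<not> nonneg_on L (c k)" "distinct L"
  shows "(\<lambda>v. - move L k c i v) = push (rev L) (\<lambda>v. - c k v) (\<lambda>v. - c i v)"
  unfolding eul_uminus_left eul_uminus_right using assms by (simp add: move_def coeff_def eul_rev)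

lemma move_compat:
  assumes L: "distinct L" "set L = I" and f: "family L B c" and k: "k \<in> I" and ij: "i \<in> I" "j \<in> I"
  shows "eul L (move L k c i) (move L k c i) = 1" "i \<noteq> j \<Longrightarrow> compat L (move L k c i) (move L k c j)"
proof -
  note F = familyD[OF f]
  have main: "eul M (push M \<kappa> x) (push M \<kappa> x) = 1 \<and> compat M (\<lambda>v. - \<kappa> v) (push M \<kappa> x) \<and>
      (y \<noteq> x \<longrightarrow> compat M (push M \<kappa> x) (push M \<kappa> y))"
    if M: "distinct M" "set M = I" and k: "pos_root M \<kappa>"
      and x: "eul M x x = 1" "compat M \<kappa> x" and y: "eul M y y = 1" "compat M \<kappa> y"
      and xy: "x \<noteq> y \<Longrightarrow> compat M x y"
      and w: "eul M w w = 1" "eul M \<delta> w \<noteq> 0" "w = \<kappa> \<or> compat M w \<kappa>" "w = x \<or> compat M w x"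
        "w = y \<or> compat M w y" for M \<kappa> x y w
  proof -
    have dich: "\<And>z. eul M z z = 1 \<Longrightarrow> nonneg_on M z \<or> nonpos_on M z"
      using dichotomy_full[OF M] unfolding dichotomy_def by blast
    have r: "eul M (push M \<kappa> x) (push M \<kappa> x) = 1" using push_facts(2)[OF k x(1) dich[OF x(1)] x(2)] .
    moreover have "compat M (\<lambda>v. - \<kappa> v) (push M \<kappa> x)"
      using push_self_compat[OF k x(1) dich[OF x(1)] x(2) dich[OF r]] .
    moreover have "compat M (push M \<kappa> x) (push M \<kappa> y)" if "y \<noteq> x"
      using push_compat[OF M k x y xy w] that by blast
    ultimately show ?thesis by blast
  qed
  obtain l where l: "l \<in> I" "eul L \<delta> (c l) \<noteq> 0" using F(4) by blast
  \<comment> \<open>Compatibility of \<open>w\<close> is stated for vectors, so equal vectors at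
    different indices must be ruled out: both their pairings would be 1.\<close>
  have inj: "c a \<noteq> c b" if "a \<in> I" "b \<in> I" "a \<noteq> b" for a b
  proof
    assume "c a = c b"
    then have "eul L (c a) (c b) * eul L (c b) (c a) = 1" using F(1)[OF that(1)] by simp
    then show False using compatD(1)[OF F(2)[OF that]] by simp
  qed
  have wc: "c l = c a \<or> compat L (c l) (c a)" if "a \<in> I" for a using F(2)[OF l(1) that] by blast
  have dich: "nonneg_on L (c k) \<or> nonpos_on L (c k)"
    using dichotomy_full[OF L] F(1)[OF k] unfolding dichotomy_def by blast
  have res: "eul L (move L k c a) (move L k c a) = 1 \<and> compat L (move L k c k) (move L k c a) \<and>
      (b \<noteq> a \<longrightarrow> compat L (move L k c a) (move L k c b))"
    if ab: "a \<in> I" "b \<in> I" "a \<noteq> k" "b \<noteq> k" for a b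
  proof (cases "nonneg_on L (c k)")
    case True
    then have pk: "pos_root L (c k)" using F(1)[OF k] by (simp add: pos_root_def)
    have "eul L (push L (c k) (c a)) (push L (c k) (c a)) = 1 \<and>
        compat L (\<lambda>v. - c k v) (push L (c k) (c a)) \<and>
        (c b \<noteq> c a \<longrightarrow> compat L (push L (c k) (c a)) (push L (c k) (c b)))"
      by (rule main[OF L pk F(1)[OF ab(1)] F(2)[OF k ab(1)] F(1)[OF ab(2)] F(2)[OF k ab(2)] _ F(1)[OF l(1)] l(2)
            wc[OF k] wc[OF ab(1)] wc[OF ab(2)]]) (use ab F(2)[OF ab(1,2)] in auto)
    then show ?thesis
      unfolding move_self move_pos[of a k L c, OF ab(3) True] move_pos[of b k L c, OF ab(4) True] using inj[OF ab(2,1)] by blast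
  next
    case False
    \<comment> \<open>Reversing the order and negating the family makes \<open>c k\<close> positive,
      preserves compatibility, and leaves the defect of \<open>c l\<close> nonzero.\<close>
    let ?R = "rev L" and ?n = "\<lambda>a v. - c a v"
    have R: "distinct ?R" "set ?R = I" using L by auto
    have cr: "compat ?R (?n a) (?n b) = compat L (c a) (c b)" for a b by (rule compat_rev[OF L(1)])
    have er: "eul ?R (?n a) (?n a) = eul L (c a) (c a)" for a
      unfolding eul_uminus_left eul_uminus_right using eul_rev[OF L(1)] by simp
    have pk: "pos_root ?R (?n k)"
      unfolding pos_root_def er nonneg_on_uminus nonpos_on_rev using False dich F(1)[OF k] by blast
    have dl: "eul ?R \<delta> (?n l) \<noteq> 0"
      unfolding eul_uminus_right eul_rev[OF L(1)] eul_delta_right[OF L] using l(2) by simp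
    have wc': "?n l = ?n a \<or> compat ?R (?n l) (?n a)" if "a \<in> I" for a
      unfolding cr using wc[OF that] by auto
    have E: "eul ?R (?n a) (?n a) = 1" if "a \<in> I" for a unfolding er by (rule F(1)[OF that])
    have CC: "compat ?R (?n a) (?n b)" if "a \<in> I" "b \<in> I" "a \<noteq> b" for a b unfolding cr by (rule F(2)[OF that])
    have "eul ?R (push ?R (?n k) (?n a)) (push ?R (?n k) (?n a)) = 1 \<and>
        compat ?R (\<lambda>v. - ?n k v) (push ?R (?n k) (?n a)) \<and>
        (?n b \<noteq> ?n a \<longrightarrow> compat ?R (push ?R (?n k) (?n a)) (push ?R (?n k) (?n b)))"
      by (rule main[OF R pk E[OF ab(1)] CC[OF k ab(1)] E[OF ab(2)] CC[OF k ab(2)] _ E[OF l(1)] dl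
            wc'[OF k] wc'[OF ab(1)] wc'[OF ab(2)]]) (use ab CC[OF ab(1,2)] in auto)
    then have *: "eul ?R (\<lambda>v. - move L k c a v) (\<lambda>v. - move L k c a v) = 1"
        "compat ?R (\<lambda>v. - (- c k v)) (\<lambda>v. - move L k c a v)"
        "?n b \<noteq> ?n a \<longrightarrow> compat ?R (\<lambda>v. - move L k c a v) (\<lambda>v. - move L k c b v)"
      unfolding move_neg[of a k L c, OF ab(3) False L(1)] move_neg[of b k L c, OF ab(4) False L(1)] by blast+
    have "eul L (move L k c a) (move L k c a) = 1"
      using *(1) unfolding eul_uminus_left eul_uminus_right eul_rev[OF L(1)] by simp
    moreover have "compat L (move L k c k) (move L k c a)"
      unfolding move_self using *(2) compat_rev[OF L(1), of "\<lambda>v. - c k v" "move L k c a"] by simp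
    moreover have "?n b \<noteq> ?n a" if "b \<noteq> a"
      using inj[OF ab(2,1) that] by (metis (no_types) minus_minus ext fun_cong)
    ultimately show ?thesis using *(3) compat_rev[OF L(1)] by blast
  qed
  have kk: "eul L (move L k c k) (move L k c k) = 1" unfolding move_self using F(1)[OF k] by simp
  show "eul L (move L k c i) (move L k c i) = 1" using res[OF ij(1) ij(1)] kk by (cases "i = k") auto
  show "compat L (move L k c i) (move L k c j)" if "i \<noteq> j"
  proof (cases "i = k")
    case True
    then show ?thesis using res[OF ij(2,2)] that by simp
  next
    case False
    show ?thesis
    proof (cases "j = k")
      case True
      then show ?thesis using res[OF ij(1,1)] that by (simp add: compat_commute)
    next
      case j: False
      then show ?thesis using res[OF ij False j] that by blast
    qed
  qed
qed

text \<open>The constant \<epsilon> is the sign of \<open>c k\<close>. Of the two Euler values that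
  make up \<open>B i k\<close>, compatibility annihilates the one not seen by the coefficient,
  except when it is nonpositive and the other one is zero; in both cases the coefficient is a
  positive part.\<close>

lemma coeff_facts:
  assumes L: "distinct L" "set L = I" and f: "family L B c" and k: "k \<in> I"
  obtains \<epsilon> :: int where "\<epsilon> = 1 \<or> \<epsilon> = -1"
    "\<And>i. i \<in> I \<Longrightarrow> i \<noteq> k \<Longrightarrow> coeff L c k i = max 0 (\<epsilon> * B i k)"
    "\<And>i. i \<in> I \<Longrightarrow> i \<noteq> k \<Longrightarrow> 0 < coeff L c k i \<Longrightarrow> sym L (c i) (c k) = - coeff L c k i"
proof -
  note F = familyD[OF f]
  have dich: "nonneg_on L (c i) \<or> nonpos_on L (c i)" if "i \<in> I" for i
    using dichotomy_full[OF L] F(1)[OF that] unfolding dichotomy_def by blast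
  show ?thesis
  proof (cases "nonneg_on L (c k)")
    case True
    show ?thesis
    proof (rule that[of 1])
      fix i assume i: "i \<in> I" "i \<noteq> k"
      note C = compatD[OF F(2)[OF k i(1) i(2)[symmetric]]]
      have "eul L (c i) (c k) = 0 \<or> (eul L (c k) (c i) = 0 \<and> eul L (c i) (c k) \<le> 0)"
        using dich[OF i(1)] C(1) C(3)[OF True] C(7)[OF True] by auto
      moreover have "eul L (c i) (c k) \<noteq> 0 \<Longrightarrow> eul L (c k) (c i) = 0" using C(1) by simp
      ultimately show "coeff L c k i = max 0 (1 * B i k)"
        "0 < coeff L c k i \<Longrightarrow> sym L (c i) (c k) = - coeff L c k i"
        using F(3)[OF i(1) k] i True by (auto simp: coeff_def sym_def max_def split: if_splits)
    qed simp
  next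
    case False
    then have np: "nonpos_on L (c k)" using dich[OF k] by blast
    show ?thesis
    proof (rule that[of "-1"])
      fix i assume i: "i \<in> I" "i \<noteq> k"
      note C = compatD[OF F(2)[OF k i(1) i(2)[symmetric]]]
      have "eul L (c k) (c i) = 0 \<or> (eul L (c i) (c k) = 0 \<and> eul L (c k) (c i) \<le> 0)"
        using dich[OF i(1)] C(1) C(4)[OF np] C(6)[OF np] by auto
      moreover have "eul L (c k) (c i) \<noteq> 0 \<Longrightarrow> eul L (c i) (c k) = 0" using C(1) by simp
      ultimately show "coeff L c k i = max 0 ((-1) * B i k)"
        "0 < coeff L c k i \<Longrightarrow> sym L (c i) (c k) = - coeff L c k i"
        using F(3)[OF i(1) k] i False by (auto simp: coeff_def sym_def max_def split: if_splits)
    qed simp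
  qed
qed

lemma family_move:
  assumes L: "distinct L" "set L = I" and f: "family L B c" and k: "k \<in> I"
  shows "family L (mutate k B) (move L k c)"
proof -
  note F = familyD[OF f]
  obtain \<epsilon> :: int where eps: "\<epsilon> = 1 \<or> \<epsilon> = -1"
    and p: "\<And>i. i \<in> I \<Longrightarrow> i \<noteq> k \<Longrightarrow> coeff L c k i = max 0 (\<epsilon> * B i k)"
    using coeff_facts[OF L f k] by metis
  let ?p = "coeff L c k" and ?c = "move L k c"
  have pk: "?p k = -2" by (simp add: coeff_def)
  have skew: "B i j = - B j i" if "i \<in> I" "j \<in> I" for i j using F(3) that by simp
  have B: "mutate k B i j = eul L (?c i) (?c j) - eul L (?c j) (?c i)" if ij: "i \<in> I" "j \<in> I" for i j
  proof -
    have "eul L (?c i) (?c j) - eul L (?c j) (?c i) = B i j + ?p j * B i k + ?p i * B k j"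
      unfolding move_def eul_add_left eul_add_right F(3)[OF ij] F(3)[OF ij(1) k] F(3)[OF k ij(2)]
      by (simp add: algebra_simps)
    also have "\<dots> = mutate k B i j"
    proof (cases "k \<in> {i, j}")
      case True
      have "B k k = 0" using skew[OF k k] by simp
      then show ?thesis using True pk by (auto simp: mutate_def)
    next
      case False
      then have "?p i = max 0 (\<epsilon> * B i k)" "?p j = max 0 (\<epsilon> * B j k)" using p ij by auto
      moreover have "B k j = - B j k" using skew k ij by blast
      ultimately show ?thesis using False eps
        by (auto simp: mutate_def mutation_term max_def algebra_simps)
    qed
    finally show ?thesis by simp
  qed
  have reg: "\<exists>l\<in>I. eul L \<delta> (?c l) \<noteq> 0"
  proof (rule ccontr)
    assume no: "\<not> ?thesis"
    have 1: "eul L \<delta> (c i) + ?p i * eul L \<delta> (c k) = 0" if "i \<in> I" for i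
      using no that unfolding move_def eul_add_right by blast
    then have "eul L \<delta> (c k) = 0" using 1[OF k] pk by simp
    then have "eul L \<delta> (c i) = 0" if "i \<in> I" for i using 1[OF that] by simp
    then show False using F(4) by blast
  qed
  \<comment> \<open>The change of basis alters only the coefficient at \<open>k\<close>.\<close>
  have expand: "(\<Sum>i\<in>I. x i * ?c i v) = (\<Sum>i\<in>I. (if i = k then x k + (\<Sum>i\<in>I. x i * ?p i) else x i) * c i v)" for x v
  proof -
    have "(\<Sum>i\<in>I. x i * ?c i v) = (\<Sum>i\<in>I. x i * c i v) + (\<Sum>i\<in>I. x i * ?p i) * c k v"
      by (simp add: move_def algebra_simps sum.distrib sum_distrib_left sum_distrib_right)
    also have "\<dots> = (\<Sum>i\<in>I. x i * c i v + (if i = k then (\<Sum>i\<in>I. x i * ?p i) * c k v else 0))"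
      using k fin by (simp add: sum.distrib)
    also have "\<dots> = (\<Sum>i\<in>I. (if i = k then x k + (\<Sum>i\<in>I. x i * ?p i) else x i) * c i v)"
      by (intro sum.cong) (auto simp: algebra_simps)
    finally show ?thesis .
  qed
  have ind: "x i = 0" if z: "\<And>v. v \<in> I \<Longrightarrow> (\<Sum>i\<in>I. x i * ?c i v) = 0" and i: "i \<in> I" for x i
  proof -
    let ?y = "\<lambda>i. if i = k then x k + (\<Sum>i\<in>I. x i * ?p i) else x i"
    have y: "?y i = 0" if "i \<in> I" for i
      using F(5)[of ?y i] z that unfolding expand by blast
    have o: "x i = 0" if "i \<in> I" "i \<noteq> k" for i using y[OF that(1)] that by simp
    have "(\<Sum>i\<in>I. x i * ?p i) = (\<Sum>i\<in>I. if i = k then x k * ?p k else 0)"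
      using o by (intro sum.cong) auto
    then have "(\<Sum>i\<in>I. x i * ?p i) = - 2 * x k" using k fin pk by simp
    then have "x k = 0" using y[OF k] by simp
    then show ?thesis using o i by blast
  qed
  obtain y where y: "\<And>v. v \<in> I \<Longrightarrow> (\<Sum>i\<in>I. y i * c i v) = \<delta> v" using F(6) by blast
  have span: "\<exists>x. \<forall>v\<in>I. (\<Sum>i\<in>I. x i * ?c i v) = \<delta> v"
  proof (intro exI ballI)
    fix v assume v: "v \<in> I"
    define S where "S = (\<Sum>i\<in>I - {k}. y i * ?p i)"
    \<comment> \<open>The solution of the equation for the coefficient at \<open>k\<close>: the term
      at \<open>k\<close> contributes \<open>- 2 * x k\<close>, so \<open>S - x k\<close> has to
      equal \<open>y k\<close>.\<close>
    define x where "x = y(k := S - y k)"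
    have "(\<Sum>i\<in>I. x i * ?p i) = x k * ?p k + (\<Sum>i\<in>I - {k}. x i * ?p i)"
      using k fin by (simp add: sum.remove)
    also have "(\<Sum>i\<in>I - {k}. x i * ?p i) = S"
      unfolding S_def by (intro sum.cong) (auto simp: x_def)
    finally have "x k + (\<Sum>i\<in>I. x i * ?p i) = y k" by (simp add: pk x_def)
    then have "(\<Sum>i\<in>I. x i * ?c i v) = (\<Sum>i\<in>I. y i * c i v)"
      unfolding expand by (intro sum.cong) (auto simp: x_def)
    then show "(\<Sum>i\<in>I. (y(k := (\<Sum>i\<in>I - {k}. y i * ?p i) - y k)) i * ?c i v) = \<delta> v"
      using y[OF v] by (simp add: x_def S_def)
  qed
  show ?thesis
    unfolding family_def
    using move_compat[OF L f k] B reg ind span by (intro conjI ballI allI impI) blast+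
qed

definition companion :: "nat list \<Rightarrow> (nat \<Rightarrow> nat \<Rightarrow> int) \<Rightarrow> (nat \<Rightarrow> nat \<Rightarrow> int) \<Rightarrow> bool" where
  "companion L B A \<longleftrightarrow> (\<exists>c. family L B c \<and> (\<forall>i\<in>I. \<forall>j\<in>I. A i j = sym L (c i) (c j)))"

lemma companion_basic:
  assumes "companion L B A" "i \<in> I" "j \<in> I"
  shows "A i j = A j i" "B i j = - B j i" "i \<noteq> j \<Longrightarrow> \<bar>A i j\<bar> = \<bar>B i j\<bar>" "A i i = 2"
proof -
  obtain c where f: "family L B c" and A: "\<And>i j. i \<in> I \<Longrightarrow> j \<in> I \<Longrightarrow> A i j = sym L (c i) (c j)"
    using assms(1) unfolding companion_def by blast
  note F = familyD[OF f]
  show "A i j = A j i" using assms A by (simp add: sym_def)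
  show "B i j = - B j i" using F(3) assms by simp
  show "A i i = 2" using assms A F(1) by (simp add: sym_def)
  assume "i \<noteq> j"
  then have "eul L (c i) (c j) = 0 \<or> eul L (c j) (c i) = 0"
    using compatD(1)[OF F(2)[OF assms(2,3)]] by simp
  then show "\<bar>A i j\<bar> = \<bar>B i j\<bar>" using F(3) A assms by (auto simp: sym_def)
qed

text \<open>Away from \<open>k\<close> the sign \<epsilon> disappears: if both coefficients are
  nonzero the corrections cancel, and if only one is, the correction is the stated product. So the
  new matrix is determined by \<open>A\<close> and \<open>B\<close> up to one common sign in row and
  column \<open>k\<close>.\<close>

lemma companion_mutate:
  assumes L: "distinct L" "set L = I" and co: "companion L B A" and k: "k \<in> I"
  obtains A' and \<epsilon> :: int where "companion L (mutate k B) A'" "\<epsilon> = 1 \<or> \<epsilon> = -1"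
    "\<And>i j. i \<in> I - {k} \<Longrightarrow> j \<in> I - {k} \<Longrightarrow>
       A' i j = (if B i k * B j k < 0 then A i j - A i k * A k j else A i j)"
    "\<And>i. i \<in> I - {k} \<Longrightarrow> A' i k = \<epsilon> * sgn (B i k) * A i k"
proof -
  obtain c where f: "family L B c" and A: "\<And>i j. i \<in> I \<Longrightarrow> j \<in> I \<Longrightarrow> A i j = sym L (c i) (c j)"
    using co unfolding companion_def by blast
  let ?p = "coeff L c k"
  obtain \<epsilon> :: int where eps: "\<epsilon> = 1 \<or> \<epsilon> = -1"
    and p: "\<And>i. i \<in> I \<Longrightarrow> i \<noteq> k \<Longrightarrow> ?p i = max 0 (\<epsilon> * B i k)"
    and q: "\<And>i. i \<in> I \<Longrightarrow> i \<noteq> k \<Longrightarrow> 0 < ?p i \<Longrightarrow> sym L (c i) (c k) = - ?p i"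
    using coeff_facts[OF L f k] by metis
  note F = familyD[OF f] and Co = companion_basic[OF co]
  have ex: "sym L (move L k c i) (move L k c j) = A i j + ?p j * A i k + ?p i * A k j + 2 * (?p i * ?p j)"
    if "i \<in> I" "j \<in> I" for i j
    unfolding A[OF that] A[OF that(1) k] A[OF k that(2)] sym_def move_def eul_add_left eul_add_right F(1)[OF k]
    by (simp add: algebra_simps)
  have z: "A i k = 0" if "i \<in> I" "i \<noteq> k" "B i k = 0" for i using Co(3)[OF that(1) k that(2)] that by simp
  have pq: "?p i = 0 \<or> A i k = - ?p i" if "i \<in> I" "i \<noteq> k" for i
  proof (cases "0 < ?p i")
    case True
    then show ?thesis using q[OF that] A[OF that(1) k] by simp
  next
    case False
    then show ?thesis using p[OF that] by simp
  qed
  have pz: "?p i = 0 \<longleftrightarrow> \<epsilon> * B i k \<le> 0" if "i \<in> I - {k}" for i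
    using p[of i] that by (simp add: max_def)
  show ?thesis
  proof (rule that[of "\<lambda>i j. sym L (move L k c i) (move L k c j)" \<epsilon>])
    show "companion L (mutate k B) (\<lambda>i j. sym L (move L k c i) (move L k c j))"
      unfolding companion_def using family_move[OF L f k] by blast
    show "\<epsilon> = 1 \<or> \<epsilon> = -1" by (rule eps)
    fix i assume i: "i \<in> I - {k}"
    show "sym L (move L k c i) (move L k c k) = \<epsilon> * sgn (B i k) * A i k"
    proof -
      have e: "sym L (move L k c i) (move L k c k) = - (A i k + 2 * ?p i)"
        using ex[of i k] i k Co(4)[OF k k] by (simp add: coeff_def algebra_simps)
      show ?thesis
      proof (cases "?p i = 0")
        case True
        then have "\<epsilon> * B i k \<le> 0" using pz[OF i] by linarith
        then show ?thesis using e True eps z i by (auto simp: sgn_if)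
      next
        case False
        then have "0 < \<epsilon> * B i k" using pz[OF i] by linarith
        moreover have "A i k = - ?p i" using pq[of i] i False by auto
        ultimately show ?thesis using e eps by (auto simp: sgn_if)
      qed
    qed
    fix j assume j: "j \<in> I - {k}"
    have e: "sym L (move L k c i) (move L k c j) = A i j + ?p j * A i k + ?p i * A j k + 2 * (?p i * ?p j)"
      using ex[of i j] i j Co(1)[OF k, of j] by simp
    have kj: "A k j = A j k" using Co(1)[OF k, of j] j by simp
    show "sym L (move L k c i) (move L k c j) = (if B i k * B j k < 0 then A i j - A i k * A k j else A i j)"
    proof (cases "?p i = 0"; cases "?p j = 0")
      assume "?p i = 0" "?p j = 0"
      then have "\<epsilon> * B i k \<le> 0" "\<epsilon> * B j k \<le> 0" using pz[OF i] pz[OF j] by linarith+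
      then have "0 \<le> B i k * B j k" using eps by (auto simp: zero_le_mult_iff)
      then show ?thesis using e \<open>?p i = 0\<close> \<open>?p j = 0\<close> by simp
    next
      assume *: "?p i = 0" "?p j \<noteq> 0"
      then have s: "\<epsilon> * B i k \<le> 0" "0 < \<epsilon> * B j k" using pz[OF i] pz[OF j] by linarith+
      have aj: "A j k = - ?p j" using pq[of j] j * by auto
      show ?thesis
      proof (cases "B i k = 0")
        case True
        then show ?thesis using e * z[of i] i by simp
      next
        case False
        then have "B i k * B j k < 0" using s eps by (auto simp: mult_less_0_iff)
        then show ?thesis using e * aj kj by (simp add: algebra_simps)
      qed
    next
      assume *: "?p i \<noteq> 0" "?p j = 0"
      then have s: "\<epsilon> * B j k \<le> 0" "0 < \<epsilon> * B i k" using pz[OF i] pz[OF j] by linarith+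
      have ai: "A i k = - ?p i" using pq[of i] i * by auto
      show ?thesis
      proof (cases "B j k = 0")
        case True
        then show ?thesis using e * z[of j] j by simp
      next
        case False
        then have "B i k * B j k < 0" using s eps by (auto simp: mult_less_0_iff)
        then show ?thesis using e * ai kj by (simp add: algebra_simps)
      qed
    next
      assume *: "?p i \<noteq> 0" "?p j \<noteq> 0"
      then have "0 < \<epsilon> * B i k" "0 < \<epsilon> * B j k" using pz[OF i] pz[OF j] by linarith+
      then have "0 < B i k * B j k" using eps by (auto simp: zero_less_mult_iff)
      moreover have "A i k = - ?p i" "A j k = - ?p j" using pq[of i] pq[of j] i j * by auto
      ultimately show ?thesis using e by simp
    qed
  qed
qed

end

section \<open>Companion matrices\<close>

context affine_graph begin

lemma companion_cong:
  assumes "companion L B A" "\<And>i j. i \<in> I \<Longrightarrow> j \<in> I \<Longrightarrow> B' i j = B i j"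
  shows "companion L B' A"
  using assms unfolding companion_def family_def by simp

text \<open>After mutation at the middle vertex, \<open>A i l - A i j * A j l\<close> and
  \<open>B i l + B i j * B j l\<close> have equal absolute values, and so have the corresponding
  summands. Hence the summands reinforce each other on both sides or on neither.\<close>

lemma companion_triangle:
  assumes L: "distinct L" "set L = I" and co: "companion L B A"
    and ijl: "i \<in> I" "j \<in> I" "l \<in> I" "i \<noteq> l" "0 < B i j" "0 < B j l"
  shows "0 < B i l \<Longrightarrow> A i j * A j l * A i l < 0" "B i l < 0 \<Longrightarrow> 0 < A i j * A j l * A i l"
proof -
  note Co = companion_basic[OF co]
  have ne: "i \<noteq> j" "j \<noteq> l" using ijl Co(2)[OF ijl(2,2)] by auto
  obtain A' where A': "companion L (mutate j B) A'"
    and f: "\<And>i l. i \<in> I - {j} \<Longrightarrow> l \<in> I - {j} \<Longrightarrow>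
       A' i l = (if B i j * B l j < 0 then A i l - A i j * A j l else A i l)"
    by (rule companion_mutate[OF L co ijl(2)]) blast
  have "B l j = - B j l" using Co(2) ijl by blast
  then have "A' i l = A i l - A i j * A j l"
    using f[of i l] ne ijl by (simp add: mult_less_0_iff)
  moreover have "mutate j B i l = B i l + B i j * B j l"
    using ne ijl unfolding mutate_def mutation_term by simp
  ultimately have e: "\<bar>A i l - A i j * A j l\<bar> = \<bar>B i l + B i j * B j l\<bar>"
    using companion_basic(3)[OF A' ijl(1,3)] ijl by simp
  have a: "\<bar>A i l\<bar> = \<bar>B i l\<bar>" "\<bar>A i j * A j l\<bar> = B i j * B j l"
    using Co(3)[OF ijl(1,3)] Co(3)[OF ijl(1,2)] Co(3)[OF ijl(2,3)] ijl ne by (simp_all add: abs_mult)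
  have pos: "0 < B i j * B j l" using ijl by simp
  show "A i j * A j l * A i l < 0" if "0 < B i l"
  proof -
    have "(0 < A i j * A j l \<and> A i l < 0) \<or> (A i j * A j l < 0 \<and> 0 < A i l)"
      using e a pos that by arith
    then show ?thesis by (auto intro: mult_pos_neg mult_neg_pos)
  qed
  show "0 < A i j * A j l * A i l" if "B i l < 0"
  proof -
    have "(0 < A i j * A j l \<and> 0 < A i l) \<or> (A i j * A j l < 0 \<and> A i l < 0)"
      using e a pos that by arith
    then show ?thesis by (auto intro: mult_neg_neg)
  qed
qed

text \<open>Mutation at \<open>i\<close> shortens the oriented square to an oriented triangle on
  \<open>l\<close>, \<open>j\<close>, \<open>k\<close>, whose product is positive. The sign is
  reversed by the new entry \<open>A' l j = - (A l i * A i j)\<close>.\<close>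

lemma companion_four_cycle:
  assumes L: "distinct L" "set L = I" and co: "companion L B A"
    and I: "i \<in> I" "j \<in> I" "k \<in> I" "l \<in> I" and ne: "i \<noteq> k" "j \<noteq> l"
    and pos: "0 < B i j" "0 < B j k" "0 < B k l" "0 < B l i" and zero: "B i k = 0" "B j l = 0"
  shows "A i j * A j k * A k l * A l i < 0"
proof -
  note Co = companion_basic[OF co]
  have skew: "B x y = - B y x" if "x \<in> I" "y \<in> I" for x y using Co(2) that by blast
  have z: "B x x = 0" if "x \<in> I" for x using skew[OF that that] by simp
  have ne': "i \<noteq> j" "j \<noteq> k" "k \<noteq> l" "l \<noteq> i" using pos z I by auto
  obtain A' where A': "companion L (mutate i B) A'"
    and f: "\<And>x y. x \<in> I - {i} \<Longrightarrow> y \<in> I - {i} \<Longrightarrow>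
       A' x y = (if B x i * B y i < 0 then A x y - A x i * A i y else A x y)"
    by (rule companion_mutate[OF L co I(1)]) blast
  have ki: "B k i = 0" using skew[OF I(3,1)] zero by simp
  have ji: "B j i = - B i j" "B l j = 0" "A l j = 0"
    using skew[OF I(2,1)] skew[OF I(4,2)] zero Co(3)[OF I(4,2)] ne by simp_all
  have "mutate i B l j = B l i * B i j" "mutate i B j k = B j k" "mutate i B l k = - B k l"
    using ne ne' pos zero ki ji skew[OF I(4,3)] unfolding mutate_def mutation_term by auto
  then have "0 < mutate i B l j" "0 < mutate i B j k" "mutate i B l k < 0" using pos by simp_all
  then have "0 < A' l j * A' j k * A' l k"
    using companion_triangle(2)[OF L A' I(4,2,3)] ne' by blast
  moreover have "B l i * B j i < 0" using pos ji by (simp add: mult_less_0_iff)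
  then have "A' l j = - (A l i * A i j)" using f[of l j] I ne' ji by simp
  moreover have "A' j k = A j k" "A' l k = A l k" using f[of j k] f[of l k] I ne ne' ki by auto
  ultimately have "0 < - (A l i * A i j) * A j k * A k l" using Co(1)[OF I(4,3)] by simp
  moreover have "- (A l i * A i j) * A j k * A k l = - (A i j * A j k * A k l * A l i)" by (simp add: algebra_simps)
  ultimately show ?thesis by linarith
qed

lemma companion_permute:
  assumes co: "companion L B A" and g: "bij_betw g I I"
    and inv: "\<And>i j. i \<in> I \<Longrightarrow> j \<in> I \<Longrightarrow> B (g i) (g j) = B i j"
  shows "companion L B (\<lambda>i j. A (g i) (g j))"
proof -
  obtain c where f: "family L B c" and A: "\<And>i j. i \<in> I \<Longrightarrow> j \<in> I \<Longrightarrow> A i j = sym L (c i) (c j)"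
    using co unfolding companion_def by blast
  note F = familyD[OF f]
  have gI: "g i \<in> I" if "i \<in> I" for i using g that by (auto simp: bij_betw_def)
  have ginj: "g i \<noteq> g j" if "i \<in> I" "j \<in> I" "i \<noteq> j" for i j
    using g that by (auto simp: bij_betw_def inj_on_def)
  define h where "h = inv_into I g"
  have h: "h (g i) = i" if "i \<in> I" for i using g that by (simp add: h_def bij_betw_def)
  have hI: "h i \<in> I" "g (h i) = i" if "i \<in> I" for i
    using g that unfolding h_def by (auto simp: bij_betw_def intro: inv_into_into f_inv_into_f)
  have re: "(\<Sum>i\<in>I. x i * c (g i) v) = (\<Sum>i\<in>I. x (h i) * c i v)" for x v
  proof -
    have "(\<Sum>i\<in>I. x (h i) * c i v) = (\<Sum>i\<in>I. x (h (g i)) * c (g i) v)"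
      using sum.reindex_bij_betw[OF g, of "\<lambda>i. x (h i) * c i v"] by simp
    then show ?thesis by (simp add: h)
  qed
  have "family L B (\<lambda>i. c (g i))"
    unfolding family_def
  proof (intro conjI ballI allI impI)
    show "\<exists>l\<in>I. eul L \<delta> (c (g l)) \<noteq> 0" using F(4) hI by metis
    show "B i j = eul L (c (g i)) (c (g j)) - eul L (c (g j)) (c (g i))" if "i \<in> I" "j \<in> I" for i j
      using F(3)[OF gI gI] inv that by simp
    fix x i assume z: "\<forall>v\<in>I. (\<Sum>i\<in>I. x i * c (g i) v) = 0" and i: "i \<in> I"
    have "x (h (g i)) = 0"
      using F(5)[of "\<lambda>i. x (h i)" "g i"] z gI[OF i] unfolding re by blast
    then show "x i = 0" using h i by simp
  next
    obtain x where "\<forall>v\<in>I. (\<Sum>i\<in>I. x i * c i v) = \<delta> v" using F(6) by blast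
    moreover have "(\<Sum>i\<in>I. x (g i) * c (g i) v) = (\<Sum>i\<in>I. x i * c i v)" for v
      unfolding re by (intro sum.cong) (simp_all add: hI)
    ultimately have "\<forall>v\<in>I. (\<Sum>i\<in>I. x (g i) * c (g i) v) = \<delta> v" by simp
    then show "\<exists>x. \<forall>v\<in>I. (\<Sum>i\<in>I. x i * c (g i) v) = \<delta> v"
      by (intro exI[of _ "\<lambda>i. x (g i)"])
  next
    show "eul L (c (g i)) (c (g i)) = 1" if "i \<in> I" for i using F(1)[OF gI[OF that]] .
    show "compat L (c (g i)) (c (g j))" if "i \<in> I" "j \<in> I" "i \<noteq> j" for i j
      using F(2)[OF gI[OF that(1)] gI[OF that(2)] ginj[OF that]] .
  qed
  moreover have "\<forall>i\<in>I. \<forall>j\<in>I. A (g i) (g j) = sym L (c (g i)) (c (g j))" using A gI by blast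
  ultimately show ?thesis unfolding companion_def by blast
qed

text \<open>The null vector consists of the coordinates of \<delta> in the family; independence of
  the family transfers the one-dimensional radical to them.\<close>

lemma companion_rank:
  assumes L: "distinct L" "set L = I" and co: "companion L B A"
  obtains \<xi> where "\<exists>i\<in>I. \<xi> i \<noteq> 0" "\<And>i. i \<in> I \<Longrightarrow> (\<Sum>j\<in>I. A i j * \<xi> j) = 0"
    "\<And>x. 0 \<le> (\<Sum>i\<in>I. \<Sum>j\<in>I. x i * x j * A i j)"
    "\<And>x i j. (\<Sum>i\<in>I. \<Sum>j\<in>I. x i * x j * A i j) = 0 \<Longrightarrow> i \<in> I \<Longrightarrow> j \<in> I \<Longrightarrow> x i * \<xi> j = x j * \<xi> i"
proof -
  obtain c where f: "family L B c" and A: "\<And>i j. i \<in> I \<Longrightarrow> j \<in> I \<Longrightarrow> A i j = sym L (c i) (c j)"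
    using co unfolding companion_def by blast
  note F = familyD[OF f]
  define S where "S x v = (\<Sum>i\<in>I. x i * c i v)" for x v
  have SL: "eul L (S x) y = (\<Sum>i\<in>I. x i * eul L (c i) y)" for x y
    unfolding S_def[abs_def] eul_sum_left eul_scale_left ..
  have SR: "eul L y (S x) = (\<Sum>i\<in>I. x i * eul L y (c i))" for x y
    unfolding S_def[abs_def] eul_sum_right eul_scale_right ..
  have q: "(\<Sum>i\<in>I. \<Sum>j\<in>I. x i * x j * A i j) = qf I (S x)" for x
  proof -
    have "(\<Sum>i\<in>I. \<Sum>j\<in>I. x i * x j * A i j)
        = (\<Sum>i\<in>I. \<Sum>j\<in>I. x i * (x j * eul L (c i) (c j))) + (\<Sum>i\<in>I. \<Sum>j\<in>I. x j * (x i * eul L (c j) (c i)))"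
      by (simp add: A sym_def algebra_simps sum.distrib)
    also have "(\<Sum>i\<in>I. \<Sum>j\<in>I. x j * (x i * eul L (c j) (c i))) = (\<Sum>j\<in>I. \<Sum>i\<in>I. x j * (x i * eul L (c j) (c i)))"
      by (rule sum.swap)
    also have "(\<Sum>i\<in>I. \<Sum>j\<in>I. x i * (x j * eul L (c i) (c j))) = eul L (S x) (S x)"
    proof -
      have "eul L (S x) (S x) = (\<Sum>i\<in>I. x i * eul L (c i) (S x))" by (rule SL)
      then show ?thesis by (simp add: SR sum_distrib_left)
    qed
    finally show ?thesis using eul_qf[OF L(1), of "S x"] L(2) by simp
  qed
  obtain \<xi> where xi: "\<And>v. v \<in> I \<Longrightarrow> S \<xi> v = \<delta> v" using F(6) unfolding S_def by blast
  obtain v0 where v0: "v0 \<in> I" using nonempty by blast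
  show ?thesis
  proof (rule that[of \<xi>])
    show "\<exists>i\<in>I. \<xi> i \<noteq> 0"
    proof (rule ccontr)
      assume "\<not> ?thesis"
      then have "S \<xi> v0 = 0" by (simp add: S_def)
      then show False using xi[OF v0] delta_pos[OF v0] by simp
    qed
    show "(\<Sum>j\<in>I. A i j * \<xi> j) = 0" if "i \<in> I" for i
    proof -
      have "(\<Sum>j\<in>I. A i j * \<xi> j) = eul L (c i) (S \<xi>) + eul L (S \<xi>) (c i)"
        using that by (simp add: A sym_def SL SR algebra_simps sum.distrib)
      also have "\<dots> = eul L (c i) \<delta> + eul L \<delta> (c i)"
        using L(2) xi eul_cong[of L "c i" "c i" "S \<xi>" \<delta>] eul_cong[of L "S \<xi>" \<delta> "c i" "c i"] by simp
      finally show ?thesis using eul_delta_right[OF L] by simp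
    qed
    show "0 \<le> (\<Sum>i\<in>I. \<Sum>j\<in>I. x i * x j * A i j)" for x unfolding q by (rule qf_nonneg)
    fix x i j assume z: "(\<Sum>i\<in>I. \<Sum>j\<in>I. x i * x j * A i j) = 0" and ij: "i \<in> I" "j \<in> I"
    have pr: "S x v * \<delta> v0 = S x v0 * \<delta> v" if "v \<in> I" for v
      using qf_zero_proportional[OF z[unfolded q] that v0] .
    have "x i * \<delta> v0 - S x v0 * \<xi> i = 0" if "i \<in> I" for i
    proof (rule F(5)[of "\<lambda>i. x i * \<delta> v0 - S x v0 * \<xi> i", OF _ that])
      fix v assume v: "v \<in> I"
      have "(\<Sum>i\<in>I. (x i * d - a * \<xi> i) * c i v) = S x v * d - a * S \<xi> v" for a d
        by (simp add: S_def algebra_simps sum_subtractf sum_distrib_left)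
      then show "(\<Sum>i\<in>I. (x i * \<delta> v0 - S x v0 * \<xi> i) * c i v) = 0" using pr[OF v] xi[OF v] by simp
    qed
    then have e: "x i * \<delta> v0 = S x v0 * \<xi> i" "x j * \<delta> v0 = S x v0 * \<xi> j" using ij by simp_all
    have "\<delta> v0 * (x i * \<xi> j) = (x i * \<delta> v0) * \<xi> j" by simp
    also have "\<dots> = (x j * \<delta> v0) * \<xi> i" unfolding e by simp
    finally have "\<delta> v0 * (x i * \<xi> j) = \<delta> v0 * (x j * \<xi> i)" by simp
    then show "x i * \<xi> j = x j * \<xi> i" using delta_pos[OF v0] by simp
  qed
qed

section \<open>Companions up to signs, and automorphisms\<close>

definition rigid :: "nat list \<Rightarrow> (nat \<Rightarrow> nat \<Rightarrow> int) \<Rightarrow> bool" where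
  "rigid L B \<longleftrightarrow> (\<forall>A A'. companion L B A \<longrightarrow> companion L B A' \<longrightarrow>
     (\<exists>D. (\<forall>i\<in>I. D i = 1 \<or> D i = -1) \<and> (\<forall>i\<in>I. \<forall>j\<in>I. A' i j = D i * D j * A i j)))"

definition connected_matrix :: "(nat \<Rightarrow> nat \<Rightarrow> int) \<Rightarrow> bool" where
  "connected_matrix B \<longleftrightarrow> (\<forall>S. S \<subseteq> I \<longrightarrow> S \<noteq> {} \<longrightarrow> (\<forall>i\<in>S. \<forall>j\<in>I - S. B i j = 0) \<longrightarrow> S = I)"

definition skew :: "(nat \<Rightarrow> nat \<Rightarrow> int) \<Rightarrow> bool" where
  "skew B \<longleftrightarrow> (\<forall>i\<in>I. \<forall>j\<in>I. B i j = - B j i)"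

text \<open>Two companions of the mutated matrix are mutated back and compared there. Away from
  \<open>k\<close> the formulas are compatible with conjugation by signs; the unknown signs in row
  and column \<open>k\<close> are absorbed by changing the sign of the vertex \<open>k\<close>
  alone.\<close>

lemma rigid_mutate:
  assumes L: "distinct L" "set L = I" and B: "skew B" "rigid L B" and k: "k \<in> I"
  shows "rigid L (mutate k B)"
  unfolding rigid_def
proof (intro allI impI)
  let ?B = "mutate k B"
  fix A1 A2 assume c1: "companion L ?B A1" and c2: "companion L ?B A2"
  note C1 = companion_basic[OF c1] and C2 = companion_basic[OF c2]
  obtain A1' and e1 :: int where A1': "companion L (mutate k ?B) A1'" and e1: "e1 = 1 \<or> e1 = -1"
    and f1: "\<And>i j. i \<in> I - {k} \<Longrightarrow> j \<in> I - {k} \<Longrightarrow>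
       A1' i j = (if ?B i k * ?B j k < 0 then A1 i j - A1 i k * A1 k j else A1 i j)"
    and g1: "\<And>i. i \<in> I - {k} \<Longrightarrow> A1' i k = e1 * sgn (?B i k) * A1 i k"
    by (rule companion_mutate[OF L c1 k]) blast
  obtain A2' and e2 :: int where A2': "companion L (mutate k ?B) A2'" and e2: "e2 = 1 \<or> e2 = -1"
    and f2: "\<And>i j. i \<in> I - {k} \<Longrightarrow> j \<in> I - {k} \<Longrightarrow>
       A2' i j = (if ?B i k * ?B j k < 0 then A2 i j - A2 i k * A2 k j else A2 i j)"
    and g2: "\<And>i. i \<in> I - {k} \<Longrightarrow> A2' i k = e2 * sgn (?B i k) * A2 i k"
    by (rule companion_mutate[OF L c2 k]) blast
  have "companion L B A1'" "companion L B A2'"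
    by (rule companion_cong[OF A1'], simp only: mutate_mutate)
       (rule companion_cong[OF A2'], simp only: mutate_mutate)
  then have "\<exists>D. (\<forall>i\<in>I. D i = 1 \<or> D i = -1) \<and> (\<forall>i\<in>I. \<forall>j\<in>I. A2' i j = D i * D j * A1' i j)"
    using B(2) unfolding rigid_def by blast
  then obtain D where D: "\<And>i. i \<in> I \<Longrightarrow> D i = 1 \<or> D i = -1"
    "\<And>i j. i \<in> I \<Longrightarrow> j \<in> I \<Longrightarrow> A2' i j = D i * D j * A1' i j"
    by blast
  define D' where "D' i = (if i = k then e1 * e2 * D k else D i)" for i
  have ee: "(e1 * e2) * (e1 * e2) = 1" "e1 * e1 = 1" "e2 * e2 = 1" using e1 e2 by auto
  have DD: "D k * D k = 1" using D(1)[OF k] by auto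
  have ik: "A2 i k = D' i * D' k * A1 i k" if "i \<in> I - {k}" for i
  proof (cases "?B i k = 0")
    case True
    then show ?thesis using C1(3)[of i k] C2(3)[of i k] that k by simp
  next
    case False
    have "e2 * sgn (?B i k) * A2 i k = D i * D k * (e1 * sgn (?B i k) * A1 i k)"
      using D(2)[of i k] that k g1[OF that] g2[OF that] by simp
    then have "sgn (?B i k) * (e2 * A2 i k) = sgn (?B i k) * (D i * D k * e1 * A1 i k)"
      by (simp add: algebra_simps)
    then have "e2 * A2 i k = D i * D k * e1 * A1 i k" using False by (simp add: sgn_0_0)
    then have "(e2 * e2) * A2 i k = D i * (e1 * e2 * D k) * A1 i k" by (simp add: algebra_simps)
    then show ?thesis using that ee by (simp add: D'_def)
  qed
  have ki: "A2 k i = D' k * D' i * A1 k i" if "i \<in> I - {k}" for i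
    using ik[OF that] C1(1)[of i k] C2(1)[of i k] that k by (simp add: algebra_simps)
  have "A2 i j = D' i * D' j * A1 i j" if ij: "i \<in> I" "j \<in> I" for i j
  proof -
    consider "i = k" "j = k" | "i = k" "j \<noteq> k" | "i \<noteq> k" "j = k" | "i \<noteq> k" "j \<noteq> k" by blast
    then show ?thesis
    proof cases
      case 1
      have "D' k * D' k = ((e1 * e2) * (e1 * e2)) * (D k * D k)" by (simp add: D'_def algebra_simps)
      then have "D' k * D' k = 1" unfolding ee DD by simp
      then show ?thesis using C1(4)[OF k k] C2(4)[OF k k] 1 by simp
    next
      case 4
      then have m: "i \<in> I - {k}" "j \<in> I - {k}" using ij by auto
      have e: "A2' i j = D i * D j * A1' i j" using D(2) ij by blast
      show ?thesis
      proof (cases "?B i k * ?B j k < 0")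
        case True
        then have "A2 i j = D i * D j * (A1 i j - A1 i k * A1 k j) + A2 i k * A2 k j"
          using e f1[OF m] f2[OF m] by simp
        also have "A2 i k * A2 k j = D i * D j * (((e1 * e2) * (e1 * e2)) * (D k * D k)) * (A1 i k * A1 k j)"
          unfolding ik[OF m(1)] ki[OF m(2)] using 4 by (simp add: D'_def algebra_simps)
        finally show ?thesis unfolding ee DD using 4 by (simp add: D'_def algebra_simps)
      next
        case False
        then show ?thesis using e f1[OF m] f2[OF m] 4 by (simp add: D'_def)
      qed
    next
      case 2
      then show ?thesis using ki[of j] ij by simp
    next
      case 3
      then show ?thesis using ik[of i] ij by simp
    qed
  qed
  moreover have "D' i = 1 \<or> D' i = -1" if "i \<in> I" for i
    using D(1)[OF that] D(1)[OF k] e1 e2 unfolding D'_def by (elim disjE) simp_all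
  ultimately show "\<exists>D. (\<forall>i\<in>I. D i = 1 \<or> D i = -1) \<and> (\<forall>i\<in>I. \<forall>j\<in>I. A2 i j = D i * D j * A1 i j)" by blast
qed

lemma separated_mutate:
  assumes "k \<in> I" and z: "\<And>i j. i \<in> S \<Longrightarrow> j \<in> I - S \<Longrightarrow> B i j = 0" and ij: "i \<in> S" "j \<in> I - S"
  shows "mutate k B i j = 0"
proof -
  have 1: "B i j = 0" using z[OF ij] .
  show ?thesis
  proof (cases "k \<in> S")
    case True
    then show ?thesis using 1 z[OF _ ij(2)] by (simp add: mutate_def)
  next
    case False
    then show ?thesis using 1 z[OF ij(1), of k] assms(1) by (simp add: mutate_def)
  qed
qed

text \<open>A separation persists under mutation, and mutating again at \<open>k\<close> would carry
  it back to \<open>B\<close>.\<close>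

lemma connected_mutate:
  assumes "connected_matrix B" "k \<in> I"
  shows "connected_matrix (mutate k B)"
  unfolding connected_matrix_def
proof (intro allI impI)
  fix S assume S: "S \<subseteq> I" "S \<noteq> {}" "\<forall>i\<in>S. \<forall>j\<in>I - S. mutate k B i j = 0"
  have "B i j = 0" if "i \<in> S" "j \<in> I - S" for i j
    using separated_mutate[of k S "mutate k B" i j, OF assms(2) _ that] S(3) unfolding mutate_mutate by blast
  then show "S = I" using assms(1) S(1,2) unfolding connected_matrix_def by blast
qed

lemma automorphism_sign:
  assumes "rigid L B" "companion L B A" "bij_betw g I I"
    "\<And>i j. i \<in> I \<Longrightarrow> j \<in> I \<Longrightarrow> B (g i) (g j) = B i j"
  obtains D where "\<And>i. i \<in> I \<Longrightarrow> D i = 1 \<or> D i = (-1::int)"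
    "\<And>i j. i \<in> I \<Longrightarrow> j \<in> I \<Longrightarrow> A (g i) (g j) = D i * D j * A i j"
proof -
  have "\<exists>D. (\<forall>i\<in>I. D i = 1 \<or> D i = -1) \<and> (\<forall>i\<in>I. \<forall>j\<in>I. A (g i) (g j) = D i * D j * A i j)"
    using companion_permute[OF assms(2-4)] assms(1,2) unfolding rigid_def by blast
  then show ?thesis using that by blast
qed

lemma involution_no_square:
  assumes L: "distinct L" "set L = I" and co: "companion L B A" and r: "rigid L B"
    and cn: "connected_matrix B"
    and g: "\<And>i. i \<in> I \<Longrightarrow> g i \<in> I" "\<And>i. i \<in> I \<Longrightarrow> g (g i) = i" and f: "f \<in> I" "g f = f"
    and inv: "\<And>i j. i \<in> I \<Longrightarrow> j \<in> I \<Longrightarrow> B (g i) (g j) = B i j"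
    and ij: "i \<in> I" "j \<in> I"
  shows "B i (g i) = 0" "0 \<le> B i j * B (g i) j"
proof -
  note Co = companion_basic[OF co]
  have bij: "bij_betw g I I" using g by (intro bij_betw_byWitness[where f' = g]) auto
  have zero: "B i (g i) = 0" if "i \<in> I" for i
  proof -
    have "B (g i) i = B i (g i)" using inv[OF that g(1)[OF that]] g(2)[OF that] by simp
    then show ?thesis using Co(2)[OF that g(1)[OF that]] by linarith
  qed
  show "B i (g i) = 0" using zero ij by blast
  obtain D where D: "\<And>i. i \<in> I \<Longrightarrow> D i = 1 \<or> D i = (-1::int)"
    "\<And>i j. i \<in> I \<Longrightarrow> j \<in> I \<Longrightarrow> A (g i) (g j) = D i * D j * A i j"
    using automorphism_sign[OF r co bij inv] by blast
  \<comment> \<open>Applying \<open>g\<close> twice multiplies \<open>A x y\<close> by the signs at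
    \<open>x\<close>, \<open>g x\<close>, \<open>y\<close> and \<open>g y\<close>. Between
    \<open>S\<close> and its complement this factor is -1, so the entry vanishes; since
    \<open>S\<close> contains the fixed vertex, connectedness leaves nothing outside.\<close>
  define S where "S = {i\<in>I. D i = D (g i)}"
  have "S = I"
  proof -
    have "B x y = 0" if xy: "x \<in> S" "y \<in> I - S" for x y
    proof -
      have I: "x \<in> I" "y \<in> I" "g x \<in> I" "g y \<in> I" using xy g by (auto simp: S_def)
      have "A x y = D (g x) * D (g y) * (D x * D y * A x y)"
        using D(2)[OF I(3,4)] D(2)[OF I(1,2)] g I by simp
      moreover have "D (g x) * D (g y) * (D x * D y) = -1"
        using xy D(1)[OF I(1)] D(1)[OF I(2)] D(1)[OF I(3)] D(1)[OF I(4)] by (auto simp: S_def)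
      ultimately have "A x y = - A x y" by (metis mult.assoc mult_minus1)
      then have "A x y = 0" by simp
      then show ?thesis using Co(3)[OF I(1,2)] xy by (cases "x = y") auto
    qed
    moreover have "S \<subseteq> I" "f \<in> S" using f by (auto simp: S_def)
    ultimately show ?thesis using cn unfolding connected_matrix_def by blast
  qed
  have Dg: "D (g x) = D x" if "x \<in> I" for x
  proof -
    have "x \<in> S" using that \<open>S = I\<close> by blast
    then show ?thesis by (simp add: S_def)
  qed
  have no: False if ij: "i \<in> I" "j \<in> I" "0 < B i j" "B (g i) j < 0" for i j
  proof -
    have I: "g i \<in> I" "g j \<in> I" using g ij by auto
    have jg: "0 < B j (g i)" using ij Co(2)[OF I(1) ij(2)] by simp
    have p: "0 < B (g i) (g j)" "0 < B (g j) i"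
      using inv[OF ij(1,2)] inv[OF ij(2) I(1)] g(2)[OF ij(1)] ij jg by simp_all
    have ne: "i \<noteq> g i" "j \<noteq> g j"
    proof -
      show "i \<noteq> g i" using ij by auto
      show "j \<noteq> g j"
      proof
        assume "j = g j"
        then have "B (g i) j = B i j" using inv[OF ij(1,2)] by simp
        then show False using ij by simp
      qed
    qed
    have "A i j * A j (g i) * A (g i) (g j) * A (g j) i < 0"
      using companion_four_cycle[OF L co ij(1,2) I ne ij(3) jg p zero[OF ij(1)] zero[OF ij(2)]] .
    moreover have "A (g i) (g j) = D i * D j * A i j" using D(2) ij by blast
    moreover have "A (g j) i = D j * D i * A j (g i)"
      using D(2)[OF ij(2) I(1)] g(2)[OF ij(1)] Dg[OF ij(1)] by simp
    ultimately have "(D i * D i) * (D j * D j) * (A i j * A i j) * (A j (g i) * A j (g i)) < 0"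
      by (simp add: algebra_simps)
    moreover have "0 \<le> (D i * D i) * (D j * D j) * (A i j * A i j) * (A j (g i) * A j (g i))"
      by (rule mult_nonneg_nonneg, rule mult_nonneg_nonneg, rule mult_nonneg_nonneg) simp_all
    ultimately show False by simp
  qed
  have gi: "g i \<in> I" using g ij by blast
  show "0 \<le> B i j * B (g i) j"
  proof (rule ccontr)
    assume "\<not> ?thesis"
    then have "(0 < B i j \<and> B (g i) j < 0) \<or> (B i j < 0 \<and> 0 < B (g i) j)"
      by (simp add: not_le mult_less_0_iff)
    then show False using no[OF ij] no[OF gi ij(2)] unfolding g(2)[OF ij(1)] by blast
  qed
qed

text \<open>The edges at \<open>f\<close> both leave it or both enter it, so the triangle is never
  oriented, whatever the direction between \<open>x\<close> and \<open>y\<close>. The four cases put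
  its vertices in transitive order.\<close>

lemma companion_triangle_apex:
  assumes L: "distinct L" "set L = I" and co: "companion L B A"
    and I: "f \<in> I" "x \<in> I" "y \<in> I" and s: "0 < B f x * B f y" and xy: "B x y \<noteq> 0"
  shows "A f x * A f y * A x y < 0"
proof -
  note Co = companion_basic[OF co]
  have skew: "B u v = - B v u" if "u \<in> I" "v \<in> I" for u v using Co(2) that by blast
  have s1: "A u v = A v u" if "u \<in> I" "v \<in> I" for u v using Co(1) that by blast
  have ne: "f \<noteq> x" "f \<noteq> y" "x \<noteq> y" using s xy skew[OF I(1,1)] skew[OF I(2,2)] by auto
  have k: "B x f = - B f x" "B y f = - B f y" "B y x = - B x y" using skew I by blast+
  consider "0 < B f x" "0 < B f y" "0 < B x y" | "0 < B f x" "0 < B f y" "B x y < 0"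
    | "B f x < 0" "B f y < 0" "0 < B x y" | "B f x < 0" "B f y < 0" "B x y < 0"
    using s xy by (auto simp: zero_less_mult_iff neq_iff)
  then show ?thesis
  proof cases
    case 1
    then show ?thesis using companion_triangle(1)[OF L co I(1,2,3) ne(2)] by (simp add: algebra_simps)
  next
    case 2
    then show ?thesis using companion_triangle(1)[OF L co I(1,3,2) ne(1)] k s1[OF I(3,2)] by (simp add: algebra_simps)
  next
    case 3
    then show ?thesis using companion_triangle(1)[OF L co I(2,3,1) ne(1)[symmetric]] k s1[OF I(3,1)] s1[OF I(2,1)]
      by (simp add: algebra_simps)
  next
    case 4
    then show ?thesis using companion_triangle(1)[OF L co I(3,2,1) ne(2)[symmetric]] k s1[OF I(3,1)] s1[OF I(2,1)] s1[OF I(3,2)]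
      by (simp add: algebra_simps)
  qed
qed

text \<open>Equal entries around the triangle make it oriented; a negative common value is traversed
  backwards.\<close>

lemma orbit_triangle_sign:
  assumes L: "distinct L" "set L = I" and co: "companion L B A"
    and I: "x \<in> I" "y \<in> I" "z \<in> I" and e: "B x y = B y z" "B y z = B z x" "B x y \<noteq> 0"
  shows "0 < A x y * A y z * A z x"
proof -
  note Co = companion_basic[OF co]
  have ne: "x \<noteq> z" "z \<noteq> x" using e Co(2)[OF I(1,1)] by auto
  show ?thesis
  proof (cases "0 < B x y")
    case True
    then have "B x z < 0" using e Co(2)[OF I(1,3)] by simp
    then show ?thesis using companion_triangle(2)[OF L co I(1,2,3) ne(1)] True e Co(1)[OF I(1,3)] by simp
  next
    case False
    then have "0 < B z y" "0 < B y x" "B z x < 0" using e Co(2)[OF I(3,2)] Co(2)[OF I(2,1)] by auto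
    then show ?thesis
      using companion_triangle(2)[OF L co I(3,2,1) ne(2)] Co(1)[OF I(3,2)] Co(1)[OF I(2,1)]
      by (simp add: algebra_simps)
  qed
qed

end

section \<open>Quivers of affine type\<close>

lemma topological_order:
  assumes "finite S" "finite r" "acyclic r"
  obtains L where "distinct L" "set L = S" "sorted_wrt (\<lambda>u v. (v, u) \<notin> r) L"
proof -
  have wf: "wf r" using assms by (intro finite_acyclic_wf)
  have "\<exists>L. distinct L \<and> set L = S \<and> sorted_wrt (\<lambda>u v. (v, u) \<notin> r) L"
    using assms(1)
  proof (induction S rule: finite_psubset_induct)
    case (psubset S)
    show ?case
    proof (cases "S = {}")
      case False
      then obtain x where x: "x \<in> S" by blast
      show ?thesis
      proof (rule wfE_min[OF wf x])
        fix s assume s: "s \<in> S" "\<And>y. (y, s) \<in> r \<Longrightarrow> y \<notin> S"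
        have "S - {s} \<subset> S" using s(1) by blast
        from psubset.IH[OF this] obtain L
          where L: "distinct L" "set L = S - {s}" "sorted_wrt (\<lambda>u v. (v, u) \<notin> r) L" by (elim exE conjE)
        have "(v, s) \<notin> r" if "v \<in> set L" for v using s(2)[of v] that L(2) by auto
        then have "sorted_wrt (\<lambda>u v. (v, u) \<notin> r) (s # L)" using L(3) by simp
        moreover have "distinct (s # L)" "set (s # L) = S" using L(1,2) s(1) by auto
        ultimately show "\<exists>L. distinct L \<and> set L = S \<and> sorted_wrt (\<lambda>u v. (v, u) \<notin> r) L"
          by (intro exI[of _ "s # L"] conjI)
      qed
    qed simp
  qed
  then show ?thesis using that by (elim exE conjE)
qed

definition graph_weight :: "nat set set \<Rightarrow> nat \<Rightarrow> nat \<Rightarrow> int" where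
  "graph_weight X i j = (if i \<noteq> j \<and> {i, j} \<in> X then 1 else 0)"

lemma weighted_graph_weight: "weighted_graph (graph_weight X)"
  by unfold_locales (auto simp: graph_weight_def insert_commute)

lemma adj_skew: "adj Q i j = - adj Q j i"
  by (simp add: adj_def)

lemma count_underlying:
  assumes "has_underlying_graph Q X" "finite X" "i \<noteq> j"
  shows "int (count Q (i, j)) + int (count Q (j, i)) = graph_weight X i j"
proof -
  define f where "f = (\<lambda>(i::nat, j). {i, j})"
  have "count (image_mset f Q) {i, j} = (\<Sum>e\<in>f -` {{i, j}} \<inter> set_mset Q. count Q e)"
    by (rule count_image_mset)
  also have "f -` {{i, j}} = {(i, j), (j, i)}"
  proof (rule Set.set_eqI)
    fix e :: "nat \<times> nat"
    obtain a b where e: "e = (a, b)" by (cases e)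
    have "{a, b} = {i, j} \<longleftrightarrow> a = i \<and> b = j \<or> a = j \<and> b = i" by (rule doubleton_eq_iff)
    then show "e \<in> f -` {{i, j}} \<longleftrightarrow> e \<in> {(i, j), (j, i)}" unfolding e f_def by simp
  qed
  also have "(\<Sum>e\<in>{(i, j), (j, i)} \<inter> set_mset Q. count Q e) = (\<Sum>e\<in>{(i, j), (j, i)}. count Q e)"
  proof (rule sum.mono_neutral_left)
    show "\<forall>e\<in>{(i, j), (j, i)} - {(i, j), (j, i)} \<inter> set_mset Q. count Q e = 0"
      by (metis DiffE IntI not_in_iff)
  qed simp_all
  also have "\<dots> = count Q (i, j) + count Q (j, i)" using assms(3) by simp
  finally have 1: "count (image_mset f Q) {i, j} = count Q (i, j) + count Q (j, i)" .
  have "image_mset f Q = mset_set X"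
    using assms(1) unfolding has_underlying_graph_def f_def .
  then have "count Q (i, j) + count Q (j, i) = (if {i, j} \<in> X then 1 else 0)"
    using 1 assms(2) by (simp add: count_mset_set')
  then have "int (count Q (i, j) + count Q (j, i)) = (if {i, j} \<in> X then 1 else 0)" by simp
  then show ?thesis using assms(3) unfolding graph_weight_def by simp
qed

lemma mutated_adj_mutate: "mutated_adj k Q i j = mutate k (adj Q) i j"
  by (simp add: mutated_adj_def mutate_def)

lemma is_mutation_adj:
  "is_mutation N k Q Q' \<Longrightarrow> i \<in> {1..N} \<Longrightarrow> j \<in> {1..N} \<Longrightarrow> adj Q' i j = mutate k (adj Q) i j"
  unfolding is_mutation_def mutated_adj_mutate by blast

lemma mutate_cong:
  assumes "\<And>i j. i \<in> I \<Longrightarrow> j \<in> I \<Longrightarrow> B i j = B' i j" "i \<in> I" "j \<in> I" "k \<in> I"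
  shows "mutate k B i j = mutate k B' i j"
  using assms by (simp add: mutate_def)

lemma is_mutation_sym:
  assumes "is_mutation N k Q Q'"
  shows "is_mutation N k Q' Q"
proof -
  have k: "k \<in> {1..N}" using assms by (simp add: is_mutation_def)
  have "adj Q i j = mutate k (adj Q') i j" if "i \<in> {1..N}" "j \<in> {1..N}" for i j
  proof -
    have "mutate k (adj Q') i j = mutate k (mutate k (adj Q)) i j"
      by (rule mutate_cong[OF is_mutation_adj[OF assms] that k])
    then show ?thesis unfolding mutate_mutate by (rule sym)
  qed
  then show ?thesis
    using assms unfolding is_mutation_def mutated_adj_mutate by blast
qed

text \<open>Mutation is an involution, so both alternatives of mutation equivalence give a chain of
  mutations from \<open>Q0\<close> to \<open>Q\<close>. The matrix of the new quiver is compared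
  with the mutated matrix on the vertex set only, which explains the form of the step.\<close>

lemma mutation_equivalent_invariant:
  assumes "mutation_equivalent N Q Q0" and P: "P (adj Q0)"
    and step: "\<And>B B' k. P B \<Longrightarrow> k \<in> {1..N} \<Longrightarrow> (\<And>i j. B' i j = - B' j i) \<Longrightarrow>
      (\<And>i j. i \<in> {1..N} \<Longrightarrow> j \<in> {1..N} \<Longrightarrow> B' i j = mutate k B i j) \<Longrightarrow> P B'"
  shows "P (adj Q)"
proof -
  let ?R = "\<lambda>P P'. \<exists>k. is_mutation N k P P'"
  have "symp ?R" unfolding symp_def by (blast intro: is_mutation_sym)
  then have "symp ?R\<^sup>*\<^sup>*" by (rule symp_rtranclp)
  then have "?R\<^sup>*\<^sup>* Q0 Q" using assms(1) unfolding mutation_equivalent_def by (blast dest: sympD)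
  then show ?thesis
  proof (induction rule: rtranclp_induct)
    case (step Q1 Q2)
    then obtain k where k: "is_mutation N k Q1 Q2" by blast
    show ?case
    proof (rule assms(3)[OF step.IH])
      show "k \<in> {1..N}" using k by (simp add: is_mutation_def)
      show "adj Q2 i j = - adj Q2 j i" for i j by (rule adj_skew)
      show "adj Q2 i j = mutate k (adj Q1) i j" if "i \<in> {1..N}" "j \<in> {1..N}" for i j
        using is_mutation_adj[OF k that] .
    qed
  qed (rule P)
qed

section \<open>The family of an acyclic quiver\<close>

context weighted_graph begin

definition unit :: "nat \<Rightarrow> nat \<Rightarrow> int" where
  "unit i = (\<lambda>v. if v = i then 1 else 0)"

text \<open>Along a topological order simple roots pair to zero from earlier to later and to minus
  the edge weight from later to earlier, so their skew-symmetrized Gram matrix is the exchange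
  matrix.\<close>

lemma eul_units:
  assumes "distinct L" "sorted_wrt (\<lambda>u v. B u v = n u v \<and> B v u = - n u v) L" "i \<in> set L" "j \<in> set L"
  shows "eul L (unit i) (unit i) = 1 \<and> (i \<noteq> j \<longrightarrow> eul L (unit i) (unit j) \<le> 0 \<and>
     eul L (unit i) (unit j) * eul L (unit j) (unit i) = 0 \<and>
     B i j = eul L (unit i) (unit j) - eul L (unit j) (unit i))"
  using assms
proof (induction L arbitrary: i j)
  case (Cons s L)
  have d: "distinct (s # L)" using Cons.prems by simp
  have us: "simple_at (s # L) s (unit s)" by (simp add: simple_at_def unit_def)
  have left: "eul (s # L) (unit s) (unit j) = (if j = s then 1 else 0)" for j
    unfolding simple_head_left[OF d us] by (simp add: unit_def)
  have right: "eul (s # L) (unit j) (unit s) = - n j s" if "j \<in> set L" for j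
  proof -
    have "(\<Sum>k\<in>set L. n k s * unit j k) = n j s"
      using that by (simp add: unit_def if_distrib[of "(*) _"] cong: if_cong)
    moreover have "unit j s = 0" using that d by (auto simp: unit_def)
    ultimately show ?thesis unfolding simple_head_right[OF d us] by simp
  qed
  have rest: "eul (s # L) (unit i) (unit j) = eul L (unit i) (unit j)" if "j \<in> set L" for i j
    using that d by (auto simp: unit_def)
  have B: "B s v = n s v" "B v s = - n s v" if "v \<in> set L" for v using Cons.prems that by auto
  show ?case
  proof (cases "i = s")
    case True
    then show ?thesis using left[of s] left[of j] right[of j] B[of j] Cons.prems n_sym[of j s] n_nonneg[of s j]
      by (auto simp del: eul.simps)
  next
    case i: False
    then have iL: "i \<in> set L" using Cons.prems by simp
    have IH: "eul L (unit i) (unit i) = 1 \<and> (i \<noteq> j \<longrightarrow> eul L (unit i) (unit j) \<le> 0 \<and>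
       eul L (unit i) (unit j) * eul L (unit j) (unit i) = 0 \<and>
       B i j = eul L (unit i) (unit j) - eul L (unit j) (unit i))" if "j \<in> set L" for j
      using Cons.IH[OF _ _ iL that] Cons.prems by simp
    show ?thesis
    proof (cases "j = s")
      case True
      then show ?thesis
        using left[of i] right[OF iL] B[OF iL] rest[OF iL, of i] IH[OF iL] n_sym[of i s] n_nonneg[of i s] i
        by (simp del: eul.simps)
    next
      case False
      then have "j \<in> set L" using Cons.prems by simp
      then show ?thesis unfolding rest[OF iL] rest[OF \<open>j \<in> set L\<close>] by (rule IH)
    qed
  qed
qed simp

end

context affine_graph begin

lemma family_base:
  assumes L: "distinct L" "set L = I" and s: "sorted_wrt (\<lambda>u v. B u v = n u v \<and> B v u = - n u v) L"
    and skew: "\<And>i. B i i = 0"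
  shows "family L B unit"
proof -
  note U = eul_units[OF L(1) s]
  have pos: "nonneg_on L (unit i)" for i by (simp add: nonneg_on_def unit_def)
  have np: "\<not> nonpos_on L (unit i)" if "i \<in> I" for i using that L by (auto simp: nonpos_on_def unit_def)
  obtain s M where sM: "L = s # M" using L nonempty by (cases L) auto
  have "simple_at (s # M) s (unit s)" by (simp add: simple_at_def unit_def)
  then have "eul L \<delta> (unit s) \<noteq> 0" using eul_delta_simple_head[of s M] L sM by blast
  moreover have "s \<in> I" using L sM by auto
  ultimately have reg: "\<exists>l\<in>I. eul L \<delta> (unit l) \<noteq> 0" by blast
  have sum: "(\<Sum>i\<in>I. x i * unit i v) = x v" if "v \<in> I" for x v
    using that fin by (simp add: unit_def if_distrib[of "(*) _"] cong: if_cong)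
  show ?thesis
    unfolding family_def
  proof (intro conjI ballI allI impI)
    fix i j assume ij: "i \<in> I" "j \<in> I"
    show "eul L (unit i) (unit i) = 1" using U ij L by blast
    show "B i j = eul L (unit i) (unit j) - eul L (unit j) (unit i)"
      using U[of i j] ij L skew by (cases "i = j") auto
    assume "i \<noteq> j"
    then show "compat L (unit i) (unit j)"
      using U[of i j] U[of j i] ij L np[OF ij(1)] np[OF ij(2)] unfolding compat_def by auto
  next
    show "x i = 0" if "\<forall>v\<in>I. (\<Sum>i\<in>I. x i * unit i v) = 0" "i \<in> I" for x i using that sum by simp
    show "\<exists>x. \<forall>v\<in>I. (\<Sum>i\<in>I. x i * unit i v) = \<delta> v" using sum by (intro exI[of _ \<delta>]) simp
  qed (rule reg)
qed

text \<open>Every vertex has at most one smaller neighbour. Choosing signs by increasing label, the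
  sign of a new vertex has only one entry to correct.\<close>

lemma rigid_tree:
  assumes tree: "\<And>i j. i \<in> I \<Longrightarrow> j \<in> I \<Longrightarrow> i < j \<Longrightarrow> B i j \<noteq> 0 \<Longrightarrow> i = p j"
  shows "rigid L B"
  unfolding rigid_def
proof (intro allI impI)
  fix A A' assume c: "companion L B A" and c': "companion L B A'"
  note C = companion_basic[OF c] and C' = companion_basic[OF c']
  have "\<exists>D. (\<forall>i. D i = 1 \<or> D i = -1) \<and>
     (\<forall>i\<in>I. \<forall>j\<in>I. i < m \<longrightarrow> j < m \<longrightarrow> A' i j = D i * D j * A i j)" for m :: nat
  proof (induction m)
    case 0
    show ?case by (intro exI[of _ "\<lambda>i. 1"]) simp
  next
    case (Suc m)
    then obtain D where D: "\<And>i. D i = 1 \<or> D i = (-1::int)"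
      "\<And>i j. i \<in> I \<Longrightarrow> j \<in> I \<Longrightarrow> i < m \<Longrightarrow> j < m \<Longrightarrow> A' i j = D i * D j * A i j" by blast
    define d where "d = (if A' (p m) m = D (p m) * A (p m) m then 1 else (-1::int))"
    define E where "E = D(m := d)"
    have E: "E i = 1 \<or> E i = -1" for i using D(1) by (simp add: E_def d_def)
    have im: "A' i m = E i * E m * A i m" if i: "i \<in> I" "m \<in> I" "i < m" for i
    proof (cases "B i m = 0")
      case True
      then show ?thesis using C(3)[OF i(1,2)] C'(3)[OF i(1,2)] i by simp
    next
      case False
      then have ip: "i = p m" using tree i by blast
      have "\<bar>A' i m\<bar> = \<bar>A i m\<bar>" using C(3)[OF i(1,2)] C'(3)[OF i(1,2)] i by simp
      then have "A' i m = A i m \<or> A' i m = - A i m" by (simp add: abs_eq_iff)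
      then show ?thesis using D(1)[of i] i ip by (auto simp: E_def d_def)
    qed
    have "A' i j = E i * E j * A i j" if ij: "i \<in> I" "j \<in> I" "i < Suc m" "j < Suc m" for i j
    proof -
      consider "i < m" "j < m" | "i = m" "j = m" | "i < m" "j = m" | "i = m" "j < m"
        using ij by (auto simp: less_Suc_eq)
      then show ?thesis
      proof cases
        case 1
        then show ?thesis using D(2) ij by (simp add: E_def)
      next
        case 2
        have "E m * E m = 1" using E[of m] by auto
        then show ?thesis using C(4)[OF ij(1,1)] C'(4)[OF ij(1,1)] 2 by simp
      next
        case 3
        then show ?thesis using im ij by simp
      next
        case 4
        then show ?thesis using im[of j] ij C(1)[OF ij(1,2)] C'(1)[OF ij(1,2)] by simp
      qed
    qed
    then show ?case using E by blast
  qed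
  from this[of "Suc (Max I)"]
  show "\<exists>D. (\<forall>i\<in>I. D i = 1 \<or> D i = -1) \<and> (\<forall>i\<in>I. \<forall>j\<in>I. A' i j = D i * D j * A i j)"
    using fin Max_ge[of I] by (meson le_imp_less_Suc)
qed

end

section \<open>Invariants of a mutation class\<close>

locale affine_quiver_type = affine_graph "graph_weight X" "{1..N}" \<delta>
  for X :: "nat set set" and N :: nat and \<delta> :: "nat \<Rightarrow> int" +
  assumes finite_edges: "finite X"
begin

lemma acyclic_base:
  assumes "quiver N Q" "acyclic (set_mset Q)" "has_underlying_graph Q X"
  obtains L where "distinct L" "set L = {1..N}" "family L (adj Q) unit"
proof -
  obtain L where L: "distinct L" "set L = {1..N}" "sorted_wrt (\<lambda>u v. (v, u) \<notin> set_mset Q) L"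
    using topological_order[of "{1..N}" "set_mset Q"] assms(2) by auto
  have "sorted_wrt (\<lambda>u v. u \<noteq> v \<and> (v, u) \<notin># Q) L"
    using L(1,3) by (induction L) auto
  then have "sorted_wrt (\<lambda>u v. adj Q u v = graph_weight X u v \<and> adj Q v u = - graph_weight X u v) L"
  proof (rule sorted_wrt_mono_rel[rotated])
    fix u v assume "u \<noteq> v \<and> (v, u) \<notin># Q"
    then show "adj Q u v = graph_weight X u v \<and> adj Q v u = - graph_weight X u v"
      using count_underlying[OF assms(3) finite_edges, of u v] by (simp add: adj_def not_in_iff)
  qed
  then have "family L (adj Q) unit"
    using L by (intro family_base) (auto simp: adj_def)
  then show ?thesis using that L by blast
qed

lemma adj_base:
  assumes "has_underlying_graph Q X" "quiver N Q" "i \<noteq> j"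
  shows "adj Q i j \<noteq> 0 \<longleftrightarrow> {i, j} \<in> X"
proof -
  have "count Q (i, j) = 0 \<or> count Q (j, i) = 0"
    using assms(2) unfolding quiver_def by (metis not_in_iff)
  then show ?thesis
    using count_underlying[OF assms(1) finite_edges assms(3)] assms(3)
    by (auto simp: adj_def graph_weight_def split: if_splits)
qed

lemma connected_base:
  assumes "has_underlying_graph Q X" "quiver N Q"
  shows "connected_matrix (adj Q)"
  unfolding connected_matrix_def
proof (intro allI impI)
  fix S assume S: "S \<subseteq> {1..N}" "S \<noteq> {}" "\<forall>i\<in>S. \<forall>j\<in>{1..N} - S. adj Q i j = 0"
  show "S = {1..N}"
    using S(1,2)
  proof (rule connected)
    show "graph_weight X i j = 0" if "i \<in> S" "j \<in> {1..N} - S" for i j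
      using S(3) that adj_base[OF assms, of i j] by (auto simp: graph_weight_def)
  qed
qed

text \<open>Rigidity is conditional on a parent function, so that cycles can share the other
  conclusions: the largest vertex of a cycle has two smaller neighbours.\<close>

lemma of_type_structure:
  assumes "quiver N Q0" "acyclic (set_mset Q0)" "has_underlying_graph Q0 X" "mutation_equivalent N Q Q0"
  obtains L A where "distinct L" "set L = {1..N}" "companion L (adj Q) A" "connected_matrix (adj Q)"
    "\<And>p. (\<And>i j. i < j \<Longrightarrow> {i, j} \<in> X \<Longrightarrow> i = p j) \<Longrightarrow> rigid L (adj Q)"
proof -
  obtain L where L: "distinct L" "set L = {1..N}" "family L (adj Q0) unit"
    using acyclic_base[OF assms(1-3)] by blast
  have 1: "\<exists>A. companion L (adj Q) A"
  proof (rule mutation_equivalent_invariant[OF assms(4), where P = "\<lambda>B. \<exists>A. companion L B A"])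
    show "\<exists>A. companion L (adj Q0) A"
      using L(3) unfolding companion_def
      by (intro exI[of _ "\<lambda>i j. sym L (unit i) (unit j)"] exI[of _ unit]) simp
    fix B B' k assume "\<exists>A. companion L B A" and k: "k \<in> {1..N}"
      and B': "\<And>i j. i \<in> {1..N} \<Longrightarrow> j \<in> {1..N} \<Longrightarrow> B' i j = mutate k B i j"
    then obtain A where "companion L B A" by blast
    then obtain A' where A': "companion L (mutate k B) A'" using companion_mutate[OF L(1,2) _ k] by metis
    show "\<exists>A. companion L B' A" using companion_cong[OF A' B'] by blast
  qed
  have 2: "connected_matrix (adj Q)"
  proof (rule mutation_equivalent_invariant[OF assms(4), where P = connected_matrix])
    show "connected_matrix (adj Q0)" by (rule connected_base[OF assms(3,1)])
    fix B B' k assume "connected_matrix B" and k: "k \<in> {1..N}"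
      and B': "\<And>i j. i \<in> {1..N} \<Longrightarrow> j \<in> {1..N} \<Longrightarrow> B' i j = mutate k B i j"
    then have c: "connected_matrix (mutate k B)" by (intro connected_mutate)
    show "connected_matrix B'"
      unfolding connected_matrix_def
    proof (intro allI impI)
      fix S assume S: "S \<subseteq> {1..N}" "S \<noteq> {}" "\<forall>i\<in>S. \<forall>j\<in>{1..N} - S. B' i j = 0"
      have "\<forall>i\<in>S. \<forall>j\<in>{1..N} - S. mutate k B i j = 0"
      proof (intro ballI)
        fix i j assume ij: "i \<in> S" "j \<in> {1..N} - S"
        then have "B' i j = mutate k B i j" using S(1) by (intro B') auto
        then show "mutate k B i j = 0" using S(3) ij by simp
      qed
      then show "S = {1..N}" using c[unfolded connected_matrix_def, rule_format, OF S(1,2)] by simp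
    qed
  qed
  have 3: "rigid L (adj Q)" if p: "\<And>i j. i < j \<Longrightarrow> {i, j} \<in> X \<Longrightarrow> i = p j" for p
  proof -
    have "skew (adj Q) \<and> rigid L (adj Q)"
    proof (rule mutation_equivalent_invariant[OF assms(4), where P = "\<lambda>B. skew B \<and> rigid L B"])
      have "rigid L (adj Q0)"
      proof (rule rigid_tree[where p = p])
        show "i = p j" if "i < j" "adj Q0 i j \<noteq> 0" for i j
          using p[OF that(1)] adj_base[OF assms(3,1), of i j] that by simp
      qed
      moreover have "skew (adj Q0)" unfolding skew_def by (intro ballI adj_skew)
      ultimately show "skew (adj Q0) \<and> rigid L (adj Q0)" by (rule conjI[rotated])
      fix B B' k assume *: "skew B \<and> rigid L B" and k: "k \<in> {1..N}" and sk: "\<And>i j. B' i j = - B' j i"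
        and B': "\<And>i j. i \<in> {1..N} \<Longrightarrow> j \<in> {1..N} \<Longrightarrow> B' i j = mutate k B i j"
      have "rigid L (mutate k B)" using rigid_mutate[OF L(1,2) conjunct1[OF *] conjunct2[OF *] k] .
      moreover have "companion L B' A = companion L (mutate k B) A" for A
        by (intro iffI; erule companion_cong) (simp_all add: B')
      ultimately have "rigid L B'" unfolding rigid_def by simp
      moreover have "skew B'" unfolding skew_def by (intro ballI sk)
      ultimately show "skew B' \<and> rigid L B'" by (rule conjI[rotated])
    qed
    then show ?thesis by (rule conjunct2)
  qed
  from 1 obtain A where "companion L (adj Q) A" ..
  from that[OF L(1,2) this 2 3] show ?thesis .
qed

text \<open>Two vertices of an orbit are related by a single group element, so the elements can be
  treated one at a time, and the fixed vertex may depend on the element.\<close>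

lemma admissible_involutions:
  assumes ty: "of_type N X Q" and p: "\<And>i j. i < j \<Longrightarrow> {i, j} \<in> X \<Longrightarrow> i = p j"
    and G: "\<And>g i. g \<in> G \<Longrightarrow> i \<in> {1..N} \<Longrightarrow> g i \<in> {1..N} \<and> g (g i) = i"
    and fp: "\<And>g. g \<in> G \<Longrightarrow> \<exists>f\<in>{1..N}. g f = f"
    and inv: "G_invariant N G Q"
  shows "G_admissible N G Q"
proof -
  obtain L A where L: "distinct L" "set L = {1..N}" "companion L (adj Q) A" "connected_matrix (adj Q)"
    "rigid L (adj Q)"
    using ty p unfolding of_type_def by (elim exE conjE) (rule of_type_structure, assumption+, blast)
  have "adj Q i i' = 0 \<and> (\<forall>j\<in>{1..N}. adj Q i j * adj Q i' j \<ge> 0)"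
    if i: "i \<in> {1..N}" and o: "same_orbit G i i'" for i i'
  proof -
    obtain g where g: "g \<in> G" "g i = i'" using o unfolding same_orbit_def by blast
    obtain f where f: "f \<in> {1..N}" "g f = f" using fp[OF g(1)] by blast
    have gi: "\<And>i j. i \<in> {1..N} \<Longrightarrow> j \<in> {1..N} \<Longrightarrow> adj Q (g i) (g j) = adj Q i j"
      using inv g unfolding G_invariant_def by blast
    note R = involution_no_square[OF L(1-3,5,4), of g f, OF _ _ f gi i]
    have "adj Q i (g i) = 0" by (rule R) (use G[OF g(1)] i in blast)+
    moreover have "adj Q i j * adj Q (g i) j \<ge> 0" if "j \<in> {1..N}" for j
      by (rule R) (use G[OF g(1)] that in blast)+
    ultimately show ?thesis unfolding g(2) by (intro conjI ballI)
  qed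
  then show ?thesis using inv unfolding G_admissible_def by (intro conjI ballI impI) simp_all
qed

end

section \<open>Trees\<close>

text \<open>With every parent smaller than its child, balance becomes a condition on the parent and
  the children of a vertex, and connectedness an induction down to the vertex 1.\<close>

lemma tree_affine_type:
  assumes N: "1 \<le> N" and p: "\<And>v. v \<in> {2..N} \<Longrightarrow> 1 \<le> p v \<and> p v < v"
    and X: "X = (\<lambda>v. {p v, v}) ` {2..N}"
    and d: "\<And>i. i \<in> {1..N} \<Longrightarrow> 0 < \<delta> i" "\<And>i. i \<notin> {1..N} \<Longrightarrow> \<delta> i = 0"
    and bal: "\<And>i. i \<in> {1..N} \<Longrightarrow> (if 2 \<le> i then \<delta> (p i) else 0) + (\<Sum>j\<in>{j\<in>{2..N}. p j = i}. \<delta> j) = 2 * \<delta> i"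
  shows "affine_quiver_type X N \<delta>" "\<And>i j. i < j \<Longrightarrow> {i, j} \<in> X \<Longrightarrow> i = p j"
proof -
  have edge: "{i, j} \<in> X \<longleftrightarrow> (i \<in> {2..N} \<and> j = p i) \<or> (j \<in> {2..N} \<and> p j = i)" for i j
  proof -
    have "{i, j} \<in> X \<longleftrightarrow> (\<exists>v\<in>{2..N}. {i, j} = {p v, v})" unfolding X by (simp only: image_iff)
    also have "\<dots> \<longleftrightarrow> (\<exists>v\<in>{2..N}. i = p v \<and> j = v \<or> i = v \<and> j = p v)"
      by (simp only: doubleton_eq_iff)
    finally show ?thesis by blast
  qed
  show "i = p j" if "i < j" "{i, j} \<in> X" for i j
  proof -
    have "\<not> (i \<in> {2..N} \<and> j = p i)" using p[of i] that(1) by auto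
    then show ?thesis using that(2) unfolding edge by auto
  qed
  have w: "graph_weight X j i = (if i \<in> {2..N} \<and> j = p i then 1 else 0) + (if j \<in> {2..N} \<and> p j = i then 1 else 0)" for i j
  proof (cases "i \<in> {2..N} \<and> j = p i")
    case True
    then have "j < i" "\<not> (j \<in> {2..N} \<and> p j = i)" using p[of i] p[of j] by force+
    then show ?thesis using True edge[of i j] by (simp add: graph_weight_def insert_commute)
  next
    case False
    show ?thesis
    proof (cases "j \<in> {2..N} \<and> p j = i")
      case True
      then have "i < j" using p[of j] by auto
      then show ?thesis using True False edge[of i j] by (simp add: graph_weight_def insert_commute)
    next
      case F: False
      then show ?thesis using False edge[of i j] by (auto simp: graph_weight_def insert_commute)
    qed
  qed
  interpret weighted_graph "graph_weight X" by (rule weighted_graph_weight)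
  show "affine_quiver_type X N \<delta>"
  proof unfold_locales
    show "finite {1..N}" "finite X" by (simp_all add: X)
    show "{1..N} \<noteq> {}" using N by simp
    show "0 < \<delta> i" if "i \<in> {1..N}" for i using d that by blast
    show "\<delta> i = 0" if "i \<notin> {1..N}" for i using d that by blast
    show "(\<Sum>j\<in>{1..N}. graph_weight X j i * \<delta> j) = 2 * \<delta> i" if i: "i \<in> {1..N}" for i
    proof -
      have "(\<Sum>j\<in>{1..N}. graph_weight X j i * \<delta> j)
         = (\<Sum>j\<in>{1..N}. (if i \<in> {2..N} \<and> j = p i then \<delta> j else 0)) + (\<Sum>j\<in>{1..N}. (if j \<in> {2..N} \<and> p j = i then \<delta> j else 0))"
        unfolding w sum.distrib[symmetric] by (intro sum.cong) auto
      also have "(\<Sum>j\<in>{1..N}. (if i \<in> {2..N} \<and> j = p i then \<delta> j else 0)) = (if 2 \<le> i then \<delta> (p i) else 0)"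
      proof (cases "2 \<le> i")
        case True
        then have "i \<in> {2..N}" "p i \<in> {1..N}" using i p[of i] by auto
        then show ?thesis using True by simp
      qed simp
      also have "(\<Sum>j\<in>{1..N}. (if j \<in> {2..N} \<and> p j = i then \<delta> j else 0)) = (\<Sum>j\<in>{j\<in>{2..N}. p j = i}. \<delta> j)"
        by (rule sum.mono_neutral_cong_right) auto
      finally show ?thesis using bal[OF i] by simp
    qed
    fix S assume S: "S \<subseteq> {1..N}" "S \<noteq> {}" and
      z: "\<And>i j. i \<in> S \<Longrightarrow> j \<in> {1..N} - S \<Longrightarrow> graph_weight X i j = 0"
    have "v \<in> S \<longleftrightarrow> 1 \<in> S" if "v \<in> {1..N}" for v
      using that
    proof (induction v rule: less_induct)
      case (less v)
      show ?case
      proof (cases "v = 1")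
        case False
        then have v: "v \<in> {2..N}" "p v < v" "p v \<in> {1..N}" using less.prems p[of v] by auto
        have "graph_weight X (p v) v \<noteq> 0" "graph_weight X v (p v) \<noteq> 0" using w v(1) by auto
        then have "v \<in> S \<longleftrightarrow> p v \<in> S" using z[of "p v" v] z[of v "p v"] v less.prems by blast
        then show ?thesis using less.IH[OF v(2,3)] by blast
      qed simp
    qed
    then show "S = {1..N}" using S by blast
  qed
qed

lemma permutes_involution:
  assumes "\<And>x. f (f x) = x" "\<And>x. x \<notin> S \<Longrightarrow> f x = x"
  shows "f permutes S"
  unfolding permutes_def using assms by metis

lemma sym_group_mult: "f \<otimes>\<^bsub>sym_group N\<^esub> g = f \<circ> g" and sym_group_one: "\<one>\<^bsub>sym_group N\<^esub> = id"
  by (simp_all add: sym_group_def)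

lemma sym_group_inv:
  assumes "p \<in> carrier (sym_group N)" "q \<in> carrier (sym_group N)" "q \<circ> p = id"
  shows "inv\<^bsub>sym_group N\<^esub> p = q"
  by (rule group.inv_equality[OF sym_group_is_group _ assms(1,2)])
     (simp only: sym_group_mult sym_group_one assms(3))

lemma generate_involution:
  assumes "\<And>x. s (s x) = x" "\<And>x. x \<notin> {1..N} \<Longrightarrow> s x = x" "g \<in> generate (sym_group N) {s}"
  shows "g = id \<or> g = s"
proof -
  have s: "s \<in> carrier (sym_group N)"
    using permutes_involution[of s "{1..N}"] assms(1,2) sym_group_carrier by blast
  have ss: "s \<circ> s = id" using assms(1) by auto
  have inv: "inv\<^bsub>sym_group N\<^esub> s = s"
    by (rule sym_group_inv[OF s s ss])
  show ?thesis
    using assms(3)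
  proof (induction rule: generate.induct)
    case one
    then show ?case by (simp add: sym_group_def)
  next
    case (inv h)
    then show ?case using \<open>inv\<^bsub>sym_group N\<^esub> s = s\<close> by simp
  next
    case (eng h1 h2)
    then show ?case unfolding sym_group_mult by (elim disjE) (simp_all add: ss)
  qed simp
qed

lemma generate_two_involutions:
  assumes "\<And>x. s (s x) = x" "\<And>x. x \<notin> {1..N} \<Longrightarrow> s x = x"
    "\<And>x. r (r x) = x" "\<And>x. x \<notin> {1..N} \<Longrightarrow> r x = x" "\<And>x. s (r x) = r (s x)"
    "g \<in> generate (sym_group N) {s, r}"
  shows "g = id \<or> g = s \<or> g = r \<or> g = s \<circ> r"
proof -
  have c: "s \<in> carrier (sym_group N)" "r \<in> carrier (sym_group N)"
    using permutes_involution[of s "{1..N}"] permutes_involution[of r "{1..N}"] assms(1-4) sym_group_carrier by blast+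
  have inv: "inv\<^bsub>sym_group N\<^esub> s = s" "inv\<^bsub>sym_group N\<^esub> r = r"
    using sym_group_inv[OF c(1,1)] sym_group_inv[OF c(2,2)] assms(1,3) by (simp_all add: fun_eq_iff)
  show ?thesis
    using assms(6)
  proof (induction rule: generate.induct)
    case one
    then show ?case by (simp add: sym_group_def)
  next
    case (inv h)
    then show ?case using \<open>inv\<^bsub>sym_group N\<^esub> s = s\<close> \<open>inv\<^bsub>sym_group N\<^esub> r = r\<close> by auto
  next
    case (eng h1 h2)
    have "h1 \<circ> h2 = id \<or> h1 \<circ> h2 = s \<or> h1 \<circ> h2 = r \<or> h1 \<circ> h2 = s \<circ> r"
      using eng.IH assms(1,3,5) by (elim disjE) (simp_all add: fun_eq_iff)
    then show ?case unfolding sym_group_mult .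
  qed auto
qed

context affine_quiver_type begin

lemma admissible_generated_involution:
  assumes "of_type N X Q" "\<And>i j. i < j \<Longrightarrow> {i, j} \<in> X \<Longrightarrow> i = p j"
    and s: "\<And>x. s (s x) = x" "\<And>x. x \<notin> {1..N} \<Longrightarrow> s x = x" and f: "f \<in> {1..N}" "s f = f"
    and inv: "G_invariant N (generate (sym_group N) {s}) Q"
  shows "G_admissible N (generate (sym_group N) {s}) Q"
proof (rule admissible_involutions[OF assms(1,2) _ _ inv])
  fix g assume "g \<in> generate (sym_group N) {s}"
  then have g: "g = id \<or> g = s" using generate_involution[OF s] by blast
  have "s permutes {1..N}" using permutes_involution s by blast
  then have "s i \<in> {1..N}" if "i \<in> {1..N}" for i using permutes_in_image that by fastforce
  then show "g i \<in> {1..N} \<and> g (g i) = i" if "i \<in> {1..N}" for i using g s(1) that by auto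
  show "\<exists>f\<in>{1..N}. g f = f" using g f by auto
qed

end

section \<open>Null roots of the tree diagrams\<close>

definition D_parent :: "nat \<Rightarrow> nat \<Rightarrow> nat" where
  "D_parent n v = (if v \<le> 4 then 1 else if v = n + 1 then n - 1 else v - 1)"

text \<open>The primitive null root: 1 at the four leaves, 2 along the chain between them.\<close>

definition D_delta :: "nat \<Rightarrow> nat \<Rightarrow> int" where
  "D_delta n i = (if i \<in> {1..n + 1} then if i \<in> {2, 3, n, n + 1} then 1 else 2 else 0)"

lemma D_edges_parent:
  assumes "5 \<le> n"
  shows "D_edges n = (\<lambda>v. {D_parent n v, v}) ` {2..n + 1}"
proof -
  have 1: "{2..n + 1} = {2, 3, 4} \<union> {5..n - 1} \<union> {n, n + 1}" using assms by auto
  have 2: "(\<lambda>v. {D_parent n v, v}) ` {5..n - 1} = {{i, i + 1} | i. 4 \<le> i \<and> i \<le> n - 2}"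
  proof (rule Set.set_eqI, rule iffI)
    fix e assume "e \<in> (\<lambda>v. {D_parent n v, v}) ` {5..n - 1}"
    then obtain v where v: "v \<in> {5..n - 1}" "e = {D_parent n v, v}" by blast
    then have "e = {v - 1, (v - 1) + 1}" "4 \<le> v - 1" "v - 1 \<le> n - 2" by (auto simp: D_parent_def)
    then show "e \<in> {{i, i + 1} | i. 4 \<le> i \<and> i \<le> n - 2}" by blast
  next
    fix e assume "e \<in> {{i, i + 1} | i. 4 \<le> i \<and> i \<le> n - 2}"
    then obtain i where i: "e = {i, i + 1}" "4 \<le> i" "i \<le> n - 2" by blast
    then have "e = {D_parent n (i + 1), i + 1}" "i + 1 \<in> {5..n - 1}" using assms by (auto simp: D_parent_def)
    then show "e \<in> (\<lambda>v. {D_parent n v, v}) ` {5..n - 1}" by blast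
  qed
  have 3: "(\<lambda>v. {D_parent n v, v}) ` {2, 3, 4} = {{1, 2}, {1, 3}, {1, 4}}"
    "(\<lambda>v. {D_parent n v, v}) ` {n, n + 1} = {{n - 1, n}, {n - 1, n + 1}}"
    using assms by (simp_all add: D_parent_def)
  show ?thesis unfolding D_edges_def 1 image_Un 2 3 ..
qed

lemma D_affine:
  assumes n: "5 \<le> n"
  shows "affine_quiver_type (D_edges n) (n + 1) (D_delta n)"
    "\<And>i j. i < j \<Longrightarrow> {i, j} \<in> D_edges n \<Longrightarrow> i = D_parent n j"
proof -
  have p: "1 \<le> D_parent n v \<and> D_parent n v < v" if "v \<in> {2..n + 1}" for v
    using that n unfolding D_parent_def by auto
  have d: "0 < D_delta n i" if "i \<in> {1..n + 1}" for i using that unfolding D_delta_def by simp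
  have d': "D_delta n i = 0" if "i \<notin> {1..n + 1}" for i using that unfolding D_delta_def by simp
  have bal: "(if 2 \<le> i then D_delta n (D_parent n i) else 0) + (\<Sum>j\<in>{j\<in>{2..n + 1}. D_parent n j = i}. D_delta n j)
      = 2 * D_delta n i" if i: "i \<in> {1..n + 1}" for i
  proof -
    let ?C = "{j\<in>{2..n + 1}. D_parent n j = i}"
    have dv: "D_delta n j = (if j \<in> {2, 3, n, n + 1} then 1 else 2)" if "1 \<le> j" "j \<le> n + 1" for j
      using that unfolding D_delta_def by simp
    have par: "j \<in> ?C \<longleftrightarrow> 2 \<le> j \<and> j \<le> n + 1 \<and> (j \<le> 4 \<and> i = 1 \<or> 4 < j \<and> j = n + 1 \<and> i = n - 1 \<or> 4 < j \<and> j < n + 1 \<and> j = i + 1)" for j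
      using n unfolding D_parent_def by auto
    consider "i = 1" | "i = 2 \<or> i = 3" | "4 \<le> i" "i \<le> n - 2" | "i = n - 1" | "i = n \<or> i = n + 1"
      using i n by force
    then show ?thesis
    proof cases
      case 1
      have "?C = {2, 3, 4}"
      proof (rule Set.set_eqI)
        show "j \<in> ?C \<longleftrightarrow> j \<in> {2, 3, 4}" for j unfolding par using 1 n by auto
      qed
      then show ?thesis using 1 n by (simp add: dv)
    next
      case 2
      have C: "?C = {}"
      proof (rule Set.set_eqI)
        show "j \<in> ?C \<longleftrightarrow> j \<in> {}" for j unfolding par using 2 n by auto
      qed
      have "(\<Sum>j\<in>?C. D_delta n j) = 0" unfolding C by simp
      moreover have "D_parent n i = 1" using 2 unfolding D_parent_def by auto
      ultimately show ?thesis using 2 n dv[of i] dv[of 1] by auto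
    next
      case 3
      have "?C = {i + 1}"
      proof (rule Set.set_eqI)
        show "j \<in> ?C \<longleftrightarrow> j \<in> {i + 1}" for j unfolding par using 3 n by auto
      qed
      moreover have "D_delta n (D_parent n i) = 2" using 3 n dv[of "D_parent n i"] unfolding D_parent_def by auto
      moreover have "D_delta n (i + 1) = 2" "D_delta n i = 2" using 3 n dv[of "i + 1"] dv[of i] by auto
      ultimately show ?thesis using 3 by simp
    next
      case 4
      have C: "?C = {n, n + 1}"
      proof (rule Set.set_eqI)
        show "j \<in> ?C \<longleftrightarrow> j \<in> {n, n + 1}" for j unfolding par using 4 n by auto
      qed
      have "(\<Sum>j\<in>?C. D_delta n j) = 2" unfolding C using n dv[of n] dv[of "n + 1"] by simp
      moreover have "D_delta n (D_parent n i) = 2" using 4 n dv[of "D_parent n i"] unfolding D_parent_def by auto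
      moreover have "D_delta n i = 2" using 4 n dv[of i] by auto
      ultimately show ?thesis using 4 n by simp
    next
      case 5
      have C: "?C = {}"
      proof (rule Set.set_eqI)
        show "j \<in> ?C \<longleftrightarrow> j \<in> {}" for j unfolding par using 5 n by auto
      qed
      have "(\<Sum>j\<in>?C. D_delta n j) = 0" unfolding C by simp
      moreover have "D_parent n i = n - 1" using 5 n unfolding D_parent_def by auto
      moreover have "D_delta n (n - 1) = 2" using n dv[of "n - 1"] by auto
      moreover have "D_delta n i = 1" using 5 n dv[of i] by auto
      ultimately show ?thesis using 5 n by auto
    qed
  qed
  have N: "1 \<le> n + 1" by simp
  show "affine_quiver_type (D_edges n) (n + 1) (D_delta n)"
    by (rule tree_affine_type(1)[OF N p D_edges_parent[OF n] d d' bal])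
  show "i = D_parent n j" if "i < j" "{i, j} \<in> D_edges n" for i j
    by (rule tree_affine_type(2)[OF N p D_edges_parent[OF n] d d' bal that])
qed

lemma D4_affine:
  "affine_quiver_type D4_edges 5 (\<lambda>i. if i = 1 then 2 else if i \<in> {2..5} then 1 else 0)"
    (is "affine_quiver_type _ _ ?d")
  "i < j \<Longrightarrow> {i, j} \<in> D4_edges \<Longrightarrow> i = 1"
proof -
  let ?p = "\<lambda>v::nat. 1::nat"
  have I: "{2..5} = {2, 3, 4, 5::nat}" by auto
  have X: "D4_edges = (\<lambda>v. {?p v, v}) ` {2..5}" unfolding D4_edges_def I by simp
  have p: "1 \<le> ?p v \<and> ?p v < v" if "v \<in> {2..5}" for v using that by simp
  have d: "0 < ?d i" if "i \<in> {1..5}" for i using that by simp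
  have d': "?d i = 0" if "i \<notin> {1..5}" for i using that by auto
  have bal: "(if 2 \<le> i then ?d (?p i) else 0) + (\<Sum>j\<in>{j\<in>{2..5}. ?p j = i}. ?d j) = 2 * ?d i" if "i \<in> {1..5}" for i
  proof (cases "i = 1")
    case True
    then have "{j\<in>{2..5}. ?p j = i} = {2, 3, 4, 5}" by auto
    then show ?thesis using True by simp
  qed (use that in auto)
  have N: "1 \<le> (5::nat)" by simp
  show "affine_quiver_type D4_edges 5 ?d" by (rule tree_affine_type(1)[OF N p X d d' bal])
  show "i = 1" if "i < j" "{i, j} \<in> D4_edges" by (rule tree_affine_type(2)[OF N p X d d' bal that])
qed

definition E6_parent :: "nat \<Rightarrow> nat" where
  "E6_parent v = (if v \<in> {3, 5, 7} then v - 1 else 1)"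

text \<open>The primitive null root: each leg descends 3, 2, 1 from the branch vertex.\<close>

definition E6_delta :: "nat \<Rightarrow> int" where
  "E6_delta i = (if i = 1 then 3 else if i \<in> {2, 4, 6} then 2 else if i \<in> {3, 5, 7} then 1 else 0)"

lemma E6_affine:
  "affine_quiver_type E6_edges 7 E6_delta"
  "i < j \<Longrightarrow> {i, j} \<in> E6_edges \<Longrightarrow> i = E6_parent j"
proof -
  have I: "{2..7} = {2, 3, 4, 5, 6, 7::nat}" "{1..7} = {1, 2, 3, 4, 5, 6, 7::nat}" by auto
  have X: "E6_edges = (\<lambda>v. {E6_parent v, v}) ` {2..7}"
    unfolding E6_edges_def I E6_parent_def by (simp add: insert_commute)
  have p: "1 \<le> E6_parent v \<and> E6_parent v < v" if "v \<in> {2..7}" for v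
    using that unfolding E6_parent_def by auto
  have d: "0 < E6_delta i" if "i \<in> {1..7}" for i using that unfolding I E6_delta_def by auto
  have d': "E6_delta i = 0" if "i \<notin> {1..7}" for i using that unfolding I E6_delta_def by auto
  have C: "{j\<in>{2..7}. E6_parent j = i} = (if i = 1 then {2, 4, 6} else if i \<in> {2, 4, 6} then {i + 1} else {})"
    if "i \<in> {1..7}" for i
    using that unfolding I E6_parent_def by auto
  have bal: "(if 2 \<le> i then E6_delta (E6_parent i) else 0) + (\<Sum>j\<in>{j\<in>{2..7}. E6_parent j = i}. E6_delta j) = 2 * E6_delta i"
    if "i \<in> {1..7}" for i
    unfolding C[OF that] using that unfolding I by (auto simp: E6_delta_def E6_parent_def)
  have N: "1 \<le> (7::nat)" by simp
  show "affine_quiver_type E6_edges 7 E6_delta" by (rule tree_affine_type(1)[OF N p X d d' bal])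
  show "i = E6_parent j" if "i < j" "{i, j} \<in> E6_edges" by (rule tree_affine_type(2)[OF N p X d d' bal that])
qed

definition E7_parent :: "nat \<Rightarrow> nat" where
  "E7_parent v = (if v \<in> {2, 3, 6} then 1 else v - 1)"

text \<open>The primitive null root: the two long legs descend 4, 3, 2, 1 from the branch vertex,
  and the short leg ends in 2.\<close>

definition E7_delta :: "nat \<Rightarrow> int" where
  "E7_delta i = (if i = 1 then 4 else if i \<in> {3, 6} then 3 else if i \<in> {2, 4, 7} then 2
     else if i \<in> {5, 8} then 1 else 0)"

lemma E7_affine:
  "affine_quiver_type E7_edges 8 E7_delta"
  "i < j \<Longrightarrow> {i, j} \<in> E7_edges \<Longrightarrow> i = E7_parent j"
proof -
  have I: "{2..8} = {2, 3, 4, 5, 6, 7, 8::nat}" "{1..8} = {1, 2, 3, 4, 5, 6, 7, 8::nat}" by auto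
  have X: "E7_edges = (\<lambda>v. {E7_parent v, v}) ` {2..8}"
    unfolding E7_edges_def I E7_parent_def by (simp add: insert_commute)
  have p: "1 \<le> E7_parent v \<and> E7_parent v < v" if "v \<in> {2..8}" for v
    using that unfolding I E7_parent_def by auto
  have d: "0 < E7_delta i" if "i \<in> {1..8}" for i using that unfolding I E7_delta_def by auto
  have d': "E7_delta i = 0" if "i \<notin> {1..8}" for i using that unfolding I E7_delta_def by auto
  have C: "{j\<in>{2..8}. E7_parent j = i} =
      (if i = 1 then {2, 3, 6} else if i \<in> {3, 4, 6, 7} then {i + 1} else {})"
    if "i \<in> {1..8}" for i
    using that unfolding I E7_parent_def by auto
  have bal: "(if 2 \<le> i then E7_delta (E7_parent i) else 0) + (\<Sum>j\<in>{j\<in>{2..8}. E7_parent j = i}. E7_delta j) = 2 * E7_delta i"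
    if "i \<in> {1..8}" for i
    unfolding C[OF that] using that unfolding I by (auto simp: E7_delta_def E7_parent_def)
  have N: "1 \<le> (8::nat)" by simp
  show "affine_quiver_type E7_edges 8 E7_delta" by (rule tree_affine_type(1)[OF N p X d d' bal])
  show "i = E7_parent j" if "i < j" "{i, j} \<in> E7_edges" by (rule tree_affine_type(2)[OF N p X d d' bal that])
qed

section \<open>Involutions on trees\<close>

lemma D4_klein_admissible:
  assumes "of_type 5 D4_edges Q"
    and inv: "G_invariant 5 {id, transpose 2 3 \<circ> transpose 4 5, transpose 2 4 \<circ> transpose 3 5,
         transpose 2 5 \<circ> transpose 3 4} Q"
  shows "G_admissible 5 {id, transpose 2 3 \<circ> transpose 4 5, transpose 2 4 \<circ> transpose 3 5,
         transpose 2 5 \<circ> transpose 3 4} Q"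
proof (rule affine_quiver_type.admissible_involutions[OF D4_affine(1) assms(1) D4_affine(2) _ _ inv])
  fix g :: "nat \<Rightarrow> nat" and i :: nat
  assume g: "g \<in> {id, transpose 2 3 \<circ> transpose 4 5, transpose 2 4 \<circ> transpose 3 5,
         transpose 2 5 \<circ> transpose 3 4}"
  show "g i \<in> {1..5} \<and> g (g i) = i" if "i \<in> {1..5}"
    using g that by (auto simp: transpose_def)
  have "g 1 = 1" using g by (auto simp: transpose_def)
  then show "\<exists>f\<in>{1..5}. g f = f" by (intro bexI[of _ 1]) auto
qed

lemma D_swap_ends_admissible:
  assumes n: "5 \<le> n" and ty: "of_type (n + 1) (D_edges n) Q"
    and inv: "G_invariant (n + 1) (generate (sym_group (n + 1)) {transpose 2 3 \<circ> transpose n (n + 1)}) Q"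
  shows "G_admissible (n + 1) (generate (sym_group (n + 1)) {transpose 2 3 \<circ> transpose n (n + 1)}) Q"
  by (rule affine_quiver_type.admissible_generated_involution[OF D_affine(1)[OF n] ty D_affine(2)[OF n], where f = 1])
     (use n inv in \<open>auto simp: transpose_def\<close>)

lemma D_swap_end_admissible:
  assumes n: "5 \<le> n" and ty: "of_type (n + 1) (D_edges n) Q"
    and inv: "G_invariant (n + 1) (generate (sym_group (n + 1)) {transpose n (n + 1)}) Q"
  shows "G_admissible (n + 1) (generate (sym_group (n + 1)) {transpose n (n + 1)}) Q"
  by (rule affine_quiver_type.admissible_generated_involution[OF D_affine(1)[OF n] ty D_affine(2)[OF n], where f = 1])
     (use n inv in \<open>auto simp: transpose_def\<close>)

lemma sigma_values:
  assumes n: "3 \<le> n"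
  shows "sigma n 1 = 2 * n - 1" "sigma n 2 = 2 * n + 1" "sigma n 3 = 2 * n"
    "sigma n (2 * n - 1) = 1" "sigma n (2 * n) = 3" "sigma n (2 * n + 1) = 2"
    "4 \<le> x \<Longrightarrow> x \<le> 2 * n - 2 \<Longrightarrow> sigma n x = 2 * n + 2 - x"
    "x = 0 \<or> 2 * n + 1 < x \<Longrightarrow> sigma n x = x"
proof -
  show "sigma n 1 = 2 * n - 1" by (simp add: sigma_def)
  have "2 \<noteq> 2 * n - 1" using n by linarith
  then show "sigma n 2 = 2 * n + 1" by (simp add: sigma_def)
  have "3 \<noteq> 2 * n - 1" "3 \<noteq> 2 * n + 1" using n by linarith+
  then show "sigma n 3 = 2 * n" by (simp add: sigma_def)
  have "2 * n - 1 \<noteq> 1" using n by linarith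
  then show "sigma n (2 * n - 1) = 1" by (simp add: sigma_def)
  have "2 * n \<noteq> 1" "2 * n \<noteq> 2 * n - 1" "2 * n \<noteq> 2" "2 * n \<noteq> 2 * n + 1" "2 * n \<noteq> 3" using n by linarith+
  then show "sigma n (2 * n) = 3" by (simp add: sigma_def)
  have "2 * n + 1 \<noteq> 1" "2 * n + 1 \<noteq> 2 * n - 1" "2 * n + 1 \<noteq> 2" using n by linarith+
  then show "sigma n (2 * n + 1) = 2" by (simp add: sigma_def)
  show "sigma n x = 2 * n + 2 - x" if "4 \<le> x" "x \<le> 2 * n - 2"
  proof -
    have "x \<noteq> 1" "x \<noteq> 2 * n - 1" "x \<noteq> 2" "x \<noteq> 2 * n + 1" "x \<noteq> 3" "x \<noteq> 2 * n" using n that by linarith+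
    then show ?thesis using that by (simp add: sigma_def)
  qed
  show "sigma n x = x" if "x = 0 \<or> 2 * n + 1 < x"
  proof -
    have "x \<noteq> 1" "x \<noteq> 2 * n - 1" "x \<noteq> 2" "x \<noteq> 2 * n + 1" "x \<noteq> 3" "x \<noteq> 2 * n" "\<not> (4 \<le> x \<and> x \<le> 2 * n - 2)"
      using n that by linarith+
    then show ?thesis by (auto simp: sigma_def)
  qed
qed

lemma sigma_facts:
  assumes n: "3 \<le> n"
  shows "sigma n (sigma n x) = x" "x \<notin> {1..2 * n + 1} \<Longrightarrow> sigma n x = x" "sigma n (n + 1) = n + 1"
    "x \<in> {1..2 * n + 1} \<Longrightarrow> sigma n x \<in> {1..2 * n + 1}"
proof -
  note v = sigma_values[OF n]
  have "x = 1 \<or> x = 2 \<or> x = 3 \<or> x = 2 * n - 1 \<or> x = 2 * n \<or> x = 2 * n + 1 \<or> (4 \<le> x \<and> x \<le> 2 * n - 2) \<or>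
      (x = 0 \<or> 2 * n + 1 < x)" by linarith
  then have "sigma n (sigma n x) = x \<and> (x \<in> {1..2 * n + 1} \<longrightarrow> sigma n x \<in> {1..2 * n + 1})"
  proof (elim disjE conjE)
    assume x: "4 \<le> x" "x \<le> 2 * n - 2"
    have "4 \<le> 2 * n + 2 - x" "2 * n + 2 - x \<le> 2 * n - 2" "2 * n + 2 - (2 * n + 2 - x) = x" using x by linarith+
    then show ?thesis using v(7)[OF x] v(7)[of "2 * n + 2 - x"] by auto
  next
    assume "x = 0"
    then show ?thesis using v(8)[of x] by simp
  next
    assume "2 * n + 1 < x"
    then show ?thesis using v(8)[of x] by simp
  qed (use v(1-6) n in auto)
  then show "sigma n (sigma n x) = x" "x \<in> {1..2 * n + 1} \<Longrightarrow> sigma n x \<in> {1..2 * n + 1}" by blast+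
  show "sigma n x = x" if "x \<notin> {1..2 * n + 1}" using v(8)[of x] that by auto
  show "sigma n (n + 1) = n + 1" using v(7)[of "n + 1"] n by simp
qed

lemma D_reflect_admissible:
  assumes n: "3 \<le> n" and ty: "of_type (2 * n + 1) (D_edges (2 * n)) Q"
    and inv: "G_invariant (2 * n + 1) (generate (sym_group (2 * n + 1)) {sigma n}) Q"
  shows "G_admissible (2 * n + 1) (generate (sym_group (2 * n + 1)) {sigma n}) Q"
proof -
  have m: "5 \<le> 2 * n" using n by simp
  show ?thesis
  \<comment> \<open>This symmetry exchanges the branch vertices 1 and \<open>2 * n - 1\<close>; the
    vertex it fixes is the middle of the chain.\<close>
  proof (rule affine_quiver_type.admissible_generated_involution[OF D_affine(1)[OF m] ty, where f = "n + 1"])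
    show "i = D_parent (2 * n) j" if "i < j" "{i, j} \<in> D_edges (2 * n)" for i j by (rule D_affine(2)[OF m that])
    show "n + 1 \<in> {1..2 * n + 1}" using n by simp
  qed (use sigma_facts[OF n] inv in auto)
qed

lemma D_reflect_swap_admissible:
  assumes n: "3 \<le> n" and ty: "of_type (2 * n + 1) (D_edges (2 * n)) Q"
    and inv: "G_invariant (2 * n + 1) (generate (sym_group (2 * n + 1))
           {sigma n, transpose 2 3 \<circ> transpose (2 * n) (2 * n + 1)}) Q"
  shows "G_admissible (2 * n + 1) (generate (sym_group (2 * n + 1))
           {sigma n, transpose 2 3 \<circ> transpose (2 * n) (2 * n + 1)}) Q"
proof -
  let ?r = "transpose 2 3 \<circ> transpose (2 * n) (2 * n + 1)"
  have m: "5 \<le> 2 * n" using n by simp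
  have r: "?r (?r x) = x" "x \<notin> {1..2 * n + 1} \<Longrightarrow> ?r x = x" "?r (n + 1) = n + 1"
    "x \<in> {1..2 * n + 1} \<Longrightarrow> ?r x \<in> {1..2 * n + 1}" for x
    using n by (auto simp: transpose_def)
  \<comment> \<open>Commuting generators make their product an involution as well. Outside the four
    leaves \<open>?r\<close> is the identity, and \<open>sigma n\<close> permutes the
    leaves.\<close>
  have com: "sigma n (?r x) = ?r (sigma n x)" for x
  proof (cases "x \<in> {2, 3, 2 * n, 2 * n + 1}")
    case True
    have "2 * n \<noteq> 2" "2 * n \<noteq> 3" "2 * n + 1 \<noteq> 2" "2 * n + 1 \<noteq> 3" using n by linarith+
    then show ?thesis using True sigma_values(2,3,5,6)[OF n] by (auto simp: transpose_def)
  next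
    case False
    then have "?r x = x" by (auto simp: transpose_def)
    moreover have "sigma n x \<notin> {2, 3, 2 * n, 2 * n + 1}"
    proof
      assume "sigma n x \<in> {2, 3, 2 * n, 2 * n + 1}"
      then have "sigma n (sigma n x) \<in> {2, 3, 2 * n, 2 * n + 1}" using sigma_values(2,3,5,6)[OF n] by auto
      then show False using False sigma_facts(1)[OF n] by simp
    qed
    then have "?r (sigma n x) = sigma n x" by (auto simp: transpose_def)
    ultimately show ?thesis by simp
  qed
  show ?thesis
  proof (rule affine_quiver_type.admissible_involutions[OF D_affine(1)[OF m] ty _ _ _ inv])
    show "i = D_parent (2 * n) j" if "i < j" "{i, j} \<in> D_edges (2 * n)" for i j by (rule D_affine(2)[OF m that])
    fix g assume "g \<in> generate (sym_group (2 * n + 1)) {sigma n, ?r}"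
    then have g: "g = id \<or> g = sigma n \<or> g = ?r \<or> g = sigma n \<circ> ?r"
      using generate_two_involutions[OF sigma_facts(1,2)[OF n] r(1,2) com] by blast
    show "g i \<in> {1..2 * n + 1} \<and> g (g i) = i" if i: "i \<in> {1..2 * n + 1}" for i
      using g
    proof (elim disjE)
      assume "g = sigma n \<circ> ?r"
      then have "g i = sigma n (?r i)" "g (g i) = sigma n (?r (sigma n (?r i)))" by simp_all
      moreover have "sigma n (?r (sigma n (?r i))) = i"
        using com[of "sigma n (?r i)"] sigma_facts(1)[OF n, of "?r i"] r(1)[of i] by simp
      ultimately show ?thesis using sigma_facts(4)[OF n] r(4) i by simp
    qed (use sigma_facts[OF n] r i in auto)
    have "n + 1 \<in> {1..2 * n + 1}" using n by simp
    moreover have "g (n + 1) = n + 1"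
      using g
    proof (elim disjE)
      assume "g = sigma n \<circ> ?r"
      then have "g (n + 1) = sigma n (?r (n + 1))" by simp
      then show ?thesis using sigma_facts(3)[OF n] r(3) by simp
    qed (use sigma_facts(3)[OF n] r(3) in auto)
    ultimately show "\<exists>f\<in>{1..2 * n + 1}. g f = f" by blast
  qed
qed

lemma E6_swap_admissible:
  assumes ty: "of_type 7 E6_edges Q"
    and inv: "G_invariant 7 (generate (sym_group 7) {transpose 4 6 \<circ> transpose 5 7}) Q"
  shows "G_admissible 7 (generate (sym_group 7) {transpose 4 6 \<circ> transpose 5 7}) Q"
  by (rule affine_quiver_type.admissible_generated_involution[OF E6_affine(1) ty E6_affine(2), where f = 1])
     (use inv in \<open>auto simp: transpose_def\<close>)

lemma E7_swap_admissible:
  assumes ty: "of_type 8 E7_edges Q"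
    and inv: "G_invariant 8 (generate (sym_group 8) {transpose 3 6 \<circ> transpose 4 7 \<circ> transpose 5 8}) Q"
  shows "G_admissible 8 (generate (sym_group 8) {transpose 3 6 \<circ> transpose 4 7 \<circ> transpose 5 8}) Q"
  by (rule affine_quiver_type.admissible_generated_involution[OF E7_affine(1) ty E7_affine(2), where f = 1])
     (use inv in \<open>auto simp: transpose_def\<close>)

section \<open>Cycles\<close>

text \<open>Since the entries sum to zero without all vanishing, one is positive and one negative.
  Each of these uses at least 1 of the total 2, so nothing is left for the rest.\<close>

lemma sum_squares_two:
  fixes u :: "'a \<Rightarrow> int"
  assumes fin: "finite I" and sq: "(\<Sum>v\<in>I. u v * u v) = 2" and s: "(\<Sum>v\<in>I. u v) = 0"
  obtains a b where "a \<in> I" "b \<in> I" "a \<noteq> b"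
    "\<And>v. v \<in> I \<Longrightarrow> u v = (if v = a then 1 else 0) - (if v = b then 1 else 0)"
proof -
  have "\<exists>a\<in>I. 0 < u a"
  proof (rule ccontr)
    assume "\<not> ?thesis"
    then have "\<And>v. v \<in> I \<Longrightarrow> 0 \<le> - u v" by (simp add: not_less)
    moreover have "(\<Sum>v\<in>I. - u v) = 0" using s by (simp add: sum_negf)
    ultimately have "\<forall>v\<in>I. u v = 0" using sum_nonneg_eq_0_iff[OF fin, of "\<lambda>v. - u v"] by simp
    then show False using sq by simp
  qed
  then obtain a where a: "a \<in> I" "0 < u a" by blast
  have "\<exists>b\<in>I. u b < 0"
  proof (rule ccontr)
    assume "\<not> ?thesis"
    then have "\<And>v. v \<in> I \<Longrightarrow> 0 \<le> u v" by (simp add: not_less)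
    then have "\<forall>v\<in>I. u v = 0" using s sum_nonneg_eq_0_iff[OF fin, of u] by simp
    then show False using sq by simp
  qed
  then obtain b where b: "b \<in> I" "u b < 0" by blast
  have ab: "a \<noteq> b" using a b by auto
  have "(\<Sum>v\<in>I. u v * u v) = u a * u a + (u b * u b + (\<Sum>v\<in>I - {a} - {b}. u v * u v))"
    using fin a b ab by (simp add: sum.remove[of I a] sum.remove[of "I - {a}" b])
  moreover have "1 \<le> u a * u a" "1 \<le> u b * u b" using a b by (smt (verit) mult_le_0_iff)+
  moreover have nn: "0 \<le> (\<Sum>v\<in>I - {a} - {b}. u v * u v)" by (intro sum_nonneg) simp
  ultimately have "u a * u a = 1" "u b * u b = 1" "(\<Sum>v\<in>I - {a} - {b}. u v * u v) = 0" using sq by linarith+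
  moreover from this(3) have "u v * u v = 0" if "v \<in> I - {a} - {b}" for v
    using sum_nonneg_eq_0_iff[of "I - {a} - {b}" "\<lambda>v. u v * u v"] fin that by simp
  ultimately have "u a = 1" "u b = -1" "\<And>v. v \<in> I - {a} - {b} \<Longrightarrow> u v = 0"
    using a b by (auto simp: zmult_eq_1_iff)
  then show ?thesis using that[of a b] a b ab by auto
qed

text \<open>Orthogonality makes the supports of \<open>P\<close> and \<open>R\<close> disjoint, and
  likewise those of \<open>Q\<close> and \<open>S\<close>. If no factor vanishes, \<open>Q\<close>
  and \<open>S\<close> each join the support of \<open>P\<close> to that of \<open>R\<close>, using
  complementary ends. The two factors from \<open>Q\<close> and the two from \<open>S\<close> then
  have products of equal sign.\<close>

lemma root_square_sign:
  fixes P Q R S :: "'a \<Rightarrow> int"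
  assumes P: "P = (\<lambda>v. (if v = a then 1 else 0) - (if v = b then 1 else 0))"
    and Q: "Q = (\<lambda>v. (if v = p then 1 else 0) - (if v = q then 1 else 0))"
    and R: "R = (\<lambda>v. (if v = c then 1 else 0) - (if v = d then 1 else 0))"
    and S: "S = (\<lambda>v. (if v = x then 1 else 0) - (if v = y then 1 else 0))"
    and ne: "a \<noteq> b" "c \<noteq> d" "p \<noteq> q" "x \<noteq> y"
    and orth: "R a = R b" "S p = S q"
  shows "0 \<le> (Q a - Q b) * (Q c - Q d) * (S c - S d) * (S a - S b)"
proof (rule ccontr)
  assume neg: "\<not> ?thesis"
  have dis: "a \<noteq> c" "a \<noteq> d" "b \<noteq> c" "b \<noteq> d"
    using orth(1) ne unfolding R by (auto split: if_splits)
  have dis': "p \<noteq> x" "p \<noteq> y" "q \<noteq> x" "q \<noteq> y"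
    using orth(2) ne unfolding S by (auto split: if_splits)
  have nz: "Q a \<noteq> Q b" "Q c \<noteq> Q d" "S c \<noteq> S d" "S a \<noteq> S b" using neg by auto
  have Q': "(p \<in> {a, b} \<and> q \<in> {c, d}) \<or> (q \<in> {a, b} \<and> p \<in> {c, d})"
    using nz(1,2) ne dis unfolding Q by (auto split: if_splits)
  have S': "(x \<in> {a, b} \<and> y \<in> {c, d}) \<or> (y \<in> {a, b} \<and> x \<in> {c, d})"
    using nz(3,4) ne dis unfolding S by (auto split: if_splits)
  show False
    using neg Q' S' ne dis dis' dis[symmetric] ne(1,2)[symmetric] unfolding Q S by auto
qed

section \<open>Gram vectors of a cycle\<close>

locale cycle_type = affine_quiver_type X N \<delta> for X N \<delta> +
  fixes nx :: "nat \<Rightarrow> nat"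
  assumes nx: "bij_betw nx {1..N} {1..N}"
    and weight: "i \<in> {1..N} \<Longrightarrow> j \<in> {1..N} \<Longrightarrow>
      graph_weight X i j = (if j = nx i then 1 else 0) + (if i = nx j then 1 else 0)"
begin

text \<open>Differences along the cycle turn the symmetrized form into the standard scalar product
  on vectors of sum zero, where roots become differences of two unit vectors.\<close>

abbreviation diff :: "(nat \<Rightarrow> int) \<Rightarrow> nat \<Rightarrow> int" where
  "diff x v \<equiv> x v - x (nx v)"

lemma qf_cycle: "qf {1..N} x = (\<Sum>v\<in>{1..N}. diff x v * diff x v)"
proof -
  have nxI: "nx i \<in> {1..N}" if "i \<in> {1..N}" for i using nx that by (auto simp: bij_betw_def)
  have re: "(\<Sum>v\<in>{1..N}. f (nx v)) = (\<Sum>v\<in>{1..N}. f v)" for f :: "nat \<Rightarrow> int"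
    by (rule sum.reindex_bij_betw[OF nx])
  have one: "(\<Sum>j\<in>{1..N}. (if j = nx i then 1 else 0) * x i * x j) = x i * x (nx i)" if "i \<in> {1..N}" for i
  proof -
    have "(\<Sum>j\<in>{1..N}. (if j = nx i then 1 else 0) * x i * x j) = (\<Sum>j\<in>{1..N}. if j = nx i then x i * x (nx i) else 0)"
      by (intro sum.cong) auto
    then show ?thesis using nxI[OF that] by simp
  qed
  have "(\<Sum>i\<in>{1..N}. \<Sum>j\<in>{1..N}. graph_weight X i j * x i * x j)
     = (\<Sum>i\<in>{1..N}. \<Sum>j\<in>{1..N}. (if j = nx i then 1 else 0) * x i * x j)
       + (\<Sum>i\<in>{1..N}. \<Sum>j\<in>{1..N}. (if i = nx j then 1 else 0) * x i * x j)"
    unfolding sum.distrib[symmetric] by (intro sum.cong refl) (simp only: weight distrib_right)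
  also have "(\<Sum>i\<in>{1..N}. \<Sum>j\<in>{1..N}. (if i = nx j then 1 else 0) * x i * x j)
     = (\<Sum>j\<in>{1..N}. \<Sum>i\<in>{1..N}. (if i = nx j then 1 else 0) * x j * x i)"
    by (subst sum.swap) (intro sum.cong refl, simp)
  also have "(\<Sum>i\<in>{1..N}. \<Sum>j\<in>{1..N}. (if j = nx i then 1 else 0) * x i * x j) = (\<Sum>i\<in>{1..N}. x i * x (nx i))"
    by (intro sum.cong refl one)
  finally have "(\<Sum>i\<in>{1..N}. \<Sum>j\<in>{1..N}. graph_weight X i j * x i * x j) = 2 * (\<Sum>i\<in>{1..N}. x i * x (nx i))"
    by simp
  moreover have "(\<Sum>v\<in>{1..N}. diff x v * diff x v)
     = (\<Sum>v\<in>{1..N}. x v * x v) + (\<Sum>v\<in>{1..N}. x (nx v) * x (nx v)) - 2 * (\<Sum>i\<in>{1..N}. x i * x (nx i))"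
    by (simp add: algebra_simps sum.distrib sum_subtractf sum_distrib_left)
  moreover have "(\<Sum>v\<in>{1..N}. x (nx v) * x (nx v)) = (\<Sum>v\<in>{1..N}. x v * x v)"
    by (rule re)
  ultimately show ?thesis by (simp add: qf_def)
qed

lemma sym_cycle:
  assumes "distinct L" "set L = {1..N}"
  shows "sym L x y = (\<Sum>v\<in>{1..N}. diff x v * diff y v)"
proof -
  let ?z = "\<lambda>v. x v + 1 * y v"
  have e: "2 * eul L z z = (\<Sum>v\<in>{1..N}. diff z v * diff z v)" for z
    using eul_qf[OF assms(1), of z] assms(2) qf_cycle by simp
  have "eul L ?z ?z = eul L x x + eul L y y + sym L x y"
    unfolding eul_add_left eul_add_right sym_def by simp
  then have "2 * sym L x y = 2 * eul L ?z ?z - 2 * eul L x x - 2 * eul L y y" by simp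
  also have "\<dots> = (\<Sum>v\<in>{1..N}. diff ?z v * diff ?z v) - (\<Sum>v\<in>{1..N}. diff x v * diff x v) - (\<Sum>v\<in>{1..N}. diff y v * diff y v)"
    unfolding e ..
  also have "\<dots> = (\<Sum>v\<in>{1..N}. 2 * (diff x v * diff y v))"
    unfolding sum_subtractf[symmetric] by (intro sum.cong refl) (simp add: algebra_simps)
  finally show ?thesis by (simp add: sum_distrib_left[symmetric])
qed

text \<open>Oriented squares without diagonals are excluded outright, with no reference to a
  symmetry. This is what the involution (1 4)(2 3) of the 4-cycle calls for, since it fixes no
  vertex and the graph is not a tree.\<close>

lemma no_square:
  assumes L: "distinct L" "set L = {1..N}" and co: "companion L B A"
    and I: "i \<in> {1..N}" "j \<in> {1..N}" "k \<in> {1..N}" "l \<in> {1..N}" and ne: "i \<noteq> k" "j \<noteq> l"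
    and pos: "0 < B i j" "0 < B j k" "0 < B k l" "0 < B l i" and zero: "B i k = 0" "B j l = 0"
  shows False
proof -
  obtain c where f: "family L B c"
    and A: "\<And>i j. i \<in> {1..N} \<Longrightarrow> j \<in> {1..N} \<Longrightarrow> A i j = sym L (c i) (c j)"
    using co unfolding companion_def by blast
  note F = familyD[OF f]
  have "\<exists>a b. a \<in> {1..N} \<and> b \<in> {1..N} \<and> a \<noteq> b \<and>
      (\<forall>v\<in>{1..N}. diff (c i) v = (if v = a then 1 else 0) - (if v = b then 1 else 0))" if "i \<in> {1..N}" for i
  proof -
    have "sym L (c i) (c i) = 2" using F(1)[OF that] by (simp add: sym_def)
    then have "(\<Sum>v\<in>{1..N}. diff (c i) v * diff (c i) v) = 2" using sym_cycle[OF L] by simp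
    moreover have "(\<Sum>v\<in>{1..N}. diff (c i) v) = 0"
      using sum.reindex_bij_betw[OF nx, of "c i"] by (simp add: sum_subtractf)
    ultimately show ?thesis
      using sum_squares_two[of "{1..N}" "\<lambda>v. diff (c i) v"] by (metis finite_atLeastAtMost)
  qed
  then obtain a b where ab: "\<And>i. i \<in> {1..N} \<Longrightarrow> a i \<in> {1..N}" "\<And>i. i \<in> {1..N} \<Longrightarrow> b i \<in> {1..N}"
      "\<And>i. i \<in> {1..N} \<Longrightarrow> a i \<noteq> b i"
      "\<And>i v. i \<in> {1..N} \<Longrightarrow> v \<in> {1..N} \<Longrightarrow> diff (c i) v = (if v = a i then 1 else 0) - (if v = b i then 1 else 0)"
    by metis
  define D where "D i = (\<lambda>v. (if v = a i then 1 else (0::int)) - (if v = b i then 1 else 0))" for i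
  have val: "A i j = D j (a i) - D j (b i)" if ij: "i \<in> {1..N}" "j \<in> {1..N}" for i j
  proof -
    have "A i j = (\<Sum>v\<in>{1..N}. diff (c i) v * diff (c j) v)" using A[OF ij] sym_cycle[OF L] by simp
    also have "\<dots> = (\<Sum>v\<in>{1..N}. (if v = a i then D j (a i) else 0) - (if v = b i then D j (b i) else 0))"
      by (intro sum.cong refl) (auto simp: ab(4)[OF ij(1)] ab(4)[OF ij(2)] D_def)
    also have "\<dots> = D j (a i) - D j (b i)"
      using ab(1,2)[OF ij(1)] by (simp add: sum_subtractf)
    finally show ?thesis .
  qed
  note Co = companion_basic[OF co]
  have 1: "A i j * A j k * A k l * A l i < 0"
    by (rule companion_four_cycle[OF L co I ne pos zero])
  have 2: "A i j * A k j * A k l * A i l < 0"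
    using 1 unfolding Co(1)[OF I(2,3)] Co(1)[OF I(4,1)] .
  have z: "A i k = 0" "A j l = 0" using Co(3)[OF I(1,3) ne(1)] Co(3)[OF I(2,4) ne(2)] zero by auto
  have "0 \<le> (D j (a i) - D j (b i)) * (D j (a k) - D j (b k)) * (D l (a k) - D l (b k)) * (D l (a i) - D l (b i))"
  proof (rule root_square_sign[OF D_def[of i] D_def[of j] D_def[of k] D_def[of l]])
    show "a i \<noteq> b i" "a k \<noteq> b k" "a j \<noteq> b j" "a l \<noteq> b l" using ab(3) I by blast+
    show "D k (a i) = D k (b i)" "D l (a j) = D l (b j)"
      using z val[OF I(1,3)] val[OF I(2,4)] by linarith+
  qed
  then have "0 \<le> A i j * A k j * A k l * A i l"
    unfolding val[OF I(1,2)] val[OF I(3,2)] val[OF I(3,4)] val[OF I(1,4)] .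
  then show False using 2 by linarith
qed

lemma admissible_generated_involution_cycle:
  assumes ty: "quiver N Q0" "acyclic (set_mset Q0)" "has_underlying_graph Q0 X" "mutation_equivalent N Q Q0"
    and s: "\<And>x. s (s x) = x" "\<And>x. x \<notin> {1..N} \<Longrightarrow> s x = x"
    and inv: "G_invariant N (generate (sym_group N) {s}) Q"
  shows "G_admissible N (generate (sym_group N) {s}) Q"
proof -
  obtain L A where L: "distinct L" "set L = {1..N}" "companion L (adj Q) A"
    by (rule of_type_structure[OF ty]) (rule that; assumption)
  have sI: "s i \<in> {1..N}" if "i \<in> {1..N}" for i
  proof -
    have "s permutes {1..N}" using s by (rule permutes_involution)
    then show ?thesis using permutes_in_image[of s "{1..N}" i] that by blast
  qed
  have sinv: "adj Q (s i) (s j) = adj Q i j" if "i \<in> {1..N}" "j \<in> {1..N}" for i j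
  proof -
    have "s \<in> generate (sym_group N) {s}" by (rule generate.incl) simp
    then show ?thesis using inv[unfolded G_invariant_def, rule_format] that by simp
  qed
  have zero: "adj Q i (s i) = 0" if "i \<in> {1..N}" for i
  proof -
    have "adj Q (s i) i = adj Q i (s i)" using sinv[OF that sI[OF that]] s(1) by simp
    then show ?thesis using adj_skew[of Q i "s i"] by linarith
  qed
  have no: False if ij: "i \<in> {1..N}" "j \<in> {1..N}" "0 < adj Q i j" "adj Q (s i) j < 0" for i j
  proof (rule no_square[OF L ij(1,2) sI[OF ij(1)] sI[OF ij(2)]])
    show "i \<noteq> s i" using ij by auto
    show "j \<noteq> s j"
    proof
      assume "j = s j"
      then have "adj Q (s i) j = adj Q i j" using sinv[OF ij(1,2)] by simp
      then show False using ij by simp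
    qed
    show "0 < adj Q i j" by (rule ij)
    show jg: "0 < adj Q j (s i)" using ij adj_skew[of Q "s i" j] by simp
    show "0 < adj Q (s i) (s j)" using sinv[OF ij(1,2)] ij by simp
    show "0 < adj Q (s j) i" using sinv[OF ij(2) sI[OF ij(1)]] jg s(1) by simp
    show "adj Q i (s i) = 0" "adj Q j (s j) = 0" using zero ij by blast+
  qed
  have "adj Q i i' = 0 \<and> (\<forall>j\<in>{1..N}. adj Q i j * adj Q i' j \<ge> 0)"
    if i: "i \<in> {1..N}" and o: "same_orbit (generate (sym_group N) {s}) i i'" for i i'
  proof -
    obtain g where g: "g \<in> generate (sym_group N) {s}" "g i = i'" using o unfolding same_orbit_def by blast
    have "g = id \<or> g = s" using generate_involution[OF s g(1)] .
    then show ?thesis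
    proof
      assume "g = id"
      then have "i' = i" using g(2) by simp
      then show ?thesis by (simp add: adj_def)
    next
      assume "g = s"
      then have i': "i' = s i" using g(2) by simp
      have "0 \<le> adj Q i j * adj Q (s i) j" if j: "j \<in> {1..N}" for j
      proof (rule ccontr)
        assume "\<not> ?thesis"
        then have "(0 < adj Q i j \<and> adj Q (s i) j < 0) \<or> (adj Q i j < 0 \<and> 0 < adj Q (s i) j)"
          by (simp add: not_le mult_less_0_iff)
        then show False using no[OF i j] no[OF sI[OF i] j] unfolding s(1) by blast
      qed
      then show ?thesis unfolding i' using zero[OF i] by (intro conjI ballI)
    qed
  qed
  then show ?thesis using inv unfolding G_admissible_def by (intro conjI ballI impI) simp_all
qed

end

section \<open>The labelled cycle\<close>

text \<open>The traversal 1, 2, ..., n, 2n, 2n - 1, ..., n + 1 and back to 1.\<close>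

definition A_next :: "nat \<Rightarrow> nat \<Rightarrow> nat" where
  "A_next n i = (if i < n then i + 1 else if i = n then 2 * n else if i = n + 1 then 1 else i - 1)"

definition A_prev :: "nat \<Rightarrow> nat \<Rightarrow> nat" where
  "A_prev n i = (if i = 1 then n + 1 else if i \<le> n then i - 1 else if i = 2 * n then n else i + 1)"

lemma A_next_bij:
  assumes "2 \<le> n"
  shows "bij_betw (A_next n) {1..2 * n} {1..2 * n}"
proof (rule bij_betw_byWitness[where f' = "A_prev n"])
  show "\<forall>i\<in>{1..2 * n}. A_prev n (A_next n i) = i"
    using assms unfolding A_prev_def A_next_def by auto
  show "\<forall>i\<in>{1..2 * n}. A_next n (A_prev n i) = i"
    using assms unfolding A_prev_def A_next_def by auto
  show "A_next n ` {1..2 * n} \<subseteq> {1..2 * n}" using assms unfolding A_next_def by auto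
  show "A_prev n ` {1..2 * n} \<subseteq> {1..2 * n}" using assms unfolding A_prev_def by auto
qed

lemma A_edges_next:
  assumes n: "2 \<le> n"
  shows "A_edges n = (\<lambda>i. {i, A_next n i}) ` {1..2 * n}"
proof -
  have 1: "{1..2 * n} = {1..n - 1} \<union> {n, n + 1} \<union> {n + 2..2 * n}" using n by auto
  have 2: "(\<lambda>i. {i, A_next n i}) ` {1..n - 1} = {{i, i + 1} | i. 1 \<le> i \<and> i \<le> n - 1}"
  proof (rule Set.set_eqI, rule iffI)
    fix e assume "e \<in> (\<lambda>i. {i, A_next n i}) ` {1..n - 1}"
    then obtain i where "i \<in> {1..n - 1}" "e = {i, A_next n i}" by (rule imageE)
    moreover from this have "A_next n i = i + 1" using n unfolding A_next_def by auto
    ultimately have "e = {i, i + 1} \<and> 1 \<le> i \<and> i \<le> n - 1" by simp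
    then show "e \<in> {{i, i + 1} | i. 1 \<le> i \<and> i \<le> n - 1}" by blast
  next
    fix e assume "e \<in> {{i, i + 1} | i. 1 \<le> i \<and> i \<le> n - 1}"
    then obtain i where i: "e = {i, i + 1}" "1 \<le> i" "i \<le> n - 1" by blast
    then have "e = {i, A_next n i}" "i \<in> {1..n - 1}" using n by (auto simp: A_next_def)
    then show "e \<in> (\<lambda>i. {i, A_next n i}) ` {1..n - 1}" by (rule image_eqI)
  qed
  have 3: "(\<lambda>i. {i, A_next n i}) ` {n + 2..2 * n} = {{j, j + 1} | j. n + 1 \<le> j \<and> j \<le> 2 * n - 1}"
  proof (rule Set.set_eqI, rule iffI)
    fix e assume "e \<in> (\<lambda>i. {i, A_next n i}) ` {n + 2..2 * n}"
    then obtain i where i: "e = {i, A_next n i}" "i \<in> {n + 2..2 * n}" by (rule imageE)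
    then have "A_next n i = i - 1" "(i - 1) + 1 = i" by (simp_all add: A_next_def)
    moreover have "n + 1 \<le> i - 1" "i - 1 \<le> 2 * n - 1" using i(2) by auto
    ultimately have "e = {i - 1, (i - 1) + 1} \<and> n + 1 \<le> i - 1 \<and> i - 1 \<le> 2 * n - 1"
      using i(1) by (simp add: insert_commute)
    then show "e \<in> {{j, j + 1} | j. n + 1 \<le> j \<and> j \<le> 2 * n - 1}" by blast
  next
    fix e assume "e \<in> {{j, j + 1} | j. n + 1 \<le> j \<and> j \<le> 2 * n - 1}"
    then obtain j where j: "e = {j, j + 1}" "n + 1 \<le> j" "j \<le> 2 * n - 1" by blast
    have "A_next n (j + 1) = j" using j by (simp add: A_next_def)
    then have "e = {j + 1, A_next n (j + 1)}" using j(1) by (simp add: insert_commute)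
    moreover have "j + 1 \<in> {n + 2..2 * n}" using j n by simp
    ultimately show "e \<in> (\<lambda>i. {i, A_next n i}) ` {n + 2..2 * n}" by (rule image_eqI)
  qed
  have 4: "(\<lambda>i. {i, A_next n i}) ` {n, n + 1} = {{n, 2 * n}, {1, n + 1}}"
    by (simp add: A_next_def insert_commute)
  show ?thesis unfolding A_edges_def 1 image_Un 2 3 4 ..
qed

lemma A_next_ne:
  assumes "2 \<le> n" "i \<in> {1..2 * n}"
  shows "A_next n i \<noteq> i" "A_next n (A_next n i) \<noteq> i"
  using assms unfolding A_next_def by auto

lemma A_weight:
  assumes n: "2 \<le> n" and ij: "i \<in> {1..2 * n}" "j \<in> {1..2 * n}"
  shows "graph_weight (A_edges n) i j = (if j = A_next n i then 1 else 0) + (if i = A_next n j then 1 else 0)"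
proof -
  have "{i, j} \<in> A_edges n \<longleftrightarrow> (\<exists>v\<in>{1..2 * n}. {i, j} = {v, A_next n v})"
    unfolding A_edges_next[OF n] by (simp only: image_iff)
  also have "\<dots> \<longleftrightarrow> (\<exists>v\<in>{1..2 * n}. i = v \<and> j = A_next n v \<or> i = A_next n v \<and> j = v)"
    by (simp only: doubleton_eq_iff)
  finally have e: "{i, j} \<in> A_edges n \<longleftrightarrow> j = A_next n i \<or> i = A_next n j" using ij by auto
  have "\<not> (j = A_next n i \<and> i = A_next n j)" using A_next_ne(2)[OF n ij(1)] by auto
  moreover have "j = A_next n i \<Longrightarrow> i \<noteq> j" "i = A_next n j \<Longrightarrow> i \<noteq> j"
    using A_next_ne(1)[OF n ij(1)] A_next_ne(1)[OF n ij(2)] by auto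
  ultimately show ?thesis unfolding graph_weight_def e by auto
qed

lemma A_cycle:
  assumes n: "2 \<le> n"
  shows "cycle_type (A_edges n) (2 * n) (\<lambda>i. if i \<in> {1..2 * n} then 1 else 0) (A_next n)"
proof -
  interpret weighted_graph "graph_weight (A_edges n)" by (rule weighted_graph_weight)
  have nxI: "A_next n i \<in> {1..2 * n}" if "i \<in> {1..2 * n}" for i
    using A_next_bij[OF n] that by (auto simp: bij_betw_def)
  show ?thesis
  proof unfold_locales
    show "finite {1..2 * n}" "finite (A_edges n)" by (simp_all add: A_edges_next[OF n])
    show "{1..2 * n} \<noteq> {}" using n by simp
    show "bij_betw (A_next n) {1..2 * n} {1..2 * n}" by (rule A_next_bij[OF n])
    show "graph_weight (A_edges n) i j = (if j = A_next n i then 1 else 0) + (if i = A_next n j then 1 else 0)"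
      if "i \<in> {1..2 * n}" "j \<in> {1..2 * n}" for i j by (rule A_weight[OF n that])
    show "(0::int) < (if i \<in> {1..2 * n} then 1 else 0)" if "i \<in> {1..2 * n}" for i using that by simp
    show "(if i \<in> {1..2 * n} then 1 else (0::int)) = 0" if "i \<notin> {1..2 * n}" for i using that by simp
    show "(\<Sum>j\<in>{1..2 * n}. graph_weight (A_edges n) j i * (if j \<in> {1..2 * n} then 1 else 0))
        = 2 * (if i \<in> {1..2 * n} then 1 else 0)" if i: "i \<in> {1..2 * n}" for i
    proof -
      have "(\<Sum>j\<in>{1..2 * n}. graph_weight (A_edges n) j i * (if j \<in> {1..2 * n} then 1 else 0))
         = (\<Sum>j\<in>{1..2 * n}. if i = A_next n j then 1 else 0) + (\<Sum>j\<in>{1..2 * n}. if j = A_next n i then 1 else 0)"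
        unfolding sum.distrib[symmetric] by (intro sum.cong refl) (simp add: A_weight[OF n _ i])
      also have "(\<Sum>j\<in>{1..2 * n}. if i = A_next n j then 1 else (0::int)) = (\<Sum>j\<in>{1..2 * n}. if i = j then 1 else 0)"
        by (rule sum.reindex_bij_betw[OF A_next_bij[OF n], of "\<lambda>j. if i = j then 1 else 0"])
      finally show ?thesis using i nxI[OF i] by simp
    qed
    fix S assume S: "S \<subseteq> {1..2 * n}" "S \<noteq> {}"
      and z: "\<And>i j. i \<in> S \<Longrightarrow> j \<in> {1..2 * n} - S \<Longrightarrow> graph_weight (A_edges n) i j = 0"
    have nx: "i \<in> S \<longleftrightarrow> A_next n i \<in> S" if "i \<in> {1..2 * n}" for i
    proof -
      have "graph_weight (A_edges n) i (A_next n i) \<noteq> 0" "graph_weight (A_edges n) (A_next n i) i \<noteq> 0"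
        using A_weight[OF n that nxI[OF that]] A_weight[OF n nxI[OF that] that] by auto
      then show ?thesis using z[of i "A_next n i"] z[of "A_next n i" i] that nxI[OF that] by blast
    qed
    have low: "i \<in> S \<longleftrightarrow> 1 \<in> S" if "1 \<le> i" "i \<le> n" for i
      using that
    proof (induction i rule: dec_induct)
      case (step i)
      then have "i \<in> S \<longleftrightarrow> i + 1 \<in> S" using nx[of i] by (simp add: A_next_def)
      then show ?case using step by simp
    qed simp
    have high: "j \<in> S \<longleftrightarrow> 1 \<in> S" if "n + 1 \<le> j" "j \<le> 2 * n" for j
      using that
    proof (induction j rule: dec_induct)
      case base
      then show ?case using nx[of "n + 1"] by (simp add: A_next_def)
    next
      case (step j)
      then have "Suc j \<in> S \<longleftrightarrow> j \<in> S" using nx[of "Suc j"] by (simp add: A_next_def)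
      then show ?case using step by simp
    qed
    have "i \<in> S \<longleftrightarrow> 1 \<in> S" if "i \<in> {1..2 * n}" for i
      using low[of i] high[of i] that by (cases "i \<le> n") auto
    then show "S = {1..2 * n}" using S by blast
  qed
qed

lemma tau_facts:
  assumes "2 \<le> n"
  shows "tau n (tau n x) = x" "x \<notin> {1..2 * n} \<Longrightarrow> tau n x = x"
  using assms unfolding tau_def by auto

lemma A_admissible:
  assumes n: "2 \<le> n" and N: "N = 2 * n" and ty: "of_type_A N (A_edges n) c p q Q"
    and s: "\<And>x. s (s x) = x" "\<And>x. x \<notin> {1..N} \<Longrightarrow> s x = x"
    and inv: "G_invariant N (generate (sym_group N) {s}) Q"
  shows "G_admissible N (generate (sym_group N) {s}) Q"
proof -
  obtain Q0 where "quiver N Q0" "acyclic (set_mset Q0)" "has_underlying_graph Q0 (A_edges n)"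
    "mutation_equivalent N Q Q0"
    using ty unfolding of_type_A_def by (elim exE conjE)
  then show ?thesis
    using s inv by (rule cycle_type.admissible_generated_involution_cycle[OF A_cycle[OF n, folded N]])
qed

lemma A2_edges: "{{1, 2}, {2, 4}, {4, 3}, {3, 1}} = A_edges 2"
proof -
  have "{{i, i + 1} | i::nat. 1 \<le> i \<and> i \<le> 2 - 1} = {{1, 2}}"
  proof -
    have "1 \<le> i \<and> i \<le> 2 - 1 \<longleftrightarrow> i = 1" for i :: nat by auto
    then show ?thesis by (simp add: numeral_2_eq_2)
  qed
  moreover have "{{j, j + 1} | j::nat. 2 + 1 \<le> j \<and> j \<le> 2 * 2 - 1} = {{3, 4}}"
  proof -
    have "2 + 1 \<le> j \<and> j \<le> 2 * 2 - 1 \<longleftrightarrow> j = 3" for j :: nat by auto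
    then show ?thesis by simp
  qed
  ultimately show ?thesis unfolding A_edges_def by (simp add: insert_commute)
qed

lemma A2_admissible:
  assumes ty: "of_type_A 4 {{1, 2}, {2, 4}, {4, 3}, {3, 1}} c p q Q"
    and inv: "G_invariant 4 (generate (sym_group 4) {transpose 1 4 \<circ> transpose 2 3}) Q"
  shows "G_admissible 4 (generate (sym_group 4) {transpose 1 4 \<circ> transpose 2 3}) Q"
proof -
  let ?s = "transpose 1 4 \<circ> transpose 2 3 :: nat \<Rightarrow> nat"
  have s: "?s (?s x) = x" "x \<notin> {1..2 * 2} \<Longrightarrow> ?s x = x" for x by (auto simp: transpose_def)
  have s': "x \<notin> {1..4} \<Longrightarrow> ?s x = x" for x using s(2)[of x] by simp
  show ?thesis
    by (rule A_admissible[of 2, OF _ _ ty[unfolded A2_edges] s(1) s' inv]) simp_all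
qed

section \<open>Rotations of order three\<close>

lemma permutes_order_three:
  assumes "\<And>x. f (f (f x)) = x" "\<And>x. x \<notin> S \<Longrightarrow> f x = x"
  shows "f permutes S"
  unfolding permutes_def using assms by metis

lemma generate_order_three:
  assumes s: "\<And>x. s (s (s x)) = x" "\<And>x. x \<notin> {1..N} \<Longrightarrow> s x = x" and g: "g \<in> generate (sym_group N) {s}"
  shows "g = id \<or> g = s \<or> g = s \<circ> s"
proof -
  have c: "s \<in> carrier (sym_group N)" "s \<circ> s \<in> carrier (sym_group N)"
    using permutes_order_three[of s "{1..N}"] permutes_order_three[of "s \<circ> s" "{1..N}"] s sym_group_carrier by simp_all
  have sss: "s \<circ> (s \<circ> s) = id" using s(1) by (simp add: fun_eq_iff)
  have inv: "inv\<^bsub>sym_group N\<^esub> s = s \<circ> s"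
    using sym_group_inv[OF c] sss by (simp add: comp_assoc)
  show ?thesis
    using g
  proof (induction rule: generate.induct)
    case one
    then show ?case by (simp add: sym_group_def)
  next
    case (inv h)
    then show ?case using \<open>inv\<^bsub>sym_group N\<^esub> s = s \<circ> s\<close> by simp
  next
    case (eng h1 h2)
    have "h1 \<circ> h2 = id \<or> h1 \<circ> h2 = s \<or> h1 \<circ> h2 = s \<circ> s"
      using eng.IH s(1) by (elim disjE) (simp_all add: fun_eq_iff)
    then show ?case unfolding sym_group_mult .
  qed simp
qed

text \<open>The square of the generator reduces to the generator itself: the pair \<open>i\<close>,
  \<open>s (s i)\<close> is the pair \<open>s k\<close>, \<open>k\<close> for
  \<open>k = s (s i)\<close>.\<close>

lemma admissible_order_three:
  assumes s: "\<And>x. s (s (s x)) = x" "\<And>x. x \<notin> {1..N} \<Longrightarrow> s x = x"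
    and inv: "G_invariant N (generate (sym_group N) {s}) Q"
    and zero: "\<And>i. i \<in> {1..N} \<Longrightarrow> adj Q i (s i) = 0"
    and sgn: "\<And>i j. i \<in> {1..N} \<Longrightarrow> j \<in> {1..N} \<Longrightarrow> 0 \<le> adj Q i j * adj Q (s i) j"
  shows "G_admissible N (generate (sym_group N) {s}) Q"
proof -
  have sI: "s i \<in> {1..N}" if "i \<in> {1..N}" for i
  proof -
    have "s permutes {1..N}" using s by (rule permutes_order_three)
    then show ?thesis using permutes_in_image[of s "{1..N}" i] that by blast
  qed
  have "adj Q i i' = 0 \<and> (\<forall>j\<in>{1..N}. adj Q i j * adj Q i' j \<ge> 0)"
    if i: "i \<in> {1..N}" and o: "same_orbit (generate (sym_group N) {s}) i i'" for i i'
  proof -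
    obtain g where g: "g \<in> generate (sym_group N) {s}" "g i = i'" using o unfolding same_orbit_def by blast
    have "g = id \<or> g = s \<or> g = s \<circ> s" using s g(1) by (rule generate_order_three)
    then have "i' = i \<or> i' = s i \<or> i' = s (s i)" using g(2) by auto
    then show ?thesis
    proof (elim disjE)
      assume "i' = i"
      then show ?thesis by (simp add: adj_def)
    next
      assume "i' = s i"
      then show ?thesis using zero[OF i] sgn[OF i] by simp
    next
      assume i': "i' = s (s i)"
      have k: "s (s i) \<in> {1..N}" using sI[OF sI[OF i]] .
      have "adj Q (s (s i)) i = 0" using zero[OF k] unfolding s(1) .
      moreover have "0 \<le> adj Q i j * adj Q (s (s i)) j" if "j \<in> {1..N}" for j
        using sgn[OF k that] unfolding s(1) by (simp only: mult.commute)
      ultimately show ?thesis unfolding i' using adj_skew[of Q i "s (s i)"] by simp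
    qed
  qed
  then show ?thesis using inv unfolding G_admissible_def by (intro conjI ballI impI) simp_all
qed

context affine_graph begin

text \<open>Otherwise \<open>f\<close> would be the apex of three triangles that are not oriented,
  each with negative product. Multiplied together they give a square times the product along the
  orbit, which is positive because the orbit is an oriented triangle.\<close>

lemma fixed_vertex_orbit_triangle:
  assumes L: "distinct L" "set L = I" and co: "companion L B A"
    and I: "f \<in> I" "x \<in> I" "y \<in> I" "z \<in> I" and e: "B x y = B y z" "B y z = B z x" "B x y \<noteq> 0"
    and f: "B f x = B f y" "B f y = B f z"
  shows "B f x = 0"
proof (rule ccontr)
  assume nz: "B f x \<noteq> 0"
  then have p: "0 < B f x * B f x" by (simp add: zero_less_mult_iff) linarith
  have t: "A f x * A f y * A x y < 0" "A f y * A f z * A y z < 0" "A f z * A f x * A z x < 0"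
    using companion_triangle_apex[OF L co I(1) I(2,3)] companion_triangle_apex[OF L co I(1) I(3,4)]
      companion_triangle_apex[OF L co I(1) I(4,2)] p f e by auto
  have "(A f x * A f y * A x y) * (A f y * A f z * A y z) * (A f z * A f x * A z x) < 0"
    by (rule mult_pos_neg[OF mult_neg_neg[OF t(1,2)] t(3)])
  moreover have "(A f x * A f y * A x y) * (A f y * A f z * A y z) * (A f z * A f x * A z x)
     = (A f x * A f y * A f z) * (A f x * A f y * A f z) * (A x y * A y z * A z x)"
    by (simp add: algebra_simps)
  moreover have "0 \<le> (A f x * A f y * A f z) * (A f x * A f y * A f z) * (A x y * A y z * A z x)"
    using orbit_triangle_sign[OF L co I(2-4) e] by (intro mult_nonneg_nonneg[OF zero_le_square]) simp
  ultimately show False by linarith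
qed

end

lemma D4_order_three_admissible:
  assumes ty: "of_type 5 D4_edges Q"
    and inv: "G_invariant 5 (generate (sym_group 5) {cycle_of_list [3, 4, 5]}) Q"
  shows "G_admissible 5 (generate (sym_group 5) {cycle_of_list [3, 4, 5]}) Q"
proof -
  let ?d = "\<lambda>i::nat. if i = 1 then 2 else if i \<in> {2..5} then 1 else (0::int)"
  interpret affine_quiver_type D4_edges 5 ?d by (rule D4_affine(1))
  define g :: "nat \<Rightarrow> nat" where "g = cycle_of_list [3, 4, 5]"
  have gv: "g 1 = 1" "g 2 = 2" "g 3 = 4" "g 4 = 5" "g 5 = 3" by (simp_all add: g_def transpose_def)
  have g3: "g (g (g x)) = x" "x \<notin> {1..5} \<Longrightarrow> g x = x" for x by (auto simp: g_def transpose_def)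
  obtain Q0 where Q0: "quiver 5 Q0" "acyclic (set_mset Q0)" "has_underlying_graph Q0 D4_edges"
    "mutation_equivalent 5 Q Q0"
    using ty unfolding of_type_def by (elim exE conjE)
  obtain L A where L: "distinct L" "set L = {1..5}" "companion L (adj Q) A" and cn: "connected_matrix (adj Q)"
    by (rule of_type_structure[OF Q0]) (rule that; assumption)
  have I: "{1..5} = {1, 2, 3, 4, 5::nat}" by auto
  have gi: "adj Q (g i) (g j) = adj Q i j" if "i \<in> {1..5}" "j \<in> {1..5}" for i j
  proof -
    have "g \<in> generate (sym_group 5) {cycle_of_list [3, 4, 5]}" unfolding g_def by (rule generate.incl) simp
    then show ?thesis using inv[unfolded G_invariant_def, rule_format] that by simp
  qed
  have e: "adj Q 3 4 = adj Q 4 5" "adj Q 4 5 = adj Q 5 3" "adj Q 1 3 = adj Q 1 4" "adj Q 1 4 = adj Q 1 5"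
    "adj Q 2 3 = adj Q 2 4" "adj Q 2 4 = adj Q 2 5"
    using gi[of 3 4] gi[of 4 5] gi[of 1 3] gi[of 1 4] gi[of 2 3] gi[of 2 4] unfolding gv by simp_all
  have m: "1 \<in> {1..5::nat}" "2 \<in> {1..5::nat}" "3 \<in> {1..5::nat}" "4 \<in> {1..5::nat}" "5 \<in> {1..5::nat}" by simp_all
  \<comment> \<open>If the orbit were an oriented triangle, both fixed vertices 1 and 2 would be cut
    off from it, against connectedness.\<close>
  have z34: "adj Q 3 4 = 0"
  proof (rule ccontr)
    assume nz: "adj Q 3 4 \<noteq> 0"
    have 1: "adj Q 1 3 = 0" by (rule fixed_vertex_orbit_triangle[OF L m(1) m(3-5) e(1,2) nz e(3,4)])
    have 2: "adj Q 2 3 = 0" by (rule fixed_vertex_orbit_triangle[OF L m(2) m(3-5) e(1,2) nz e(5,6)])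
    have "\<forall>i\<in>{1, 2}. \<forall>j\<in>{1..5} - {1, 2}. adj Q i j = 0" unfolding I using 1 2 e by auto
    moreover have "{1, 2} \<subseteq> {1..5::nat}" "{1, 2::nat} \<noteq> {}" using m by simp_all
    ultimately have "{1, 2} = {1..5::nat}" using cn unfolding connected_matrix_def by blast
    then show False using m(3) by auto
  qed
  have z: "adj Q i (g i) = 0" if "i \<in> {1..5}" for i
    using that z34 e(1,2) unfolding I by (auto simp: gv gv(1)[unfolded One_nat_def] adj_def)
  have zz: "adj Q i j = 0" if "i \<in> {3, 4, 5}" "j \<in> {3, 4, 5}" for i j
    using that z34 e(1,2) adj_skew[of Q 4 3] adj_skew[of Q 5 4] adj_skew[of Q 3 5] by (auto simp: adj_def)
  have sg: "0 \<le> adj Q i j * adj Q (g i) j" if ij: "i \<in> {1..5}" "j \<in> {1..5}" for i j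
  proof (cases "j \<in> {1, 2}")
    case True
    then have "g j = j" using gv by auto
    then show ?thesis using gi[OF ij] by simp
  next
    case j: False
    then have j: "j \<in> {3, 4, 5}" using ij unfolding I by blast
    show ?thesis
    proof (cases "i \<in> {1, 2}")
      case True
      then have "g i = i" using gv by auto
      then show ?thesis by simp
    next
      case False
      then show ?thesis using zz[OF _ j] ij unfolding I by auto
    qed
  qed
  show ?thesis
    using admissible_order_three[of g 5 Q, OF g3 inv[folded g_def] z sg] unfolding g_def .
qed

text \<open>The matrix below is the quotient of an invariant form by the rotation; \<open>\<tau>\<close> is the squared
  modulus of \<open>T0 + T1 \<omega> + T2 \<omega>\<^sup>2\<close> for a primitive third root of unity \<open>\<omega>\<close>.\<close>

lemma E6_invariant_arith:
  fixes F1 F2 P1 P2 T0 T1 T2 u v w :: int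
  defines "\<sigma> \<equiv> T0 + T1 + T2"
    and "\<tau> \<equiv> T0 * T0 + T1 * T1 + T2 * T2 - T0 * T1 - T1 * T2 - T0 * T2"
  assumes e1: "2 * u + 3 * F1 * v + 3 * F2 * w = 0"
    and e2: "F1 * u + (2 + 2 * P1) * v + \<sigma> * w = 0"
    and e3: "F2 * u + \<sigma> * v + (2 + 2 * P2) * w = 0"
    and nz: "\<not> (u = 0 \<and> v = 0 \<and> w = 0)"
    and P: "0 \<le> P1" "0 \<le> P2" "P1 \<le> 1" "P2 \<le> 1" "0 < P1 \<Longrightarrow> F1 = 0" "0 < P2 \<Longrightarrow> F2 = 0"
    and F: "\<not> (F1 = 0 \<and> F2 = 0)" "P1 = 0 \<Longrightarrow> \<bar>F1\<bar> \<le> 1" "P2 = 0 \<Longrightarrow> \<bar>F2\<bar> \<le> 1"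
    and tau: "\<tau> < (2 - P1) * (2 - P2)"
  shows "P1 = 0" "P2 = 0"
    "(T0 * T1 = 0 \<and> T1 * T2 = 0 \<and> T0 * T2 = 0) \<or>
     (\<forall>T\<in>{T0, T1, T2}. T \<noteq> 0 \<longrightarrow> 0 < F1 * F2 * T)"
proof -
  define a where "a = 2 + 2 * P1"
  define b where "b = 2 + 2 * P2"
  \<comment> \<open>The determinant of the matrix with rows \<open>(2, 3 * F1, 3 * F2)\<close>,
    \<open>(F1, a, \<sigma>)\<close>, \<open>(F2, \<sigma>, b)\<close>, where the factor 3 is the
    length of an orbit. The identities that follow are Cramer's rule; since the null vector is not
    zero, \<open>D = 0\<close>.\<close>
  define D where "D = 2 * (a * b - \<sigma> * \<sigma>) - 3 * F1 * (F1 * b - \<sigma> * F2) + 3 * F2 * (F1 * \<sigma> - F2 * a)"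
  note e = e1 e2[folded a_def] e3[folded b_def]
  have "D * u = (a * b - \<sigma> * \<sigma>) * (2 * u + 3 * F1 * v + 3 * F2 * w) - (3 * F1 * b - 3 * F2 * \<sigma>) * (F1 * u + a * v + \<sigma> * w)
      + (3 * F1 * \<sigma> - 3 * F2 * a) * (F2 * u + \<sigma> * v + b * w)"
    unfolding D_def by algebra
  then have du: "D * u = 0" unfolding e by simp
  have "D * v = - (F1 * b - \<sigma> * F2) * (2 * u + 3 * F1 * v + 3 * F2 * w) + (2 * b - 3 * F2 * F2) * (F1 * u + a * v + \<sigma> * w)
      - (2 * \<sigma> - 3 * F1 * F2) * (F2 * u + \<sigma> * v + b * w)"
    unfolding D_def by algebra
  then have dv: "D * v = 0" unfolding e by simp
  have "D * w = (F1 * \<sigma> - a * F2) * (2 * u + 3 * F1 * v + 3 * F2 * w) - (2 * \<sigma> - 3 * F1 * F2) * (F1 * u + a * v + \<sigma> * w)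
      + (2 * a - 3 * F1 * F1) * (F2 * u + \<sigma> * v + b * w)"
    unfolding D_def by algebra
  then have dw: "D * w = 0" unfolding e by simp
  have D: "D = 0" using du dv dw nz by auto
  have small: "T * T = 0 \<or> T * T = 1" if "T * T \<le> 2" for T :: int
  proof -
    have "\<bar>T\<bar> < 2"
    proof (rule ccontr)
      assume "\<not> ?thesis"
      then have "2 * 2 \<le> \<bar>T\<bar> * \<bar>T\<bar>" by (intro mult_mono) auto
      then show False using that by simp
    qed
    then have "T = 0 \<or> T = 1 \<or> T = -1" by linarith
    then show ?thesis by auto
  qed
  have sq: "y * y \<noteq> 2" for y :: int using small[of y] by auto
  have unit: "y * y = 1" if "y \<noteq> 0" "\<bar>y\<bar> \<le> 1" for y :: int
  proof -
    have "y = 1 \<or> y = -1" using that by linarith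
    then show ?thesis by auto
  qed
  \<comment> \<open>Here \<open>P1 = 1\<close> and \<open>F1 = 0\<close>, whence
    \<open>P2 = 0\<close> and \<open>F2 * F2 = 1\<close>; the determinant then requires \<sigma> to
    have square 2.\<close>
  have no1: "\<not> 0 < P1"
  proof
    assume p: "0 < P1"
    then have 1: "F1 = 0" "P1 = 1" using P by auto
    then have "F2 \<noteq> 0" using F(1) by simp
    then have "P2 = 0" using P by fastforce
    then have "F2 * F2 = 1" using unit[OF \<open>F2 \<noteq> 0\<close>] F(3) by simp
    have "2 * (8 - \<sigma> * \<sigma>) - 12 * (F2 * F2) = 0"
      using D unfolding D_def a_def b_def 1 \<open>P2 = 0\<close> by simp
    then have "\<sigma> * \<sigma> = 2" using \<open>F2 * F2 = 1\<close> by simp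
    then show False using sq by blast
  qed
  have no2: "\<not> 0 < P2"
  proof
    assume p: "0 < P2"
    then have 1: "F2 = 0" "P2 = 1" using P by auto
    then have "F1 \<noteq> 0" using F(1) by simp
    then have "P1 = 0" using P by fastforce
    then have "F1 * F1 = 1" using unit[OF \<open>F1 \<noteq> 0\<close>] F(2) by simp
    have "2 * (8 - \<sigma> * \<sigma>) - 12 * (F1 * F1) = 0"
      using D unfolding D_def a_def b_def 1 \<open>P1 = 0\<close> by simp
    then have "\<sigma> * \<sigma> = 2" using \<open>F1 * F1 = 1\<close> by simp
    then show False using sq by blast
  qed
  show p1: "P1 = 0" using no1 P by simp
  show p2: "P2 = 0" using no2 P by simp
  have D': "4 - \<sigma> * \<sigma> = 3 * (F1 * F1 + F2 * F2 - F1 * F2 * \<sigma>)"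
    using D unfolding D_def a_def b_def p1 p2 by (simp add: algebra_simps)
  define e2 where "e2 = T0 * T1 + T1 * T2 + T0 * T2"
  define q where "q = T0 * T0 + T1 * T1 + T2 * T2"
  have te: "\<tau> = \<sigma> * \<sigma> - 3 * e2" and qe: "q = \<sigma> * \<sigma> - 2 * e2"
    unfolding \<tau>_def \<sigma>_def e2_def q_def by algebra+
  have "2 * \<tau> = (T0 - T1) * (T0 - T1) + (T1 - T2) * (T1 - T2) + (T0 - T2) * (T0 - T2)"
    unfolding \<tau>_def by algebra
  then have t0: "0 \<le> \<tau>" using zero_le_square[of "T0 - T1"] zero_le_square[of "T1 - T2"] zero_le_square[of "T0 - T2"]
    by linarith
  have t4: "\<tau> < 4" using tau p1 p2 by simp
  have sqs: "0 \<le> T0 * T0" "0 \<le> T1 * T1" "0 \<le> T2 * T2" by simp_all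
  have pos: "1 \<le> y * y" if "y \<noteq> 0" for y :: int
  proof -
    have "0 < y * y" using that by (simp add: zero_less_mult_iff) linarith
    then show ?thesis by simp
  qed
  let ?R = "(T0 * T1 = 0 \<and> T1 * T2 = 0 \<and> T0 * T2 = 0) \<or>
     (\<forall>T\<in>{T0, T1, T2}. T \<noteq> 0 \<longrightarrow> 0 < F1 * F2 * T)"
  have one: ?R if "\<sigma> * \<sigma> = 1"
  proof -
    \<comment> \<open>From \<open>0 \<le> 1 - 3 * e2 < 4\<close> only \<open>e2 = 0\<close> remains;
      then the squares of the three entries sum to 1, so just one of them is nonzero.\<close>
    have "e2 = 0" using te t0 t4 that by presburger
    then have "q = 1" using qe that by simp
    then have "T0 * T1 = 0 \<and> T1 * T2 = 0 \<and> T0 * T2 = 0"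
      using pos[of T0] pos[of T1] pos[of T2] sqs unfolding q_def
      by (cases "T0 = 0"; cases "T1 = 0"; cases "T2 = 0") auto
    then show ?thesis by blast
  qed
  show ?R
  proof (cases "F1 = 0 \<or> F2 = 0")
    case True
    then have "F1 * F1 + F2 * F2 = 1" using F unit[of F1] unit[of F2] p1 p2 by auto
    then have "\<sigma> * \<sigma> = 1" using D' True by auto
    then show ?thesis by (rule one)
  next
    case False
    then have u: "F1 * F1 = 1" "F2 * F2 = 1" using unit[of F1] unit[of F2] F p1 p2 by auto
    \<comment> \<open>In this variable the vanishing of the determinant factors as
      \<open>(s - 1) * (s - 2) = 0\<close>. For \<open>s = 2\<close> the bounds on \<tau> force
      \<open>e2 = 1\<close> and square sum 2: two entries equal the sign of \<open>F1 * F2\<close>,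
      the third is zero.\<close>
    define s where "s = F1 * F2 * \<sigma>"
    have ss: "s * s = \<sigma> * \<sigma>"
    proof -
      have "s * s = (F1 * F1) * (F2 * F2) * (\<sigma> * \<sigma>)" unfolding s_def by algebra
      then show ?thesis unfolding u by simp
    qed
    have "(s - 1) * (s - 2) = 0" using D' ss unfolding u s_def[symmetric] by (simp add: algebra_simps)
    then have "s = 1 \<or> s = 2" by simp
    then show ?thesis
    proof
      assume "s = 1"
      then show ?thesis using one ss by simp
    next
      assume s2: "s = 2"
      then have s4: "\<sigma> * \<sigma> = 4" using ss by simp
      have "e2 = 1" using te t0 t4 s4 by presburger
      then have q2: "q = 2" using qe s4 by simp
      have G: "(F1 * F2 = 1 \<and> \<sigma> = 2) \<or> (F1 * F2 = -1 \<and> \<sigma> = -2)"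
      proof -
        have "(F1 * F2) * (F1 * F2) = 1" using u by (simp add: algebra_simps)
        then have "F1 * F2 = 1 \<or> F1 * F2 = -1" by (simp add: zmult_eq_1_iff)
        then show ?thesis using s2 unfolding s_def by auto
      qed
      have v: "T0 = 0 \<or> T0 = 1 \<or> T0 = -1" "T1 = 0 \<or> T1 = 1 \<or> T1 = -1" "T2 = 0 \<or> T2 = 1 \<or> T2 = -1"
        using small[of T0] small[of T1] small[of T2] q2 sqs unfolding q_def by (auto simp: zmult_eq_1_iff)
      have "\<forall>T\<in>{T0, T1, T2}. T \<noteq> 0 \<longrightarrow> 0 < F1 * F2 * T"
        using G
      proof
        assume g: "F1 * F2 = 1 \<and> \<sigma> = 2"
        then have "0 \<le> T0" "0 \<le> T1" "0 \<le> T2" using v q2 unfolding q_def \<sigma>_def by auto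
        then show ?thesis using g by auto
      next
        assume g: "F1 * F2 = -1 \<and> \<sigma> = -2"
        then have "T0 \<le> 0" "T1 \<le> 0" "T2 \<le> 0" using v q2 unfolding q_def \<sigma>_def by auto
        then show ?thesis using g by auto
      qed
      then show ?thesis by blast
    qed
  qed
qed

text \<open>The null vector is invariant under the rotation, which leaves a system of three
  equations, and the form is strictly positive on nonzero vectors that sum to zero on each orbit,
  which bounds the remaining entries. In the second alternative each triangle with edges
  \<open>F1\<close>, \<open>F2\<close> and a nonzero \<open>T\<close> has positive product and is
  therefore oriented.\<close>

lemma E6_invariant_form:
  fixes F1 F2 P1 P2 T0 T1 T2 :: int and z :: "nat \<Rightarrow> int"
  assumes q: "\<And>x. q x = 2 * (x 1 * x 1 + x 2 * x 2 + x 3 * x 3 + x 4 * x 4 + x 5 * x 5 + x 6 * x 6 + x 7 * x 7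
        + F1 * x 1 * (x 2 + x 4 + x 6) + F2 * x 1 * (x 3 + x 5 + x 7)
        + P1 * (x 2 * x 4 + x 4 * x 6 + x 6 * x 2) + P2 * (x 3 * x 5 + x 5 * x 7 + x 7 * x 3)
        + T0 * (x 2 * x 3 + x 4 * x 5 + x 6 * x 7) + T1 * (x 2 * x 5 + x 4 * x 7 + x 6 * x 3)
        + T2 * (x 2 * x 7 + x 4 * x 3 + x 6 * x 5))"
    and nonneg: "\<And>x. 0 \<le> q x"
    and null: "\<And>x i j. q x = 0 \<Longrightarrow> i \<in> {1..7} \<Longrightarrow> j \<in> {1..7} \<Longrightarrow> x i * z j = x j * z i"
    and nz: "\<exists>i\<in>{1..7}. z i \<noteq> 0"
    and r1: "2 * z 1 + F1 * (z 2 + z 4 + z 6) + F2 * (z 3 + z 5 + z 7) = 0"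
    and r2: "F1 * z 1 + 2 * z 2 + P1 * (z 4 + z 6) + T0 * z 3 + T1 * z 5 + T2 * z 7 = 0"
    and r3: "F2 * z 1 + 2 * z 3 + P2 * (z 5 + z 7) + T0 * z 2 + T1 * z 6 + T2 * z 4 = 0"
    and qz: "q z = 0"
    and P: "P1 \<noteq> 0 \<Longrightarrow> 0 < P1 \<and> F1 = 0" "P2 \<noteq> 0 \<Longrightarrow> 0 < P2 \<and> F2 = 0"
    and F: "\<not> (F1 = 0 \<and> F2 = 0)"
  shows "P1 = 0 \<and> P2 = 0 \<and> ((T0 * T1 = 0 \<and> T1 * T2 = 0 \<and> T0 * T2 = 0) \<or>
     (\<forall>T\<in>{T0, T1, T2}. T \<noteq> 0 \<longrightarrow> 0 < F1 * F2 * T))"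
proof -
  define vec where "vec a b c d e f g = (\<lambda>i::nat. [a, b, c, d, e, f, g] ! (i - 1))" for a b c d e f g :: int
  have vec: "vec a b c d e f g 1 = a" "vec a b c d e f g 2 = b" "vec a b c d e f g 3 = c"
    "vec a b c d e f g 4 = d" "vec a b c d e f g 5 = e" "vec a b c d e f g 6 = f" "vec a b c d e f g 7 = g"
    for a b c d e f g unfolding vec_def by simp_all
  have m: "1 \<in> {1..7::nat}" "2 \<in> {1..7::nat}" "3 \<in> {1..7::nat}" "4 \<in> {1..7::nat}" "5 \<in> {1..7::nat}"
    "6 \<in> {1..7::nat}" "7 \<in> {1..7::nat}" by simp_all
  have I: "{1..7} = {1, 2, 3, 4, 5, 6, 7::nat}" by auto
  have cyc: "a = b \<and> b = c" if e: "a * a = b * c" "b * b = c * a" "c * c = a * b" for a b c :: int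
  proof -
    have "(a - b) * (a - b) + (b - c) * (b - c) + (c - a) * (c - a)
        = 2 * (a * a - b * c) + 2 * (b * b - c * a) + 2 * (c * c - a * b)"
      by (simp add: algebra_simps)
    then have "(a - b) * (a - b) + (b - c) * (b - c) + (c - a) * (c - a) = 0" using e by simp
    then have "(a - b) * (a - b) = 0" "(b - c) * (b - c) = 0"
      using zero_le_square[of "a - b"] zero_le_square[of "b - c"] zero_le_square[of "c - a"] by linarith+
    then show ?thesis by simp
  qed
  \<comment> \<open>The rotated null vector is null too, hence proportional to \<open>z\<close>. The
    resulting relations on each orbit have only constant integral solutions, by
    \<open>cyc\<close>.\<close>
  let ?y = "vec (z 1) (z 4) (z 5) (z 6) (z 7) (z 2) (z 3)"
  have "q ?y = q z" unfolding q vec by (simp add: algebra_simps)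
  then have y: "q ?y = 0" using qz by simp
  have v: "z 2 = z 4 \<and> z 4 = z 6"
  proof (rule cyc)
    show "z 2 * z 2 = z 4 * z 6" using null[OF y m(6) m(2)] unfolding vec by (simp add: algebra_simps)
    show "z 4 * z 4 = z 6 * z 2" using null[OF y m(2) m(4)] unfolding vec by (simp add: algebra_simps)
    show "z 6 * z 6 = z 2 * z 4" using null[OF y m(4) m(6)] unfolding vec by (simp add: algebra_simps)
  qed
  have w: "z 3 = z 5 \<and> z 5 = z 7"
  proof (rule cyc)
    show "z 3 * z 3 = z 5 * z 7" using null[OF y m(7) m(3)] unfolding vec by (simp add: algebra_simps)
    show "z 5 * z 5 = z 7 * z 3" using null[OF y m(3) m(5)] unfolding vec by (simp add: algebra_simps)
    show "z 7 * z 7 = z 3 * z 5" using null[OF y m(5) m(7)] unfolding vec by (simp add: algebra_simps)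
  qed
  define u0 where "u0 = z 1"
  define v0 where "v0 = z 2"
  define w0 where "w0 = z 3"
  have zs: "z 1 = u0" "z 2 = v0" "z 4 = v0" "z 6 = v0" "z 3 = w0" "z 5 = w0" "z 7 = w0"
    using v w by (simp_all add: u0_def v0_def w0_def)
  have nz0: "\<not> (u0 = 0 \<and> v0 = 0 \<and> w0 = 0)"
  proof
    assume 0: "u0 = 0 \<and> v0 = 0 \<and> w0 = 0"
    obtain i where "i \<in> {1..7}" "z i \<noteq> 0" using nz by blast
    then show False using zs 0 unfolding I by (auto simp del: One_nat_def)
  qed
  have e1: "2 * u0 + 3 * F1 * v0 + 3 * F2 * w0 = 0" using r1 unfolding zs by (simp add: algebra_simps)
  have e2: "F1 * u0 + (2 + 2 * P1) * v0 + (T0 + T1 + T2) * w0 = 0" using r2 unfolding zs by (simp add: algebra_simps)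
  have e3: "F2 * u0 + (T0 + T1 + T2) * v0 + (2 + 2 * P2) * w0 = 0" using r3 unfolding zs by (simp add: algebra_simps)
  \<comment> \<open>The test vector is the difference of two unit vectors in one orbit. It is not
    null, because null vectors are constant on orbits, so \<open>4 - 2 * P1\<close> is strictly
    positive.\<close>
  have b1: "P1 \<le> 1"
  proof -
    let ?x = "vec 0 1 0 (-1) 0 0 0"
    have x: "q ?x = 4 - 2 * P1" unfolding q vec by simp
    have "q ?x \<noteq> 0"
    proof
      assume 0: "q ?x = 0"
      show False using null[OF 0 m(2,1)] null[OF 0 m(2,3)] null[OF 0 m(2,4)] nz0 unfolding vec zs by simp
    qed
    then show ?thesis using nonneg[of ?x] x by linarith
  qed
  have b2: "P2 \<le> 1"
  proof -
    let ?x = "vec 0 0 1 0 (-1) 0 0"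
    have x: "q ?x = 4 - 2 * P2" unfolding q vec by simp
    have "q ?x \<noteq> 0"
    proof
      assume 0: "q ?x = 0"
      show False using null[OF 0 m(3,1)] null[OF 0 m(3,2)] null[OF 0 m(3,5)] nz0 unfolding vec zs by simp
    qed
    then show ?thesis using nonneg[of ?x] x by linarith
  qed
  \<comment> \<open>At the two test vectors the form takes the values \<open>8 + 6 * F1\<close> and
    \<open>8 - 6 * F1\<close>.\<close>
  have f1: "\<bar>F1\<bar> \<le> 1" if "P1 = 0"
    using nonneg[of "vec 1 1 0 1 0 1 0"] nonneg[of "vec 1 (-1) 0 (-1) 0 (-1) 0"] that unfolding q vec by simp
  have f2: "\<bar>F2\<bar> \<le> 1" if "P2 = 0"
    using nonneg[of "vec 1 0 1 0 1 0 1"] nonneg[of "vec 1 0 (-1) 0 (-1) 0 (-1)"] that unfolding q vec by simp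
  have tau: "T0 * T0 + T1 * T1 + T2 * T2 - T0 * T1 - T1 * T2 - T0 * T2 < (2 - P1) * (2 - P2)" (is "?t < _")
  proof -
    define k where "k = 2 - P2"
    have k: "0 < k" using b2 by (simp add: k_def)
    \<comment> \<open>With entries \<open>1, -1, 0\<close> on the first orbit, the entries on the
      second are those minimizing the form among vectors of sum zero there; everything is scaled by
      \<open>k\<close> to stay integral.\<close>
    let ?x = "vec 0 k (T2 - T0) (- k) (T0 - T1) 0 (T1 - T2)"
    have x: "q ?x = 2 * k * (k * (2 - P1) - ?t)"
    proof -
      have P2: "P2 = 2 - k" by (simp add: k_def)
      show ?thesis unfolding q vec P2 by algebra
    qed
    have "q ?x \<noteq> 0"
    proof
      assume 0: "q ?x = 0"
      have "k * u0 = 0" "k * v0 = 0" using null[OF 0 m(2,1)] null[OF 0 m(2,6)] unfolding vec zs by simp_all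
      then have 1: "u0 = 0" "v0 = 0" using k by simp_all
      have "k * w0 = 0" using null[OF 0 m(2,3)] unfolding vec zs 1 by simp
      then show False using 1 k nz0 by simp
    qed
    then have "0 < 2 * k * (k * (2 - P1) - ?t)" using nonneg[of ?x] unfolding x by linarith
    then have "0 < k * (2 - P1) - ?t" using k by (simp add: zero_less_mult_iff)
    then show ?thesis by (simp add: k_def algebra_simps)
  qed
  have p: "0 \<le> P1" "0 \<le> P2" "0 < P1 \<Longrightarrow> F1 = 0" "0 < P2 \<Longrightarrow> F2 = 0"
    using P by (cases "P1 = 0"; cases "P2 = 0"; simp)+
  note R = E6_invariant_arith[OF e1 e2 e3 nz0 p(1,2) b1 b2 p(3,4) F f1 f2 tau]
  show ?thesis using R by blast
qed

text \<open>Applying \<open>g\<close> three times shows that the product of the signs along an orbit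
  is the same for adjacent vertices, hence everywhere equal to its value \<open>D f\<close> at the
  fixed vertex. Multiplying all signs by \<open>D f\<close> changes no entry and makes every such
  product 1, which is the condition for the signs to be removable by a conjugation.\<close>

lemma (in affine_graph) order_three_symmetrize:
  assumes r: "rigid L B" and co: "companion L B A" and cn: "connected_matrix B"
    and g: "\<And>i. i \<in> I \<Longrightarrow> g i \<in> I" "\<And>i. i \<in> I \<Longrightarrow> g (g (g i)) = i" and f: "f \<in> I" "g f = f"
    and inv: "\<And>i j. i \<in> I \<Longrightarrow> j \<in> I \<Longrightarrow> B (g i) (g j) = B i j"
  obtains E where "\<And>i. i \<in> I \<Longrightarrow> E i = 1 \<or> E i = (-1::int)"
    "\<And>i. i \<in> I \<Longrightarrow> E i * E (g i) * E (g (g i)) = 1"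
    "\<And>i j. i \<in> I \<Longrightarrow> j \<in> I \<Longrightarrow> A (g i) (g j) = E i * E j * A i j"
proof -
  note Co = companion_basic[OF co]
  have bij: "bij_betw g I I"
    using g by (intro bij_betw_byWitness[where f' = "\<lambda>i. g (g i)"]) auto
  obtain D where D: "\<And>i. i \<in> I \<Longrightarrow> D i = 1 \<or> D i = (-1::int)"
    "\<And>i j. i \<in> I \<Longrightarrow> j \<in> I \<Longrightarrow> A (g i) (g j) = D i * D j * A i j"
    using automorphism_sign[OF r co bij inv] by blast
  have D2: "D i * D i = 1" if "i \<in> I" for i using D(1)[OF that] by auto
  define t where "t i = D i * D (g i) * D (g (g i))" for i
  have t1: "t i = 1 \<or> t i = -1" if "i \<in> I" for i
    using D(1)[OF that] D(1)[OF g(1)[OF that]] D(1)[OF g(1)[OF g(1)[OF that]]] unfolding t_def by auto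
  define K where "K = {i\<in>I. t i = D f}"
  have "K = I"
  proof -
    have "B x y = 0" if xy: "x \<in> K" "y \<in> I - K" for x y
    proof -
      have I: "x \<in> I" "y \<in> I" "g x \<in> I" "g y \<in> I" "g (g x) \<in> I" "g (g y) \<in> I" using xy g by (auto simp: K_def)
      have "A x y = D (g (g x)) * D (g (g y)) * (D (g x) * D (g y) * (D x * D y * A x y))"
        using D(2)[OF I(5,6)] D(2)[OF I(3,4)] D(2)[OF I(1,2)] g I by simp
      then have "A x y = t x * t y * A x y" unfolding t_def by (simp only: mult_ac)
      moreover have "t x * t y = -1"
        using xy t1[OF I(1)] t1[OF I(2)] by (auto simp: K_def)
      ultimately have "A x y = 0" by simp
      then show ?thesis using Co(3)[OF I(1,2)] xy by (cases "x = y") auto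
    qed
    moreover have "K \<subseteq> I" "f \<in> K" using f D2[OF f(1)] by (auto simp: K_def t_def)
    ultimately show ?thesis using cn unfolding connected_matrix_def by blast
  qed
  then have tf: "t i = D f" if "i \<in> I" for i using that unfolding K_def by blast
  show ?thesis
  proof (rule that[of "\<lambda>i. D f * D i"])
    show "D f * D i = 1 \<or> D f * D i = -1" if "i \<in> I" for i using D(1)[OF f(1)] D(1)[OF that] by auto
    show "D f * D i * (D f * D (g i)) * (D f * D (g (g i))) = 1" if "i \<in> I" for i
    proof -
      have "D f * D i * (D f * D (g i)) * (D f * D (g (g i))) = (D f * D f) * (D f * t i)"
        unfolding t_def by (simp only: mult_ac)
      then show ?thesis unfolding tf[OF that] D2[OF f(1)] by simp
    qed
    show "A (g i) (g j) = D f * D i * (D f * D j) * A i j" if "i \<in> I" "j \<in> I" for i j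
    proof -
      have "D f * D i * (D f * D j) * A i j = (D f * D f) * (D i * D j * A i j)" by (simp only: mult_ac)
      then show ?thesis unfolding D2[OF f(1)] using D(2)[OF that] by simp
    qed
  qed
qed

lemma E6_order_three_admissible:
  assumes ty: "of_type 7 E6_edges Q"
    and inv: "G_invariant 7 (generate (sym_group 7) {cycle_of_list [2, 4, 6] \<circ> cycle_of_list [3, 5, 7]}) Q"
  shows "G_admissible 7 (generate (sym_group 7) {cycle_of_list [2, 4, 6] \<circ> cycle_of_list [3, 5, 7]}) Q"
proof -
  interpret affine_quiver_type E6_edges 7 E6_delta by (rule E6_affine(1))
  define g :: "nat \<Rightarrow> nat" where "g = cycle_of_list [2, 4, 6] \<circ> cycle_of_list [3, 5, 7]"
  have gv: "g 1 = 1" "g 2 = 4" "g 3 = 5" "g 4 = 6" "g 5 = 7" "g 6 = 2" "g 7 = 3"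
    by (simp_all add: g_def transpose_def)
  have I: "{1..7} = {1, 2, 3, 4, 5, 6, 7::nat}" by auto
  have g3: "g (g (g x)) = x" for x
  proof (cases "x \<in> {1..7}")
    case True
    then show ?thesis unfolding I by (auto simp: gv simp del: One_nat_def)
  next
    case False
    then have "g x = x" unfolding I by (simp add: g_def transpose_def)
    then show ?thesis by simp
  qed
  have gout: "g x = x" if "x \<notin> {1..7}" for x using that unfolding I by (simp add: g_def transpose_def)
  have gin: "g x \<in> {1..7}" if "x \<in> {1..7}" for x
    using that unfolding I by (auto simp: gv simp del: One_nat_def)
  obtain Q0 where Q0: "quiver 7 Q0" "acyclic (set_mset Q0)" "has_underlying_graph Q0 E6_edges"
    "mutation_equivalent 7 Q Q0"
    using ty unfolding of_type_def by (elim exE conjE)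
  obtain L A where L: "distinct L" "set L = {1..7}" "companion L (adj Q) A" and cn: "connected_matrix (adj Q)"
    and rg: "rigid L (adj Q)"
    by (rule of_type_structure[OF Q0]) (use E6_affine(2) in blast)
  note Co = companion_basic[OF L(3)]
  have gi: "adj Q (g i) (g j) = adj Q i j" if "i \<in> {1..7}" "j \<in> {1..7}" for i j
  proof -
    have "g \<in> generate (sym_group 7) {cycle_of_list [2, 4, 6] \<circ> cycle_of_list [3, 5, 7]}"
      unfolding g_def by (rule generate.incl) simp
    then show ?thesis using inv[unfolded G_invariant_def, rule_format] that by simp
  qed
  have m: "1 \<in> {1..7::nat}" "2 \<in> {1..7::nat}" "3 \<in> {1..7::nat}" "4 \<in> {1..7::nat}" "5 \<in> {1..7::nat}"
    "6 \<in> {1..7::nat}" "7 \<in> {1..7::nat}" by simp_all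
  obtain E where E: "\<And>i. i \<in> {1..7} \<Longrightarrow> E i = 1 \<or> E i = (-1::int)"
    "\<And>i. i \<in> {1..7} \<Longrightarrow> E i * E (g i) * E (g (g i)) = 1"
    "\<And>i j. i \<in> {1..7} \<Longrightarrow> j \<in> {1..7} \<Longrightarrow> A (g i) (g j) = E i * E j * A i j"
    by (rule order_three_symmetrize[OF rg L(3) cn gin g3 m(1) gv(1) gi]) (assumption | rule that; assumption)+
  \<comment> \<open>Solves \<open>S (g i) = E i * S i\<close> along each orbit, starting with 1 at
    the vertices 2 and 3; the solution closes up because the product of \<open>E\<close> over an
    orbit is 1. Conjugation by \<open>S\<close> makes the companion invariant under the
    rotation.\<close>
  define S where "S i = (if i = 4 then E 2 else if i = 6 then E 2 * E 4 else if i = 5 then E 3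
     else if i = 7 then E 3 * E 5 else 1)" for i :: nat
  have Sg: "S (g i) = E i * S i" if "i \<in> {1..7}" for i
  proof -
    have "E 1 * E 1 * E 1 = 1" using E(2)[OF m(1)] unfolding gv .
    then have "E 1 = 1" using E(1)[OF m(1)] by auto
    moreover have "E 2 * E 4 * E 6 = 1" "E 3 * E 5 * E 7 = 1" using E(2)[OF m(2)] E(2)[OF m(3)] unfolding gv .
    ultimately show ?thesis
      using that unfolding I by (auto simp: gv S_def mult_ac simp del: One_nat_def)
  qed
  have S1: "S i * S i = 1" if "i \<in> {1..7}" for i
    using E(1)[OF m(2)] E(1)[OF m(3)] E(1)[OF m(4)] E(1)[OF m(5)] unfolding S_def by auto
  define C where "C i j = S i * S j * A i j" for i j
  have Cg: "C (g i) (g j) = C i j" if "i \<in> {1..7}" "j \<in> {1..7}" for i j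
  proof -
    have e: "E i * E i = 1" "E j * E j = 1" using E(1)[OF that(1)] E(1)[OF that(2)] by auto
    have "C (g i) (g j) = (E i * E i) * (E j * E j) * C i j"
      unfolding C_def Sg[OF that(1)] Sg[OF that(2)] E(3)[OF that] by (simp only: mult_ac)
    then show ?thesis unfolding e by simp
  qed
  have Cs: "C i j = C j i" if "i \<in> {1..7}" "j \<in> {1..7}" for i j
    unfolding C_def Co(1)[OF that] by (simp only: mult_ac)
  have Cd: "C i i = 2" if "i \<in> {1..7}" for i unfolding C_def Co(4)[OF that that] S1[OF that] by simp
  have Ca: "\<bar>C i j\<bar> = \<bar>adj Q i j\<bar>" if "i \<in> {1..7}" "j \<in> {1..7}" "i \<noteq> j" for i j
  proof -
    have "\<bar>S i\<bar> = 1" "\<bar>S j\<bar> = 1" using S1[OF that(1)] S1[OF that(2)] by (auto simp: zmult_eq_1_iff)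
    then show ?thesis unfolding C_def abs_mult Co(3)[OF that] by simp
  qed
  define F1 where "F1 = C 1 2"
  define F2 where "F2 = C 1 3"
  define P1 where "P1 = C 2 4"
  define P2 where "P2 = C 3 5"
  define T0 where "T0 = C 2 3"
  define T1 where "T1 = C 2 5"
  define T2 where "T2 = C 2 7"
  note Crot = Cg[OF m(1) m(2), unfolded gv] Cg[OF m(1) m(4), unfolded gv] Cg[OF m(1) m(3), unfolded gv]
    Cg[OF m(1) m(5), unfolded gv] Cg[OF m(2) m(4), unfolded gv] Cg[OF m(4) m(6), unfolded gv]
    Cg[OF m(3) m(5), unfolded gv] Cg[OF m(5) m(7), unfolded gv] Cg[OF m(2) m(3), unfolded gv]
    Cg[OF m(4) m(5), unfolded gv] Cg[OF m(2) m(5), unfolded gv] Cg[OF m(4) m(7), unfolded gv]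
    Cg[OF m(2) m(7), unfolded gv] Cg[OF m(4) m(3), unfolded gv]
  note Csym = Cs[OF m(2) m(1)] Cs[OF m(3) m(1)] Cs[OF m(4) m(1)] Cs[OF m(5) m(1)] Cs[OF m(6) m(1)]
    Cs[OF m(7) m(1)] Cs[OF m(4) m(2)] Cs[OF m(6) m(4)] Cs[OF m(2) m(6)] Cs[OF m(5) m(3)] Cs[OF m(7) m(5)]
    Cs[OF m(3) m(7)] Cs[OF m(3) m(2)] Cs[OF m(5) m(4)] Cs[OF m(7) m(6)] Cs[OF m(5) m(2)] Cs[OF m(7) m(4)]
    Cs[OF m(3) m(6)] Cs[OF m(7) m(2)] Cs[OF m(3) m(4)] Cs[OF m(5) m(6)]
  have en:
    "C 1 1 = 2" "C 1 2 = F1" "C 1 3 = F2" "C 1 4 = F1" "C 1 5 = F2" "C 1 6 = F1" "C 1 7 = F2"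
    "C 2 1 = F1" "C 2 2 = 2" "C 2 3 = T0" "C 2 4 = P1" "C 2 5 = T1" "C 2 6 = P1" "C 2 7 = T2"
    "C 3 1 = F2" "C 3 2 = T0" "C 3 3 = 2" "C 3 4 = T2" "C 3 5 = P2" "C 3 6 = T1" "C 3 7 = P2"
    "C 4 1 = F1" "C 4 2 = P1" "C 4 3 = T2" "C 4 4 = 2" "C 4 5 = T0" "C 4 6 = P1" "C 4 7 = T1"
    "C 5 1 = F2" "C 5 2 = T1" "C 5 3 = P2" "C 5 4 = T0" "C 5 5 = 2" "C 5 6 = T2" "C 5 7 = P2"
    "C 6 1 = F1" "C 6 2 = P1" "C 6 3 = T1" "C 6 4 = P1" "C 6 5 = T2" "C 6 6 = 2" "C 6 7 = T0"
    "C 7 1 = F2" "C 7 2 = T2" "C 7 3 = P2" "C 7 4 = T1" "C 7 5 = P2" "C 7 6 = T0" "C 7 7 = 2"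
    by (simp_all only: Crot Csym Cd[OF m(1)] Cd[OF m(2)] Cd[OF m(3)] Cd[OF m(4)] Cd[OF m(5)] Cd[OF m(6)] Cd[OF m(7)]
      F1_def F2_def P1_def P2_def T0_def T1_def T2_def)
  define q where "q x = (\<Sum>i\<in>{1..7}. \<Sum>j\<in>{1..7}. x i * x j * C i j)" for x
  have q: "q x = 2 * (x 1 * x 1 + x 2 * x 2 + x 3 * x 3 + x 4 * x 4 + x 5 * x 5 + x 6 * x 6 + x 7 * x 7
        + F1 * x 1 * (x 2 + x 4 + x 6) + F2 * x 1 * (x 3 + x 5 + x 7)
        + P1 * (x 2 * x 4 + x 4 * x 6 + x 6 * x 2) + P2 * (x 3 * x 5 + x 5 * x 7 + x 7 * x 3)
        + T0 * (x 2 * x 3 + x 4 * x 5 + x 6 * x 7) + T1 * (x 2 * x 5 + x 4 * x 7 + x 6 * x 3)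
        + T2 * (x 2 * x 7 + x 4 * x 3 + x 6 * x 5))" for x
    unfolding q_def I by (simp add: en algebra_simps del: One_nat_def)
  obtain xi where xi: "\<exists>i\<in>{1..7}. xi i \<noteq> 0" "\<And>i. i \<in> {1..7} \<Longrightarrow> (\<Sum>j\<in>{1..7}. A i j * xi j) = 0"
    "\<And>x. 0 \<le> (\<Sum>i\<in>{1..7}. \<Sum>j\<in>{1..7}. x i * x j * A i j)"
    "\<And>x i j. (\<Sum>i\<in>{1..7}. \<Sum>j\<in>{1..7}. x i * x j * A i j) = 0 \<Longrightarrow> i \<in> {1..7} \<Longrightarrow> j \<in> {1..7} \<Longrightarrow> x i * xi j = x j * xi i"
    by (rule companion_rank[OF L]) (rule that; assumption)
  have qA: "q x = (\<Sum>i\<in>{1..7}. \<Sum>j\<in>{1..7}. (S i * x i) * (S j * x j) * A i j)" for x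
    unfolding q_def C_def by (intro sum.cong refl) (simp only: mult_ac)
  define z where "z i = S i * xi i" for i
  have SS: "S i * (S i * a) = a" if "i \<in> {1..7}" for i a
    using S1[OF that] by (simp only: mult.assoc[symmetric] mult_1_left)
  have zr: "(\<Sum>j\<in>{1..7}. C i j * z j) = 0" if i: "i \<in> {1..7}" for i
  proof -
    have "(\<Sum>j\<in>{1..7}. C i j * z j) = (\<Sum>j\<in>{1..7}. S i * (A i j * xi j))"
    proof (rule sum.cong[OF refl])
      fix j assume j: "j \<in> {1..7::nat}"
      have "C i j * z j = S i * (A i j * (S j * (S j * xi j)))" unfolding C_def z_def by (simp only: mult_ac)
      then show "C i j * z j = S i * (A i j * xi j)" unfolding SS[OF j] .
    qed
    also have "\<dots> = S i * (\<Sum>j\<in>{1..7}. A i j * xi j)" by (rule sum_distrib_left[symmetric])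
    finally show ?thesis unfolding xi(2)[OF i] by simp
  qed
  have qz: "q z = 0"
  proof -
    have "q z = (\<Sum>i\<in>{1..7}. z i * (\<Sum>j\<in>{1..7}. C i j * z j))"
      unfolding q_def sum_distrib_left by (intro sum.cong refl) (simp only: mult_ac)
    also have "\<dots> = 0" by (intro sum.neutral ballI) (simp only: zr mult_zero_right)
    finally show ?thesis .
  qed
  have nonneg: "0 \<le> q x" for x unfolding qA by (rule xi(3))
  have null: "x i * z j = x j * z i" if x: "q x = 0" and ij: "i \<in> {1..7}" "j \<in> {1..7}" for x i j
  proof -
    have "(S i * x i) * xi j = (S j * x j) * xi i" by (rule xi(4)[OF x[unfolded qA] ij])
    then have "S i * (S j * ((S i * x i) * xi j)) = S i * (S j * ((S j * x j) * xi i))" by simp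
    moreover have "S i * (S j * ((S i * x i) * xi j)) = S i * (S i * (x i * (S j * xi j)))" by (simp only: mult_ac)
    moreover have "S i * (S j * ((S j * x j) * xi i)) = S j * (S j * (x j * (S i * xi i)))" by (simp only: mult_ac)
    ultimately show ?thesis unfolding SS[OF ij(1)] SS[OF ij(2)] z_def by simp
  qed
  have nz: "\<exists>i\<in>{1..7}. z i \<noteq> 0"
  proof -
    obtain i where i: "i \<in> {1..7}" "xi i \<noteq> 0" using xi(1) by blast
    have "S i \<noteq> 0" using S1[OF i(1)] by auto
    then have "z i \<noteq> 0" unfolding z_def using i(2) by simp
    then show ?thesis using i(1) by blast
  qed
  have r1: "2 * z 1 + F1 * (z 2 + z 4 + z 6) + F2 * (z 3 + z 5 + z 7) = 0"
    using zr[OF m(1)] unfolding I by (simp add: en algebra_simps del: One_nat_def)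
  have r2: "F1 * z 1 + 2 * z 2 + P1 * (z 4 + z 6) + T0 * z 3 + T1 * z 5 + T2 * z 7 = 0"
    using zr[OF m(2)] unfolding I by (simp add: en algebra_simps del: One_nat_def)
  have r3: "F2 * z 1 + 2 * z 3 + P2 * (z 5 + z 7) + T0 * z 2 + T1 * z 6 + T2 * z 4 = 0"
    using zr[OF m(3)] unfolding I by (simp add: en algebra_simps del: One_nat_def)
  have rot: "adj Q 1 4 = adj Q 1 2" "adj Q 1 6 = adj Q 1 4" "adj Q 1 5 = adj Q 1 3" "adj Q 1 7 = adj Q 1 5"
    "adj Q 4 6 = adj Q 2 4" "adj Q 6 2 = adj Q 4 6" "adj Q 5 7 = adj Q 3 5" "adj Q 7 3 = adj Q 5 7"
    "adj Q 4 5 = adj Q 2 3" "adj Q 6 7 = adj Q 4 5" "adj Q 4 7 = adj Q 2 5" "adj Q 6 3 = adj Q 4 7"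
    "adj Q 4 3 = adj Q 2 7" "adj Q 6 5 = adj Q 4 3"
  using gi[OF m(1) m(2)] gi[OF m(1) m(4)] gi[OF m(1) m(3)] gi[OF m(1) m(5)] gi[OF m(2) m(4)] gi[OF m(4) m(6)]
    gi[OF m(3) m(5)] gi[OF m(5) m(7)] gi[OF m(2) m(3)] gi[OF m(4) m(5)] gi[OF m(2) m(5)] gi[OF m(4) m(7)]
    gi[OF m(2) m(7)] gi[OF m(4) m(3)] unfolding gv .
  have pos: "0 < C x y * C y w * C w x" if "0 < A x y * A y w * A w x" "x \<in> {1..7}" "y \<in> {1..7}" "w \<in> {1..7}" for x y w
  proof -
    have "C x y * C y w * C w x = (S x * S x) * (S y * S y) * (S w * S w) * (A x y * A y w * A w x)"
      unfolding C_def by (simp only: mult_ac)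
    then show ?thesis using that(1) unfolding S1[OF that(2)] S1[OF that(3)] S1[OF that(4)] by simp
  qed
  have cube: "0 < a" if "0 < a * a * a" for a :: int
  proof (rule ccontr)
    assume "\<not> 0 < a"
    then have "a * a * a \<le> 0" by (intro mult_nonneg_nonpos[OF zero_le_square]) simp
    then show False using that by simp
  qed
  \<comment> \<open>A nonzero \<open>P1\<close> makes the orbit of 2 an oriented triangle. Its
    product, the cube of \<open>P1\<close>, is positive, and the fixed vertex 1 has no arrows to
    it.\<close>
  have p1: "0 < P1 \<and> F1 = 0" if "P1 \<noteq> 0"
  proof -
    have n: "adj Q 2 4 \<noteq> 0" using that Ca[OF m(2,4)] unfolding P1_def by simp
    have "0 < C 2 4 * C 4 6 * C 6 2"
      by (rule pos[OF orbit_triangle_sign[OF L m(2,4,6) rot(5)[symmetric] rot(6)[symmetric] n] m(2,4,6)])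
    then have "0 < P1 * P1 * P1" unfolding en .
    moreover have "adj Q 1 2 = 0"
      by (rule fixed_vertex_orbit_triangle[OF L m(1,2,4,6) rot(5)[symmetric] rot(6)[symmetric] n
          rot(1)[symmetric] rot(2)[symmetric]])
    ultimately show ?thesis using cube[of P1] Ca[OF m(1,2)] unfolding F1_def by simp
  qed
  have p2: "0 < P2 \<and> F2 = 0" if "P2 \<noteq> 0"
  proof -
    have n: "adj Q 3 5 \<noteq> 0" using that Ca[OF m(3,5)] unfolding P2_def by simp
    have "0 < C 3 5 * C 5 7 * C 7 3"
      by (rule pos[OF orbit_triangle_sign[OF L m(3,5,7) rot(7)[symmetric] rot(8)[symmetric] n] m(3,5,7)])
    then have "0 < P2 * P2 * P2" unfolding en .
    moreover have "adj Q 1 3 = 0"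
      by (rule fixed_vertex_orbit_triangle[OF L m(1,3,5,7) rot(7)[symmetric] rot(8)[symmetric] n
          rot(3)[symmetric] rot(4)[symmetric]])
    ultimately show ?thesis using cube[of P2] Ca[OF m(1,3)] unfolding F2_def by simp
  qed
  have F: "\<not> (F1 = 0 \<and> F2 = 0)"
  proof
    assume "F1 = 0 \<and> F2 = 0"
    then have 0: "adj Q 1 2 = 0" "adj Q 1 3 = 0" using Ca[OF m(1,2)] Ca[OF m(1,3)] unfolding F1_def F2_def by simp_all
    then have 1: "adj Q 1 4 = 0" "adj Q 1 6 = 0" "adj Q 1 5 = 0" "adj Q 1 7 = 0" by (simp_all only: rot(1-4))
    have "\<forall>i\<in>{1}. \<forall>j\<in>{1..7} - {1}. adj Q i j = 0" unfolding I by (simp add: 0 1 del: One_nat_def)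
    moreover have "{1} \<subseteq> {1..7::nat}" "{1::nat} \<noteq> {}" using m by simp_all
    ultimately have e: "{1} = {1..7::nat}" using cn unfolding connected_matrix_def by blast
    have "(2::nat) \<in> {1}" unfolding e by (rule m(2))
    then show False by simp
  qed
  have R: "P1 = 0 \<and> P2 = 0 \<and> ((T0 * T1 = 0 \<and> T1 * T2 = 0 \<and> T0 * T2 = 0) \<or>
     (\<forall>T\<in>{T0, T1, T2}. T \<noteq> 0 \<longrightarrow> 0 < F1 * F2 * T))"
    by (rule E6_invariant_form[where q = q and z = z, OF q nonneg null nz r1 r2 r3 qz p1 p2 F])
  have z0: "adj Q 2 4 = 0" "adj Q 3 5 = 0"
    using R Ca[OF m(2,4)] Ca[OF m(3,5)] unfolding P1_def P2_def by simp_all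
  \<comment> \<open>If 2 were a source or a sink of the triangle 1, 2, \<open>y\<close>, the
    triangle would not be oriented and its product would be negative.\<close>
  have opp: "adj Q 2 1 * adj Q 2 y < 0"
    if y: "y \<in> {3, 5, 7}" and T: "0 < F1 * F2 * C 2 y" for y
  proof (rule ccontr)
    assume n: "\<not> ?thesis"
    have yI: "y \<in> {1..7}" "2 \<noteq> y" "1 \<noteq> y" using y by auto
    have f: "C 2 1 = F1" "C 1 y = F2" using y en by auto
    have nz: "adj Q 2 1 \<noteq> 0" "adj Q 2 y \<noteq> 0" "adj Q 1 y \<noteq> 0"
      using T Ca[OF m(2,1)] Ca[OF m(2) yI(1,2)] Ca[OF m(1) yI(1,3)] unfolding f by auto
    then have "0 < adj Q 2 1 * adj Q 2 y" using n by (meson mult_eq_0_iff not_less order_le_less)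
    then have "A 2 1 * A 2 y * A 1 y < 0" by (rule companion_triangle_apex[OF L m(2,1) yI(1) _ nz(3)])
    moreover have "C 2 1 * C 2 y * C 1 y = (S 2 * S 2) * (S 1 * S 1) * (S y * S y) * (A 2 1 * A 2 y * A 1 y)"
      unfolding C_def by (simp only: mult_ac)
    ultimately have "C 2 1 * C 2 y * C 1 y < 0" unfolding S1[OF m(1)] S1[OF m(2)] S1[OF yI(1)] by simp
    then show False using T unfolding f by (simp add: mult_ac)
  qed
  \<comment> \<open>Two different nonzero entries can occur only in the second alternative, and then
    both arrows are opposite to the one between 2 and 1, hence have the same direction at 2.\<close>
  have tt: "0 \<le> adj Q 2 x * adj Q 2 y" if xy: "x \<in> {3, 5, 7}" "y \<in> {3, 5, 7}" for x y
  proof (cases "x = y \<or> adj Q 2 x = 0 \<or> adj Q 2 y = 0")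
    case False
    have I: "x \<in> {1..7}" "y \<in> {1..7}" "2 \<noteq> x" "2 \<noteq> y" using xy by auto
    have n: "C 2 x \<noteq> 0" "C 2 y \<noteq> 0" using False Ca[OF m(2) I(1,3)] Ca[OF m(2) I(2,4)] by auto
    have "C 2 x \<in> {T0, T1, T2}" "C 2 y \<in> {T0, T1, T2}" using xy en by auto
    moreover have "\<not> (T0 * T1 = 0 \<and> T1 * T2 = 0 \<and> T0 * T2 = 0)" using n False xy en by auto
    ultimately have "0 < F1 * F2 * C 2 x" "0 < F1 * F2 * C 2 y" using R n by blast+
    then have "adj Q 2 1 * adj Q 2 x < 0" "adj Q 2 1 * adj Q 2 y < 0" using opp xy by blast+
    then have "0 < adj Q 2 x * adj Q 2 y" by (auto simp: mult_less_0_iff zero_less_mult_iff)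
    then show ?thesis by simp
  qed auto
  define f1 where "f1 = adj Q 1 2"
  define f2 where "f2 = adj Q 1 3"
  define t0 where "t0 = adj Q 2 3"
  define t1 where "t1 = adj Q 2 5"
  define t2 where "t2 = adj Q 2 7"
  have t': "0 \<le> t0 * t1" "0 \<le> t1 * t2" "0 \<le> t2 * t0" "0 \<le> t1 * t0" "0 \<le> t2 * t1" "0 \<le> t0 * t2"
    using tt unfolding t0_def t1_def t2_def by simp_all
  have sk: "adj Q 2 1 = - adj Q 1 2" "adj Q 3 1 = - adj Q 1 3" "adj Q 4 1 = - adj Q 1 4"
    "adj Q 5 1 = - adj Q 1 5" "adj Q 6 1 = - adj Q 1 6" "adj Q 7 1 = - adj Q 1 7" "adj Q 4 2 = - adj Q 2 4"
    "adj Q 6 4 = - adj Q 4 6" "adj Q 2 6 = - adj Q 6 2" "adj Q 5 3 = - adj Q 3 5" "adj Q 7 5 = - adj Q 5 7"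
    "adj Q 3 7 = - adj Q 7 3" "adj Q 3 2 = - adj Q 2 3" "adj Q 5 4 = - adj Q 4 5" "adj Q 7 6 = - adj Q 6 7"
    "adj Q 5 2 = - adj Q 2 5" "adj Q 7 4 = - adj Q 4 7" "adj Q 3 6 = - adj Q 6 3" "adj Q 7 2 = - adj Q 2 7"
    "adj Q 3 4 = - adj Q 4 3" "adj Q 5 6 = - adj Q 6 5"
    by (rule adj_skew)+
  have adj_self: "adj Q i i = 0" for i by (simp add: adj_def)
  have ben:
    "adj Q 1 1 = 0" "adj Q 1 2 = f1" "adj Q 1 3 = f2" "adj Q 1 4 = f1" "adj Q 1 5 = f2" "adj Q 1 6 = f1" "adj Q 1 7 = f2"
    "adj Q 2 1 = - f1" "adj Q 2 2 = 0" "adj Q 2 3 = t0" "adj Q 2 4 = 0" "adj Q 2 5 = t1" "adj Q 2 6 = 0" "adj Q 2 7 = t2"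
    "adj Q 3 1 = - f2" "adj Q 3 2 = - t0" "adj Q 3 3 = 0" "adj Q 3 4 = - t2" "adj Q 3 5 = 0" "adj Q 3 6 = - t1" "adj Q 3 7 = 0"
    "adj Q 4 1 = - f1" "adj Q 4 2 = 0" "adj Q 4 3 = t2" "adj Q 4 4 = 0" "adj Q 4 5 = t0" "adj Q 4 6 = 0" "adj Q 4 7 = t1"
    "adj Q 5 1 = - f2" "adj Q 5 2 = - t1" "adj Q 5 3 = 0" "adj Q 5 4 = - t0" "adj Q 5 5 = 0" "adj Q 5 6 = - t2" "adj Q 5 7 = 0"
    "adj Q 6 1 = - f1" "adj Q 6 2 = 0" "adj Q 6 3 = t1" "adj Q 6 4 = 0" "adj Q 6 5 = t2" "adj Q 6 6 = 0" "adj Q 6 7 = t0"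
    "adj Q 7 1 = - f2" "adj Q 7 2 = - t2" "adj Q 7 3 = 0" "adj Q 7 4 = - t1" "adj Q 7 5 = 0" "adj Q 7 6 = - t0" "adj Q 7 7 = 0"
    by (simp_all only: f1_def f2_def t0_def t1_def t2_def rot z0 sk adj_self minus_zero)
  have zz: "adj Q i (g i) = 0" if "i \<in> {1..7}" for i
    using that unfolding I by (auto simp: gv ben simp del: One_nat_def)
  have "\<forall>i\<in>{1..7}. \<forall>j\<in>{1..7}. 0 \<le> adj Q i j * adj Q (g i) j"
    unfolding I by (simp only: ball_simps gv ben t' mult_minus_left mult_minus_right minus_minus
      mult_zero_left mult_zero_right zero_le_square order_refl simp_thms)
  then have sg: "0 \<le> adj Q i j * adj Q (g i) j" if "i \<in> {1..7}" "j \<in> {1..7}" for i j using that by blast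
  show ?thesis
    using admissible_order_three[of g 7 Q, OF g3 gout inv[folded g_def] zz sg] unfolding g_def .
qed

theorem theorem3p7:
  fixes N :: nat and of_type_X :: "quiver \<Rightarrow> bool" and G :: "(nat \<Rightarrow> nat) set" and Q :: quiver
  assumes "folding_pair N of_type_X G"
    and "quiver N Q"
    and "of_type_X Q"
  shows "(G_invariant N G Q \<longrightarrow> G_admissible N G Q) \<and>
         (G_invariant N G Q \<longleftrightarrow> G_admissible N G Q)"
proof -
  have "G_admissible N G Q" if inv: "G_invariant N G Q"
    using assms(1)
  proof cases
    case a
    then show ?thesis using A2_admissible inv assms(3) by simp
  next
    case (b n)
    then show ?thesis using A_admissible[OF b(4) refl _ tau_facts[OF b(4)]] inv assms(3) by simp
  next
    case c
    then show ?thesis using D4_klein_admissible inv assms(3) by simp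
  next
    case d
    then show ?thesis using D4_order_three_admissible inv assms(3) by simp
  next
    case (e n)
    then show ?thesis using D_swap_ends_admissible[OF e(4)] inv assms(3) by simp
  next
    case (f n)
    then show ?thesis using D_swap_end_admissible[OF f(4)] inv assms(3) by simp
  next
    case (g n)
    then show ?thesis using D_reflect_admissible[OF g(4)] inv assms(3) by simp
  next
    case (h n)
    then show ?thesis using D_reflect_swap_admissible[OF h(4)] inv assms(3) by simp
  next
    case i
    then show ?thesis using E6_order_three_admissible inv assms(3) by simp
  next
    case j
    then show ?thesis using E6_swap_admissible inv assms(3) by simp
  next
    case k
    then show ?thesis using E7_swap_admissible inv assms(3) by simp
  qed
  moreover have "G_invariant N G Q" if "G_admissible N G Q" using that by (simp add: G_admissible_def)
  ultimately show ?thesis by blast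
qed

end
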